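(* Let $k$ be a field. A Hopf algebra $L$ over $k$ is finite dimensional if and only if there exist a positive integer $n$ and an invertible solution $R\in \mathcal{M}_n(k)\otimes \mathcal{M}_n(k)\cong \mathcal{M}_{n^2}(k)$ of the pentagon equation $R^{12}R^{13}R^{23}=R^{23}R^{12}$ in $\mathcal{M}_n(k)^{\otimes 3}$ such that $L\cong P(n,R)$ as Hopf algebras. Furthermore, in this case, $$\dim(L)=\frac{n^2}{\dim\big(\mathcal{M}_n(k)^{R,r}\big)}=l(R).$$
   Context: All vector spaces, algebras (associative, unital), Hopf algebras and tensor products are over a field $k$. $\mathcal{M}_n(k)$ is the algebra of $n\times n$ matrices. For $R=\sum R^1\otimes R^2\in A\otimes A$ ($A$ an algebra), $R^{12}=\sum R^1\otimes R^2\otimes 1_A$, $R^{13}=\sum R^1\otimes 1_A\otimes R^2$, $R^{23}=\sum 1_A\otimes R^1\otimes R^2$. The length $l(R)$ of $R\neq 0$ is the smallest $m$ such that $R=\sum_{i=1}^m a_i\otimes b_i$ for some $a_i,b_i\in A$. The space of right $R$-coinvariants is $A^{R,r}=\{a\in A\mid (1_A\otimes a)R=1_A\otimes a\}$. Definition of $P(n,R)$: let $R\in\mathcal{M}_n(k)\otimes\mathcal{M}_n(k)$ be an invertible solution of the pentagon equation, and write $R=\sum_{i=1}^m A_i\otimes B_i$ with $m=l(R)$; then $\{A_i\}$ and $\{B_i\}$ are linearly independent. Let $\{B_i^*\}$ be the dual basis of $\{B_i\}$ (on the span of the $B_i$) and $U=R^{-1}=\sum U^1\otimes U^2$. Then $P(n,R)$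 is the subspace of $\mathcal{M}_n(k)$ with basis $\{A_1,\dots,A_m\}$; it is a unital subalgebra of $\mathcal{M}_n(k)$ and a Hopf algebra with comultiplication $\Delta(A_p)=R^{-1}(I_n\otimes A_p)R$, counit $\varepsilon(A_p)=\langle B_p^*,I_n\rangle$ and antipode $S(A_p)=\sum\langle B_p^*,U^2\rangle U^1$, for $p=1,\dots,m$. *)

theory Defs
  imports "Jordan_Normal_Form.VS_Connect" "HOL-Library.Poly_Mapping" "HOL-Algebra.QuotRing"
begin

text \<open>
  The ground field is a type \<open>'k\<close> of class \<open>field\<close>, viewed as the structure \<^term>\<open>class_ring\<close>.
  Algebras are records of type \<open>module\<close>, which carry both a ring and a scalar multiplication;
  the locale \<open>algebra\<close> of \<open>HOL-Algebra\<close> cannot be used because it demands commutativity.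
\<close>

locale assoc_algebra =
  fixes A :: "('k :: field, 'a, 'm) module_scheme" (structure)
  assumes vectorspace: "vectorspace class_ring A"
    and ring: "ring A"
    and smult_mult_left:
      "\<lbrakk>x \<in> carrier A; y \<in> carrier A\<rbrakk> \<Longrightarrow> (c \<odot> x) \<otimes> y = c \<odot> (x \<otimes> y)"
    and smult_mult_right:
      "\<lbrakk>x \<in> carrier A; y \<in> carrier A\<rbrakk> \<Longrightarrow> x \<otimes> (c \<odot> y) = c \<odot> (x \<otimes> y)"

definition algebra_hom ::
    "('k :: field, 'a, 'm) module_scheme \<Rightarrow> ('k, 'b, 'n) module_scheme \<Rightarrow> ('a \<Rightarrow> 'b) set" where
  "algebra_hom A B = Ring.ring_hom A B \<inter> LinearCombinations.module_hom class_ring A B"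

definition field_algebra :: "('k :: field, 'k) module" where
  "field_algebra = \<lparr>carrier = UNIV, mult = (*), one = 1, zero = 0, add = (+), smult = (*)\<rparr>"

text \<open>
  The free vector space on \<open>carrier A \<times> carrier B\<close>, with the product of formal sums induced by
  \<open>(a, b) (c, d) = (ac, bd)\<close>. When only the vector space structure of \<open>A \<otimes> B\<close> matters, the
  multiplications of \<open>A\<close> and \<open>B\<close> are irrelevant.
\<close>

definition formal_tensors ::
    "('k :: field, 'a, 'm) module_scheme \<Rightarrow> ('k, 'b, 'n) module_scheme \<Rightarrow>
     ('k, 'a \<times> 'b \<Rightarrow>\<^sub>0 'k) module" where
  "formal_tensors A B =
    \<lparr>carrier = {f. Poly_Mapping.keys f \<subseteq> carrier A \<times> carrier B},
     mult = (\<lambda>f g. \<Sum>p \<in> Poly_Mapping.keys f. \<Sum>q \<in> Poly_Mapping.keys g.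
        Poly_Mapping.single (fst p \<otimes>\<^bsub>A\<^esub> fst q, snd p \<otimes>\<^bsub>B\<^esub> snd q)
          (Poly_Mapping.lookup f p * Poly_Mapping.lookup g q)),
     one = Poly_Mapping.single (\<one>\<^bsub>A\<^esub>, \<one>\<^bsub>B\<^esub>) 1,
     zero = 0,
     add = (+),
     smult = (\<lambda>c. Poly_Mapping.map ((*) c))\<rparr>"

definition bilinear_relations ::
    "('k :: field, 'a, 'm) module_scheme \<Rightarrow> ('k, 'b, 'n) module_scheme \<Rightarrow>
     ('a \<times> 'b \<Rightarrow>\<^sub>0 'k) set" where
  "bilinear_relations A B =
    {Poly_Mapping.single (a \<oplus>\<^bsub>A\<^esub> a', b) 1 - Poly_Mapping.single (a, b) 1
       - Poly_Mapping.single (a', b) 1 |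
       a a' b. a \<in> carrier A \<and> a' \<in> carrier A \<and> b \<in> carrier B} \<union>
    {Poly_Mapping.single (a, b \<oplus>\<^bsub>B\<^esub> b') 1 - Poly_Mapping.single (a, b) 1
       - Poly_Mapping.single (a, b') 1 |
       a b b'. a \<in> carrier A \<and> b \<in> carrier B \<and> b' \<in> carrier B} \<union>
    {Poly_Mapping.single (c \<odot>\<^bsub>A\<^esub> a, b) 1 - Poly_Mapping.single (a, b) c |
       c a b. a \<in> carrier A \<and> b \<in> carrier B} \<union>
    {Poly_Mapping.single (a, c \<odot>\<^bsub>B\<^esub> b) 1 - Poly_Mapping.single (a, b) c |
       c a b. a \<in> carrier A \<and> b \<in> carrier B}"

definition tensor_ideal ::
    "('k :: field, 'a, 'm) module_scheme \<Rightarrow> ('k, 'b, 'n) module_scheme \<Rightarrow>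
     ('a \<times> 'b \<Rightarrow>\<^sub>0 'k) set" where
  "tensor_ideal A B =
    LinearCombinations.module.span class_ring (formal_tensors A B) (bilinear_relations A B)"

text \<open>
  The quotient of the formal sums by the bilinear relations; its elements are cosets. For algebras
  \<open>A\<close> and \<open>B\<close> the span of the relations is a two-sided ideal, and the ring part below is the
  quotient ring.
\<close>

definition tensor ::
    "('k :: field, 'a, 'm) module_scheme \<Rightarrow> ('k, 'b, 'n) module_scheme \<Rightarrow>
     ('k, ('a \<times> 'b \<Rightarrow>\<^sub>0 'k) set) module" where
  "tensor A B =
    \<lparr>carrier = a_rcosets\<^bsub>formal_tensors A B\<^esub> (tensor_ideal A B),
     mult = rcoset_mult (formal_tensors A B) (tensor_ideal A B),
     one = tensor_ideal A B +>\<^bsub>formal_tensors A B\<^esub> \<one>\<^bsub>formal_tensors A B\<^esub>,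
     zero = tensor_ideal A B,
     add = set_add (formal_tensors A B),
     smult = (\<lambda>c X. \<Union>f\<in>X. tensor_ideal A B +>\<^bsub>formal_tensors A B\<^esub> (c \<odot>\<^bsub>formal_tensors A B\<^esub> f))\<rparr>"

definition pure_tensor ::
    "('k :: field, 'a, 'm) module_scheme \<Rightarrow> ('k, 'b, 'n) module_scheme \<Rightarrow> 'a \<Rightarrow> 'b \<Rightarrow>
     ('a \<times> 'b \<Rightarrow>\<^sub>0 'k) set" where
  "pure_tensor A B a b =
    tensor_ideal A B +>\<^bsub>formal_tensors A B\<^esub> Poly_Mapping.single (a, b) 1"

text \<open>
  The linear map into \<open>X\<close> induced by a bilinear map \<open>\<beta>\<close>: the value \<open>\<Sum> \<beta>(a, b)\<close> is the same for
  every representative of a tensor \<open>t = \<Sum> a \<otimes> b\<close>.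
\<close>

definition tensor_lift ::
    "('k :: field, 'c, 'm) module_scheme \<Rightarrow> ('a \<Rightarrow> 'b \<Rightarrow> 'c) \<Rightarrow> ('a \<times> 'b \<Rightarrow>\<^sub>0 'k) set \<Rightarrow> 'c" where
  "tensor_lift X \<beta> t = the_elem
    ((\<lambda>f. \<Oplus>\<^bsub>X\<^esub>p \<in> Poly_Mapping.keys f. Poly_Mapping.lookup f p \<odot>\<^bsub>X\<^esub> \<beta> (fst p) (snd p)) ` t)"

definition tensor_map ::
    "('k :: field, 'c, 'm) module_scheme \<Rightarrow> ('k, 'd, 'n) module_scheme \<Rightarrow>
     ('a \<Rightarrow> 'c) \<Rightarrow> ('b \<Rightarrow> 'd) \<Rightarrow> ('a \<times> 'b \<Rightarrow>\<^sub>0 'k) set \<Rightarrow> ('c \<times> 'd \<Rightarrow>\<^sub>0 'k) set" where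
  "tensor_map C D f g = tensor_lift (tensor C D) (\<lambda>a b. pure_tensor C D (f a) (g b))"

text \<open>
  For subspaces \<open>V \<subseteq> A\<close> and \<open>W \<subseteq> B\<close> the canonical map \<open>V \<otimes> W \<rightarrow> A \<otimes> B\<close> is injective; an element
  of \<open>A \<otimes> B\<close> in its range is regarded as an element of \<open>V \<otimes> W\<close>.
\<close>

definition tensor_restrict ::
    "('k :: field, 'a) module \<Rightarrow> 'a set \<Rightarrow> ('k, 'b) module \<Rightarrow> 'b set \<Rightarrow>
     ('a \<times> 'b \<Rightarrow>\<^sub>0 'k) set \<Rightarrow> ('a \<times> 'b \<Rightarrow>\<^sub>0 'k) set" where
  "tensor_restrict A V B W t =
    (THE s. s \<in> carrier (tensor (A\<lparr>carrier := V\<rparr>) (B\<lparr>carrier := W\<rparr>)) \<and>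
            tensor_map A B (\<lambda>a. a) (\<lambda>b. b) s = t)"

record (overloaded) ('k :: zero, 'a) hopf = "('k, 'a) module" +
  comult :: "'a \<Rightarrow> ('a \<times> 'a \<Rightarrow>\<^sub>0 'k) set"
  counit :: "'a \<Rightarrow> 'k"
  antipode :: "'a \<Rightarrow> 'a"

text \<open>
  In Sweedler notation, coassociativity compares the two elements
  \<open>\<Sum> (x\<^bsub>(1)(1)\<^esub> \<otimes> x\<^bsub>(1)(2)\<^esub>) \<otimes> x\<^bsub>(2)\<^esub>\<close> and \<open>\<Sum> (x\<^bsub>(1)\<^esub> \<otimes> x\<^bsub>(2)(1)\<^esub>) \<otimes> x\<^bsub>(2)(2)\<^esub>\<close>
  of \<open>(L \<otimes> L) \<otimes> L\<close>.
\<close>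

locale hopf_algebra = assoc_algebra L
  for L :: "('k :: field, 'a, 'm) hopf_scheme" (structure) +
  assumes comult_hom: "comult L \<in> algebra_hom L (tensor L L)"
    and counit_hom: "counit L \<in> algebra_hom L field_algebra"
    and coassoc: "x \<in> carrier L \<Longrightarrow>
      tensor_lift (tensor (tensor L L) L)
        (\<lambda>a b. pure_tensor (tensor L L) L (comult L a) b) (comult L x) =
      tensor_lift (tensor (tensor L L) L)
        (\<lambda>a b. tensor_lift (tensor (tensor L L) L)
          (\<lambda>c d. pure_tensor (tensor L L) L (pure_tensor L L a c) d) (comult L b)) (comult L x)"
    and counit_left: "x \<in> carrier L \<Longrightarrow>
      tensor_lift L (\<lambda>a b. counit L a \<odot> b) (comult L x) = x"
    and counit_right: "x \<in> carrier L \<Longrightarrow>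
      tensor_lift L (\<lambda>a b. counit L b \<odot> a) (comult L x) = x"
    and antipode_linear: "antipode L \<in> LinearCombinations.module_hom class_ring L L"
    and antipode_left: "x \<in> carrier L \<Longrightarrow>
      tensor_lift L (\<lambda>a b. antipode L a \<otimes> b) (comult L x) = counit L x \<odot> \<one>"
    and antipode_right: "x \<in> carrier L \<Longrightarrow>
      tensor_lift L (\<lambda>a b. a \<otimes> antipode L b) (comult L x) = counit L x \<odot> \<one>"

definition hopf_isomorphic ::
    "('k :: field, 'a, 'm) hopf_scheme \<Rightarrow> ('k, 'b, 'n) hopf_scheme \<Rightarrow> bool" where
  "hopf_isomorphic L H \<longleftrightarrow>
    (\<exists>f. f \<in> algebra_hom L H \<and> bij_betw f (carrier L) (carrier H) \<and>
      (\<forall>x \<in> carrier L.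
        comult H (f x) = tensor_map H H f f (comult L x) \<and>
        counit H (f x) = counit L x \<and>
        antipode H (f x) = f (antipode L x)))"

definition leg12 ::
    "('k :: field, 'a, 'm) module_scheme \<Rightarrow> ('a \<times> 'a \<Rightarrow>\<^sub>0 'k) set \<Rightarrow>
     (('a \<times> 'a \<Rightarrow>\<^sub>0 'k) set \<times> 'a \<Rightarrow>\<^sub>0 'k) set" where
  "leg12 A = tensor_lift (tensor (tensor A A) A)
    (\<lambda>a b. pure_tensor (tensor A A) A (pure_tensor A A a b) \<one>\<^bsub>A\<^esub>)"

definition leg13 ::
    "('k :: field, 'a, 'm) module_scheme \<Rightarrow> ('a \<times> 'a \<Rightarrow>\<^sub>0 'k) set \<Rightarrow>
     (('a \<times> 'a \<Rightarrow>\<^sub>0 'k) set \<times> 'a \<Rightarrow>\<^sub>0 'k) set" where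
  "leg13 A = tensor_lift (tensor (tensor A A) A)
    (\<lambda>a b. pure_tensor (tensor A A) A (pure_tensor A A a \<one>\<^bsub>A\<^esub>) b)"

definition leg23 ::
    "('k :: field, 'a, 'm) module_scheme \<Rightarrow> ('a \<times> 'a \<Rightarrow>\<^sub>0 'k) set \<Rightarrow>
     (('a \<times> 'a \<Rightarrow>\<^sub>0 'k) set \<times> 'a \<Rightarrow>\<^sub>0 'k) set" where
  "leg23 A = tensor_lift (tensor (tensor A A) A)
    (\<lambda>a b. pure_tensor (tensor A A) A (pure_tensor A A \<one>\<^bsub>A\<^esub> a) b)"

definition pentagon_equation ::
    "('k :: field, 'a, 'm) module_scheme \<Rightarrow> ('a \<times> 'a \<Rightarrow>\<^sub>0 'k) set \<Rightarrow> bool" where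
  "pentagon_equation A R \<longleftrightarrow>
    leg12 A R \<otimes>\<^bsub>tensor (tensor A A) A\<^esub> leg13 A R \<otimes>\<^bsub>tensor (tensor A A) A\<^esub> leg23 A R
      = leg23 A R \<otimes>\<^bsub>tensor (tensor A A) A\<^esub> leg12 A R"

definition is_decomposition ::
    "('k :: field, 'a, 'm) module_scheme \<Rightarrow> ('a \<times> 'a \<Rightarrow>\<^sub>0 'k) set \<Rightarrow> nat \<Rightarrow>
     (nat \<Rightarrow> 'a) \<Rightarrow> (nat \<Rightarrow> 'a) \<Rightarrow> bool" where
  "is_decomposition A R m a b \<longleftrightarrow>
    a \<in> {..<m} \<rightarrow> carrier A \<and> b \<in> {..<m} \<rightarrow> carrier A \<and>
    R = (\<Oplus>\<^bsub>tensor A A\<^esub>i \<in> {..<m}. pure_tensor A A (a i) (b i))"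

definition tensor_length ::
    "('k :: field, 'a, 'm) module_scheme \<Rightarrow> ('a \<times> 'a \<Rightarrow>\<^sub>0 'k) set \<Rightarrow> nat" where
  "tensor_length A R = (LEAST m. \<exists>a b. is_decomposition A R m a b)"

definition right_coinvariants ::
    "('k :: field, 'a, 'm) module_scheme \<Rightarrow> ('a \<times> 'a \<Rightarrow>\<^sub>0 'k) set \<Rightarrow> 'a set" where
  "right_coinvariants A R =
    {a \<in> carrier A.
      pure_tensor A A \<one>\<^bsub>A\<^esub> a \<otimes>\<^bsub>tensor A A\<^esub> R = pure_tensor A A \<one>\<^bsub>A\<^esub> a}"

abbreviation mat_algebra :: "nat \<Rightarrow> ('k :: field, 'k mat) module" where
  "mat_algebra n \<equiv> module_mat TYPE('k) n n"

text \<open>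
  The value at \<open>x\<close> of the \<open>p\<close>-th member of the basis dual to the linearly independent family
  \<open>b 0, \<dots>, b (m - 1)\<close>; only meaningful for \<open>x\<close> in the span of that family.
\<close>

definition dual_basis ::
    "('k :: field, 'a, 'm) module_scheme \<Rightarrow> nat \<Rightarrow> (nat \<Rightarrow> 'a) \<Rightarrow> nat \<Rightarrow> 'a \<Rightarrow> 'k" where
  "dual_basis V m b p x =
    (THE c. (\<forall>i \<ge> m. c i = 0) \<and> x = (\<Oplus>\<^bsub>V\<^esub>i \<in> {..<m}. c i \<odot>\<^bsub>V\<^esub> b i)) p"

text \<open>
  \<open>P(n, R)\<close> relative to a decomposition \<open>R = \<Sum>i<m. A i \<otimes> B i\<close> with \<open>m = l(R)\<close>. Counit and
  antipode are given on the basis \<open>A 0, \<dots>, A (m - 1)\<close> and extended linearly; the formula for the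
  comultiplication is linear as it stands. In the antipode, \<open>U = R\<^sup>-\<^sup>1\<close> is regarded as an element
  of \<open>mat_algebra n \<otimes> span B\<close>, since the dual basis is defined on \<open>span B\<close> only.
\<close>

definition P_of_decomposition ::
    "nat \<Rightarrow> ('k :: field mat \<times> 'k mat \<Rightarrow>\<^sub>0 'k) set \<Rightarrow> nat \<Rightarrow> (nat \<Rightarrow> 'k mat) \<Rightarrow> (nat \<Rightarrow> 'k mat) \<Rightarrow>
     ('k, 'k mat) hopf" where
  "P_of_decomposition n R m A B =
    (let M = mat_algebra n;
         U = inv\<^bsub>tensor M M\<^esub> R;
         SA = LinearCombinations.module.span class_ring M (A ` {..<m});
         SB = LinearCombinations.module.span class_ring M (B ` {..<m})
     in
      \<lparr>carrier = SA,
       mult = mult M,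
       one = \<one>\<^bsub>M\<^esub>,
       zero = \<zero>\<^bsub>M\<^esub>,
       add = add M,
       smult = smult M,
       comult = (\<lambda>x. tensor_restrict M SA M SA
          (U \<otimes>\<^bsub>tensor M M\<^esub> pure_tensor M M \<one>\<^bsub>M\<^esub> x \<otimes>\<^bsub>tensor M M\<^esub> R)),
       counit = (\<lambda>x. \<Sum>p<m. dual_basis M m A p x * dual_basis M m B p \<one>\<^bsub>M\<^esub>),
       antipode = (\<lambda>x. \<Oplus>\<^bsub>M\<^esub>p \<in> {..<m}. dual_basis M m A p x \<odot>\<^bsub>M\<^esub>
          tensor_lift M (\<lambda>u v. dual_basis M m B p v \<odot>\<^bsub>M\<^esub> u)
            (tensor_restrict M (carrier M) M SB U))\<rparr>)"

text \<open>For an invertible solution of the pentagon equation the result does not depend on the chosen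
  decomposition of minimal length.\<close>

definition P_hopf :: "nat \<Rightarrow> ('k :: field mat \<times> 'k mat \<Rightarrow>\<^sub>0 'k) set \<Rightarrow> ('k, 'k mat) hopf" where
  "P_hopf n R =
    (let m = tensor_length (mat_algebra n) R;
         (A, B) = (SOME (A, B). is_decomposition (mat_algebra n) R m A B)
     in P_of_decomposition n R m A B)"

definition invertible_pentagon_solution ::
    "nat \<Rightarrow> ('k :: field mat \<times> 'k mat \<Rightarrow>\<^sub>0 'k) set \<Rightarrow> bool" where
  "invertible_pentagon_solution n R \<longleftrightarrow>
    R \<in> Units (tensor (mat_algebra n) (mat_algebra n)) \<and> pentagon_equation (mat_algebra n) R"

end

theory Submission
  imports Defs
begin

text \<open>
  Fix a basis \<open>e\<^sub>0, \<dots>, e\<^sub>m\<^sub>-\<^sub>1\<close> of a finite-dimensional Hopf algebra and let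
  \<open>e\<^sub>i e\<^sub>j = \<Sum> \<mu> i j q e\<^sub>q\<close> and \<open>\<Delta>(e\<^sub>p) = \<Sum> \<delta> p i j e\<^sub>i \<otimes> e\<^sub>j\<close>. The idea behind the theorem is that an
  invertible solution \<open>R = \<Sum> A\<^sub>i \<otimes> B\<^sub>i\<close> of the pentagon equation, with independent \<open>A\<^sub>i\<close> and
  independent \<open>B\<^sub>i\<close>, amounts to a unital representation of a Heisenberg double, that is, of the relations
  \<open>A\<^sub>i A\<^sub>j = \<Sum> \<mu> i j q A\<^sub>q\<close>, \<open>B\<^sub>i B\<^sub>j = \<Sum> \<delta> p i j B\<^sub>p\<close> and
  \<open>A\<^sub>p B\<^sub>q = \<Sum> \<delta> p i j \<mu> r i q B\<^sub>r A\<^sub>j\<close>.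

  Every finite-dimensional \<open>L\<close> has such a representation on itself: \<open>A\<^sub>j\<close> has the entries
  \<open>\<mu> x j y\<close> and \<open>B\<^sub>q\<close> the entries \<open>\<delta> x q y\<close> (\<open>regular_realization\<close>). The antipode axioms say that
  \<open>\<Sum> S(A\<^sub>i) \<otimes> B\<^sub>i\<close> is inverse to \<open>R\<close>, and the relations give the pentagon equation
  (\<open>realization_of_heisenberg_relations\<close>). The map \<open>e\<^sub>i \<mapsto> A\<^sub>i\<close> is then an isomorphism onto the
  Hopf algebra of \<open>R\<close> (\<open>realize_iso\<close>). The latter is formed from an unknown decomposition of minimal
  length; but two decompositions with independent legs differ by a change of basis of the first leg
  and the contragredient change of basis of the second, and the formulas for counit and antipode
  pair a first leg with a second one.

  Conversely, contracting the third leg of the pentagon equation with a functional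
  (\<open>slice\<close>) yields the relations for the \<open>B\<^sub>i\<close> (\<open>B_mult\<close>), the identity
  \<open>(1 \<otimes> A\<^sub>p) R = R \<Delta>(A\<^sub>p)\<close> (\<open>R_X\<close>), and hence the commutation relation (\<open>AB_commute\<close>). In particular
  a Hopf algebra isomorphic to that of \<open>R\<close> has dimension \<open>m = l(R)\<close>.

  The formula for the coinvariants \<open>N\<close> is the structure theorem for Hopf modules. An element \<open>a\<close> lies
  in \<open>N\<close> iff \<open>a B\<^sub>q = \<eta>\<^sub>q a\<close> for all \<open>q\<close>, where \<open>1 = \<Sum> \<eta>\<^sub>q A\<^sub>q\<close>. With the antipode \<open>T\<close> of the co-opposite
  Hopf algebra, the element \<open>e = \<Sum> B\<^sub>i T(A\<^sub>i)\<close> satisfies \<open>e B\<^sub>q = \<eta>\<^sub>q e\<close>, \<open>\<Sum> B\<^sub>i e A\<^sub>i = 1\<close> and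
  \<open>e A\<^sub>j B\<^sub>i e = e\<close> or \<open>0\<close> according to whether \<open>i = j\<close> (\<open>e_B\<close>, \<open>sum_B_e_A\<close>, \<open>e_A_B_e\<close>). So every matrix is
  uniquely of the form \<open>\<Sum> w\<^sub>i A\<^sub>i\<close> with \<open>w\<^sub>i \<in> N\<close>, and \<open>n\<^sup>2 = m dim N\<close> (\<open>coinvariants_dim\<close>).

  The antipode \<open>T\<close> is the inverse of \<open>S\<close>. That \<open>S\<close> is injective is read off from
  a representation of the relations for the co-opposite Hopf algebra in which \<open>A\<^sub>p\<close> acts as right multiplication by
  \<open>S(e\<^sub>p)\<close>: the identities for \<open>e\<close> force the \<open>A\<^sub>p\<close> to be independent
  (\<open>antipode_rows_independent\<close>, \<open>co_opposite\<close>).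

  Tensor products are handled through coordinates: a tensor is determined by its scalar coordinates,
  those of a product and of the value of an induced linear map are given by the expected sums
  (\<open>lift\<close>, \<open>rep_mult\<close>), and so all identities between tensors become identities between sums in \<open>k\<close>.
\<close>

section \<open>The ring of linear endomorphisms\<close>

text \<open>
  All computations with the operators \<open>A\<^sub>i\<close>, \<open>B\<^sub>i\<close> take place in one ring of type class \<open>ring\<close>, so that
  the simplifier can reason about sums and products in it. Matrices of any size
  embed into this ring, without preserving the unit.
\<close>

typedef (overloaded) 'k lend = "{f :: (nat \<Rightarrow> 'k::field) \<Rightarrow> nat \<Rightarrow> 'k.
    (\<forall>u v. f (\<lambda>i. u i + v i) = (\<lambda>i. f u i + f v i)) \<and> (\<forall>c v. f (\<lambda>i. c * v i) = (\<lambda>i. c * f v i))}"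
  morphisms app Lend
  by (rule exI[of _ "\<lambda>v. v"]) simp

setup_lifting type_definition_lend

lemma app_scale: "app f (\<lambda>i. c * v i) = (\<lambda>i. c * app f v i)"
  using app[of f] by simp

lemma lend_eqI: "(\<And>v i. app f v i = app g v i) \<Longrightarrow> f = g"
  by (metis app_inject ext)

instantiation lend :: (field) ring
begin
lift_definition zero_lend :: "'a lend" is "\<lambda>v i. 0" by simp
lift_definition plus_lend :: "'a lend \<Rightarrow> 'a lend \<Rightarrow> 'a lend" is "\<lambda>f g v i. f v i + g v i"
  by (simp add: algebra_simps)
lift_definition uminus_lend :: "'a lend \<Rightarrow> 'a lend" is "\<lambda>f v i. - f v i"
  by (simp add: algebra_simps)
lift_definition minus_lend :: "'a lend \<Rightarrow> 'a lend \<Rightarrow> 'a lend" is "\<lambda>f g v i. f v i - g v i"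
  by (simp add: algebra_simps)
lift_definition times_lend :: "'a lend \<Rightarrow> 'a lend \<Rightarrow> 'a lend" is "\<lambda>f g v. f (g v)"
  by simp
instance
proof
  fix a b c :: "'a lend"
  show "(a * b) * c = a * (b * c)" by transfer simp
  show "(a + b) * c = a * c + b * c" by transfer simp
  show "a * (b + c) = a * b + a * c" by transfer (simp add: fun_eq_iff)
qed (transfer; simp add: fun_eq_iff algebra_simps)+
end

lift_definition scl :: "'k::field \<Rightarrow> 'k lend \<Rightarrow> 'k lend" is "\<lambda>c f v i. c * f v i"
  by (simp add: algebra_simps)

lemma app_simps [simp]:
  "app 0 v i = 0" "app (f + g) v i = app f v i + app g v i" "app (- f) v i = - app f v i"
  "app (f - g) v i = app f v i - app g v i" "app (f * g) v i = app f (app g v) i"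
  "app (scl c f) v i = c * app f v i"
  by (transfer; simp)+

lemma app_sum: "app (sum F A) v i = (\<Sum>a\<in>A. app (F a) v i)"
  by (induction A rule: infinite_finite_induct) auto

lemma scl_mult_left [simp]: "scl c f * g = scl c (f * g)"
  by (rule lend_eqI) simp
lemma scl_mult_right [simp]: "f * scl c g = scl c (f * g)"
  by (rule lend_eqI) (simp, metis app_scale app_simps(6) ext)
lemma scl_scl [simp]: "scl c (scl d f) = scl (c * d) f"
  by (rule lend_eqI) (simp add: algebra_simps)
lemma scl_0 [simp]: "scl 0 f = 0" "scl c 0 = 0" "scl 1 f = f"
  by (rule lend_eqI; simp)+
lemma scl_sum: "scl c (sum F A) = (\<Sum>a\<in>A. scl c (F a))"
  by (rule lend_eqI) (simp add: app_sum sum_distrib_left)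
lemma scl_sum_left: "scl (sum u A) f = (\<Sum>a\<in>A. scl (u a) f)"
  by (rule lend_eqI) (simp add: app_sum sum_distrib_right)
lemma scl_if: "scl (if P then c else 0) f = (if P then scl c f else 0)"
  by simp
lemma scl_eq_0: "scl c f = 0 \<longleftrightarrow> c = 0 \<or> f = 0"
  by (metis scl_0 scl_scl field_class.field_inverse)

lift_definition opm :: "nat set \<Rightarrow> (nat \<Rightarrow> nat \<Rightarrow> 'k::field) \<Rightarrow> 'k lend" is
  "\<lambda>I X v a. if a \<in> I then (\<Sum>b\<in>I. X a b * v b) else 0"
  by (auto simp: fun_eq_iff algebra_simps sum.distrib sum_distrib_left)

lemma app_opm: "app (opm I X) v a = (if a \<in> I then (\<Sum>b\<in>I. X a b * v b) else 0)"
  by transfer simp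

lemma opm_mult:
  "opm I X * opm I Y = opm I (\<lambda>a b. \<Sum>c\<in>I. X a c * Y c b)"
proof (rule lend_eqI)
  fix v i
  have "(\<Sum>b\<in>I. X i b * (if b \<in> I then \<Sum>c\<in>I. Y b c * v c else 0)) = (\<Sum>b\<in>I. (\<Sum>c\<in>I. X i b * (Y b c * v c)))"
    by (rule sum.cong) (auto simp: sum_distrib_left)
  also have "\<dots> = (\<Sum>c\<in>I. (\<Sum>b\<in>I. X i b * (Y b c * v c)))" by (rule sum.swap)
  finally show "app (opm I X * opm I Y) v i = app (opm I (\<lambda>a b. \<Sum>c\<in>I. X a c * Y c b)) v i"
    by (simp add: app_opm sum_distrib_right mult.assoc)
qed

lemma opm_cong: "(\<And>a b. a \<in> I \<Longrightarrow> b \<in> I \<Longrightarrow> X a b = Y a b) \<Longrightarrow> opm I X = opm I Y"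
  by (rule lend_eqI) (simp add: app_opm cong: sum.cong)

lemma opm_scl: "scl c (opm I X) = opm I (\<lambda>a b. c * X a b)"
  by (rule lend_eqI) (simp add: app_opm sum_distrib_left mult.assoc)

lemma opm_sum: "finite A \<Longrightarrow> (\<Sum>x\<in>A. opm I (F x)) = opm I (\<lambda>a b. \<Sum>x\<in>A. F x a b)"
  by (rule lend_eqI) (auto simp add: app_opm app_sum sum_distrib_right sum.swap[of _ A I])

lemma opm_lincomb:
  "finite A \<Longrightarrow> (\<Sum>x\<in>A. scl (u x) (opm I (F x))) = opm I (\<lambda>a b. \<Sum>x\<in>A. u x * F x a b)"
  by (simp add: opm_scl opm_sum)

lemma opm_inject:
  assumes "finite I" "opm I X = opm I Y" "a \<in> I" "b \<in> I"
  shows "X a b = Y a b"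
proof -
  have "app (opm I Z) (\<lambda>i. if i = b then 1 else 0) a = Z a b" for Z :: "nat \<Rightarrow> nat \<Rightarrow> 'a"
    using assms by (simp add: app_opm if_distrib cong: if_cong)
  then show ?thesis using assms by metis
qed

section \<open>Hopf algebras given by structure constants\<close>

lemma sum_swap_23:
  "(\<Sum>p\<in>A. \<Sum>q\<in>B. \<Sum>r\<in>C. f p q r) = (\<Sum>p\<in>A. \<Sum>r\<in>C. \<Sum>q\<in>B. f p q r)"
  by (rule sum.cong[OF refl], rule sum.swap)

lemma sum_rotate3:
  "(\<Sum>p\<in>A. \<Sum>q\<in>B. \<Sum>r\<in>C. f p q r) = (\<Sum>q\<in>B. \<Sum>r\<in>C. \<Sum>p\<in>A. f p q r)"
  by (subst sum.swap, rule sum.cong[OF refl], rule sum.swap)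

lemma sum_rotate3':
  "(\<Sum>p\<in>A. \<Sum>q\<in>B. \<Sum>r\<in>C. f p q r) = (\<Sum>r\<in>C. \<Sum>p\<in>A. \<Sum>q\<in>B. f p q r)"
  by (rule sum_rotate3[symmetric])

lemma sum_swap_13:
  "(\<Sum>p\<in>A. \<Sum>q\<in>B. \<Sum>r\<in>C. f p q r) = (\<Sum>r\<in>C. \<Sum>q\<in>B. \<Sum>p\<in>A. f p q r)"
  by (subst sum_rotate3', rule sum.cong[OF refl], rule sum.swap)

lemma sum_swap_pairs:
  "(\<Sum>p\<in>A. \<Sum>q\<in>B. \<Sum>r\<in>C. \<Sum>s\<in>D. f p q r s) = (\<Sum>r\<in>C. \<Sum>s\<in>D. \<Sum>p\<in>A. \<Sum>q\<in>B. f p q r s)"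
proof -
  have "(\<Sum>p\<in>A. \<Sum>q\<in>B. \<Sum>r\<in>C. \<Sum>s\<in>D. f p q r s) = (\<Sum>p\<in>A. \<Sum>r\<in>C. \<Sum>s\<in>D. \<Sum>q\<in>B. f p q r s)"
    by (intro sum.cong refl sum_rotate3)
  also have "\<dots> = (\<Sum>r\<in>C. \<Sum>s\<in>D. \<Sum>p\<in>A. \<Sum>q\<in>B. f p q r s)" by (rule sum_rotate3)
  finally show ?thesis .
qed

text \<open>
  A coalgebra with basis \<open>I\<close>, comultiplication \<open>e\<^sub>p \<mapsto> \<Sum> \<delta> p i j e\<^sub>i \<otimes> e\<^sub>j\<close> and counit \<open>\<epsilon>\<close>. Algebras are
  covered as well: with \<open>\<delta> p i j\<close> read as the coefficient of \<open>e\<^sub>p\<close> in \<open>e\<^sub>i e\<^sub>j\<close>, the same identities are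
  associativity and the unit laws.
\<close>

locale coalg =
  fixes I :: "'i set" and \<delta> :: "'i \<Rightarrow> 'i \<Rightarrow> 'i \<Rightarrow> 'k :: field" and \<epsilon> :: "'i \<Rightarrow> 'k"
  assumes fin: "finite I"
    and coassoc: "\<lbrakk>p \<in> I; i \<in> I; j \<in> I; k \<in> I\<rbrakk> \<Longrightarrow>
      (\<Sum>a\<in>I. \<delta> p a k * \<delta> a i j) = (\<Sum>a\<in>I. \<delta> p i a * \<delta> a j k)"
    and counit_l: "\<lbrakk>p \<in> I; j \<in> I\<rbrakk> \<Longrightarrow> (\<Sum>i\<in>I. \<delta> p i j * \<epsilon> i) = (if p = j then 1 else 0)"
    and counit_r: "\<lbrakk>p \<in> I; j \<in> I\<rbrakk> \<Longrightarrow> (\<Sum>i\<in>I. \<delta> p j i * \<epsilon> i) = (if p = j then 1 else 0)"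
begin

text \<open>
  The convolution product of two linear maps from the coalgebra to the ring of operators, each given
  by its values on the basis.
\<close>

definition conv :: "('i \<Rightarrow> 'k lend) \<Rightarrow> ('i \<Rightarrow> 'k lend) \<Rightarrow> 'i \<Rightarrow> 'k lend" where
  "conv F G p = (\<Sum>i\<in>I. \<Sum>j\<in>I. scl (\<delta> p i j) (F i * G j))"

lemma conv_cong:
  "(\<And>i. i \<in> I \<Longrightarrow> F i = F' i) \<Longrightarrow> (\<And>i. i \<in> I \<Longrightarrow> G i = G' i) \<Longrightarrow> conv F G p = conv F' G' p"
  by (simp add: conv_def cong: sum.cong)

lemma conv_assoc:
  assumes "p \<in> I"
  shows "conv (conv F G) K p = conv F (conv G K) p"
proof -
  have "conv (conv F G) K p = (\<Sum>a\<in>I. \<Sum>k\<in>I. \<Sum>i\<in>I. \<Sum>j\<in>I. scl (\<delta> p a k * \<delta> a i j) (F i * G j * K k))"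
    by (simp add: conv_def sum_distrib_right scl_sum)
  also have "\<dots> = (\<Sum>i\<in>I. \<Sum>j\<in>I. \<Sum>a\<in>I. \<Sum>k\<in>I. scl (\<delta> p a k * \<delta> a i j) (F i * G j * K k))"
    by (rule sum_swap_pairs)
  also have "\<dots> = (\<Sum>i\<in>I. \<Sum>j\<in>I. \<Sum>k\<in>I. \<Sum>a\<in>I. scl (\<delta> p a k * \<delta> a i j) (F i * G j * K k))"
    by (intro sum.cong refl sum.swap)
  also have "\<dots> = (\<Sum>i\<in>I. \<Sum>j\<in>I. \<Sum>k\<in>I. \<Sum>a\<in>I. scl (\<delta> p i a * \<delta> a j k) (F i * G j * K k))"
    unfolding scl_sum_left[symmetric] by (simp add: assms coassoc cong: sum.cong)
  also have "\<dots> = (\<Sum>i\<in>I. \<Sum>a\<in>I. \<Sum>j\<in>I. \<Sum>k\<in>I. scl (\<delta> p i a * \<delta> a j k) (F i * G j * K k))"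
    by (intro sum.cong refl sum_rotate3')
  also have "\<dots> = conv F (conv G K) p"
    by (simp add: conv_def sum_distrib_left scl_sum mult.assoc)
  finally show ?thesis .
qed

lemma conv_unit_left:
  assumes "p \<in> I" "\<And>j. j \<in> I \<Longrightarrow> u * F j = F j"
  shows "conv (\<lambda>i. scl (\<epsilon> i) u) F p = F p"
proof -
  have "conv (\<lambda>i. scl (\<epsilon> i) u) F p = (\<Sum>j\<in>I. \<Sum>i\<in>I. scl (\<delta> p i j * \<epsilon> i) (F j))"
    unfolding conv_def by (subst sum.swap) (simp add: assms cong: sum.cong)
  also have "\<dots> = F p"
    using assms fin by (simp flip: scl_sum_left add: counit_l scl_if cong: sum.cong)
  finally show ?thesis .
qed

lemma conv_unit_right:
  assumes "p \<in> I" "\<And>j. j \<in> I \<Longrightarrow> F j * u = F j"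
  shows "conv F (\<lambda>i. scl (\<epsilon> i) u) p = F p"
proof -
  have "conv F (\<lambda>i. scl (\<epsilon> i) u) p = (\<Sum>j\<in>I. \<Sum>i\<in>I. scl (\<delta> p j i * \<epsilon> i) (F j))"
    unfolding conv_def by (simp add: assms cong: sum.cong)
  also have "\<dots> = F p"
    using assms fin by (simp flip: scl_sum_left add: counit_r scl_if cong: sum.cong)
  finally show ?thesis .
qed

text \<open>
  A left and a right convolution inverse of the same map agree, by associativity. The operator \<open>u\<close>
  is the unit of the subring in question, not the unit of the ambient ring.
\<close>

lemma conv_inverse_unique:
  assumes "\<And>i. i \<in> I \<Longrightarrow> conv F G i = scl (\<epsilon> i) u" "\<And>i. i \<in> I \<Longrightarrow> conv G H i = scl (\<epsilon> i) u"
    and "\<And>i. i \<in> I \<Longrightarrow> F i * u = F i" "\<And>i. i \<in> I \<Longrightarrow> u * H i = H i"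
    and "p \<in> I"
  shows "F p = H p"
proof -
  have "F p = conv F (\<lambda>i. scl (\<epsilon> i) u) p" using assms by (simp add: conv_unit_right)
  also have "\<dots> = conv F (conv G H) p" by (rule conv_cong) (simp_all add: assms)
  also have "\<dots> = conv (conv F G) H p" using assms by (simp add: conv_assoc)
  also have "\<dots> = conv (\<lambda>i. scl (\<epsilon> i) u) H p" by (rule conv_cong) (simp_all add: assms)
  also have "\<dots> = H p" using assms by (simp add: conv_unit_left)
  finally show ?thesis .
qed

lemma coalg_cop: "coalg I (\<lambda>p i j. \<delta> p j i) \<epsilon>"
  by unfold_locales (simp_all add: fin coassoc counit_l counit_r)

text \<open>
  The tensor square of a coalgebra; convolution over it is used to compare the maps
  \<open>x \<otimes> y \<mapsto> S(xy)\<close> and \<open>x \<otimes> y \<mapsto> S(y)S(x)\<close>.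
\<close>

lemma coalg_square:
  "coalg (I \<times> I) (\<lambda>p i j. \<delta> (fst p) (fst i) (fst j) * \<delta> (snd p) (snd i) (snd j))
    (\<lambda>i. \<epsilon> (fst i) * \<epsilon> (snd i))"
proof unfold_locales
  have *: "(\<Sum>a\<in>I \<times> I. f (fst a) * g (snd a)) = (\<Sum>a\<in>I. f a) * (\<Sum>a\<in>I. g a)" for f g :: "'i \<Rightarrow> 'k"
    by (simp add: sum_product sum.cartesian_product case_prod_beta)
  fix p i j k assume "p \<in> I \<times> I" "i \<in> I \<times> I" "j \<in> I \<times> I" "k \<in> I \<times> I"
  then show "(\<Sum>a\<in>I \<times> I. \<delta> (fst p) (fst a) (fst k) * \<delta> (snd p) (snd a) (snd k) *
         (\<delta> (fst a) (fst i) (fst j) * \<delta> (snd a) (snd i) (snd j))) =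
       (\<Sum>a\<in>I \<times> I. \<delta> (fst p) (fst i) (fst a) * \<delta> (snd p) (snd i) (snd a) *
         (\<delta> (fst a) (fst j) (fst k) * \<delta> (snd a) (snd j) (snd k)))"
    using *[of "\<lambda>a. \<delta> (fst p) a (fst k) * \<delta> a (fst i) (fst j)" "\<lambda>a. \<delta> (snd p) a (snd k) * \<delta> a (snd i) (snd j)"]
      *[of "\<lambda>a. \<delta> (fst p) (fst i) a * \<delta> a (fst j) (fst k)" "\<lambda>a. \<delta> (snd p) (snd i) a * \<delta> a (snd j) (snd k)"]
    by (auto simp: coassoc ac_simps)
next
  have *: "(\<Sum>a\<in>I \<times> I. f (fst a) * g (snd a)) = (\<Sum>a\<in>I. f a) * (\<Sum>a\<in>I. g a)" for f g :: "'i \<Rightarrow> 'k"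
    by (simp add: sum_product sum.cartesian_product case_prod_beta)
  fix p j assume pj: "p \<in> I \<times> I" "j \<in> I \<times> I"
  have "(\<Sum>i\<in>I \<times> I. \<delta> (fst p) (fst i) (fst j) * \<delta> (snd p) (snd i) (snd j) * (\<epsilon> (fst i) * \<epsilon> (snd i)))
      = (\<Sum>i\<in>I. \<delta> (fst p) i (fst j) * \<epsilon> i) * (\<Sum>i\<in>I. \<delta> (snd p) i (snd j) * \<epsilon> i)"
    by (subst *[symmetric]) (simp add: ac_simps)
  then show "(\<Sum>i\<in>I \<times> I. \<delta> (fst p) (fst i) (fst j) * \<delta> (snd p) (snd i) (snd j) * (\<epsilon> (fst i) * \<epsilon> (snd i))) = (if p = j then 1 else 0)"
    using pj by (auto simp: counit_l prod_eq_iff)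
  have "(\<Sum>i\<in>I \<times> I. \<delta> (fst p) (fst j) (fst i) * \<delta> (snd p) (snd j) (snd i) * (\<epsilon> (fst i) * \<epsilon> (snd i)))
      = (\<Sum>i\<in>I. \<delta> (fst p) (fst j) i * \<epsilon> i) * (\<Sum>i\<in>I. \<delta> (snd p) (snd j) i * \<epsilon> i)"
    by (subst *[symmetric]) (simp add: ac_simps)
  then show "(\<Sum>i\<in>I \<times> I. \<delta> (fst p) (fst j) (fst i) * \<delta> (snd p) (snd j) (snd i) * (\<epsilon> (fst i) * \<epsilon> (snd i))) = (if p = j then 1 else 0)"
    using pj by (auto simp: counit_r prod_eq_iff)
qed (simp add: fin)

end

text \<open>
  A Hopf algebra by structure constants: \<open>e\<^sub>i e\<^sub>j = \<Sum> \<mu> i j q e\<^sub>q\<close>, \<open>1 = \<Sum> \<eta> i e\<^sub>i\<close> and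
  \<open>S(e\<^sub>p) = \<Sum> S p a e\<^sub>a\<close>.
\<close>

locale hopf_sc = C: coalg I \<delta> \<epsilon> + D: coalg I "\<lambda>p i j. \<mu> i j p" \<eta>
  for I :: "nat set" and \<mu> \<delta> :: "nat \<Rightarrow> nat \<Rightarrow> nat \<Rightarrow> 'k :: field" and \<eta> \<epsilon> :: "nat \<Rightarrow> 'k" +
  fixes S :: "nat \<Rightarrow> nat \<Rightarrow> 'k"
  assumes bialg: "\<lbrakk>i \<in> I; j \<in> I; k \<in> I; l \<in> I\<rbrakk> \<Longrightarrow> (\<Sum>a\<in>I. \<mu> i j a * \<delta> a k l) =
      (\<Sum>p\<in>I. \<Sum>q\<in>I. \<Sum>r\<in>I. \<Sum>s\<in>I. \<delta> i p q * \<delta> j r s * \<mu> p r k * \<mu> q s l)"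
    and eps_mult: "\<lbrakk>i \<in> I; j \<in> I\<rbrakk> \<Longrightarrow> (\<Sum>a\<in>I. \<mu> i j a * \<epsilon> a) = \<epsilon> i * \<epsilon> j"
    and delta_eta: "\<lbrakk>i \<in> I; j \<in> I\<rbrakk> \<Longrightarrow> (\<Sum>a\<in>I. \<delta> a i j * \<eta> a) = \<eta> i * \<eta> j"
    and eps_eta: "(\<Sum>a\<in>I. \<epsilon> a * \<eta> a) = 1"
    and S_left: "\<lbrakk>p \<in> I; q \<in> I\<rbrakk> \<Longrightarrow> (\<Sum>i\<in>I. \<Sum>j\<in>I. \<Sum>a\<in>I. \<delta> p i j * S i a * \<mu> a j q) = \<epsilon> p * \<eta> q"
    and S_right: "\<lbrakk>p \<in> I; q \<in> I\<rbrakk> \<Longrightarrow> (\<Sum>i\<in>I. \<Sum>j\<in>I. \<Sum>a\<in>I. \<delta> p i j * S j a * \<mu> i a q) = \<epsilon> p * \<eta> q"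
begin

text \<open>
  The axioms are invariant under exchanging multiplication with comultiplication, so each identity
  about one of them gives an identity about the other.
\<close>

lemma dual: "hopf_sc I (\<lambda>i j p. \<delta> p i j) (\<lambda>p i j. \<mu> i j p) \<epsilon> \<eta> (\<lambda>i j. S j i)"
proof unfold_locales
  fix i j k l assume *: "i \<in> I" "j \<in> I" "k \<in> I" "l \<in> I"
  have "(\<Sum>p\<in>I. \<Sum>q\<in>I. \<Sum>r\<in>I. \<Sum>s\<in>I. \<mu> p q i * \<mu> r s j * \<delta> k p r * \<delta> l q s)
     = (\<Sum>p\<in>I. \<Sum>r\<in>I. \<Sum>q\<in>I. \<Sum>s\<in>I. \<mu> p q i * \<mu> r s j * \<delta> k p r * \<delta> l q s)"
    by (intro sum.cong refl sum.swap)
  with bialg[OF *(3,4,1,2)]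
  show "(\<Sum>a\<in>I. \<delta> a i j * \<mu> k l a) =
       (\<Sum>p\<in>I. \<Sum>q\<in>I. \<Sum>r\<in>I. \<Sum>s\<in>I. \<mu> p q i * \<mu> r s j * \<delta> k p r * \<delta> l q s)"
    by (simp add: ac_simps)
next
  show "(\<Sum>a\<in>I. \<eta> a * \<epsilon> a) = 1" using eps_eta by (simp add: ac_simps)
next
  fix p q assume *: "p \<in> I" "q \<in> I"
  show "(\<Sum>i\<in>I. \<Sum>j\<in>I. \<Sum>a\<in>I. \<mu> i j p * S a i * \<delta> q a j) = \<eta> p * \<epsilon> q"
    using S_left[OF *(2,1)] by (subst sum_swap_13) (simp add: ac_simps)
  have "(\<Sum>i\<in>I. \<Sum>j\<in>I. \<Sum>a\<in>I. \<mu> i j p * S a j * \<delta> q i a)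
      = (\<Sum>i\<in>I. \<Sum>a\<in>I. \<Sum>j\<in>I. \<mu> i j p * S a j * \<delta> q i a)"
    by (rule sum_swap_23)
  then show "(\<Sum>i\<in>I. \<Sum>j\<in>I. \<Sum>a\<in>I. \<mu> i j p * S a j * \<delta> q i a) = \<eta> p * \<epsilon> q"
    using S_right[OF *(2,1)] by (simp add: ac_simps)
qed (simp_all add: eps_mult delta_eta)

end

context hopf_sc
begin

text \<open>
  The image of the element with coordinates \<open>x\<close> under the linear map \<open>e\<^sub>i \<mapsto> a i\<close>.
\<close>

definition img :: "(nat \<Rightarrow> 'k lend) \<Rightarrow> (nat \<Rightarrow> 'k) \<Rightarrow> 'k lend" where
  "img a x = (\<Sum>i\<in>I. scl (x i) (a i))"

lemma rep_unit:
  assumes rep: "\<And>i j. i \<in> I \<Longrightarrow> j \<in> I \<Longrightarrow> a i * a j = img a (\<mu> i j)" and j: "j \<in> I"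
  shows "img a \<eta> * a j = a j" "a j * img a \<eta> = a j"
proof -
  have "img a \<eta> * a j = (\<Sum>k\<in>I. \<Sum>i\<in>I. scl (\<mu> i j k * \<eta> i) (a k))"
    using j by (subst sum.swap) (simp add: img_def sum_distrib_right rep scl_sum ac_simps cong: sum.cong)
  also have "\<dots> = a j"
    using j C.fin by (simp flip: scl_sum_left add: D.counit_l scl_if cong: sum.cong)
  finally show "img a \<eta> * a j = a j" .
  have "a j * img a \<eta> = (\<Sum>k\<in>I. \<Sum>i\<in>I. scl (\<mu> j i k * \<eta> i) (a k))"
    using j by (subst sum.swap) (simp add: img_def sum_distrib_left rep scl_sum ac_simps cong: sum.cong)
  also have "\<dots> = a j"
    using j C.fin by (simp flip: scl_sum_left add: D.counit_r scl_if cong: sum.cong)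
  finally show "a j * img a \<eta> = a j" .
qed

lemma rep_antipode:
  assumes rep: "\<And>i j. i \<in> I \<Longrightarrow> j \<in> I \<Longrightarrow> a i * a j = img a (\<mu> i j)" and p: "p \<in> I"
  shows "C.conv (\<lambda>i. img a (S i)) a p = scl (\<epsilon> p) (img a \<eta>)"
    "C.conv a (\<lambda>i. img a (S i)) p = scl (\<epsilon> p) (img a \<eta>)"
proof -
  have "C.conv (\<lambda>i. img a (S i)) a p = (\<Sum>i\<in>I. \<Sum>j\<in>I. \<Sum>b\<in>I. \<Sum>q\<in>I. scl (\<delta> p i j * S i b * \<mu> b j q) (a q))"
    by (simp add: C.conv_def img_def sum_distrib_right scl_sum rep ac_simps cong: sum.cong)
  also have "\<dots> = (\<Sum>i\<in>I. \<Sum>q\<in>I. \<Sum>j\<in>I. \<Sum>b\<in>I. scl (\<delta> p i j * S i b * \<mu> b j q) (a q))"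
    by (intro sum.cong refl sum_rotate3')
  also have "\<dots> = (\<Sum>q\<in>I. \<Sum>i\<in>I. \<Sum>j\<in>I. \<Sum>b\<in>I. scl (\<delta> p i j * S i b * \<mu> b j q) (a q))"
    by (rule sum.swap)
  also have "\<dots> = scl (\<epsilon> p) (img a \<eta>)"
    using p by (simp flip: scl_sum_left add: S_left img_def scl_sum)
  finally show "C.conv (\<lambda>i. img a (S i)) a p = scl (\<epsilon> p) (img a \<eta>)" .
  have "C.conv a (\<lambda>i. img a (S i)) p = (\<Sum>i\<in>I. \<Sum>j\<in>I. \<Sum>b\<in>I. \<Sum>q\<in>I. scl (\<delta> p i j * S j b * \<mu> i b q) (a q))"
    by (simp add: C.conv_def img_def sum_distrib_left scl_sum rep ac_simps cong: sum.cong)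
  also have "\<dots> = (\<Sum>i\<in>I. \<Sum>q\<in>I. \<Sum>j\<in>I. \<Sum>b\<in>I. scl (\<delta> p i j * S j b * \<mu> i b q) (a q))"
    by (intro sum.cong refl sum_rotate3')
  also have "\<dots> = (\<Sum>q\<in>I. \<Sum>i\<in>I. \<Sum>j\<in>I. \<Sum>b\<in>I. scl (\<delta> p i j * S j b * \<mu> i b q) (a q))"
    by (rule sum.swap)
  also have "\<dots> = scl (\<epsilon> p) (img a \<eta>)"
    using p by (simp flip: scl_sum_left add: S_right img_def scl_sum)
  finally show "C.conv a (\<lambda>i. img a (S i)) p = scl (\<epsilon> p) (img a \<eta>)" .
qed

text \<open>
  Both \<open>x \<otimes> y \<mapsto> S(xy)\<close> and \<open>x \<otimes> y \<mapsto> S(y)S(x)\<close> are convolution inverses of \<open>x \<otimes> y \<mapsto> xy\<close>, hence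
  equal. The argument is carried out in the image of a representation \<open>a\<close>.
\<close>

lemma rep_antimult:
  assumes rep: "\<And>i j. i \<in> I \<Longrightarrow> j \<in> I \<Longrightarrow> a i * a j = img a (\<mu> i j)"
    and ij: "i \<in> I" "j \<in> I"
  shows "(\<Sum>k\<in>I. scl (\<mu> i j k) (img a (S k))) = img a (S j) * img a (S i)"
proof -
  interpret Q: coalg "I \<times> I" "\<lambda>p i j. \<delta> (fst p) (fst i) (fst j) * \<delta> (snd p) (snd i) (snd j)"
    "\<lambda>i. \<epsilon> (fst i) * \<epsilon> (snd i)"
    by (rule C.coalg_square)
  let ?u = "img a \<eta>" and ?s = "\<lambda>i. img a (S i)"
  let ?P = "\<lambda>p. \<Sum>k\<in>I. scl (\<mu> (fst p) (snd p) k) (?s k)"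
  let ?m = "\<lambda>p. a (fst p) * a (snd p)" and ?Q = "\<lambda>p. ?s (snd p) * ?s (fst p)"
  have unit: "?u * a k = a k" "a k * ?u = a k" if "k \<in> I" for k
    using rep_unit[of a] rep that by blast+
  have unit_s: "?u * ?s k = ?s k" "?s k * ?u = ?s k" for k
    by (simp_all add: img_def[of a "S k"] sum_distrib_left sum_distrib_right unit cong: sum.cong)
  have anti1: "(\<Sum>i\<in>I. \<Sum>j\<in>I. scl (\<delta> p i j) (?s i * a j)) = scl (\<epsilon> p) ?u" if "p \<in> I" for p
    using rep_antipode(1)[of a p] rep that by (simp add: C.conv_def)
  have anti2: "(\<Sum>i\<in>I. \<Sum>j\<in>I. scl (\<delta> p i j) (a i * ?s j)) = scl (\<epsilon> p) ?u" if "p \<in> I" for p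
    using rep_antipode(2)[of a p] rep that by (simp add: C.conv_def)
  have "?P (i, j) = ?Q (i, j)"
  proof (rule Q.conv_inverse_unique[where G = ?m and u = ?u])
    fix x assume "x \<in> I \<times> I"
    then obtain i j where x: "x = (i, j)" and ij: "i \<in> I" "j \<in> I" by auto
    have "Q.conv ?P ?m x =
      (\<Sum>p\<in>I. \<Sum>r\<in>I. \<Sum>q\<in>I. \<Sum>s\<in>I. scl (\<delta> i p q * \<delta> j r s) ((\<Sum>k\<in>I. scl (\<mu> p r k) (?s k)) * (a q * a s)))"
      by (simp add: Q.conv_def x sum.cartesian_product')
    also have "\<dots> = (\<Sum>p\<in>I. \<Sum>r\<in>I. \<Sum>q\<in>I. \<Sum>s\<in>I. \<Sum>l\<in>I. \<Sum>k\<in>I. scl (\<delta> i p q * \<delta> j r s * \<mu> p r k * \<mu> q s l) (?s k * a l))"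
      by (simp add: rep img_def[of a "\<mu> _ _"] sum_distrib_left sum_distrib_right scl_sum ac_simps cong: sum.cong)
    also have "\<dots> = (\<Sum>p\<in>I. \<Sum>r\<in>I. \<Sum>l\<in>I. \<Sum>k\<in>I. \<Sum>q\<in>I. \<Sum>s\<in>I. scl (\<delta> i p q * \<delta> j r s * \<mu> p r k * \<mu> q s l) (?s k * a l))"
      by (intro sum.cong refl sum_swap_pairs)
    also have "\<dots> = (\<Sum>l\<in>I. \<Sum>k\<in>I. \<Sum>p\<in>I. \<Sum>r\<in>I. \<Sum>q\<in>I. \<Sum>s\<in>I. scl (\<delta> i p q * \<delta> j r s * \<mu> p r k * \<mu> q s l) (?s k * a l))"
      by (rule sum_swap_pairs)
    also have "\<dots> = (\<Sum>l\<in>I. \<Sum>k\<in>I. \<Sum>p\<in>I. \<Sum>q\<in>I. \<Sum>r\<in>I. \<Sum>s\<in>I. scl (\<delta> i p q * \<delta> j r s * \<mu> p r k * \<mu> q s l) (?s k * a l))"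
      by (intro sum.cong refl sum.swap)
    also have "\<dots> = (\<Sum>l\<in>I. \<Sum>k\<in>I. scl (\<Sum>b\<in>I. \<mu> i j b * \<delta> b k l) (?s k * a l))"
      unfolding scl_sum_left[symmetric] by (simp add: bialg ij cong: sum.cong)
    also have "\<dots> = (\<Sum>l\<in>I. \<Sum>k\<in>I. \<Sum>b\<in>I. scl (\<mu> i j b * \<delta> b k l) (?s k * a l))"
      by (simp add: scl_sum_left)
    also have "\<dots> = (\<Sum>b\<in>I. \<Sum>k\<in>I. \<Sum>l\<in>I. scl (\<mu> i j b * \<delta> b k l) (?s k * a l))"
      by (rule sum_swap_13)
    also have "\<dots> = (\<Sum>b\<in>I. scl (\<mu> i j b) (\<Sum>k\<in>I. \<Sum>l\<in>I. scl (\<delta> b k l) (?s k * a l)))"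
      by (simp add: scl_sum)
    also have "\<dots> = (\<Sum>b\<in>I. scl (\<mu> i j b * \<epsilon> b) ?u)"
      by (simp add: anti1 cong: sum.cong)
    also have "\<dots> = scl (\<epsilon> i * \<epsilon> j) ?u"
      by (simp flip: scl_sum_left add: eps_mult ij)
    finally show "Q.conv ?P ?m x = scl (\<epsilon> (fst x) * \<epsilon> (snd x)) ?u" by (simp add: x)
    have "Q.conv ?m ?Q x =
      (\<Sum>p\<in>I. \<Sum>r\<in>I. \<Sum>q\<in>I. \<Sum>s\<in>I. scl (\<delta> i p q * \<delta> j r s) (a p * (a r * (?s s * ?s q))))"
      by (simp add: Q.conv_def x mult.assoc sum.cartesian_product')
    also have "\<dots> = (\<Sum>p\<in>I. \<Sum>q\<in>I. \<Sum>r\<in>I. \<Sum>s\<in>I. scl (\<delta> i p q * \<delta> j r s) (a p * (a r * (?s s * ?s q))))"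
      by (intro sum.cong refl sum.swap)
    also have "\<dots> = (\<Sum>p\<in>I. \<Sum>q\<in>I. scl (\<delta> i p q) (a p * ((\<Sum>r\<in>I. \<Sum>s\<in>I. scl (\<delta> j r s) (a r * ?s s)) * ?s q)))"
      by (simp add: sum_distrib_left sum_distrib_right scl_sum mult.assoc)
    also have "\<dots> = (\<Sum>p\<in>I. \<Sum>q\<in>I. scl (\<epsilon> j) (scl (\<delta> i p q) (a p * ?s q)))"
      by (simp add: anti2 ij unit_s ac_simps)
    also have "\<dots> = scl (\<epsilon> j) (\<Sum>p\<in>I. \<Sum>q\<in>I. scl (\<delta> i p q) (a p * ?s q))"
      by (simp add: scl_sum del: scl_scl)
    also have "\<dots> = scl (\<epsilon> i * \<epsilon> j) ?u"
      by (simp add: anti2 ij ac_simps)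
    finally show "Q.conv ?m ?Q x = scl (\<epsilon> (fst x) * \<epsilon> (snd x)) ?u" by (simp add: x)
  next
    fix x assume "x \<in> I \<times> I"
    show "?P x * ?u = ?P x" by (simp add: sum_distrib_right unit_s)
    show "?u * ?Q x = ?Q x" by (simp flip: mult.assoc add: unit_s)
  qed (use ij in auto)
  then show ?thesis by simp
qed

text \<open>
  Left multiplication by \<open>e\<^sub>i\<close>. This representation is faithful because of the unit, and so identities
  that hold in the image of every representation hold for the structure constants.
\<close>

definition lreg :: "nat \<Rightarrow> 'k lend" where
  "lreg i = opm I (\<lambda>y x. \<mu> i x y)"

lemma lreg_mult:
  assumes ij: "i \<in> I" "j \<in> I"
  shows "lreg i * lreg j = img lreg (\<mu> i j)"
proof -
  have "lreg i * lreg j = opm I (\<lambda>y x. \<Sum>c\<in>I. \<mu> i c y * \<mu> j x c)"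
    by (simp add: lreg_def opm_mult)
  also have "\<dots> = opm I (\<lambda>y x. \<Sum>k\<in>I. \<mu> i j k * \<mu> k x y)"
    by (rule opm_cong) (use D.coassoc[OF _ ij] in \<open>simp add: mult.commute\<close>)
  also have "\<dots> = img lreg (\<mu> i j)"
    by (simp add: img_def lreg_def opm_lincomb C.fin)
  finally show ?thesis .
qed

lemma lreg_inject:
  assumes "img lreg x = img lreg y" "k \<in> I"
  shows "x k = y k"
proof -
  have *: "(\<Sum>b\<in>I. (\<Sum>i\<in>I. z i * \<mu> i b k) * \<eta> b) = z k" for z
  proof -
    have "(\<Sum>b\<in>I. (\<Sum>i\<in>I. z i * \<mu> i b k) * \<eta> b) = (\<Sum>i\<in>I. z i * (\<Sum>b\<in>I. \<mu> i b k * \<eta> b))"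
      by (simp add: sum_distrib_left sum_distrib_right mult.assoc) (rule sum.swap)
    then show ?thesis using \<open>k \<in> I\<close> C.fin by (simp add: D.counit_r if_distrib cong: sum.cong if_cong)
  qed
  have "img lreg z = opm I (\<lambda>y b. \<Sum>i\<in>I. z i * \<mu> i b y)" for z
    by (simp add: img_def lreg_def opm_lincomb C.fin)
  then have "(\<Sum>i\<in>I. x i * \<mu> i b k) = (\<Sum>i\<in>I. y i * \<mu> i b k)" if "b \<in> I" for b
    using assms opm_inject[OF C.fin, of "\<lambda>y b. \<Sum>i\<in>I. x i * \<mu> i b y" "\<lambda>z b. \<Sum>i\<in>I. y i * \<mu> i b z" k b] that by simp
  then show ?thesis using *[of x] *[of y] by (simp cong: sum.cong)
qed

lemma antimult:
  assumes "i \<in> I" "j \<in> I" "k \<in> I"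
  shows "(\<Sum>a\<in>I. \<mu> i j a * S a k) = (\<Sum>p\<in>I. \<Sum>q\<in>I. S j p * S i q * \<mu> p q k)"
proof (rule lreg_inject[OF _ assms(3)])
  have "img lreg (\<lambda>k. \<Sum>a\<in>I. \<mu> i j a * S a k) = (\<Sum>a\<in>I. scl (\<mu> i j a) (img lreg (S a)))"
    by (simp add: img_def scl_sum scl_sum_left) (rule sum.swap)
  also have "\<dots> = img lreg (S j) * img lreg (S i)"
    by (rule rep_antimult) (use lreg_mult assms in auto)
  also have "\<dots> = (\<Sum>p\<in>I. \<Sum>q\<in>I. scl (S j p * S i q) (img lreg (\<mu> p q)))"
    by (simp add: img_def[of lreg "S _"] sum_product lreg_mult cong: sum.cong) (simp add: ac_simps)
  also have "\<dots> = img lreg (\<lambda>k. \<Sum>p\<in>I. \<Sum>q\<in>I. S j p * S i q * \<mu> p q k)"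
    by (simp add: img_def scl_sum scl_sum_left) (rule sum_rotate3')
  finally show "img lreg (\<lambda>k. \<Sum>a\<in>I. \<mu> i j a * S a k) = img lreg (\<lambda>k. \<Sum>p\<in>I. \<Sum>q\<in>I. S j p * S i q * \<mu> p q k)" .
qed

lemma anticomult:
  assumes "i \<in> I" "j \<in> I" "k \<in> I"
  shows "(\<Sum>a\<in>I. S k a * \<delta> a i j) = (\<Sum>p\<in>I. \<Sum>q\<in>I. \<delta> k p q * S q i * S p j)"
proof -
  interpret dual: hopf_sc I "\<lambda>i j p. \<delta> p i j" "\<lambda>p i j. \<mu> i j p" \<epsilon> \<eta> "\<lambda>i j. S j i" by (rule dual)
  show ?thesis using dual.antimult[OF assms] by (simp add: ac_simps)
qed

lemma S_unit:
  assumes "k \<in> I"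
  shows "(\<Sum>a\<in>I. \<eta> a * S a k) = \<eta> k"
proof -
  have "(\<Sum>p\<in>I. \<eta> p * (\<epsilon> p * \<eta> k)) = (\<Sum>p\<in>I. \<epsilon> p * \<eta> p) * \<eta> k"
    unfolding sum_distrib_right by (simp add: ac_simps)
  then have "\<eta> k = (\<Sum>p\<in>I. \<eta> p * (\<epsilon> p * \<eta> k))"
    using eps_eta by simp
  also have "\<dots> = (\<Sum>p\<in>I. \<eta> p * (\<Sum>i\<in>I. \<Sum>j\<in>I. \<Sum>a\<in>I. \<delta> p i j * S i a * \<mu> a j k))"
    using assms by (simp add: S_left)
  also have "\<dots> = (\<Sum>p\<in>I. \<Sum>i\<in>I. \<Sum>j\<in>I. \<delta> p i j * \<eta> p * (\<Sum>a\<in>I. S i a * \<mu> a j k))"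
    by (simp add: sum_distrib_left ac_simps)
  also have "\<dots> = (\<Sum>i\<in>I. \<Sum>j\<in>I. (\<Sum>p\<in>I. \<delta> p i j * \<eta> p) * (\<Sum>a\<in>I. S i a * \<mu> a j k))"
    by (subst sum_rotate3) (simp add: sum_distrib_right)
  also have "\<dots> = (\<Sum>i\<in>I. \<Sum>j\<in>I. (\<eta> i * \<eta> j) * (\<Sum>a\<in>I. S i a * \<mu> a j k))"
    by (simp add: delta_eta cong: sum.cong)
  also have "\<dots> = (\<Sum>i\<in>I. \<eta> i * (\<Sum>j\<in>I. \<Sum>a\<in>I. S i a * (\<mu> a j k * \<eta> j)))"
    by (simp add: sum_distrib_left ac_simps)
  also have "\<dots> = (\<Sum>i\<in>I. \<eta> i * (\<Sum>a\<in>I. S i a * (\<Sum>j\<in>I. \<mu> a j k * \<eta> j)))"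
    by (simp add: sum_distrib_left) (rule sum_swap_23)
  also have "\<dots> = (\<Sum>i\<in>I. \<eta> i * S i k)"
    using assms C.fin by (simp add: D.counit_r if_distrib cong: sum.cong if_cong)
  finally show ?thesis by simp
qed

end

section \<open>Representations of the Heisenberg double\<close>

text \<open>
  Induction on the number of vectors: the last vector, after subtraction of its components along the
  others, has a nonzero entry \<open>r\<close>, and evaluation at \<open>r\<close>, corrected and normalized, is the functional
  dual to it.
\<close>

lemma dual_functionals:
  fixes v :: "nat \<Rightarrow> 'j \<Rightarrow> 'k :: field"
  assumes J: "finite J"
    and indep: "\<And>c. (\<And>j. j \<in> J \<Longrightarrow> (\<Sum>i<m. c i * v i j) = 0) \<Longrightarrow> \<forall>i<m. c i = 0"
  shows "\<exists>\<psi>. \<forall>i<m. \<forall>l<m. (\<Sum>j\<in>J. \<psi> i j * v l j) = (if i = l then 1 else 0)"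
  using indep
proof (induction m)
  case (Suc m)
  have "\<forall>i<m. c i = 0" if "\<And>j. j \<in> J \<Longrightarrow> (\<Sum>i<m. c i * v i j) = 0" for c
    using Suc.prems[of "\<lambda>i. if i < m then c i else 0"] that by (fastforce split: if_splits)
  with Suc.IH obtain \<psi> where \<psi>: "\<And>i l. i < m \<Longrightarrow> l < m \<Longrightarrow> (\<Sum>j\<in>J. \<psi> i j * v l j) = (if i = l then 1 else 0)"
    by blast
  define t where "t i = (\<Sum>j\<in>J. \<psi> i j * v m j)" for i
  define w where "w j = v m j - (\<Sum>i<m. t i * v i j)" for j
  have "\<exists>r\<in>J. w r \<noteq> 0"
  proof (rule ccontr)
    assume "\<not> ?thesis"
    then have "(\<Sum>i<Suc m. (if i = m then 1 else - t i) * v i j) = 0" if "j \<in> J" for j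
      using that by (simp add: w_def sum_negf)
    with Suc.prems[of "\<lambda>i. if i = m then 1 else - t i"] show False by force
  qed
  then obtain r where r: "r \<in> J" "w r \<noteq> 0" by blast
  define \<theta> where "\<theta> j = ((if j = r then 1 else 0) - (\<Sum>i<m. v i r * \<psi> i j)) / w r" for j
  have \<theta>: "(\<Sum>j\<in>J. \<theta> j * v l j) = (v l r - (\<Sum>i<m. v i r * (\<Sum>j\<in>J. \<psi> i j * v l j))) / w r" for l
  proof -
    have "(\<Sum>j\<in>J. \<theta> j * v l j) = ((\<Sum>j\<in>J. (if j = r then v l j else 0)) - (\<Sum>j\<in>J. \<Sum>i<m. v i r * (\<psi> i j * v l j))) / w r"
      unfolding \<theta>_def sum_subtractf[symmetric] sum_divide_distrib
      by (intro sum.cong refl) (simp add: algebra_simps diff_divide_distrib sum_distrib_left)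
    also have "(\<Sum>j\<in>J. \<Sum>i<m. v i r * (\<psi> i j * v l j)) = (\<Sum>i<m. v i r * (\<Sum>j\<in>J. \<psi> i j * v l j))"
      by (subst sum.swap) (simp add: sum_distrib_left)
    finally show ?thesis using r J by simp
  qed
  have \<theta>1: "(\<Sum>j\<in>J. \<theta> j * v l j) = 0" if "l < m" for l
  proof -
    have "(\<Sum>i<m. v i r * (\<Sum>j\<in>J. \<psi> i j * v l j)) = (\<Sum>i<m. if i = l then v i r else 0)"
      by (rule sum.cong) (use that \<psi> in auto)
    then show ?thesis using that by (simp add: \<theta>)
  qed
  have \<theta>2: "(\<Sum>j\<in>J. \<theta> j * v m j) = 1"
    using r(2) unfolding \<theta> w_def t_def by (simp add: ac_simps)
  define \<psi>' where "\<psi>' i j = (if i = m then \<theta> j else \<psi> i j - t i * \<theta> j)" for i j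
  have "(\<Sum>j\<in>J. \<psi>' i j * v l j) = (if i = l then 1 else 0)" if "i < Suc m" "l < Suc m" for i l
  proof (cases "i = m")
    case True
    then show ?thesis using that \<theta>1 \<theta>2 by (auto simp: \<psi>'_def less_Suc_eq)
  next
    case False
    have "(\<Sum>j\<in>J. \<psi>' i j * v l j) = (\<Sum>j\<in>J. \<psi> i j * v l j) - t i * (\<Sum>j\<in>J. \<theta> j * v l j)"
      using False by (simp add: \<psi>'_def algebra_simps sum_subtractf sum_distrib_left)
    then show ?thesis using that False \<theta>1 \<theta>2 \<psi> by (cases "l = m") (auto simp: t_def[symmetric])
  qed
  then show ?case by blast
qed simp

lemma square_inverse:
  fixes S :: "nat \<Rightarrow> nat \<Rightarrow> 'k :: field"
  assumes "\<And>c. (\<And>j. j < m \<Longrightarrow> (\<Sum>i<m. c i * S i j) = 0) \<Longrightarrow> \<forall>i<m. c i = 0"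
  obtains T where "\<And>i k. i < m \<Longrightarrow> k < m \<Longrightarrow> (\<Sum>j<m. S i j * T j k) = (if i = k then 1 else 0)"
    "\<And>i k. i < m \<Longrightarrow> k < m \<Longrightarrow> (\<Sum>j<m. T i j * S j k) = (if i = k then 1 else 0)"
proof -
  have "\<exists>\<psi>. \<forall>i<m. \<forall>l<m. (\<Sum>j<m. \<psi> i j * S l j) = (if i = l then 1 else 0)"
  proof (rule dual_functionals)
    show "\<forall>i<m. c i = 0" if "\<And>j. j \<in> {..<m} \<Longrightarrow> (\<Sum>i<m. c i * S i j) = 0" for c
      by (rule assms) (rule that, simp)
  qed simp
  then obtain \<psi> where \<psi>: "\<forall>i<m. \<forall>l<m. (\<Sum>j<m. \<psi> i j * S l j) = (if i = l then 1 else 0)" ..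
  define MS where "MS = mat m m (\<lambda>(i, j). S i j)"
  define MT where "MT = mat m m (\<lambda>(i, j). \<psi> j i)"
  have ent: "(MS * MT) $$ (i, k) = (\<Sum>j<m. S i j * \<psi> k j)" "(MT * MS) $$ (i, k) = (\<Sum>j<m. \<psi> j i * S j k)"
    if "i < m" "k < m" for i k
    using that by (simp_all add: MS_def MT_def scalar_prod_def lessThan_atLeast0)
  have "MS * MT = 1\<^sub>m m"
    by (rule eq_matI) (use \<psi> ent in \<open>auto simp: MS_def MT_def ac_simps\<close>)
  then have "MT * MS = 1\<^sub>m m"
    by (rule mat_mult_left_right_inverse[rotated 2]) (simp_all add: MS_def MT_def)
  then have "(\<Sum>j<m. \<psi> j i * S j k) = (if i = k then 1 else 0)" if "i < m" "k < m" for i k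
    using ent(2)[OF that] that by simp
  then show ?thesis using \<psi> by (intro that[of "\<lambda>i j. \<psi> j i"]) (auto simp: ac_simps)
qed

text \<open>
  A representation of the Heisenberg double of the co-opposite Hopf algebra (whence \<open>\<delta> p j i\<close> instead
  of \<open>\<delta> p i j\<close>) in which both subalgebras have the unit \<open>u\<close>. This choice
  of side makes \<open>S\<close> itself the antipode that enters \<open>e\<close>.
\<close>

locale heisenberg = hopf_sc +
  fixes A B :: "nat \<Rightarrow> 'a lend" and u :: "'a lend"
  assumes A_rep: "\<lbrakk>i \<in> I; j \<in> I\<rbrakk> \<Longrightarrow> A i * A j = img A (\<mu> i j)"
    and A_unit: "img A \<eta> = u"
    and B_rep: "\<lbrakk>i \<in> I; j \<in> I\<rbrakk> \<Longrightarrow> B i * B j = (\<Sum>p\<in>I. scl (\<delta> p j i) (B p))"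
    and B_unit: "img B \<epsilon> = u"
    and AB_comm: "\<lbrakk>p \<in> I; q \<in> I\<rbrakk> \<Longrightarrow>
      A p * B q = (\<Sum>r\<in>I. \<Sum>i\<in>I. \<Sum>j\<in>I. scl (\<delta> p j i * \<mu> r i q) (B r * A j))"
begin

text \<open>
  The image of \<open>S(e\<^sub>p)\<close> is \<open>s p\<close>. Right multiplication by \<open>e = \<Sum> B\<^sub>i S(A\<^sub>i)\<close> is the projection of a Hopf module
  onto its coinvariants.
\<close>

definition s :: "nat \<Rightarrow> 'a lend" where "s p = img A (S p)"
definition e :: "'a lend" where "e = (\<Sum>i\<in>I. B i * s i)"

lemma A_u: "i \<in> I \<Longrightarrow> A i * u = A i"
  using rep_unit[of A i] A_rep A_unit by auto

lemma B_u: "i \<in> I \<Longrightarrow> B i * u = B i"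
proof -
  assume i: "i \<in> I"
  have "B i * u = (\<Sum>p\<in>I. \<Sum>j\<in>I. scl (\<delta> p j i * \<epsilon> j) (B p))"
    unfolding B_unit[symmetric] img_def using i
    by (subst sum.swap) (simp add: sum_distrib_left B_rep scl_sum ac_simps cong: sum.cong)
  also have "\<dots> = B i"
    using i C.fin by (simp flip: scl_sum_left add: C.counit_l scl_if cong: sum.cong)
  finally show ?thesis .
qed

lemma s_u: "s i * u = s i"
  by (simp add: s_def img_def sum_distrib_right A_u cong: sum.cong)

lemma e_u: "e * u = e"
  by (simp add: e_def sum_distrib_right mult.assoc s_u)

lemma s_conv:
  assumes "p \<in> I"
  shows "(\<Sum>i\<in>I. \<Sum>j\<in>I. scl (\<delta> p i j) (s i * A j)) = scl (\<epsilon> p) u"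
    "(\<Sum>i\<in>I. \<Sum>j\<in>I. scl (\<delta> p i j) (A i * s j)) = scl (\<epsilon> p) u"
  using rep_antipode[of A p] A_rep A_unit assms by (auto simp: C.conv_def s_def)

text \<open>
  The product \<open>B\<^sub>i B\<^sub>j\<close> collects the comultiplication of each \<open>e\<^sub>p\<close>, and \<open>S(e\<^sub>p\<^sub>1) e\<^sub>p\<^sub>2 = \<epsilon>(e\<^sub>p)\<close>.
\<close>

lemma sum_B_e_A: "(\<Sum>i\<in>I. B i * e * A i) = u"
proof -
  have "(\<Sum>i\<in>I. B i * e * A i) = (\<Sum>i\<in>I. \<Sum>j\<in>I. B i * B j * (s j * A i))"
    by (simp add: e_def sum_distrib_left sum_distrib_right mult.assoc)
  also have "\<dots> = (\<Sum>i\<in>I. \<Sum>j\<in>I. \<Sum>p\<in>I. scl (\<delta> p j i) (B p * (s j * A i)))"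
    by (simp add: B_rep sum_distrib_right cong: sum.cong)
  also have "\<dots> = (\<Sum>p\<in>I. \<Sum>j\<in>I. \<Sum>i\<in>I. scl (\<delta> p j i) (B p * (s j * A i)))"
    by (rule sum_swap_13)
  also have "\<dots> = (\<Sum>p\<in>I. B p * (\<Sum>j\<in>I. \<Sum>i\<in>I. scl (\<delta> p j i) (s j * A i)))"
    by (simp add: sum_distrib_left)
  also have "\<dots> = (\<Sum>p\<in>I. scl (\<epsilon> p) (B p))"
    by (simp add: s_conv B_u cong: sum.cong)
  also have "\<dots> = u" using B_unit by (simp add: img_def)
  finally show ?thesis .
qed

text \<open>
  The commutation relation for \<open>S(A\<^sub>p)\<close>, using that \<open>S\<close> reverses the comultiplication.
\<close>

lemma s_B:
  assumes p: "p \<in> I" and q: "q \<in> I"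
  shows "s p * B q = (\<Sum>x\<in>I. \<Sum>y\<in>I. \<Sum>r\<in>I. scl (\<delta> p x y * (\<Sum>i\<in>I. S x i * \<mu> r i q)) (B r * s y))"
proof -
  have "s p * B q = (\<Sum>k\<in>I. \<Sum>r\<in>I. \<Sum>i\<in>I. \<Sum>j\<in>I. scl (\<mu> r i q) (scl (S p k * \<delta> k j i) (B r * A j)))"
    using q by (simp add: s_def img_def sum_distrib_right AB_comm scl_sum ac_simps cong: sum.cong)
  also have "\<dots> = (\<Sum>r\<in>I. \<Sum>i\<in>I. \<Sum>j\<in>I. \<Sum>k\<in>I. scl (\<mu> r i q) (scl (S p k * \<delta> k j i) (B r * A j)))"
    by (subst sum_rotate3) (intro sum.cong refl sum.swap)
  also have "\<dots> = (\<Sum>r\<in>I. \<Sum>i\<in>I. \<Sum>j\<in>I. scl (\<mu> r i q * (\<Sum>k\<in>I. S p k * \<delta> k j i)) (B r * A j))"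
    by (simp add: scl_sum_left sum_distrib_left)
  also have "\<dots> = (\<Sum>r\<in>I. \<Sum>i\<in>I. \<Sum>j\<in>I. scl (\<mu> r i q * (\<Sum>x\<in>I. \<Sum>y\<in>I. \<delta> p x y * S y j * S x i)) (B r * A j))"
    using p by (simp add: anticomult cong: sum.cong)
  also have "\<dots> = (\<Sum>r\<in>I. \<Sum>i\<in>I. \<Sum>j\<in>I. \<Sum>x\<in>I. \<Sum>y\<in>I. scl (\<delta> p x y * S x i * \<mu> r i q * S y j) (B r * A j))"
    by (simp add: scl_sum_left sum_distrib_left ac_simps)
  also have "\<dots> = (\<Sum>r\<in>I. \<Sum>x\<in>I. \<Sum>y\<in>I. \<Sum>i\<in>I. \<Sum>j\<in>I. scl (\<delta> p x y * S x i * \<mu> r i q * S y j) (B r * A j))"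
    by (intro sum.cong refl sum_swap_pairs)
  also have "\<dots> = (\<Sum>x\<in>I. \<Sum>y\<in>I. \<Sum>r\<in>I. \<Sum>i\<in>I. \<Sum>j\<in>I. scl (\<delta> p x y * S x i * \<mu> r i q * S y j) (B r * A j))"
    by (rule sum_rotate3)
  also have "\<dots> = (\<Sum>x\<in>I. \<Sum>y\<in>I. \<Sum>r\<in>I. \<Sum>i\<in>I. scl (\<delta> p x y * (S x i * \<mu> r i q)) (B r * s y))"
    by (simp add: s_def img_def sum_distrib_left scl_sum ac_simps)
  finally show ?thesis by (simp add: scl_sum_left sum_distrib_left)
qed

text \<open>
  Moving \<open>B\<^sub>q\<close> to the left through \<open>S(A\<^sub>i)\<close> produces a factor \<open>x\<^sub>1 S(x\<^sub>2)\<close>, which the antipode axiom turns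
  into a scalar.
\<close>

lemma e_B:
  assumes q: "q \<in> I"
  shows "e * B q = scl (\<eta> q) e"
proof -
  \<comment> \<open>The coefficient of \<open>e\<^sub>q\<close> in \<open>e\<^sub>r S(e\<^sub>x)\<close>.\<close>
  define N where "N x r = (\<Sum>i\<in>I. S x i * \<mu> r i q)" for x r
  have N: "(\<Sum>r\<in>I. \<Sum>x\<in>I. \<delta> p r x * N x r) = \<epsilon> p * \<eta> q" if "p \<in> I" for p
    using S_right[OF that q] by (simp add: N_def sum_distrib_left mult.assoc)
  have key: "(\<Sum>r\<in>I. \<Sum>x\<in>I. \<Sum>p\<in>I. \<delta> p x y * N x r * \<delta> t r p) = (if t = y then \<eta> q else 0)"
    if "t \<in> I" "y \<in> I" for t y
  proof -
    have "(\<Sum>r\<in>I. \<Sum>x\<in>I. \<Sum>p\<in>I. \<delta> p x y * N x r * \<delta> t r p)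
        = (\<Sum>r\<in>I. \<Sum>x\<in>I. (\<Sum>p\<in>I. \<delta> t r p * \<delta> p x y) * N x r)"
      by (simp add: sum_distrib_left ac_simps)
    also have "\<dots> = (\<Sum>r\<in>I. \<Sum>x\<in>I. (\<Sum>p\<in>I. \<delta> t p y * \<delta> p r x) * N x r)"
      using that by (simp add: C.coassoc[symmetric] cong: sum.cong)
    also have "\<dots> = (\<Sum>r\<in>I. \<Sum>x\<in>I. \<Sum>p\<in>I. \<delta> t p y * (\<delta> p r x * N x r))"
      by (simp only: sum_distrib_right mult.assoc)
    also have "\<dots> = (\<Sum>p\<in>I. \<Sum>r\<in>I. \<Sum>x\<in>I. \<delta> t p y * (\<delta> p r x * N x r))"
      by (rule sum_rotate3')
    also have "\<dots> = (\<Sum>p\<in>I. \<delta> t p y * (\<Sum>r\<in>I. \<Sum>x\<in>I. \<delta> p r x * N x r))"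
      by (simp only: sum_distrib_left)
    also have "\<dots> = (\<Sum>p\<in>I. \<delta> t p y * (\<epsilon> p * \<eta> q))"
      by (simp add: N cong: sum.cong)
    also have "\<dots> = (\<Sum>p\<in>I. \<delta> t p y * \<epsilon> p) * \<eta> q"
      by (simp add: sum_distrib_right mult.assoc)
    finally show ?thesis using that by (simp add: C.counit_l)
  qed
  have "e * B q = (\<Sum>p\<in>I. \<Sum>x\<in>I. \<Sum>y\<in>I. \<Sum>r\<in>I. scl (\<delta> p x y * N x r) (B p * B r * s y))"
    using q by (simp add: e_def sum_distrib_right sum_distrib_left mult.assoc s_B N_def[symmetric] cong: sum.cong)
  also have "\<dots> = (\<Sum>p\<in>I. \<Sum>x\<in>I. \<Sum>y\<in>I. \<Sum>r\<in>I. \<Sum>t\<in>I. scl (\<delta> p x y * N x r * \<delta> t r p) (B t * s y))"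
    by (simp add: B_rep sum_distrib_right scl_sum cong: sum.cong)
  also have "\<dots> = (\<Sum>y\<in>I. \<Sum>r\<in>I. \<Sum>p\<in>I. \<Sum>x\<in>I. \<Sum>t\<in>I. scl (\<delta> p x y * N x r * \<delta> t r p) (B t * s y))"
    by (rule sum_swap_pairs)
  also have "\<dots> = (\<Sum>y\<in>I. \<Sum>r\<in>I. \<Sum>t\<in>I. \<Sum>x\<in>I. \<Sum>p\<in>I. scl (\<delta> p x y * N x r * \<delta> t r p) (B t * s y))"
    by (intro sum.cong refl sum_swap_13)
  also have "\<dots> = (\<Sum>y\<in>I. \<Sum>t\<in>I. \<Sum>r\<in>I. \<Sum>x\<in>I. \<Sum>p\<in>I. scl (\<delta> p x y * N x r * \<delta> t r p) (B t * s y))"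
    by (intro sum.cong refl sum.swap)
  also have "\<dots> = (\<Sum>y\<in>I. \<Sum>t\<in>I. scl (if t = y then \<eta> q else 0) (B t * s y))"
    by (simp only: scl_sum_left[symmetric]) (simp add: key cong: sum.cong)
  also have "\<dots> = scl (\<eta> q) e"
    using C.fin by (simp add: scl_if e_def scl_sum cong: sum.cong)
  finally show ?thesis .
qed

lemma e_A_B:
  assumes j: "j \<in> I" and i: "i \<in> I"
  shows "e * A j * B i = (\<Sum>k\<in>I. scl (\<delta> j k i) (e * A k))"
proof -
  have "e * A j * B i = (\<Sum>r\<in>I. \<Sum>x\<in>I. \<Sum>y\<in>I. scl (\<delta> j y x * (\<mu> r x i * \<eta> r)) (e * A y))"
    using assms by (simp add: mult.assoc AB_comm sum_distrib_left)
      (simp add: mult.assoc[symmetric] e_B cong: sum.cong)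
  also have "\<dots> = (\<Sum>y\<in>I. \<Sum>x\<in>I. \<Sum>r\<in>I. scl (\<delta> j y x * (\<mu> r x i * \<eta> r)) (e * A y))"
    by (rule sum_swap_13)
  also have "\<dots> = (\<Sum>y\<in>I. \<Sum>x\<in>I. scl (\<delta> j y x * (\<Sum>r\<in>I. \<mu> r x i * \<eta> r)) (e * A y))"
    by (simp add: scl_sum_left sum_distrib_left)
  also have "\<dots> = (\<Sum>k\<in>I. scl (\<delta> j k i) (e * A k))"
    using i C.fin by (simp add: D.counit_l if_distrib if_distribR scl_if cong: sum.cong if_cong)
  finally show ?thesis .
qed

lemma e_A_e:
  assumes k: "k \<in> I"
  shows "e * A k * e = scl (\<epsilon> k) e"
proof -
  have "e * A k * e = (\<Sum>l\<in>I. e * A k * B l * s l)"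
    by (subst (2) e_def) (simp add: sum_distrib_left mult.assoc)
  also have "\<dots> = (\<Sum>l\<in>I. \<Sum>a\<in>I. scl (\<delta> k a l) (e * (A a * s l)))"
    using k by (intro sum.cong refl) (simp add: e_A_B sum_distrib_right, simp add: mult.assoc)
  also have "\<dots> = e * (\<Sum>a\<in>I. \<Sum>l\<in>I. scl (\<delta> k a l) (A a * s l))"
    by (subst sum.swap) (simp add: sum_distrib_left)
  finally show ?thesis using k by (simp add: s_conv e_u)
qed

text \<open>
  This separates the summands of \<open>\<Sum> w\<^sub>i A\<^sub>i\<close> when the \<open>w\<^sub>i\<close> are fixed by right multiplication with \<open>e\<close>:
  multiplying by \<open>B\<^sub>j e\<close> on the right leaves \<open>w\<^sub>j\<close>.
\<close>

lemma e_A_B_e: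
  assumes j: "j \<in> I" and i: "i \<in> I"
  shows "e * A j * B i * e = (if j = i then e else 0)"
proof -
  have "e * A j * B i * e = (\<Sum>k\<in>I. scl (\<delta> j k i * \<epsilon> k) e)"
    using assms by (simp add: e_A_B sum_distrib_right e_A_e cong: sum.cong)
  then show ?thesis using assms by (simp flip: scl_sum_left add: C.counit_l)
qed

text \<open>
  Multiplication by \<open>e\<close> on the left and by \<open>B\<^sub>i e\<close> on the right isolates the coefficient of \<open>A\<^sub>i\<close>.
\<close>

lemma img_A_inject:
  assumes "img A h = 0" "u \<noteq> 0" "i \<in> I"
  shows "h i = 0"
proof -
  have "0 = e * img A h * B i * e" using assms by simp
  also have "\<dots> = (\<Sum>j\<in>I. scl (h j) (e * A j * B i * e))"
    by (simp add: img_def sum_distrib_left sum_distrib_right mult.assoc)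
  also have "\<dots> = scl (h i) e"
    using assms C.fin by (simp add: e_A_B_e if_distrib cong: sum.cong if_cong)
  finally have "h i = 0 \<or> e = 0" by (simp add: scl_eq_0)
  moreover have "e \<noteq> 0" using sum_B_e_A \<open>u \<noteq> 0\<close> by auto
  ultimately show ?thesis by simp
qed

text \<open>
  The factors \<open>B\<^sub>i\<close> of \<open>e\<close> act on \<open>w\<close> by the scalars \<open>\<eta>\<^sub>i\<close>, so \<open>w e = w S(1) = w\<close>.
\<close>

lemma invariant_e:
  assumes "\<And>q. q \<in> I \<Longrightarrow> w * B q = scl (\<eta> q) w" "w * u = w"
  shows "w * e = w"
proof -
  have "w * e = (\<Sum>i\<in>I. scl (\<eta> i) (w * s i))"
    using assms by (simp add: e_def sum_distrib_left mult.assoc[symmetric] cong: sum.cong)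
  also have "\<dots> = w * (\<Sum>i\<in>I. \<Sum>k\<in>I. scl (\<eta> i * S i k) (A k))"
    by (simp add: s_def img_def sum_distrib_left scl_sum)
  also have "\<dots> = w * (\<Sum>k\<in>I. scl (\<Sum>i\<in>I. \<eta> i * S i k) (A k))"
    by (subst sum.swap) (simp add: scl_sum_left)
  also have "\<dots> = w * img A \<eta>"
    by (simp add: S_unit img_def cong: sum.cong)
  finally show ?thesis using assms(2) A_unit by simp
qed

end

section \<open>The antipode of a finite-dimensional Hopf algebra is bijective\<close>

context hopf_sc
begin

text \<open>
  The matrices of the right multiplications \<open>x \<mapsto> x e\<^sub>a\<close> and of the maps
  \<open>e\<^sub>y \<mapsto> \<Sum> \<delta> y q x e\<^sub>x\<close>, the action of the dual basis of the dual algebra.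
\<close>

definition rreg :: "nat \<Rightarrow> 'k lend" where
  "rreg a = opm I (\<lambda>x y. \<mu> y a x)"

definition hit :: "nat \<Rightarrow> 'k lend" where
  "hit q = opm I (\<lambda>x y. \<delta> y q x)"

definition idI :: "'k lend" where
  "idI = opm I (\<lambda>x y. if x = y then 1 else 0)"

lemma rreg_mult:
  assumes ij: "i \<in> I" "j \<in> I"
  shows "rreg i * rreg j = img rreg (\<mu> j i)"
proof -
  have "rreg i * rreg j = opm I (\<lambda>x z. \<Sum>y\<in>I. \<mu> y i x * \<mu> z j y)"
    by (simp add: rreg_def opm_mult)
  also have "\<dots> = opm I (\<lambda>x z. \<Sum>k\<in>I. \<mu> j i k * \<mu> z k x)"
    by (rule opm_cong) (use D.coassoc[OF _ _ ij(2,1)] in \<open>simp add: mult.commute\<close>)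
  also have "\<dots> = img rreg (\<mu> j i)"
    by (simp add: img_def rreg_def opm_lincomb C.fin)
  finally show ?thesis .
qed

lemma img_cong: "(\<And>i. i \<in> I \<Longrightarrow> x i = y i) \<Longrightarrow> img a x = img a y"
  by (simp add: img_def cong: sum.cong)

lemma img_lincomb: "(\<Sum>k\<in>K. scl (c k) (img a (x k))) = img a (\<lambda>i. \<Sum>k\<in>K. c k * x k i)"
  unfolding img_def scl_sum scl_scl scl_sum_left by (rule sum.swap)

lemma rreg_unit: "img rreg \<eta> = idI"
  unfolding img_def rreg_def idI_def
  by (subst opm_lincomb[OF C.fin], rule opm_cong) (use D.counit_r in \<open>auto simp: mult.commute\<close>)

lemma hit_mult:
  assumes ij: "i \<in> I" "j \<in> I"
  shows "hit i * hit j = (\<Sum>p\<in>I. scl (\<delta> p j i) (hit p))"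
  unfolding hit_def opm_mult opm_lincomb[OF C.fin]
  by (rule opm_cong) (use C.coassoc[OF _ ij(2,1)] in \<open>simp add: mult.commute\<close>)

lemma hit_unit: "img hit \<epsilon> = idI"
  unfolding img_def hit_def idI_def
  by (subst opm_lincomb[OF C.fin], rule opm_cong) (use C.counit_l in \<open>auto simp: mult.commute\<close>)

lemma hit_rreg:
  assumes r: "r \<in> I" and a: "a \<in> I"
  shows "hit r * rreg a = (\<Sum>k\<in>I. \<Sum>l\<in>I. \<Sum>t\<in>I. scl (\<delta> a k l * \<mu> t k r) (rreg l * hit t))"
proof -
  have "(\<Sum>y\<in>I. \<mu> z a y * \<delta> y r x)
      = (\<Sum>k\<in>I. \<Sum>l\<in>I. \<Sum>t\<in>I. (\<delta> a k l * \<mu> t k r) * (\<Sum>y\<in>I. \<mu> y l x * \<delta> z t y))"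
    if "x \<in> I" "z \<in> I" for x z
  proof -
    have "(\<Sum>y\<in>I. \<mu> z a y * \<delta> y r x)
      = (\<Sum>t\<in>I. \<Sum>y\<in>I. \<Sum>k\<in>I. \<Sum>l\<in>I. \<delta> z t y * \<delta> a k l * \<mu> t k r * \<mu> y l x)"
      using that a r by (simp add: bialg)
    also have "\<dots> = (\<Sum>k\<in>I. \<Sum>l\<in>I. \<Sum>t\<in>I. \<Sum>y\<in>I. \<delta> z t y * \<delta> a k l * \<mu> t k r * \<mu> y l x)"
      by (rule sum_swap_pairs)
    finally show ?thesis by (simp add: sum_distrib_left ac_simps)
  qed
  then have "hit r * rreg a = opm I (\<lambda>x z. \<Sum>k\<in>I. \<Sum>l\<in>I. \<Sum>t\<in>I. (\<delta> a k l * \<mu> t k r) * (\<Sum>y\<in>I. \<mu> y l x * \<delta> z t y))"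
    unfolding hit_def rreg_def opm_mult by (intro opm_cong) (simp add: mult.commute)
  then show ?thesis
    by (simp add: hit_def rreg_def opm_mult opm_scl opm_sum C.fin)
qed

definition rregS :: "nat \<Rightarrow> 'k lend" where
  "rregS p = img rreg (S p)"

lemma hit_rregS:
  assumes r: "r \<in> I" and j: "j \<in> I"
  shows "hit r * rregS j
    = (\<Sum>c\<in>I. \<Sum>d\<in>I. \<Sum>t\<in>I. scl (\<delta> j c d * (\<Sum>k\<in>I. S d k * \<mu> t k r)) (rregS c * hit t))"
proof -
  have "hit r * rregS j = (\<Sum>a\<in>I. \<Sum>k\<in>I. \<Sum>l\<in>I. \<Sum>t\<in>I. scl (\<mu> t k r) (scl (S j a * \<delta> a k l) (rreg l * hit t)))"
    using r by (simp add: rregS_def img_def sum_distrib_left hit_rreg scl_sum ac_simps cong: sum.cong)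
  also have "\<dots> = (\<Sum>k\<in>I. \<Sum>l\<in>I. \<Sum>t\<in>I. \<Sum>a\<in>I. scl (\<mu> t k r) (scl (S j a * \<delta> a k l) (rreg l * hit t)))"
    by (subst sum_rotate3) (intro sum.cong refl sum.swap)
  also have "\<dots> = (\<Sum>k\<in>I. \<Sum>l\<in>I. \<Sum>t\<in>I. scl (\<mu> t k r * (\<Sum>a\<in>I. S j a * \<delta> a k l)) (rreg l * hit t))"
    by (simp add: scl_sum_left sum_distrib_left)
  also have "\<dots> = (\<Sum>k\<in>I. \<Sum>l\<in>I. \<Sum>t\<in>I. scl (\<mu> t k r * (\<Sum>c\<in>I. \<Sum>d\<in>I. \<delta> j c d * S d k * S c l)) (rreg l * hit t))"
    using j by (simp add: anticomult cong: sum.cong)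
  also have "\<dots> = (\<Sum>k\<in>I. \<Sum>l\<in>I. \<Sum>t\<in>I. \<Sum>c\<in>I. \<Sum>d\<in>I. scl (\<delta> j c d * S d k * \<mu> t k r * S c l) (rreg l * hit t))"
    by (simp add: scl_sum_left sum_distrib_left ac_simps)
  also have "\<dots> = (\<Sum>k\<in>I. \<Sum>c\<in>I. \<Sum>d\<in>I. \<Sum>l\<in>I. \<Sum>t\<in>I. scl (\<delta> j c d * S d k * \<mu> t k r * S c l) (rreg l * hit t))"
    by (intro sum.cong refl sum_swap_pairs)
  also have "\<dots> = (\<Sum>c\<in>I. \<Sum>d\<in>I. \<Sum>k\<in>I. \<Sum>l\<in>I. \<Sum>t\<in>I. scl (\<delta> j c d * S d k * \<mu> t k r * S c l) (rreg l * hit t))"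
    by (rule sum_rotate3)
  also have "\<dots> = (\<Sum>c\<in>I. \<Sum>d\<in>I. \<Sum>t\<in>I. \<Sum>k\<in>I. \<Sum>l\<in>I. scl (\<delta> j c d * S d k * \<mu> t k r * S c l) (rreg l * hit t))"
    by (intro sum.cong refl sum_rotate3')
  also have "\<dots> = (\<Sum>c\<in>I. \<Sum>d\<in>I. \<Sum>t\<in>I. \<Sum>k\<in>I. scl (\<delta> j c d * (S d k * \<mu> t k r)) (rregS c * hit t))"
    by (simp add: rregS_def img_def sum_distrib_right scl_sum ac_simps)
  finally show ?thesis by (simp add: scl_sum_left sum_distrib_left)
qed

text \<open>
  Compatibility of multiplication and comultiplication moves \<open>hit\<close> to the right (\<open>hit_rreg\<close>), while here
  it has to be moved to the left; the antipode inverts the relation. Expanding \<open>hit r * rregS j\<close> on the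
  right-hand side leaves the scalar sum \<open>Q\<close>, which contains a factor \<open>S(x\<^sub>1) x\<^sub>2\<close> and
  collapses to a Kronecker symbol.
\<close>

lemma rregS_hit:
  assumes p: "p \<in> I" and q: "q \<in> I"
  shows "rregS p * hit q = (\<Sum>r\<in>I. \<Sum>i\<in>I. \<Sum>j\<in>I. scl (\<delta> p j i * \<mu> r i q) (hit r * rregS j))"
proof -
  \<comment> \<open>The coefficient of \<open>e\<^sub>r\<close> in \<open>e\<^sub>t S(e\<^sub>d)\<close>.\<close>
  define P where "P d t r = (\<Sum>k\<in>I. S d k * \<mu> t k r)" for d t r
  have P: "(\<Sum>d\<in>I. \<Sum>i\<in>I. \<Sum>r\<in>I. \<delta> j d i * (P d t r * \<mu> r i q)) = (if t = q then \<epsilon> j else 0)"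
    if "j \<in> I" "t \<in> I" for j t
  proof -
    have "(\<Sum>r\<in>I. P d t r * \<mu> r i q) = (\<Sum>b\<in>I. \<Sum>k\<in>I. S d k * \<mu> k i b * \<mu> t b q)"
      if di: "d \<in> I" "i \<in> I" for d i
    proof -
      have "(\<Sum>r\<in>I. P d t r * \<mu> r i q) = (\<Sum>k\<in>I. S d k * (\<Sum>r\<in>I. \<mu> r i q * \<mu> t k r))"
        unfolding P_def sum_distrib_right sum_distrib_left by (subst sum.swap) (simp add: ac_simps)
      also have "\<dots> = (\<Sum>k\<in>I. S d k * (\<Sum>b\<in>I. \<mu> t b q * \<mu> k i b))"
        using D.coassoc[of q t _ i] di \<open>t \<in> I\<close> q by (simp cong: sum.cong)
      also have "\<dots> = (\<Sum>b\<in>I. \<Sum>k\<in>I. S d k * \<mu> k i b * \<mu> t b q)"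
        by (subst sum.swap) (simp add: sum_distrib_left ac_simps)
      finally show ?thesis .
    qed
    then have "(\<Sum>d\<in>I. \<Sum>i\<in>I. \<Sum>r\<in>I. \<delta> j d i * (P d t r * \<mu> r i q))
      = (\<Sum>d\<in>I. \<Sum>i\<in>I. \<Sum>b\<in>I. \<Sum>k\<in>I. \<delta> j d i * (S d k * \<mu> k i b * \<mu> t b q))"
      by (simp flip: sum_distrib_left cong: sum.cong)
    also have "\<dots> = (\<Sum>b\<in>I. \<Sum>d\<in>I. \<Sum>i\<in>I. \<Sum>k\<in>I. \<delta> j d i * (S d k * \<mu> k i b * \<mu> t b q))"
      by (rule sum_rotate3')
    also have "\<dots> = (\<Sum>b\<in>I. (\<Sum>d\<in>I. \<Sum>i\<in>I. \<Sum>k\<in>I. \<delta> j d i * S d k * \<mu> k i b) * \<mu> t b q)"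
      by (simp add: sum_distrib_right mult.assoc)
    also have "\<dots> = (\<Sum>b\<in>I. \<epsilon> j * (\<mu> t b q * \<eta> b))"
      by (intro sum.cong refl) (simp add: S_left that)
    also have "\<dots> = (if t = q then \<epsilon> j else 0)"
      using that q by (simp add: D.counit_r flip: sum_distrib_left)
    finally show ?thesis .
  qed
  have Q: "(\<Sum>r\<in>I. \<Sum>i\<in>I. \<Sum>d\<in>I. \<Sum>j\<in>I. \<delta> p j i * \<mu> r i q * (\<delta> j c d * P d t r)) = (if t = q \<and> p = c then 1 else 0)"
    if "c \<in> I" "t \<in> I" for c t
  proof -
    have "(\<Sum>r\<in>I. \<Sum>i\<in>I. \<Sum>d\<in>I. \<Sum>j\<in>I. \<delta> p j i * \<mu> r i q * (\<delta> j c d * P d t r))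
      = (\<Sum>r\<in>I. \<Sum>i\<in>I. \<Sum>d\<in>I. (\<Sum>j\<in>I. \<delta> p j i * \<delta> j c d) * (P d t r * \<mu> r i q))"
      by (simp add: sum_distrib_left sum_distrib_right ac_simps)
    also have "\<dots> = (\<Sum>r\<in>I. \<Sum>i\<in>I. \<Sum>d\<in>I. (\<Sum>j\<in>I. \<delta> p c j * \<delta> j d i) * (P d t r * \<mu> r i q))"
      using p that by (simp add: C.coassoc cong: sum.cong)
    also have "\<dots> = (\<Sum>r\<in>I. \<Sum>i\<in>I. \<Sum>d\<in>I. \<Sum>j\<in>I. \<delta> p c j * (\<delta> j d i * (P d t r * \<mu> r i q)))"
      by (simp add: sum_distrib_right mult.assoc)
    also have "\<dots> = (\<Sum>d\<in>I. \<Sum>j\<in>I. \<Sum>r\<in>I. \<Sum>i\<in>I. \<delta> p c j * (\<delta> j d i * (P d t r * \<mu> r i q)))"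
      by (rule sum_swap_pairs)
    also have "\<dots> = (\<Sum>j\<in>I. \<Sum>d\<in>I. \<Sum>r\<in>I. \<Sum>i\<in>I. \<delta> p c j * (\<delta> j d i * (P d t r * \<mu> r i q)))"
      by (rule sum.swap)
    also have "\<dots> = (\<Sum>j\<in>I. \<Sum>d\<in>I. \<Sum>i\<in>I. \<Sum>r\<in>I. \<delta> p c j * (\<delta> j d i * (P d t r * \<mu> r i q)))"
      by (intro sum.cong refl sum.swap)
    also have "\<dots> = (\<Sum>j\<in>I. \<delta> p c j * (if t = q then \<epsilon> j else 0))"
      unfolding sum_distrib_left[symmetric] using P[OF _ that(2)] by (simp add: sum_distrib_left cong: sum.cong)
    also have "\<dots> = (if t = q then \<Sum>j\<in>I. \<delta> p c j * \<epsilon> j else 0)" by simp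
    finally show ?thesis using that p by (simp add: C.counit_r)
  qed
  have "(\<Sum>r\<in>I. \<Sum>i\<in>I. \<Sum>j\<in>I. scl (\<delta> p j i * \<mu> r i q) (hit r * rregS j))
    = (\<Sum>r\<in>I. \<Sum>i\<in>I. \<Sum>j\<in>I. \<Sum>c\<in>I. \<Sum>d\<in>I. \<Sum>t\<in>I. scl (\<delta> p j i * \<mu> r i q * (\<delta> j c d * P d t r)) (rregS c * hit t))"
    by (simp add: hit_rregS scl_sum P_def[symmetric] cong: sum.cong)
  also have "\<dots> = (\<Sum>r\<in>I. \<Sum>i\<in>I. \<Sum>j\<in>I. \<Sum>c\<in>I. \<Sum>t\<in>I. \<Sum>d\<in>I. scl (\<delta> p j i * \<mu> r i q * (\<delta> j c d * P d t r)) (rregS c * hit t))"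
    by (intro sum.cong refl sum.swap)
  also have "\<dots> = (\<Sum>r\<in>I. \<Sum>i\<in>I. \<Sum>c\<in>I. \<Sum>t\<in>I. \<Sum>d\<in>I. \<Sum>j\<in>I. scl (\<delta> p j i * \<mu> r i q * (\<delta> j c d * P d t r)) (rregS c * hit t))"
    by (rule sum.cong[OF refl], rule sum.cong[OF refl], subst sum_rotate3, intro sum.cong refl sum.swap)
  also have "\<dots> = (\<Sum>c\<in>I. \<Sum>t\<in>I. \<Sum>r\<in>I. \<Sum>i\<in>I. \<Sum>d\<in>I. \<Sum>j\<in>I. scl (\<delta> p j i * \<mu> r i q * (\<delta> j c d * P d t r)) (rregS c * hit t))"
    by (rule sum_swap_pairs)
  also have "\<dots> = (\<Sum>c\<in>I. \<Sum>t\<in>I. scl (if t = q \<and> p = c then 1 else 0) (rregS c * hit t))"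
    by (simp only: scl_sum_left[symmetric]) (simp add: Q cong: sum.cong)
  also have "\<dots> = (\<Sum>c\<in>I. if p = c then \<Sum>t\<in>I. if t = q then rregS c * hit t else 0 else 0)"
    by (intro sum.cong refl) (auto intro!: sum.cong)
  also have "\<dots> = rregS p * hit q"
    using p q C.fin by simp
  finally show ?thesis by simp
qed

lemma regular_heisenberg: "heisenberg I \<mu> \<delta> \<eta> \<epsilon> S rregS hit idI"
proof unfold_locales
  fix i j assume ij: "i \<in> I" "j \<in> I"
  have "rregS i * rregS j = (\<Sum>q\<in>I. \<Sum>p\<in>I. scl (S j p * S i q) (img rreg (\<mu> p q)))"
    by (simp add: rregS_def img_def[of rreg "S _"] sum_product rreg_mult ac_simps cong: sum.cong)
  also have "\<dots> = img rreg (\<lambda>k. \<Sum>p\<in>I. \<Sum>q\<in>I. S j p * S i q * \<mu> p q k)"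
    by (subst sum.swap) (simp add: img_def scl_sum scl_sum_left, rule sum_rotate3')
  also have "\<dots> = img rregS (\<mu> i j)"
    unfolding img_def[of rregS] rregS_def img_lincomb
    by (rule img_cong) (simp add: antimult ij)
  finally show "rregS i * rregS j = img rregS (\<mu> i j)" .
next
  have "img rregS \<eta> = img rreg \<eta>"
    unfolding img_def[of rregS] rregS_def img_lincomb
    by (rule img_cong) (simp add: S_unit)
  then show "img rregS \<eta> = idI" by (simp add: rreg_unit)
qed (fact hit_mult hit_unit rregS_hit)+

text \<open>
  If \<open>\<Sum> h\<^sub>i S(e\<^sub>i) = 0\<close>, then \<open>\<Sum> h\<^sub>i A\<^sub>i = 0\<close> in the representation with \<open>A\<^sub>i\<close> the right multiplication by
  \<open>S(e\<^sub>i)\<close>, and there the \<open>A\<^sub>i\<close> are independent.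
\<close>

lemma antipode_rows_independent:
  assumes "\<And>j. j \<in> I \<Longrightarrow> (\<Sum>i\<in>I. h i * S i j) = 0" "i \<in> I"
  shows "h i = 0"
proof -
  interpret H: heisenberg I \<mu> \<delta> \<eta> \<epsilon> S rregS hit idI by (rule regular_heisenberg)
  have "img rregS h = img rreg (\<lambda>_. 0)"
    unfolding img_def[of rregS] rregS_def img_lincomb
    by (rule img_cong) (simp add: assms)
  then have "img rregS h = 0" by (simp add: img_def)
  moreover have "idI \<noteq> 0"
  proof
    assume "idI = 0"
    then have "opm I (\<lambda>x y. if x = y then 1 else 0 :: 'k) = opm I (\<lambda>x y. 0)"
      by (simp add: idI_def) (rule lend_eqI, simp add: app_opm)
    from opm_inject[OF C.fin this \<open>i \<in> I\<close> \<open>i \<in> I\<close>] show False by simp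
  qed
  ultimately show ?thesis using H.img_A_inject \<open>i \<in> I\<close> by blast
qed

text \<open>
  An injective antipode on a finite-dimensional Hopf algebra is bijective, and its inverse is an
  antipode for the co-opposite comultiplication.
\<close>

lemma co_opposite:
  assumes I: "I = {..<m}"
  obtains T where "hopf_sc I \<mu> (\<lambda>p i j. \<delta> p j i) \<eta> \<epsilon> T"
proof -
  obtain T where ST: "\<And>i k. i < m \<Longrightarrow> k < m \<Longrightarrow> (\<Sum>j<m. S i j * T j k) = (if i = k then 1 else 0)"
    and TS: "\<And>i k. i < m \<Longrightarrow> k < m \<Longrightarrow> (\<Sum>j<m. T i j * S j k) = (if i = k then 1 else 0)"
  proof (rule square_inverse)
    show "\<forall>i<m. c i = 0" if "\<And>j. j < m \<Longrightarrow> (\<Sum>i<m. c i * S i j) = 0" for c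
      using antipode_rows_independent[of c] that by (simp add: I)
  qed blast
  have inj: "x q = y q" if "\<And>k. k \<in> I \<Longrightarrow> (\<Sum>q\<in>I. x q * S q k) = (\<Sum>q\<in>I. y q * S q k)" "q \<in> I" for x y q
    using antipode_rows_independent[of "\<lambda>q. x q - y q" q] that by (simp add: algebra_simps sum_subtractf)
  have "hopf_sc I \<mu> (\<lambda>p i j. \<delta> p j i) \<eta> \<epsilon> T"
  proof (intro hopf_sc.intro hopf_sc_axioms.intro)
    show "coalg I (\<lambda>p i j. \<delta> p j i) \<epsilon>" by (rule C.coalg_cop)
    show "coalg I (\<lambda>p i j. \<mu> i j p) \<eta>" by (rule D.coalg_axioms)
    fix i j assume ij: "i \<in> I" "j \<in> I"
    show "(\<Sum>a\<in>I. \<mu> i j a * \<epsilon> a) = \<epsilon> i * \<epsilon> j" using ij by (rule eps_mult)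
    show "(\<Sum>a\<in>I. \<delta> a j i * \<eta> a) = \<eta> i * \<eta> j" using delta_eta ij by simp
    fix k l assume kl: "k \<in> I" "l \<in> I"
    have "(\<Sum>a\<in>I. \<mu> i j a * \<delta> a l k) = (\<Sum>q\<in>I. \<Sum>p\<in>I. \<Sum>s\<in>I. \<Sum>r\<in>I. \<delta> i q p * \<delta> j s r * \<mu> q s l * \<mu> p r k)"
      using ij kl by (simp add: bialg)
    also have "\<dots> = (\<Sum>p\<in>I. \<Sum>q\<in>I. \<Sum>s\<in>I. \<Sum>r\<in>I. \<delta> i q p * \<delta> j s r * \<mu> q s l * \<mu> p r k)"
      by (rule sum.swap)
    also have "\<dots> = (\<Sum>p\<in>I. \<Sum>q\<in>I. \<Sum>r\<in>I. \<Sum>s\<in>I. \<delta> i q p * \<delta> j s r * \<mu> q s l * \<mu> p r k)"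
      by (intro sum.cong refl sum.swap)
    finally show "(\<Sum>a\<in>I. \<mu> i j a * \<delta> a l k) =
        (\<Sum>p\<in>I. \<Sum>q\<in>I. \<Sum>r\<in>I. \<Sum>s\<in>I. \<delta> i q p * \<delta> j s r * \<mu> p r k * \<mu> q s l)"
      by (simp add: ac_simps)
  next
    show "(\<Sum>a\<in>I. \<epsilon> a * \<eta> a) = 1" by (rule eps_eta)
  next
    fix p q assume pq: "p \<in> I" "q \<in> I"
    \<comment> \<open>apply the injective antipode to both sides\<close>
    have TSI: "(\<Sum>b\<in>I. T a b * S b k) = (if a = k then 1 else 0)" if "a \<in> I" "k \<in> I" for a k
      using TS that by (simp add: I)
    have eta: "(\<Sum>q\<in>I. (\<epsilon> p * \<eta> q) * S q k) = \<epsilon> p * \<eta> k" if "k \<in> I" for k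
      using S_unit[OF that] by (simp add: mult.assoc flip: sum_distrib_left)
    have 1: "(\<Sum>q\<in>I. (\<Sum>i\<in>I. \<Sum>j\<in>I. \<Sum>a\<in>I. \<delta> p j i * T i a * \<mu> a j q) * S q k) = \<epsilon> p * \<eta> k" if k: "k \<in> I" for k
    proof -
      have in1: "(\<Sum>a\<in>I. T i a * (\<Sum>q\<in>I. \<mu> a j q * S q k)) = (\<Sum>x\<in>I. S j x * \<mu> x i k)" if "i \<in> I" "j \<in> I" for i j
      proof -
        have "(\<Sum>a\<in>I. T i a * (\<Sum>q\<in>I. \<mu> a j q * S q k)) = (\<Sum>a\<in>I. \<Sum>x\<in>I. \<Sum>y\<in>I. S j x * \<mu> x y k * (T i a * S a y))"
        proof -
          have "(\<Sum>a\<in>I. T i a * (\<Sum>q\<in>I. \<mu> a j q * S q k)) = (\<Sum>a\<in>I. T i a * (\<Sum>x\<in>I. \<Sum>y\<in>I. S j x * S a y * \<mu> x y k))"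
            using that k by (simp add: antimult)
          then show ?thesis by (simp add: sum_distrib_left ac_simps)
        qed
        also have "\<dots> = (\<Sum>x\<in>I. \<Sum>y\<in>I. S j x * \<mu> x y k * (\<Sum>a\<in>I. T i a * S a y))"
          by (subst sum_rotate3) (simp add: sum_distrib_left)
        also have "\<dots> = (\<Sum>x\<in>I. S j x * \<mu> x i k)"
          using that C.fin by (simp add: TSI if_distrib cong: sum.cong if_cong)
        finally show ?thesis .
      qed
      have "(\<Sum>q\<in>I. (\<Sum>i\<in>I. \<Sum>j\<in>I. \<Sum>a\<in>I. \<delta> p j i * T i a * \<mu> a j q) * S q k)
        = (\<Sum>q\<in>I. \<Sum>i\<in>I. \<Sum>j\<in>I. \<Sum>a\<in>I. \<delta> p j i * (T i a * (\<mu> a j q * S q k)))"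
        by (simp add: sum_distrib_right mult.assoc)
      also have "\<dots> = (\<Sum>i\<in>I. \<Sum>j\<in>I. \<Sum>a\<in>I. \<Sum>q\<in>I. \<delta> p j i * (T i a * (\<mu> a j q * S q k)))"
        by (subst sum_rotate3) (intro sum.cong refl sum.swap)
      also have "\<dots> = (\<Sum>i\<in>I. \<Sum>j\<in>I. \<delta> p j i * (\<Sum>a\<in>I. T i a * (\<Sum>q\<in>I. \<mu> a j q * S q k)))"
        by (simp add: sum_distrib_left)
      also have "\<dots> = (\<Sum>i\<in>I. \<Sum>j\<in>I. \<delta> p j i * (\<Sum>x\<in>I. S j x * \<mu> x i k))"
        by (simp add: in1 cong: sum.cong)
      also have "\<dots> = (\<Sum>j\<in>I. \<Sum>i\<in>I. \<Sum>x\<in>I. \<delta> p j i * S j x * \<mu> x i k)"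
        by (subst sum.swap) (simp add: sum_distrib_left mult.assoc)
      finally show ?thesis using pq k by (simp add: S_left)
    qed
    have 2: "(\<Sum>q\<in>I. (\<Sum>i\<in>I. \<Sum>j\<in>I. \<Sum>a\<in>I. \<delta> p j i * T j a * \<mu> i a q) * S q k) = \<epsilon> p * \<eta> k" if k: "k \<in> I" for k
    proof -
      have in1: "(\<Sum>a\<in>I. T j a * (\<Sum>q\<in>I. \<mu> i a q * S q k)) = (\<Sum>y\<in>I. S i y * \<mu> j y k)" if "i \<in> I" "j \<in> I" for i j
      proof -
        have "(\<Sum>a\<in>I. T j a * (\<Sum>q\<in>I. \<mu> i a q * S q k)) = (\<Sum>a\<in>I. \<Sum>x\<in>I. \<Sum>y\<in>I. S i y * \<mu> x y k * (T j a * S a x))"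
        proof -
          have "(\<Sum>a\<in>I. T j a * (\<Sum>q\<in>I. \<mu> i a q * S q k)) = (\<Sum>a\<in>I. T j a * (\<Sum>x\<in>I. \<Sum>y\<in>I. S a x * S i y * \<mu> x y k))"
            using that k by (simp add: antimult)
          then show ?thesis by (simp add: sum_distrib_left ac_simps)
        qed
        also have "\<dots> = (\<Sum>x\<in>I. \<Sum>y\<in>I. S i y * \<mu> x y k * (\<Sum>a\<in>I. T j a * S a x))"
          by (subst sum_rotate3) (simp add: sum_distrib_left)
        also have "\<dots> = (\<Sum>y\<in>I. \<Sum>x\<in>I. S i y * \<mu> x y k * (if j = x then 1 else 0))"
          using that by (subst sum.swap) (simp add: TSI cong: sum.cong)
        also have "\<dots> = (\<Sum>y\<in>I. S i y * \<mu> j y k)"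
          using that C.fin by (simp add: if_distrib cong: sum.cong if_cong)
        finally show ?thesis .
      qed
      have "(\<Sum>q\<in>I. (\<Sum>i\<in>I. \<Sum>j\<in>I. \<Sum>a\<in>I. \<delta> p j i * T j a * \<mu> i a q) * S q k)
        = (\<Sum>q\<in>I. \<Sum>i\<in>I. \<Sum>j\<in>I. \<Sum>a\<in>I. \<delta> p j i * (T j a * (\<mu> i a q * S q k)))"
        by (simp add: sum_distrib_right mult.assoc)
      also have "\<dots> = (\<Sum>i\<in>I. \<Sum>j\<in>I. \<Sum>a\<in>I. \<Sum>q\<in>I. \<delta> p j i * (T j a * (\<mu> i a q * S q k)))"
        by (subst sum_rotate3) (intro sum.cong refl sum.swap)
      also have "\<dots> = (\<Sum>i\<in>I. \<Sum>j\<in>I. \<delta> p j i * (\<Sum>a\<in>I. T j a * (\<Sum>q\<in>I. \<mu> i a q * S q k)))"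
        by (simp add: sum_distrib_left)
      also have "\<dots> = (\<Sum>i\<in>I. \<Sum>j\<in>I. \<delta> p j i * (\<Sum>y\<in>I. S i y * \<mu> j y k))"
        by (simp add: in1 cong: sum.cong)
      also have "\<dots> = (\<Sum>j\<in>I. \<Sum>i\<in>I. \<Sum>y\<in>I. \<delta> p j i * S i y * \<mu> j y k)"
        by (subst sum.swap) (simp add: sum_distrib_left mult.assoc)
      finally show ?thesis using pq k by (simp add: S_right)
    qed
    show "(\<Sum>i\<in>I. \<Sum>j\<in>I. \<Sum>a\<in>I. \<delta> p j i * T i a * \<mu> a j q) = \<epsilon> p * \<eta> q"
      by (rule inj[OF _ pq(2), where x = "\<lambda>q. \<Sum>i\<in>I. \<Sum>j\<in>I. \<Sum>a\<in>I. \<delta> p j i * T i a * \<mu> a j q" and y = "\<lambda>q. \<epsilon> p * \<eta> q"])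
        (simp only: 1 eta)
    show "(\<Sum>i\<in>I. \<Sum>j\<in>I. \<Sum>a\<in>I. \<delta> p j i * T j a * \<mu> i a q) = \<epsilon> p * \<eta> q"
      by (rule inj[OF _ pq(2), where x = "\<lambda>q. \<Sum>i\<in>I. \<Sum>j\<in>I. \<Sum>a\<in>I. \<delta> p j i * T j a * \<mu> i a q" and y = "\<lambda>q. \<epsilon> p * \<eta> q"])
        (simp only: 2 eta)
  qed
  then show ?thesis by (rule that)
qed

end

section \<open>Coordinates on finite-dimensional vector spaces\<close>

abbreviation vspan where "vspan \<equiv> LinearCombinations.module.span class_ring"

lemma delta_mult: "(if b then 1 else 0) * (y :: 'a :: semiring_1) = (if b then y else 0)"
  "(y :: 'a :: semiring_1) * (if b then 1 else 0) = (if b then y else 0)"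
  by simp_all

lemma sum_delta_right:
  assumes "finite J" "l \<in> J"
  shows "(\<Sum>a\<in>I. \<Sum>b\<in>J. h a b * (if b = l then g a else 0)) = (\<Sum>a\<in>I. h a l * (g a :: 'a :: semiring_1))"
proof (rule sum.cong[OF refl])
  fix a
  have "(\<Sum>b\<in>J. h a b * (if b = l then g a else 0)) = (\<Sum>b\<in>J. if b = l then h a b * g a else 0)"
    by (rule sum.cong) auto
  then show "(\<Sum>b\<in>J. h a b * (if b = l then g a else 0)) = h a l * g a" using assms by simp
qed

lemma sum_delta_left:
  assumes "finite I" "l \<in> I"
  shows "(\<Sum>a\<in>I. \<Sum>b\<in>J. h a b * (if a = l then g b else 0)) = (\<Sum>b\<in>J. h l b * (g b :: 'a :: semiring_1))"
  using sum_delta_right[OF assms, where h = "\<lambda>b a. h a b" and g = g and I = J] by (subst sum.swap) simp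

lemma sum_delta_both:
  assumes "finite P" "finite Q" "a \<in> P" "b \<in> Q"
  shows "(\<Sum>p\<in>P. \<Sum>q\<in>Q. h p q * (if p = a \<and> q = b then 1 else 0)) = (h a b :: 'k :: semiring_1)"
proof -
  have "(\<Sum>p\<in>P. \<Sum>q\<in>Q. h p q * (if p = a \<and> q = b then 1 else 0))
    = (\<Sum>p\<in>P. if p = a then \<Sum>q\<in>Q. if q = b then h p q else 0 else 0)"
    by (intro sum.cong refl) (auto intro!: sum.cong)
  then show ?thesis using assms by simp
qed

lemma algebra_homD:
  assumes "f \<in> algebra_hom A B"
  shows "x \<in> carrier A \<Longrightarrow> f x \<in> carrier B"
    "x \<in> carrier A \<Longrightarrow> y \<in> carrier A \<Longrightarrow> f (x \<otimes>\<^bsub>A\<^esub> y) = f x \<otimes>\<^bsub>B\<^esub> f y"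
    "x \<in> carrier A \<Longrightarrow> y \<in> carrier A \<Longrightarrow> f (x \<oplus>\<^bsub>A\<^esub> y) = f x \<oplus>\<^bsub>B\<^esub> f y"
    "f \<one>\<^bsub>A\<^esub> = \<one>\<^bsub>B\<^esub>"
    "x \<in> carrier A \<Longrightarrow> f (k \<odot>\<^bsub>A\<^esub> x) = k \<odot>\<^bsub>B\<^esub> f x"
  using assms by (auto simp: algebra_hom_def Ring.ring_hom_def LinearCombinations.module_hom_def)

lemma linear_homD:
  assumes "f \<in> LinearCombinations.module_hom class_ring A B"
  shows "x \<in> carrier A \<Longrightarrow> f x \<in> carrier B"
    "x \<in> carrier A \<Longrightarrow> y \<in> carrier A \<Longrightarrow> f (x \<oplus>\<^bsub>A\<^esub> y) = f x \<oplus>\<^bsub>B\<^esub> f y"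
    "x \<in> carrier A \<Longrightarrow> f (k \<odot>\<^bsub>A\<^esub> x) = k \<odot>\<^bsub>B\<^esub> f x"
  using assms by (auto simp: LinearCombinations.module_hom_def)

lemma vectorspace_if_coordinates:
  fixes V :: "('k :: field, 'a, 'm) module_scheme" (structure) and c :: "'a \<Rightarrow> 'i \<Rightarrow> 'k"
  assumes zero: "\<zero> \<in> carrier V"
    and add: "\<And>x y. x \<in> carrier V \<Longrightarrow> y \<in> carrier V \<Longrightarrow> x \<oplus> y \<in> carrier V"
    and smult: "\<And>k x. x \<in> carrier V \<Longrightarrow> k \<odot> x \<in> carrier V"
    and c_zero: "\<And>i. c \<zero> i = 0"
    and c_add: "\<And>x y i. x \<in> carrier V \<Longrightarrow> y \<in> carrier V \<Longrightarrow> c (x \<oplus> y) i = c x i + c y i"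
    and c_smult: "\<And>k x i. x \<in> carrier V \<Longrightarrow> c (k \<odot> x) i = k * c x i"
    and inj: "\<And>x y. x \<in> carrier V \<Longrightarrow> y \<in> carrier V \<Longrightarrow> (\<And>i. c x i = c y i) \<Longrightarrow> x = y"
  shows "vectorspace class_ring V"
proof (rule vs_criteria[OF class_field])
  show "\<forall>v\<in>carrier V. \<exists>neg_v\<in>carrier V. v \<oplus> neg_v = \<zero>"
  proof
    fix v assume v: "v \<in> carrier V"
    have "v \<oplus> (-1) \<odot> v = \<zero>"
      by (rule inj) (use v in \<open>simp_all add: add smult zero c_zero c_add c_smult\<close>)
    then show "\<exists>neg_v\<in>carrier V. v \<oplus> neg_v = \<zero>" using v smult by blast
  qed
qed (auto simp: add smult zero c_zero c_add c_smult algebra_simps intro!: inj)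

text \<open>
  A vector space together with a linear bijection onto the scalar families supported on a finite
  index set. Families vanish outside the index set so that equal vectors have equal functions as
  coordinates.
\<close>

locale coordinates =
  fixes V :: "('k :: field, 'a, 'm) module_scheme" (structure) and I :: "'i set" and c :: "'a \<Rightarrow> 'i \<Rightarrow> 'k"
  assumes vs: "vectorspace class_ring V" and finI: "finite I"
    and c_add: "\<lbrakk>x \<in> carrier V; y \<in> carrier V\<rbrakk> \<Longrightarrow> c (x \<oplus> y) i = c x i + c y i"
    and c_smult: "x \<in> carrier V \<Longrightarrow> c (k \<odot> x) i = k * c x i"
    and c_bij: "bij_betw c (carrier V) {f. \<forall>i. i \<notin> I \<longrightarrow> f i = 0}"
begin

lemma is_module: "Module.module class_ring V"
  using vs by (simp add: vectorspace_def)

lemma zero_in: "\<zero> \<in> carrier V" and add_in: "\<lbrakk>x \<in> carrier V; y \<in> carrier V\<rbrakk> \<Longrightarrow> x \<oplus> y \<in> carrier V"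
  and smult_in: "x \<in> carrier V \<Longrightarrow> k \<odot> x \<in> carrier V"
proof -
  interpret V: vectorspace class_ring V by (rule vs)
  show "\<zero> \<in> carrier V" by simp
  show "\<lbrakk>x \<in> carrier V; y \<in> carrier V\<rbrakk> \<Longrightarrow> x \<oplus> y \<in> carrier V" by simp
  show "x \<in> carrier V \<Longrightarrow> k \<odot> x \<in> carrier V" by simp
qed

lemma c_out: "x \<in> carrier V \<Longrightarrow> i \<notin> I \<Longrightarrow> c x i = 0"
  using c_bij by (auto simp: bij_betw_def)

lemma c_inj: "x \<in> carrier V \<Longrightarrow> y \<in> carrier V \<Longrightarrow> (\<And>i. i \<in> I \<Longrightarrow> c x i = c y i) \<Longrightarrow> x = y"
  using c_bij c_out unfolding bij_betw_def inj_on_def by (metis ext)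

lemma c_zero: "c \<zero> i = 0"
proof -
  interpret V: vectorspace class_ring V by (rule vs)
  have "c (\<zero> \<oplus> \<zero>) i = c \<zero> i + c \<zero> i" by (rule c_add) auto
  then have "c \<zero> i + c \<zero> i = c \<zero> i" by simp
  then show ?thesis by (simp only: add_cancel_left_right)
qed

definition vec :: "('i \<Rightarrow> 'k) \<Rightarrow> 'a" where
  "vec f = inv_into (carrier V) c (\<lambda>i. if i \<in> I then f i else 0)"

lemma vec_in: "vec f \<in> carrier V"
  and c_vec: "c (vec f) i = (if i \<in> I then f i else 0)"
proof -
  have *: "(\<lambda>i. if i \<in> I then f i else 0) \<in> c ` carrier V" using c_bij by (auto simp: bij_betw_def)
  show "vec f \<in> carrier V" using inv_into_into[OF *] by (simp add: vec_def)
  show "c (vec f) i = (if i \<in> I then f i else 0)" using f_inv_into_f[OF *] by (simp add: vec_def)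
qed

lemma finsum_in: "(\<And>k. k \<in> K \<Longrightarrow> f k \<in> carrier V) \<Longrightarrow> (\<Oplus>k\<in>K. f k) \<in> carrier V"
proof -
  interpret V: vectorspace class_ring V by (rule vs)
  show "(\<And>k. k \<in> K \<Longrightarrow> f k \<in> carrier V) \<Longrightarrow> (\<Oplus>k\<in>K. f k) \<in> carrier V"
    by (rule V.M.finsum_closed) auto
qed

lemma c_finsum:
  assumes "\<And>k. k \<in> K \<Longrightarrow> f k \<in> carrier V"
  shows "c (\<Oplus>k\<in>K. f k) i = (\<Sum>k\<in>K. c (f k) i)"
  using assms
proof (induction K rule: infinite_finite_induct)
  case (infinite K)
  interpret V: vectorspace class_ring V by (rule vs)
  from infinite show ?case by (simp add: c_zero)
next
  case empty
  interpret V: vectorspace class_ring V by (rule vs)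
  show ?case by (simp add: c_zero)
next
  case (insert a K)
  interpret V: vectorspace class_ring V by (rule vs)
  from insert have "(\<Oplus>k\<in>insert a K. f k) = f a \<oplus> (\<Oplus>k\<in>K. f k)"
    by (intro V.M.finsum_insert) auto
  with insert show ?case by (simp add: c_add finsum_in)
qed

definition bas :: "'i \<Rightarrow> 'a" where "bas i = vec (\<lambda>j. if j = i then 1 else 0)"

lemma bas_in: "bas i \<in> carrier V"
  by (simp add: bas_def vec_in)

lemma c_bas: "i \<in> I \<Longrightarrow> c (bas i) j = (if j = i then 1 else 0)"
  by (simp add: bas_def c_vec)

lemma lincomb_in: "(\<And>k. k \<in> K \<Longrightarrow> v k \<in> carrier V) \<Longrightarrow> (\<Oplus>k\<in>K. d k \<odot> v k) \<in> carrier V"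
  by (intro finsum_in smult_in)

lemma c_lincomb:
  assumes "\<And>k. k \<in> K \<Longrightarrow> v k \<in> carrier V"
  shows "c (\<Oplus>k\<in>K. d k \<odot> v k) i = (\<Sum>k\<in>K. d k * c (v k) i)"
  using assms by (simp add: c_finsum smult_in c_smult cong: sum.cong)

lemma expand: "x \<in> carrier V \<Longrightarrow> x = (\<Oplus>i\<in>I. c x i \<odot> bas i)"
  by (rule c_inj) (use finI in \<open>simp_all add: lincomb_in c_lincomb bas_in c_bas if_distrib cong: sum.cong if_cong\<close>)

lemma span_family:
  assumes K: "finite K" and v: "\<And>k. k \<in> K \<Longrightarrow> v k \<in> carrier V"
  shows "vspan V (v ` K) = {\<Oplus>k\<in>K. d k \<odot> v k | d. True}"
proof
  interpret V: vectorspace class_ring V by (rule vs)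
  have sub: "v ` K \<subseteq> carrier V" using v by auto
  let ?S = "{\<Oplus>k\<in>K. d k \<odot> v k | d. True}"
  have "submodule class_ring ?S V"
  proof
    show "?S \<subseteq> carrier V" using v by (auto intro!: lincomb_in)
    have "\<zero> = (\<Oplus>k\<in>K. 0 \<odot> v k)"
      by (rule c_inj) (simp_all add: zero_in lincomb_in v c_lincomb c_zero)
    then show "\<zero> \<in> ?S" by (intro CollectI exI[of _ "\<lambda>_. 0"]) simp
    fix x y assume "x \<in> ?S" "y \<in> ?S"
    then obtain d d' where "x = (\<Oplus>k\<in>K. d k \<odot> v k)" "y = (\<Oplus>k\<in>K. d' k \<odot> v k)" by auto
    then have "x \<oplus> y = (\<Oplus>k\<in>K. (d k + d' k) \<odot> v k)"
      by (intro c_inj) (simp_all add: add_in lincomb_in v c_lincomb c_add algebra_simps sum.distrib)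
    then show "x \<oplus> y \<in> ?S" by (intro CollectI exI[of _ "\<lambda>k. d k + d' k"]) simp
  next
    fix t x assume "x \<in> ?S"
    then obtain d where "x = (\<Oplus>k\<in>K. d k \<odot> v k)" by auto
    then have "t \<odot> x = (\<Oplus>k\<in>K. (t * d k) \<odot> v k)"
      by (intro c_inj) (simp_all add: smult_in lincomb_in v c_lincomb c_smult algebra_simps sum_distrib_left)
    then show "t \<odot> x \<in> ?S" by (intro CollectI exI[of _ "\<lambda>k. t * d k"]) simp
  qed
  moreover have "v ` K \<subseteq> ?S"
  proof
    fix x assume "x \<in> v ` K"
    then obtain k where k: "k \<in> K" "x = v k" by auto
    have "c (\<Oplus>l\<in>K. (if l = k then 1 else 0) \<odot> v l) i = c (v k) i" for i
      by (subst c_lincomb[OF v]) (use k K in \<open>simp_all add: delta_mult\<close>)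
    with k have "x = (\<Oplus>l\<in>K. (if l = k then 1 else 0) \<odot> v l)"
      by (intro c_inj) (simp_all only: lincomb_in v)
    then show "x \<in> ?S" by (intro CollectI exI[of _ "\<lambda>l. if l = k then 1 else 0"]) simp
  qed
  ultimately show "vspan V (v ` K) \<subseteq> ?S" by (intro V.span_is_subset)
  have sm: "submodule class_ring (vspan V (v ` K)) V" by (rule V.span_is_submodule[OF sub])
  show "?S \<subseteq> vspan V (v ` K)"
  proof safe
    fix d
    have "L \<subseteq> K \<Longrightarrow> (\<Oplus>k\<in>L. d k \<odot> v k) \<in> vspan V (v ` K)" for L
    proof (induction L rule: infinite_finite_induct)
      case (insert a L)
      then have "(\<Oplus>k\<in>insert a L. d k \<odot> v k) = d a \<odot> v a \<oplus> (\<Oplus>k\<in>L. d k \<odot> v k)"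
        using v by (intro V.M.finsum_insert) (auto intro: smult_in)
      moreover have "v a \<in> vspan V (v ` K)" using V.in_own_span[OF sub] insert by auto
      ultimately show ?case using insert sm by (auto simp: submodule_def)
    qed (use sm in \<open>auto simp: submodule_def\<close>)
    then show "(\<Oplus>k\<in>K. d k \<odot> v k) \<in> vspan V (v ` K)" by blast
  qed
qed

lemma dim: "vectorspace.fin_dim class_ring V" "vectorspace.dim class_ring V = card I"
proof -
  interpret V: vectorspace class_ring V by (rule vs)
  have inj: "inj_on bas I"
  proof (rule inj_onI)
    fix i j assume "i \<in> I" "j \<in> I" "bas i = bas j"
    then show "i = j" using c_bas[of i i] c_bas[of j i] by (auto split: if_splits)
  qed
  have gen: "V.span (bas ` I) = carrier V"
    using span_family[OF finI, of bas] expand bas_in by (auto intro: lincomb_in)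
  have "V.lin_indpt (bas ` I)"
  proof (rule V.finite_lin_indpt2)
    fix a assume "a \<in> bas ` I \<rightarrow> carrier class_ring" and 0: "V.lincomb a (bas ` I) = \<zero>"
    have "V.lincomb a (bas ` I) = (\<Oplus>i\<in>I. a (bas i) \<odot> bas i)"
      unfolding V.lincomb_def using inj bas_in by (intro V.M.finsum_reindex) (auto intro: smult_in)
    then have "(\<Sum>i\<in>I. a (bas i) * c (bas i) j) = 0" for j
      using 0 c_lincomb[of I bas "\<lambda>i. a (bas i)" j] bas_in c_zero by simp
    then have 1: "(\<Sum>i\<in>I. a (bas i) * c (bas i) j) = 0" for j .
    have "a (bas j) = 0" if "j \<in> I" for j
      using 1[of j] that finI by (simp add: c_bas delta_mult cong: sum.cong)
    then show "\<forall>v\<in>bas ` I. a v = \<zero>\<^bsub>class_ring\<^esub>" by auto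
  qed (use finI bas_in in auto)
  with gen have "V.basis (bas ` I)" using bas_in by (auto simp: V.basis_def)
  then show "V.dim = card I" using V.dim_basis[of "bas ` I"] finI inj by (simp add: card_image)
  show "V.fin_dim" unfolding V.fin_dim_def using gen finI bas_in by blast
qed

text \<open>
  Coordinates on a span with respect to an independent family. The last property relates the new
  coordinates to those of the ambient space.
\<close>

lemma coordinates_on_span:
  assumes K: "finite K" and v: "\<And>k. k \<in> K \<Longrightarrow> v k \<in> carrier V"
    and indep: "\<And>d. (\<And>i. i \<in> I \<Longrightarrow> (\<Sum>k\<in>K. d k * c (v k) i) = 0) \<Longrightarrow> \<forall>k\<in>K. d k = 0"
  obtains cK where "coordinates (V\<lparr>carrier := vspan V (v ` K)\<rparr>) K cK"
    and "\<And>d k. k \<in> K \<Longrightarrow> cK (\<Oplus>k\<in>K. d k \<odot> v k) k = d k"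
    and "\<And>k l. k \<in> K \<Longrightarrow> cK (v k) l = (if l = k then 1 else 0)"
    and "\<And>x i. x \<in> vspan V (v ` K) \<Longrightarrow> c x i = (\<Sum>k\<in>K. cK x k * c (v k) i)"
proof -
  interpret V: vectorspace class_ring V by (rule vs)
  let ?S = "vspan V (v ` K)" and ?F = "{f :: 'b \<Rightarrow> 'k. \<forall>k. k \<notin> K \<longrightarrow> f k = 0}"
  define g where "g d = (\<Oplus>k\<in>K. d k \<odot> v k)" for d
  have S: "?S = {g d | d. True}" using span_family[OF K v] by (simp add: g_def)
  have g_in: "g d \<in> carrier V" for d by (simp add: g_def lincomb_in v)
  have cg: "c (g d) i = (\<Sum>k\<in>K. d k * c (v k) i)" for d i by (simp add: g_def c_lincomb v)
  have g_eq: "d k = d' k" if "g d = g d'" "k \<in> K" for d d' k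
  proof -
    have "\<forall>k\<in>K. d k - d' k = 0"
    proof (rule indep)
      fix i show "(\<Sum>k\<in>K. (d k - d' k) * c (v k) i) = 0"
        using cg[of d i] cg[of d' i] that by (simp add: algebra_simps sum_subtractf)
    qed
    then show ?thesis using that by simp
  qed
  have g_cong: "g d = g d'" if "\<And>k. k \<in> K \<Longrightarrow> d k = d' k" for d d'
    by (rule c_inj) (use that in \<open>simp_all add: g_in cg cong: sum.cong\<close>)
  define cK where "cK x = (\<lambda>k. if k \<in> K then (SOME d. g d = x) k else 0)" for x
  have cKg: "cK (g d) k = (if k \<in> K then d k else 0)" for d k
  proof -
    have "g (SOME d'. g d' = g d) = g d" by (rule someI[of "\<lambda>d'. g d' = g d" d]) (rule refl)
    then show ?thesis using g_eq unfolding cK_def by auto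
  qed
  have gcK: "g (cK x) = x" if "x \<in> ?S" for x
    using that unfolding S by (auto intro!: g_cong simp: cKg)
  have sm: "submodule class_ring ?S V" by (rule V.span_is_submodule) (use v in auto)
  have "vectorspace class_ring (V\<lparr>carrier := ?S\<rparr>)"
    by (rule V.subspace_is_vs, rule V.span_is_subspace) (use v in auto)
  moreover have "cK (x \<oplus> y) i = cK x i + cK y i" if "x \<in> ?S" "y \<in> ?S" for x y i
  proof -
    have "x \<oplus> y = g (\<lambda>k. cK x k + cK y k)"
      by (rule c_inj) (use that gcK[of x] gcK[of y] cg[of "cK x"] cg[of "cK y"] g_in[of "cK x"] g_in[of "cK y"] in
        \<open>simp_all add: add_in g_in c_add cg[of "\<lambda>k. cK x k + cK y k"] algebra_simps sum.distrib\<close>)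
    then show ?thesis by (simp add: cKg) (simp add: cK_def)
  qed
  moreover have "cK (t \<odot> x) i = t * cK x i" if "x \<in> ?S" for x t i
  proof -
    have "t \<odot> x = g (\<lambda>k. t * cK x k)"
      by (rule c_inj) (use that gcK[of x] cg[of "cK x"] g_in[of "cK x"] in
        \<open>simp_all add: smult_in g_in c_smult cg[of "\<lambda>k. t * cK x k"] sum_distrib_left mult.assoc\<close>)
    then show ?thesis by (simp add: cKg) (simp add: cK_def)
  qed
  moreover have "bij_betw cK ?S ?F"
    unfolding bij_betw_def
  proof
    show "inj_on cK ?S" by (metis gcK inj_onI)
    show "cK ` ?S = ?F"
    proof
      show "cK ` ?S \<subseteq> ?F" by (auto simp: cK_def)
      show "?F \<subseteq> cK ` ?S"
      proof
        fix f assume "f \<in> ?F"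
        then have "f = cK (g f)" by (auto simp: cKg)
        then show "f \<in> cK ` ?S" using S by blast
      qed
    qed
  qed
  ultimately have "coordinates (V\<lparr>carrier := ?S\<rparr>) K cK"
    by (intro coordinates.intro) (use K in auto)
  moreover have "cK (v k) l = (if l = k then 1 else 0)" if "k \<in> K" for k l
  proof -
    have "v k = g (\<lambda>l. if l = k then 1 else 0)"
      by (rule c_inj) (use that K in \<open>simp_all add: v g_in cg if_distrib if_distribR cong: if_cong\<close>)
    then show ?thesis using that by (simp add: cKg)
  qed
  moreover have "c x i = (\<Sum>k\<in>K. cK x k * c (v k) i)" if "x \<in> ?S" for x i
    using cg[of "cK x" i] gcK[OF that] by simp
  moreover have "cK (\<Oplus>k\<in>K. d k \<odot> v k) k = d k" if "k \<in> K" for d k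
    using cKg[of d k] that by (simp add: g_def)
  ultimately show ?thesis by (intro that)
qed

end

lemma fin_dim_coordinates:
  fixes V :: "('k :: field, 'a, 'm) module_scheme" (structure)
  assumes "vectorspace class_ring V" "vectorspace.fin_dim class_ring V"
  shows "\<exists>c. coordinates V {..<vectorspace.dim class_ring V} c"
proof -
  interpret V: vectorspace class_ring V by (rule assms)
  obtain \<beta> where \<beta>: "finite \<beta>" "V.basis \<beta>" using V.finite_basis_exists assms by auto
  have \<beta>c: "\<beta> \<subseteq> carrier V" using \<beta> by (simp add: V.basis_def)
  have ex1: "\<exists>!a. a \<in> \<beta> \<rightarrow>\<^sub>E UNIV \<and> V.lincomb a \<beta> = x" if "x \<in> carrier V" for x
    using V.basis_criterion[OF \<beta>(1) \<beta>c] \<beta>(2) that by auto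
  define co where "co x = (THE a. a \<in> \<beta> \<rightarrow>\<^sub>E UNIV \<and> V.lincomb a \<beta> = x)" for x
  have co: "co x \<in> \<beta> \<rightarrow>\<^sub>E UNIV" "V.lincomb (co x) \<beta> = x" if "x \<in> carrier V" for x
    using theI'[OF ex1[OF that]] by (auto simp: co_def)
  have co_eq: "co x w = a w" if "x \<in> carrier V" "V.lincomb a \<beta> = x" "w \<in> \<beta>" for x a w
  proof -
    have "V.lincomb (restrict a \<beta>) \<beta> = x"
      using that \<beta>c by (subst V.lincomb_cong[where b = a]) auto
    then have "restrict a \<beta> = co x"
      using ex1[OF that(1)] co[OF that(1)] by (metis PiE_UNIV_domain UNIV_I restrict_PiE_iff)
    then show ?thesis using that(3) by (metis restrict_apply')
  qed
  have card: "card \<beta> = V.dim" using V.dim_basis[OF \<beta>] by simp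
  then obtain h where h: "bij_betw h {..<V.dim} \<beta>"
    using \<beta>(1) by (metis ex_bij_betw_nat_finite atLeast0LessThan)
  define c where "c x = (\<lambda>i. if i < V.dim then co x (h i) else 0)" for x
  have hin: "i < V.dim \<Longrightarrow> h i \<in> \<beta>" for i using h by (auto simp: bij_betw_def)
  have lc_in: "V.lincomb a \<beta> \<in> carrier V" for a using \<beta>c by auto
  have "coordinates V {..<V.dim} c"
  proof
    fix x y i assume xy: "x \<in> carrier V" "y \<in> carrier V"
    have "V.lincomb (\<lambda>w. co x w + co y w) \<beta> = V.lincomb (co x) \<beta> \<oplus> V.lincomb (co y) \<beta>"
    proof -
      have *: "(co x w + co y w) \<odot> w = co x w \<odot> w \<oplus> co y w \<odot> w" if "w \<in> \<beta>" for w
        using V.smult_l_distr[of "co x w" "co y w" w] that \<beta>c by auto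
      have "(\<Oplus>w\<in>\<beta>. (co x w + co y w) \<odot> w) = (\<Oplus>w\<in>\<beta>. co x w \<odot> w \<oplus> co y w \<odot> w)"
        using \<beta>c by (intro V.M.finsum_cong2) (auto simp: *)
      then show ?thesis
        using \<beta>c unfolding V.lincomb_def by (subst V.M.finsum_addf[symmetric]) auto
    qed
    then show "c (x \<oplus> y) i = c x i + c y i"
      using co_eq[of "x \<oplus> y" "\<lambda>w. co x w + co y w"] co xy hin by (auto simp: c_def)
  next
    fix x k i assume x: "x \<in> carrier V"
    have "V.lincomb (\<lambda>w. k * co x w) \<beta> = k \<odot> V.lincomb (co x) \<beta>"
      using V.lincomb_smult[OF \<beta>c, of "co x" k] by simp
    then show "c (k \<odot> x) i = k * c x i"
      using co_eq[of "k \<odot> x" "\<lambda>w. k * co x w"] co x hin by (auto simp: c_def)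
  next
    show "bij_betw c (carrier V) {f. \<forall>i. i \<notin> {..<V.dim} \<longrightarrow> f i = 0}"
      unfolding bij_betw_def
    proof
      show "inj_on c (carrier V)"
      proof (rule inj_onI)
        fix x y assume xy: "x \<in> carrier V" "y \<in> carrier V" "c x = c y"
        have "co x w = co y w" if w: "w \<in> \<beta>" for w
        proof -
          obtain i where "i < V.dim" "w = h i" using h w unfolding bij_betw_def by blast
          then show ?thesis using fun_cong[OF xy(3), of i] by (simp add: c_def)
        qed
        then have "V.lincomb (co x) \<beta> = V.lincomb (co y) \<beta>" using \<beta>c by (intro V.lincomb_cong) auto
        then show "x = y" using co xy by simp
      qed
      show "c ` carrier V = {f. \<forall>i. i \<notin> {..<V.dim} \<longrightarrow> f i = 0}"
      proof (intro equalityI subsetI)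
        fix f :: "nat \<Rightarrow> 'k" assume f: "f \<in> {f. \<forall>i. i \<notin> {..<V.dim} \<longrightarrow> f i = 0}"
        define x where "x = V.lincomb (\<lambda>w. f (the_inv_into {..<V.dim} h w)) \<beta>"
        have x: "x \<in> carrier V" unfolding x_def by (rule lc_in)
        have "c x i = f i" for i
        proof (cases "i < V.dim")
          case True
          then have "co x (h i) = f (the_inv_into {..<V.dim} h (h i))"
            by (intro co_eq[OF x x_def[symmetric]] hin)
          also have "\<dots> = f i" using True h by (simp add: bij_betw_def the_inv_into_f_f)
          finally show ?thesis using True by (simp add: c_def)
        qed (use f in \<open>simp add: c_def\<close>)
        then have "f = c x" by auto
        then show "f \<in> c ` carrier V" using x by blast
      qed (auto simp: c_def)
    qed
  qed (simp_all add: assms)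
  then show ?thesis by blast
qed

section \<open>Tensor products in coordinates\<close>

lemma (in coordinates) linear_functional_expand:
  assumes "\<And>x y. x \<in> carrier V \<Longrightarrow> y \<in> carrier V \<Longrightarrow> \<phi> (x \<oplus> y) = \<phi> x + \<phi> y"
    and "\<And>k x. x \<in> carrier V \<Longrightarrow> \<phi> (k \<odot> x) = k * (\<phi> x :: 'k)" and x: "x \<in> carrier V"
  shows "\<phi> x = (\<Sum>i\<in>I. c x i * \<phi> (bas i))"
proof -
  interpret V: vectorspace class_ring V by (rule vs)
  have "0 \<odot> \<zero> = \<zero>" by (rule c_inj) (simp_all add: zero_in smult_in c_smult c_zero)
  then have 0: "\<phi> \<zero> = 0" using assms(2)[OF zero_in, of 0] by simp
  have "finite K \<Longrightarrow> \<phi> (\<Oplus>i\<in>K. d i \<odot> bas i) = (\<Sum>i\<in>K. d i * \<phi> (bas i))" for K d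
  proof (induction K rule: finite_induct)
    case (insert a K)
    then have "(\<Oplus>i\<in>insert a K. d i \<odot> bas i) = d a \<odot> bas a \<oplus> (\<Oplus>i\<in>K. d i \<odot> bas i)"
      by (intro V.M.finsum_insert) (auto intro: smult_in bas_in)
    with insert show ?case by (simp add: assms smult_in bas_in lincomb_in)
  qed (simp add: 0)
  from this[OF finI, of "c x"] show ?thesis using expand[OF x] by simp
qed

text \<open>
  The linear extension of a function on the basis of a free vector space.
\<close>

definition peval :: "('x \<Rightarrow> 'k) \<Rightarrow> ('x \<Rightarrow>\<^sub>0 'k :: field) \<Rightarrow> 'k" where
  "peval h f = (\<Sum>k\<in>Poly_Mapping.keys f. Poly_Mapping.lookup f k * h k)"

lemma peval_superset:
  assumes "finite S" "Poly_Mapping.keys f \<subseteq> S"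
  shows "peval h f = (\<Sum>k\<in>S. Poly_Mapping.lookup f k * h k)"
  unfolding peval_def using assms by (intro sum.mono_neutral_left) (auto simp: in_keys_iff)

lemma peval_zero [simp]: "peval h 0 = 0" by (simp add: peval_def)

lemma peval_single [simp]: "peval h (Poly_Mapping.single k t) = t * h k"
  by (subst peval_superset[of "{k}"]) auto

lemma peval_add [simp]: "peval h (f + g) = peval h f + peval h g"
proof -
  let ?S = "Poly_Mapping.keys f \<union> Poly_Mapping.keys g"
  have "Poly_Mapping.keys (f + g) \<subseteq> ?S" by (rule Poly_Mapping.keys_add)
  then show ?thesis
    by (simp add: peval_superset[of ?S] lookup_add algebra_simps sum.distrib)
qed

lemma lookup_scale: "Poly_Mapping.lookup (Poly_Mapping.map ((*) t) f) k = t * Poly_Mapping.lookup f k"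
  for t :: "'k :: field"
  by (simp add: Poly_Mapping.map.rep_eq when_def)

lemma keys_scale: "Poly_Mapping.keys (Poly_Mapping.map ((*) t) f) \<subseteq> Poly_Mapping.keys f"
  for t :: "'k :: field"
  by (auto simp: in_keys_iff lookup_scale)

lemma peval_scale [simp]: "peval h (Poly_Mapping.map ((*) t) f) = t * peval h f"
  unfolding peval_superset[OF finite_keys keys_scale]
  by (simp add: lookup_scale peval_def sum_distrib_left mult.assoc)

lemma scale_minus_one: "Poly_Mapping.map ((*) (-1)) f = - f" for f :: "'x \<Rightarrow>\<^sub>0 'k :: field"
  by (rule poly_mapping_eqI) (simp add: lookup_scale)

lemma peval_uminus [simp]: "peval h (- f) = - peval h f"
  using peval_scale[of h "-1" f] by (simp add: scale_minus_one)

lemma peval_minus [simp]: "peval h (f - g) = peval h f - peval h g"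
  using peval_add[of h f "- g"] by simp

lemma peval_sum [simp]: "peval h (sum F S) = (\<Sum>s\<in>S. peval h (F s))"
  by (induction S rule: infinite_finite_induct) auto

lemma scale_single: "Poly_Mapping.map ((*) t) (Poly_Mapping.single k s) = Poly_Mapping.single k (t * s)"
  for t :: "'k :: field"
  by (rule poly_mapping_eqI) (simp add: lookup_scale lookup_single when_def)

lemma scale_minus: "Poly_Mapping.map ((*) t) (f - g) = Poly_Mapping.map ((*) t) f - Poly_Mapping.map ((*) t) g"
  for t :: "'k :: field"
  by (rule poly_mapping_eqI) (simp add: lookup_scale lookup_minus algebra_simps)

lemma sum_single: "(\<Sum>k\<in>Poly_Mapping.keys f. Poly_Mapping.single k (Poly_Mapping.lookup f k)) = f"
proof (rule poly_mapping_eqI)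
  fix x
  have "Poly_Mapping.lookup (\<Sum>k\<in>Poly_Mapping.keys f. Poly_Mapping.single k (Poly_Mapping.lookup f k)) x
    = (\<Sum>k\<in>Poly_Mapping.keys f. if k = x then Poly_Mapping.lookup f k else 0)"
    by (simp add: lookup_sum lookup_single when_def)
  also have "\<dots> = Poly_Mapping.lookup f x"
    by (simp add: sum.delta' in_keys_iff)
  finally show "Poly_Mapping.lookup (\<Sum>k\<in>Poly_Mapping.keys f. Poly_Mapping.single k (Poly_Mapping.lookup f k)) x
    = Poly_Mapping.lookup f x" .
qed

lemma keys_sum_subset:
  "(\<And>s. s \<in> S \<Longrightarrow> Poly_Mapping.keys (F s) \<subseteq> X) \<Longrightarrow> Poly_Mapping.keys (sum F S) \<subseteq> X"
proof (induction S rule: infinite_finite_induct)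
  case (insert s S)
  then show ?case using Poly_Mapping.keys_add[of "F s" "sum F S"] by auto
qed auto

lemma formal_tensors_carrier:
  "carrier (formal_tensors A B) = {f. Poly_Mapping.keys f \<subseteq> carrier A \<times> carrier B}"
  by (simp add: formal_tensors_def)

lemma formal_tensors_simps [simp]:
  "\<zero>\<^bsub>formal_tensors A B\<^esub> = 0" "add (formal_tensors A B) = (+)"
  "Module.smult (formal_tensors A B) = (\<lambda>t. Poly_Mapping.map ((*) t))"
  by (simp_all add: formal_tensors_def)

lemma formal_tensors_vectorspace:
  "vectorspace class_ring (formal_tensors (A :: ('k :: field, 'a, 'm) module_scheme) (B :: ('k, 'b, 'n) module_scheme))"
proof (rule vs_criteria[OF class_field], goal_cases)
  case 1 then show ?case by (simp add: formal_tensors_carrier)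
next
  case 2 then show ?case using Poly_Mapping.keys_add by (fastforce simp: formal_tensors_carrier)
next
  case 3
  have "Poly_Mapping.keys (- v) = Poly_Mapping.keys v" for v :: "'a \<times> 'b \<Rightarrow>\<^sub>0 'k"
    by (auto simp: in_keys_iff)
  then have "- v \<in> carrier (formal_tensors A B)" if "v \<in> carrier (formal_tensors A B)" for v
    using that by (simp add: formal_tensors_carrier)
  then show ?case by (metis add.right_inverse formal_tensors_simps(1,2))
next
  case 4 then show ?case using keys_scale by (fastforce simp: formal_tensors_carrier)
next
  case 8 show ?case by (auto intro!: poly_mapping_eqI simp: lookup_scale)
next
  case 9 show ?case by (auto intro!: poly_mapping_eqI simp: lookup_scale)
next
  case 10 show ?case by (auto intro!: poly_mapping_eqI simp: lookup_scale lookup_add algebra_simps)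
next
  case 11 show ?case by (auto intro!: poly_mapping_eqI simp: lookup_scale lookup_add algebra_simps)
qed (auto simp: algebra_simps)

locale tensor_coordinates = A: coordinates A I ca + B: coordinates B J cb
  for A :: "('k :: field, 'a, 'm) module_scheme" and I :: "'i set" and ca
    and B :: "('k, 'b, 'n) module_scheme" and J :: "'j set" and cb
begin

abbreviation "F \<equiv> formal_tensors A B"
abbreviation "K \<equiv> tensor_ideal A B"
abbreviation single where "single \<equiv> Poly_Mapping.single"

text \<open>
  Coordinates of the tensor represented by a formal sum.
\<close>

definition co :: "('a \<times> 'b \<Rightarrow>\<^sub>0 'k) \<Rightarrow> 'i \<times> 'j \<Rightarrow> 'k" where
  "co f p = peval (\<lambda>k. ca (fst k) (fst p) * cb (snd k) (snd p)) f"

lemma co_simps [simp]: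
  "co 0 p = 0" "co (single k t) p = t * (ca (fst k) (fst p) * cb (snd k) (snd p))"
  "co (f + g) p = co f p + co g p" "co (f - g) p = co f p - co g p" "co (- f) p = - co f p"
  "co (Poly_Mapping.map ((*) t) f) p = t * co f p" "co (sum G S) p = (\<Sum>s\<in>S. co (G s) p)"
  by (simp_all add: co_def)

lemma co_out: "f \<in> carrier F \<Longrightarrow> p \<notin> I \<times> J \<Longrightarrow> co f p = 0"
  unfolding co_def peval_def
  by (rule sum.neutral) (cases p, auto simp: A.c_out B.c_out formal_tensors_carrier)

lemma relations_in: "bilinear_relations A B \<subseteq> carrier F"
  unfolding bilinear_relations_def
  by (auto dest!: subsetD[OF Poly_Mapping.keys_diff] simp: A.add_in B.add_in A.smult_in B.smult_in formal_tensors_carrier split: if_splits)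

lemma K_submodule: "submodule class_ring K F"
proof -
  interpret F: vectorspace class_ring F by (rule formal_tensors_vectorspace)
  show ?thesis unfolding tensor_ideal_def by (rule F.span_is_submodule[OF relations_in])
qed

lemma K_rel: "f \<in> bilinear_relations A B \<Longrightarrow> f \<in> K"
proof -
  interpret F: vectorspace class_ring F by (rule formal_tensors_vectorspace)
  show "f \<in> bilinear_relations A B \<Longrightarrow> f \<in> K"
    unfolding tensor_ideal_def using F.in_own_span[OF relations_in] by auto
qed

lemma K_in: "f \<in> K \<Longrightarrow> f \<in> carrier F"
  using K_submodule by (auto simp: submodule_def)

lemma K_zero: "0 \<in> K" and K_add: "f \<in> K \<Longrightarrow> g \<in> K \<Longrightarrow> f + g \<in> K"
  and K_scale: "f \<in> K \<Longrightarrow> Poly_Mapping.map ((*) t) f \<in> K"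
  using K_submodule by (auto simp: submodule_def)

lemma K_sum: "(\<And>s. s \<in> S \<Longrightarrow> G s \<in> K) \<Longrightarrow> sum G S \<in> K"
  by (induction S rule: infinite_finite_induct) (auto intro: K_zero K_add)

lemma K_co: "f \<in> K \<Longrightarrow> co f p = 0"
proof -
  interpret F: vectorspace class_ring F by (rule formal_tensors_vectorspace)
  let ?N = "{f \<in> carrier F. \<forall>p. co f p = 0}"
  have "submodule class_ring ?N F"
  proof (rule LinearCombinations.submodule.intro[OF F.module_axioms])
    show "\<And>v w. v \<in> ?N \<Longrightarrow> w \<in> ?N \<Longrightarrow> v \<oplus>\<^bsub>F\<^esub> w \<in> ?N"
      using F.add.m_closed by auto
    show "\<And>t v. t \<in> carrier class_ring \<Longrightarrow> v \<in> ?N \<Longrightarrow> t \<odot>\<^bsub>F\<^esub> v \<in> ?N"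
      using F.smult_closed by auto
  qed (auto simp: formal_tensors_carrier)
  moreover have "bilinear_relations A B \<subseteq> ?N"
  proof
    fix f assume f: "f \<in> bilinear_relations A B"
    then have "\<forall>p. co f p = 0"
      unfolding bilinear_relations_def
      by (elim UnE CollectE exE conjE; hypsubst; simp add: A.c_add B.c_add A.c_smult B.c_smult algebra_simps)
    then show "f \<in> ?N" using relations_in f by auto
  qed
  ultimately have "K \<subseteq> ?N" unfolding tensor_ideal_def by (intro F.span_is_subset)
  then show "f \<in> K \<Longrightarrow> co f p = 0" by blast
qed

lemma rel_add_left:
  assumes "a \<in> carrier A" "a' \<in> carrier A" "b \<in> carrier B"
  shows "single (a \<oplus>\<^bsub>A\<^esub> a', b) t - single (a, b) t - single (a', b) t \<in> K"
  using K_scale[OF K_rel, of "single (a \<oplus>\<^bsub>A\<^esub> a', b) 1 - single (a, b) 1 - single (a', b) 1" t] assms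
  by (simp add: scale_minus scale_single) (unfold bilinear_relations_def, blast)

lemma rel_add_right:
  assumes "a \<in> carrier A" "b' \<in> carrier B" "b \<in> carrier B"
  shows "single (a, b \<oplus>\<^bsub>B\<^esub> b') t - single (a, b) t - single (a, b') t \<in> K"
  using K_scale[OF K_rel, of "single (a, b \<oplus>\<^bsub>B\<^esub> b') 1 - single (a, b) 1 - single (a, b') 1" t] assms
  by (simp add: scale_minus scale_single) (unfold bilinear_relations_def, blast)

lemma rel_scale_left:
  assumes "a \<in> carrier A" "b \<in> carrier B"
  shows "single (d \<odot>\<^bsub>A\<^esub> a, b) t - single (a, b) (t * d) \<in> K"
  using K_scale[OF K_rel, of "single (d \<odot>\<^bsub>A\<^esub> a, b) 1 - single (a, b) d" t] assms
  by (simp add: scale_minus scale_single) (unfold bilinear_relations_def, blast)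

lemma rel_scale_right:
  assumes "a \<in> carrier A" "b \<in> carrier B"
  shows "single (a, d \<odot>\<^bsub>B\<^esub> b) t - single (a, b) (t * d) \<in> K"
  using K_scale[OF K_rel, of "single (a, d \<odot>\<^bsub>B\<^esub> b) 1 - single (a, b) d" t] assms
  by (simp add: scale_minus scale_single) (unfold bilinear_relations_def, blast)

lemma rel_lincomb_left:
  assumes "finite S" "\<And>s. s \<in> S \<Longrightarrow> x s \<in> carrier A" "b \<in> carrier B"
  shows "single (\<Oplus>\<^bsub>A\<^esub>s\<in>S. d s \<odot>\<^bsub>A\<^esub> x s, b) t - (\<Sum>s\<in>S. single (x s, b) (t * d s)) \<in> K"
  using assms(1,2)
proof (induction S rule: finite_induct)
  case empty
  interpret V: vectorspace class_ring A by (rule A.vs)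
  have "0 \<odot>\<^bsub>A\<^esub> \<zero>\<^bsub>A\<^esub> = \<zero>\<^bsub>A\<^esub>"
    by (rule A.c_inj) (simp_all add: A.zero_in A.smult_in A.c_smult A.c_zero)
  then show ?case using rel_scale_left[OF A.zero_in assms(3), of 0 t] by simp
next
  case (insert s S)
  interpret V: vectorspace class_ring A by (rule A.vs)
  let ?y = "\<Oplus>\<^bsub>A\<^esub>s\<in>S. d s \<odot>\<^bsub>A\<^esub> x s"
  have eq: "(\<Oplus>\<^bsub>A\<^esub>s\<in>insert s S. d s \<odot>\<^bsub>A\<^esub> x s) = d s \<odot>\<^bsub>A\<^esub> x s \<oplus>\<^bsub>A\<^esub> ?y"
    using insert by (intro V.M.finsum_insert) (auto intro: A.smult_in)
  have "(single (d s \<odot>\<^bsub>A\<^esub> x s \<oplus>\<^bsub>A\<^esub> ?y, b) t - single (d s \<odot>\<^bsub>A\<^esub> x s, b) t - single (?y, b) t)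
     + (single (d s \<odot>\<^bsub>A\<^esub> x s, b) t - single (x s, b) (t * d s))
     + (single (?y, b) t - (\<Sum>s\<in>S. single (x s, b) (t * d s))) \<in> K"
    using insert assms(3)
    by (intro K_add rel_add_left rel_scale_left A.smult_in A.lincomb_in) auto
  then show ?case using insert eq by (simp add: algebra_simps)
qed

lemma rel_lincomb_right:
  assumes "finite S" "\<And>s. s \<in> S \<Longrightarrow> x s \<in> carrier B" "a \<in> carrier A"
  shows "single (a, \<Oplus>\<^bsub>B\<^esub>s\<in>S. d s \<odot>\<^bsub>B\<^esub> x s) t - (\<Sum>s\<in>S. single (a, x s) (t * d s)) \<in> K"
  using assms(1,2)
proof (induction S rule: finite_induct)
  case empty
  interpret V: vectorspace class_ring B by (rule B.vs)
  have "0 \<odot>\<^bsub>B\<^esub> \<zero>\<^bsub>B\<^esub> = \<zero>\<^bsub>B\<^esub>"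
    by (rule B.c_inj) (simp_all add: B.zero_in B.smult_in B.c_smult B.c_zero)
  then show ?case using rel_scale_right[OF assms(3) B.zero_in, of 0 t] by simp
next
  case (insert s S)
  interpret V: vectorspace class_ring B by (rule B.vs)
  let ?y = "\<Oplus>\<^bsub>B\<^esub>s\<in>S. d s \<odot>\<^bsub>B\<^esub> x s"
  have eq: "(\<Oplus>\<^bsub>B\<^esub>s\<in>insert s S. d s \<odot>\<^bsub>B\<^esub> x s) = d s \<odot>\<^bsub>B\<^esub> x s \<oplus>\<^bsub>B\<^esub> ?y"
    using insert by (intro V.M.finsum_insert) (auto intro: B.smult_in)
  have "(single (a, d s \<odot>\<^bsub>B\<^esub> x s \<oplus>\<^bsub>B\<^esub> ?y) t - single (a, d s \<odot>\<^bsub>B\<^esub> x s) t - single (a, ?y) t)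
     + (single (a, d s \<odot>\<^bsub>B\<^esub> x s) t - single (a, x s) (t * d s))
     + (single (a, ?y) t - (\<Sum>s\<in>S. single (a, x s) (t * d s))) \<in> K"
    using insert assms(3)
    by (intro K_add rel_add_right rel_scale_right B.smult_in B.lincomb_in) auto
  then show ?case using insert eq by (simp add: algebra_simps)
qed

text \<open>
  The representative of a tensor with given coordinates that involves basis vectors only.
\<close>

definition nf :: "('i \<times> 'j \<Rightarrow> 'k) \<Rightarrow> 'a \<times> 'b \<Rightarrow>\<^sub>0 'k" where
  "nf h = (\<Sum>p\<in>I. \<Sum>q\<in>J. single (A.bas p, B.bas q) (h (p, q)))"

lemma nf_in: "nf h \<in> carrier F"
proof -
  have "Poly_Mapping.keys (nf h) \<subseteq> carrier A \<times> carrier B"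
    unfolding nf_def by (intro keys_sum_subset) (auto simp: A.bas_in B.bas_in split: if_splits)
  then show ?thesis by (simp add: formal_tensors_carrier)
qed

lemma co_nf: "p \<in> I \<Longrightarrow> q \<in> J \<Longrightarrow> co (nf h) (p, q) = h (p, q)"
proof -
  assume pq: "p \<in> I" "q \<in> J"
  have "co (nf h) (p, q) = (\<Sum>p'\<in>I. \<Sum>q'\<in>J. if p' = p then if q' = q then h (p', q') else 0 else 0)"
    unfolding nf_def co_simps by (intro sum.cong refl) (simp add: A.c_bas B.c_bas)
  also have "\<dots> = (\<Sum>p'\<in>I. if p' = p then \<Sum>q'\<in>J. if q' = q then h (p', q') else 0 else 0)"
    by (intro sum.cong refl) simp
  finally show ?thesis using pq A.finI B.finI by simp
qed

text \<open>
  Modulo the bilinear relations, a pure tensor may be expanded in the two bases.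
\<close>

lemma single_nf:
  assumes "a \<in> carrier A" "b \<in> carrier B"
  shows "single (a, b) t - nf (co (single (a, b) t)) \<in> K"
proof -
  have 1: "single (a, b) t - (\<Sum>p\<in>I. single (A.bas p, b) (t * ca a p)) \<in> K"
    using rel_lincomb_left[OF A.finI, of A.bas b "ca a" t] A.expand[OF assms(1)] A.bas_in assms by simp
  have 2: "single (A.bas p, b) s - (\<Sum>q\<in>J. single (A.bas p, B.bas q) (s * cb b q)) \<in> K" for p s
    using rel_lincomb_right[OF B.finI, of B.bas "A.bas p" "cb b" s] B.expand[OF assms(2)] A.bas_in B.bas_in assms by simp
  have "(\<Sum>p\<in>I. single (A.bas p, b) (t * ca a p) - (\<Sum>q\<in>J. single (A.bas p, B.bas q) (t * ca a p * cb b q))) \<in> K"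
    by (intro K_sum 2)
  from K_add[OF 1 this] show ?thesis by (simp add: nf_def sum_subtractf mult.assoc)
qed

lemma nf_sum: "(\<Sum>s\<in>S. nf (h s)) = nf (\<lambda>p. \<Sum>s\<in>S. h s p)"
proof -
  have "(\<Sum>s\<in>S. single k (u s)) = single k (sum u S)" for k :: "'a \<times> 'b" and u :: "_ \<Rightarrow> 'k"
    by (induction S rule: infinite_finite_induct) (auto simp: single_add)
  then have "nf (\<lambda>p. \<Sum>s\<in>S. h s p) = (\<Sum>p\<in>I. \<Sum>q\<in>J. \<Sum>s\<in>S. single (A.bas p, B.bas q) (h s (p, q)))"
    by (simp only: nf_def)
  also have "\<dots> = (\<Sum>s\<in>S. nf (h s))"
    unfolding nf_def by (subst (2) sum.swap) (intro sum.cong refl sum.swap)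
  finally show ?thesis by simp
qed

lemma minus_nf:
  assumes "f \<in> carrier F"
  shows "f - nf (co f) \<in> K"
proof -
  have "(\<Sum>k\<in>Poly_Mapping.keys f. single k (Poly_Mapping.lookup f k) - nf (co (single k (Poly_Mapping.lookup f k)))) \<in> K"
    using assms by (intro K_sum) (auto intro: single_nf simp: formal_tensors_carrier)
  moreover have "(\<Sum>k\<in>Poly_Mapping.keys f. nf (co (single k (Poly_Mapping.lookup f k)))) = nf (co f)"
    unfolding nf_sum by (subst co_simps(7)[symmetric]) (simp only: sum_single)
  ultimately show ?thesis by (simp add: sum_subtractf sum_single)
qed

text \<open>
  The relations generate exactly the formal sums with vanishing coordinates: by \<open>minus_nf\<close> a formal sum
  agrees modulo the relations with a normal form, which is determined by its coordinates.
\<close>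

lemma K_iff: "f \<in> K \<longleftrightarrow> f \<in> carrier F \<and> (\<forall>p. co f p = 0)"
proof
  assume f: "f \<in> carrier F \<and> (\<forall>p. co f p = 0)"
  then have "co f = (\<lambda>p. 0)" by blast
  with f have "f - nf (\<lambda>p. 0) \<in> K" using minus_nf[of f] by simp
  then show "f \<in> K" by (simp add: nf_def)
qed (use K_co K_in in auto)

text \<open>
  The coset of a formal sum, described by coordinates instead of relations.
\<close>

definition cls :: "('a \<times> 'b \<Rightarrow>\<^sub>0 'k) \<Rightarrow> ('a \<times> 'b \<Rightarrow>\<^sub>0 'k) set" where
  "cls f = {g \<in> carrier F. \<forall>p. co g p = co f p}"

lemma F_minus: "f \<in> carrier F \<Longrightarrow> g \<in> carrier F \<Longrightarrow> f - g \<in> carrier F"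
  using Poly_Mapping.keys_diff[of f g] by (auto simp: formal_tensors_carrier)
lemma F_add: "f \<in> carrier F \<Longrightarrow> g \<in> carrier F \<Longrightarrow> f + g \<in> carrier F"
  using Poly_Mapping.keys_add[of f g] by (auto simp: formal_tensors_carrier)
lemma F_scale: "f \<in> carrier F \<Longrightarrow> Poly_Mapping.map ((*) t) f \<in> carrier F"
  using keys_scale[of t f] by (auto simp: formal_tensors_carrier)

lemma coset: 
  assumes "f \<in> carrier F"
  shows "K +>\<^bsub>F\<^esub> f = cls f"
proof -
  have "K +>\<^bsub>F\<^esub> f = (\<lambda>h. h + f) ` K" by (auto simp: a_r_coset_def')
  also have "\<dots> = cls f"
  proof (intro equalityI subsetI)
    fix g assume "g \<in> (\<lambda>h. h + f) ` K"
    then show "g \<in> cls f" using assms F_add by (auto simp: cls_def K_iff)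
  next
    fix g assume "g \<in> cls f"
    then have "g - f \<in> K" using assms F_minus[of g f] by (auto simp: cls_def K_iff)
    then show "g \<in> (\<lambda>h. h + f) ` K" by (rule image_eqI[rotated]) simp
  qed
  finally show ?thesis .
qed

lemma cls_eq_iff:
  assumes "f \<in> carrier F"
  shows "cls f = cls g \<longleftrightarrow> (\<forall>p. co f p = co g p)"
proof
  assume "cls f = cls g"
  then have "f \<in> cls g" using assms by (auto simp: cls_def)
  then show "\<forall>p. co f p = co g p" by (simp add: cls_def)
qed (simp add: cls_def)

lemma F_zero: "0 \<in> carrier F" by (simp add: formal_tensors_carrier)

lemma cls_self: "f \<in> carrier F \<Longrightarrow> f \<in> cls f"
  by (simp add: cls_def)

abbreviation "T \<equiv> tensor A B"

lemma tensor_carrier: "carrier T = cls ` carrier F"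
  by (auto simp: tensor_def A_RCOSETS_def' coset)

lemma tensor_zero: "\<zero>\<^bsub>T\<^esub> = cls 0"
  using K_iff by (auto simp: tensor_def cls_def)

lemma tensor_add:
  assumes "f \<in> carrier F" "g \<in> carrier F"
  shows "cls f \<oplus>\<^bsub>T\<^esub> cls g = cls (f + g)"
proof -
  have "cls f \<oplus>\<^bsub>T\<^esub> cls g = {h + k | h k. h \<in> cls f \<and> k \<in> cls g}"
    by (auto simp: tensor_def set_add_def')
  also have "\<dots> = cls (f + g)"
  proof (intro equalityI subsetI)
    fix x assume "x \<in> {h + k | h k. h \<in> cls f \<and> k \<in> cls g}"
    then show "x \<in> cls (f + g)" using F_add by (auto simp: cls_def)
  next
    fix x assume "x \<in> cls (f + g)"
    then have "f \<in> cls f" "x - f \<in> cls g" "x = f + (x - f)"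
      using assms F_minus[of x f] by (auto simp: cls_def)
    then show "x \<in> {h + k | h k. h \<in> cls f \<and> k \<in> cls g}" by blast
  qed
  finally show ?thesis .
qed

lemma tensor_smult:
  assumes "f \<in> carrier F"
  shows "t \<odot>\<^bsub>T\<^esub> cls f = cls (Poly_Mapping.map ((*) t) f)"
proof -
  have "t \<odot>\<^bsub>T\<^esub> cls f = (\<Union>g\<in>cls f. cls (Poly_Mapping.map ((*) t) g))"
    using coset[OF F_scale] by (auto simp: tensor_def cls_def)
  also have "\<dots> = (\<Union>g\<in>cls f. cls (Poly_Mapping.map ((*) t) f))"
    by (intro SUP_cong refl) (auto simp: cls_def)
  also have "\<dots> = cls (Poly_Mapping.map ((*) t) f)" using cls_self[OF assms] by auto
  finally show ?thesis .
qed

definition coT :: "('a \<times> 'b \<Rightarrow>\<^sub>0 'k) set \<Rightarrow> 'i \<times> 'j \<Rightarrow> 'k" where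
  "coT t = co (SOME f. f \<in> t)"

lemma coT_cls: "f \<in> carrier F \<Longrightarrow> coT (cls f) p = co f p"
proof -
  assume "f \<in> carrier F"
  then have "(SOME g. g \<in> cls f) \<in> cls f" using cls_self by (metis someI)
  moreover have "g \<in> cls f \<Longrightarrow> co g p = co f p" for g unfolding cls_def by blast
  ultimately show ?thesis unfolding coT_def by blast
qed

lemma coT_inj:
  assumes "x \<in> carrier T" "y \<in> carrier T" "\<And>p. coT x p = coT y p"
  shows "x = y"
proof -
  obtain f g where fg: "f \<in> carrier F" "g \<in> carrier F" "x = cls f" "y = cls g"
    using assms by (auto simp: tensor_carrier)
  then have "\<forall>p. co f p = co g p" using assms(3) coT_cls by metis
  then show ?thesis using fg cls_eq_iff by blast
qed

sublocale T: coordinates T "I \<times> J" coT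
proof (rule coordinates.intro)
  show "vectorspace class_ring T"
  proof (rule vectorspace_if_coordinates[where c = coT])
    show "\<zero>\<^bsub>T\<^esub> \<in> carrier T" unfolding tensor_carrier tensor_zero by (rule imageI) (rule F_zero)
    show "\<And>i. coT \<zero>\<^bsub>T\<^esub> i = 0" by (simp add: tensor_zero coT_cls F_zero)
    show "\<And>x y. x \<in> carrier T \<Longrightarrow> y \<in> carrier T \<Longrightarrow> (\<And>i. coT x i = coT y i) \<Longrightarrow> x = y"
      by (rule coT_inj)
  qed (auto simp: tensor_carrier tensor_add tensor_smult coT_cls F_add F_scale)
  show "finite (I \<times> J)" using A.finI B.finI by simp
  show "bij_betw coT (carrier T) {f. \<forall>i. i \<notin> I \<times> J \<longrightarrow> f i = 0}"
    unfolding bij_betw_def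
  proof
    show "inj_on coT (carrier T)"
      by (rule inj_onI) (erule (1) coT_inj, simp)
    show "coT ` carrier T = {f. \<forall>i. i \<notin> I \<times> J \<longrightarrow> f i = 0}"
    proof (intro equalityI subsetI)
      fix g assume "g \<in> coT ` carrier T"
      then obtain f where "f \<in> carrier F" "g = coT (cls f)" by (auto simp: tensor_carrier)
      then show "g \<in> {f. \<forall>i. i \<notin> I \<times> J \<longrightarrow> f i = 0}" using co_out by (auto simp: coT_cls)
    next
      fix g :: "'i \<times> 'j \<Rightarrow> 'k" assume g: "g \<in> {f. \<forall>i. i \<notin> I \<times> J \<longrightarrow> f i = 0}"
      have "coT (cls (nf g)) p = g p" for p
      proof (cases "p \<in> I \<times> J")
        case True
        then show ?thesis using coT_cls[OF nf_in, of g p] co_nf[of "fst p" "snd p" g] by auto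
      next
        case False
        then have "g p = 0" using g by blast
        with False show ?thesis using coT_cls[OF nf_in, of g p] co_out[OF nf_in] by simp
      qed
      then have "coT (cls (nf g)) = g" by auto
      moreover have "cls (nf g) \<in> carrier T" unfolding tensor_carrier by (rule imageI, rule nf_in)
      ultimately show "g \<in> coT ` carrier T" by (intro image_eqI[where x = "cls (nf g)"]) auto
    qed
  qed
qed (auto simp: tensor_carrier tensor_add tensor_smult coT_cls F_add F_scale)

lemma single_in: "a \<in> carrier A \<Longrightarrow> b \<in> carrier B \<Longrightarrow> single (a, b) t \<in> carrier F"
  by (auto simp: formal_tensors_carrier)

lemma pure_cls: "a \<in> carrier A \<Longrightarrow> b \<in> carrier B \<Longrightarrow> pure_tensor A B a b = cls (single (a, b) 1)"
  unfolding pure_tensor_def by (intro coset single_in)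

lemma pure_in: "a \<in> carrier A \<Longrightarrow> b \<in> carrier B \<Longrightarrow> pure_tensor A B a b \<in> carrier T"
  unfolding tensor_carrier by (simp only: pure_cls) (intro imageI single_in)

lemma coT_pure: "a \<in> carrier A \<Longrightarrow> b \<in> carrier B \<Longrightarrow> coT (pure_tensor A B a b) p = ca a (fst p) * cb b (snd p)"
  by (simp only: pure_cls coT_cls single_in) simp

text \<open>
  A bilinear map is given by a coefficient array \<open>\<gamma>\<close> in coordinates; the induced linear map has the same
  array. The hypothesis on \<open>\<beta>\<close> contains its bilinearity, and gives that the value is the same
  for all representatives of a tensor.
\<close>

lemma lift:
  assumes X: "coordinates X Q cx"
    and \<beta>_in: "\<And>a b. a \<in> carrier A \<Longrightarrow> b \<in> carrier B \<Longrightarrow> \<beta> a b \<in> carrier X"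
    and \<beta>: "\<And>a b x. a \<in> carrier A \<Longrightarrow> b \<in> carrier B \<Longrightarrow> x \<in> Q \<Longrightarrow>
      cx (\<beta> a b) x = (\<Sum>p\<in>I. \<Sum>q\<in>J. ca a p * cb b q * \<gamma> p q x)"
    and t: "t \<in> carrier T"
  shows "tensor_lift X \<beta> t \<in> carrier X"
    and "x \<in> Q \<Longrightarrow> cx (tensor_lift X \<beta> t) x = (\<Sum>p\<in>I. \<Sum>q\<in>J. coT t (p, q) * \<gamma> p q x)"
proof -
  interpret X: coordinates X Q cx by (rule X)
  obtain f where f: "f \<in> carrier F" "t = cls f" using t by (auto simp: tensor_carrier)
  define ev where "ev g = (\<Oplus>\<^bsub>X\<^esub>p \<in> Poly_Mapping.keys g. Poly_Mapping.lookup g p \<odot>\<^bsub>X\<^esub> \<beta> (fst p) (snd p))" for g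
  have ev_in: "ev g \<in> carrier X" if "g \<in> carrier F" for g
    unfolding ev_def by (intro X.lincomb_in) (use that in \<open>auto intro!: \<beta>_in simp: formal_tensors_carrier\<close>)
  have ev: "cx (ev g) x = (\<Sum>p\<in>I. \<Sum>q\<in>J. co g (p, q) * \<gamma> p q x)" if "g \<in> carrier F" "x \<in> Q" for g x
  proof -
    have "cx (ev g) x = (\<Sum>k\<in>Poly_Mapping.keys g. Poly_Mapping.lookup g k * cx (\<beta> (fst k) (snd k)) x)"
      unfolding ev_def by (intro X.c_lincomb) (use that in \<open>auto intro!: \<beta>_in simp: formal_tensors_carrier\<close>)
    also have "\<dots> = (\<Sum>k\<in>Poly_Mapping.keys g. \<Sum>p\<in>I. \<Sum>q\<in>J. Poly_Mapping.lookup g k * (ca (fst k) p * cb (snd k) q) * \<gamma> p q x)"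
      using that by (intro sum.cong refl) (subst \<beta>, auto simp: sum_distrib_left ac_simps formal_tensors_carrier)
    also have "\<dots> = (\<Sum>p\<in>I. \<Sum>q\<in>J. \<Sum>k\<in>Poly_Mapping.keys g. Poly_Mapping.lookup g k * (ca (fst k) p * cb (snd k) q) * \<gamma> p q x)"
      by (subst sum.swap) (intro sum.cong refl sum.swap)
    finally show ?thesis by (simp add: co_def peval_def sum_distrib_right)
  qed
  have "ev g = ev f" if "g \<in> t" for g
  proof (rule X.c_inj)
    have g: "g \<in> carrier F" "\<And>p. co g p = co f p" using that f(2) unfolding cls_def by blast+
    show "ev g \<in> carrier X" by (rule ev_in[OF g(1)])
    show "ev f \<in> carrier X" by (rule ev_in[OF f(1)])
    show "cx (ev g) x = cx (ev f) x" if "x \<in> Q" for x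
      by (simp only: ev[OF g(1) that] ev[OF f(1) that] g(2))
  qed
  moreover have "f \<in> t" using f cls_self by blast
  ultimately have "ev ` t = {ev f}" by blast
  then have L: "tensor_lift X \<beta> t = ev f" unfolding tensor_lift_def ev_def[abs_def] by simp
  show "tensor_lift X \<beta> t \<in> carrier X" unfolding L by (rule ev_in[OF f(1)])
  show "x \<in> Q \<Longrightarrow> cx (tensor_lift X \<beta> t) x = (\<Sum>p\<in>I. \<Sum>q\<in>J. coT t (p, q) * \<gamma> p q x)"
    unfolding L by (simp only: f(2) ev[OF f(1)] coT_cls[OF f(1)])
qed

end

text \<open>
  An algebra with its structure constants \<open>\<mu>\<close>. The product of two tensors has the same form, so that
  iterated tensor products are covered.
\<close>

locale algebra_coordinates = coordinates A I c for A :: "('k :: field, 'a, 'm) module_scheme" (structure)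
    and I :: "'i set" and c +
  fixes \<mu> :: "'i \<Rightarrow> 'i \<Rightarrow> 'i \<Rightarrow> 'k"
  assumes mult_in: "\<lbrakk>x \<in> carrier A; y \<in> carrier A\<rbrakk> \<Longrightarrow> x \<otimes> y \<in> carrier A"
    and c_mult: "\<lbrakk>x \<in> carrier A; y \<in> carrier A; r \<in> I\<rbrakk> \<Longrightarrow>
      c (x \<otimes> y) r = (\<Sum>p\<in>I. \<Sum>q\<in>I. c x p * c y q * \<mu> p q r)"
    and one_in: "\<one> \<in> carrier A"

lemma assoc_algebra_coordinates:
  assumes "assoc_algebra A" "coordinates A I c"
  shows "algebra_coordinates A I c (\<lambda>p q r. c (coordinates.bas A I c p \<otimes>\<^bsub>A\<^esub> coordinates.bas A I c q) r)"
proof -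
  interpret A: assoc_algebra A by fact
  interpret R: ring A by (rule A.ring)
  interpret C: coordinates A I c by fact
  show ?thesis
  proof
    fix x y r assume xy: "x \<in> carrier A" "y \<in> carrier A" and r: "r \<in> I"
    have "c (x \<otimes>\<^bsub>A\<^esub> y) r = (\<Sum>p\<in>I. c x p * c (C.bas p \<otimes>\<^bsub>A\<^esub> y) r)"
      using xy by (intro C.linear_functional_expand[of "\<lambda>x. c (x \<otimes>\<^bsub>A\<^esub> y) r"])
        (simp_all add: R.l_distr C.c_add A.smult_mult_left C.c_smult)
    also have "\<dots> = (\<Sum>p\<in>I. c x p * (\<Sum>q\<in>I. c y q * c (C.bas p \<otimes>\<^bsub>A\<^esub> C.bas q) r))"
      using xy C.bas_in by (intro sum.cong refl arg_cong2[where f = "(*)"]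
          C.linear_functional_expand[of "\<lambda>y. c (C.bas _ \<otimes>\<^bsub>A\<^esub> y) r"])
        (simp_all add: R.r_distr C.c_add A.smult_mult_right C.c_smult)
    finally show "c (x \<otimes>\<^bsub>A\<^esub> y) r = (\<Sum>p\<in>I. \<Sum>q\<in>I. c x p * c y q * c (C.bas p \<otimes>\<^bsub>A\<^esub> C.bas q) r)"
      by (simp add: sum_distrib_left mult.assoc)
  qed auto
qed

locale tensor_algebra = A: algebra_coordinates A I ca \<mu>A + B: algebra_coordinates B J cb \<mu>B
  for A :: "('k :: field, 'a, 'm) module_scheme" and I :: "'i set" and ca \<mu>A
    and B :: "('k, 'b, 'n) module_scheme" and J :: "'j set" and cb \<mu>B
begin

sublocale tensor_coordinates A I ca B J cb
  by unfold_locales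

definition \<mu>T :: "'i \<times> 'j \<Rightarrow> 'i \<times> 'j \<Rightarrow> 'i \<times> 'j \<Rightarrow> 'k" where
  "\<mu>T x y z = \<mu>A (fst x) (fst y) (fst z) * \<mu>B (snd x) (snd y) (snd z)"

lemma pure_mult_coords:
  assumes "a \<in> carrier A" "a' \<in> carrier A" "b \<in> carrier B" "b' \<in> carrier B" "z \<in> I \<times> J"
  shows "ca (a \<otimes>\<^bsub>A\<^esub> a') (fst z) * cb (b \<otimes>\<^bsub>B\<^esub> b') (snd z) =
    (\<Sum>x\<in>I \<times> J. \<Sum>y\<in>I \<times> J. (ca a (fst x) * cb b (snd x)) * (ca a' (fst y) * cb b' (snd y)) * \<mu>T x y z)"
proof -
  have "(\<Sum>x\<in>I \<times> J. \<Sum>y\<in>I \<times> J. (ca a (fst x) * cb b (snd x)) * (ca a' (fst y) * cb b' (snd y)) * \<mu>T x y z)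
    = (\<Sum>p\<in>I. \<Sum>q\<in>J. \<Sum>p'\<in>I. \<Sum>q'\<in>J. (ca a p * ca a' p' * \<mu>A p p' (fst z)) * (cb b q * cb b' q' * \<mu>B q q' (snd z)))"
    by (simp add: sum.cartesian_product' \<mu>T_def ac_simps)
  also have "\<dots> = (\<Sum>p\<in>I. \<Sum>p'\<in>I. \<Sum>q\<in>J. \<Sum>q'\<in>J. (ca a p * ca a' p' * \<mu>A p p' (fst z)) * (cb b q * cb b' q' * \<mu>B q q' (snd z)))"
    by (intro sum.cong refl sum.swap)
  also have "\<dots> = (\<Sum>p\<in>I. \<Sum>p'\<in>I. ca a p * ca a' p' * \<mu>A p p' (fst z)) * (\<Sum>q\<in>J. \<Sum>q'\<in>J. cb b q * cb b' q' * \<mu>B q q' (snd z))"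
    unfolding sum_distrib_right unfolding sum_distrib_left by (rule refl)
  finally show ?thesis using assms by (auto simp: A.c_mult B.c_mult)
qed

lemma F_mult:
  assumes f: "f \<in> carrier F" and g: "g \<in> carrier F"
  shows "f \<otimes>\<^bsub>F\<^esub> g \<in> carrier F"
    and "z \<in> I \<times> J \<Longrightarrow> co (f \<otimes>\<^bsub>F\<^esub> g) z = (\<Sum>x\<in>I \<times> J. \<Sum>y\<in>I \<times> J. co f x * co g y * \<mu>T x y z)"
proof -
  have in_f: "fst k \<in> carrier A" "snd k \<in> carrier B" if "k \<in> Poly_Mapping.keys f" for k
    using f that by (auto simp: formal_tensors_carrier)
  have in_g: "fst k \<in> carrier A" "snd k \<in> carrier B" if "k \<in> Poly_Mapping.keys g" for k
    using g that by (auto simp: formal_tensors_carrier)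
  have "f \<otimes>\<^bsub>F\<^esub> g = (\<Sum>p \<in> Poly_Mapping.keys f. \<Sum>q \<in> Poly_Mapping.keys g.
        single (fst p \<otimes>\<^bsub>A\<^esub> fst q, snd p \<otimes>\<^bsub>B\<^esub> snd q)
          (Poly_Mapping.lookup f p * Poly_Mapping.lookup g q))"
    by (simp add: formal_tensors_def)
  note fg = this
  show "f \<otimes>\<^bsub>F\<^esub> g \<in> carrier F"
    unfolding fg formal_tensors_carrier mem_Collect_eq
    by (intro keys_sum_subset) (auto simp: A.mult_in B.mult_in in_f in_g split: if_splits)
  assume z: "z \<in> I \<times> J"
  let ?a = "\<lambda>k x. ca (fst k) (fst x) * cb (snd k) (snd x)"
  have "co (f \<otimes>\<^bsub>F\<^esub> g) z = (\<Sum>p \<in> Poly_Mapping.keys f. \<Sum>q \<in> Poly_Mapping.keys g.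
      Poly_Mapping.lookup f p * Poly_Mapping.lookup g q * (\<Sum>x\<in>I \<times> J. \<Sum>y\<in>I \<times> J. ?a p x * ?a q y * \<mu>T x y z))"
    unfolding fg co_simps by (intro sum.cong refl) (use z in \<open>simp add: pure_mult_coords in_f in_g\<close>)
  also have "\<dots> = (\<Sum>p \<in> Poly_Mapping.keys f. \<Sum>q \<in> Poly_Mapping.keys g. \<Sum>x\<in>I \<times> J. \<Sum>y\<in>I \<times> J.
      (Poly_Mapping.lookup f p * ?a p x) * (Poly_Mapping.lookup g q * ?a q y) * \<mu>T x y z)"
    by (simp add: sum_distrib_left ac_simps)
  also have "\<dots> = (\<Sum>x\<in>I \<times> J. \<Sum>y\<in>I \<times> J. \<Sum>p \<in> Poly_Mapping.keys f. \<Sum>q \<in> Poly_Mapping.keys g.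
      (Poly_Mapping.lookup f p * ?a p x) * (Poly_Mapping.lookup g q * ?a q y) * \<mu>T x y z)"
    by (rule sum_swap_pairs)
  also have "\<dots> = (\<Sum>x\<in>I \<times> J. \<Sum>y\<in>I \<times> J. co f x * co g y * \<mu>T x y z)"
    unfolding co_def peval_def sum_product by (simp only: sum_distrib_right)
  finally show "co (f \<otimes>\<^bsub>F\<^esub> g) z = (\<Sum>x\<in>I \<times> J. \<Sum>y\<in>I \<times> J. co f x * co g y * \<mu>T x y z)" .
qed

lemma T_mult:
  assumes f: "f \<in> carrier F" and g: "g \<in> carrier F"
  shows "cls f \<otimes>\<^bsub>T\<^esub> cls g = cls (f \<otimes>\<^bsub>F\<^esub> g)"
proof -
  have "cls f \<otimes>\<^bsub>T\<^esub> cls g = (\<Union>f'\<in>cls f. \<Union>g'\<in>cls g. K +>\<^bsub>F\<^esub> (f' \<otimes>\<^bsub>F\<^esub> g'))"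
    by (simp add: tensor_def rcoset_mult_def)
  also have "\<dots> = (\<Union>f'\<in>cls f. \<Union>g'\<in>cls g. cls (f \<otimes>\<^bsub>F\<^esub> g))"
  proof (intro SUP_cong refl)
    fix f' g' assume "f' \<in> cls f" "g' \<in> cls g"
    then have f': "f' \<in> carrier F" "\<And>p. co f' p = co f p" and g': "g' \<in> carrier F" "\<And>p. co g' p = co g p"
      unfolding cls_def by blast+
    have "co (f' \<otimes>\<^bsub>F\<^esub> g') p = co (f \<otimes>\<^bsub>F\<^esub> g) p" for p
    proof (cases "p \<in> I \<times> J")
      case True
      then show ?thesis by (simp only: F_mult(2)[OF f g] F_mult(2)[OF f'(1) g'(1)] f' g')
    next
      case False
      then show ?thesis using co_out F_mult(1)[OF f g] F_mult(1)[OF f'(1) g'(1)] by metis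
    qed
    then have "cls (f' \<otimes>\<^bsub>F\<^esub> g') = cls (f \<otimes>\<^bsub>F\<^esub> g)"
      using cls_eq_iff[OF F_mult(1)[OF f'(1) g'(1)]] by blast
    then show "K +>\<^bsub>F\<^esub> (f' \<otimes>\<^bsub>F\<^esub> g') = cls (f \<otimes>\<^bsub>F\<^esub> g)"
      using coset[OF F_mult(1)[OF f'(1) g'(1)]] by simp
  qed
  also have "\<dots> = cls (f \<otimes>\<^bsub>F\<^esub> g)" using cls_self[OF f] cls_self[OF g] by auto
  finally show ?thesis .
qed

sublocale TA: algebra_coordinates T "I \<times> J" coT \<mu>T
proof (intro algebra_coordinates.intro algebra_coordinates_axioms.intro)
  show "coordinates T (I \<times> J) coT" by (rule T.coordinates_axioms)
  fix x y assume "x \<in> carrier T" "y \<in> carrier T"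
  then obtain f g where fg: "f \<in> carrier F" "g \<in> carrier F" "x = cls f" "y = cls g"
    by (auto simp: tensor_carrier)
  show "x \<otimes>\<^bsub>T\<^esub> y \<in> carrier T"
    using fg F_mult(1)[of f g] by (simp add: T_mult tensor_carrier)
  fix r assume "r \<in> I \<times> J"
  then show "coT (x \<otimes>\<^bsub>T\<^esub> y) r = (\<Sum>p\<in>I \<times> J. \<Sum>q\<in>I \<times> J. coT x p * coT y q * \<mu>T p q r)"
    using fg F_mult[of f g] by (simp only: T_mult coT_cls)
next
  show "\<one>\<^bsub>T\<^esub> \<in> carrier T"
    using pure_in[OF A.one_in B.one_in] by (simp add: tensor_def pure_tensor_def formal_tensors_def)
qed

lemma T_one: "\<one>\<^bsub>T\<^esub> = pure_tensor A B \<one>\<^bsub>A\<^esub> \<one>\<^bsub>B\<^esub>"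
  by (simp add: tensor_def pure_tensor_def formal_tensors_def)

text \<open>
  The tensor \<open>t\<close> is the sum of the pure tensors \<open>a s \<otimes> b s\<close>, expressed in coordinates.
\<close>

definition rep :: "('a \<times> 'b \<Rightarrow>\<^sub>0 'k) set \<Rightarrow> 's set \<Rightarrow> ('s \<Rightarrow> 'a) \<Rightarrow> ('s \<Rightarrow> 'b) \<Rightarrow> bool" where
  "rep t S a b \<longleftrightarrow> t \<in> carrier T \<and> (\<forall>s\<in>S. a s \<in> carrier A \<and> b s \<in> carrier B) \<and>
    (\<forall>p\<in>I. \<forall>q\<in>J. coT t (p, q) = (\<Sum>s\<in>S. ca (a s) p * cb (b s) q))"

lemma repD:
  assumes "rep t S a b"
  shows "t \<in> carrier T" "s \<in> S \<Longrightarrow> a s \<in> carrier A" "s \<in> S \<Longrightarrow> b s \<in> carrier B"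
    "p \<in> I \<Longrightarrow> q \<in> J \<Longrightarrow> coT t (p, q) = (\<Sum>s\<in>S. ca (a s) p * cb (b s) q)"
  using assms by (auto simp: rep_def)

lemma rep_iff_finsum:
  assumes "\<And>s. s \<in> S \<Longrightarrow> a s \<in> carrier A" "\<And>s. s \<in> S \<Longrightarrow> b s \<in> carrier B"
  shows "rep t S a b \<longleftrightarrow> t = (\<Oplus>\<^bsub>T\<^esub>s\<in>S. pure_tensor A B (a s) (b s))"
proof -
  let ?u = "\<Oplus>\<^bsub>T\<^esub>s\<in>S. pure_tensor A B (a s) (b s)"
  have u: "?u \<in> carrier T" by (intro T.finsum_in pure_in assms)
  have cu: "coT ?u (p, q) = (\<Sum>s\<in>S. ca (a s) p * cb (b s) q)" for p q
    by (subst T.c_finsum) (auto intro: pure_in assms simp: coT_pure assms cong: sum.cong)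
  show ?thesis
  proof
    assume r: "rep t S a b"
    show "t = ?u"
      by (rule T.c_inj) (use repD[OF r] u cu in auto)
  qed (use u cu assms in \<open>auto simp: rep_def\<close>)
qed

lemma rep_eq: "rep t S a b \<Longrightarrow> rep u S' a' b' \<Longrightarrow>
  (\<And>p q. p \<in> I \<Longrightarrow> q \<in> J \<Longrightarrow> (\<Sum>s\<in>S. ca (a s) p * cb (b s) q) = (\<Sum>s\<in>S'. ca (a' s) p * cb (b' s) q)) \<Longrightarrow> t = u"
  by (rule T.c_inj) (auto simp: rep_def)

lemma rep_exists:
  assumes "t \<in> carrier T"
  shows "rep t (I \<times> J) (\<lambda>s. coT t s \<odot>\<^bsub>A\<^esub> A.bas (fst s)) (\<lambda>s. B.bas (snd s))"
proof -
  have "(\<Sum>s\<in>I \<times> J. coT t s * ca (A.bas (fst s)) p * cb (B.bas (snd s)) q) = coT t (p, q)"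
    if "p \<in> I" "q \<in> J" for p q
  proof -
    have "(\<Sum>s\<in>I \<times> J. coT t s * ca (A.bas (fst s)) p * cb (B.bas (snd s)) q)
      = (\<Sum>s\<in>I \<times> J. if s = (p, q) then coT t s else 0)"
      by (intro sum.cong refl) (auto simp: A.c_bas B.c_bas split: if_splits)
    then show ?thesis using that A.finI B.finI by simp
  qed
  then show ?thesis using assms by (simp add: rep_def A.smult_in A.bas_in B.bas_in A.c_smult)
qed

lemma rep_pure: "a \<in> carrier A \<Longrightarrow> b \<in> carrier B \<Longrightarrow> rep (pure_tensor A B a b) {0::nat} (\<lambda>_. a) (\<lambda>_. b)"
  by (simp add: rep_def pure_in coT_pure)

lemma rep_mult:
  assumes r: "rep t S a b" and r': "rep u S' a' b'"
  shows "rep (t \<otimes>\<^bsub>T\<^esub> u) (S \<times> S') (\<lambda>(s, s'). a s \<otimes>\<^bsub>A\<^esub> a' s') (\<lambda>(s, s'). b s \<otimes>\<^bsub>B\<^esub> b' s')"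
proof -
  have "coT (t \<otimes>\<^bsub>T\<^esub> u) z = (\<Sum>s\<in>S. \<Sum>s'\<in>S'. ca (a s \<otimes>\<^bsub>A\<^esub> a' s') (fst z) * cb (b s \<otimes>\<^bsub>B\<^esub> b' s') (snd z))"
    if z: "z \<in> I \<times> J" for z
  proof -
    have "coT (t \<otimes>\<^bsub>T\<^esub> u) z = (\<Sum>x\<in>I \<times> J. \<Sum>y\<in>I \<times> J. coT t x * coT u y * \<mu>T x y z)"
      using r r' z by (intro TA.c_mult) (auto dest: repD)
    also have "\<dots> = (\<Sum>x\<in>I \<times> J. \<Sum>y\<in>I \<times> J. \<Sum>s\<in>S. \<Sum>s'\<in>S'.
      (ca (a s) (fst x) * cb (b s) (snd x)) * (ca (a' s') (fst y) * cb (b' s') (snd y)) * \<mu>T x y z)"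
    proof (intro sum.cong refl)
      fix x y assume "x \<in> I \<times> J" "y \<in> I \<times> J"
      then have eq: "coT t x = (\<Sum>s\<in>S. ca (a s) (fst x) * cb (b s) (snd x))"
        "coT u y = (\<Sum>s\<in>S'. ca (a' s) (fst y) * cb (b' s) (snd y))"
        using repD(4)[OF r, of "fst x" "snd x"] repD(4)[OF r', of "fst y" "snd y"] by auto
      show "coT t x * coT u y * \<mu>T x y z = (\<Sum>s\<in>S. \<Sum>s'\<in>S'.
        (ca (a s) (fst x) * cb (b s) (snd x)) * (ca (a' s') (fst y) * cb (b' s') (snd y)) * \<mu>T x y z)"
        unfolding eq sum_product unfolding sum_distrib_right by (rule refl)
    qed
    also have "\<dots> = (\<Sum>s\<in>S. \<Sum>s'\<in>S'. \<Sum>x\<in>I \<times> J. \<Sum>y\<in>I \<times> J.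
      (ca (a s) (fst x) * cb (b s) (snd x)) * (ca (a' s') (fst y) * cb (b' s') (snd y)) * \<mu>T x y z)"
      by (rule sum_swap_pairs)
    also have "\<dots> = (\<Sum>s\<in>S. \<Sum>s'\<in>S'. ca (a s \<otimes>\<^bsub>A\<^esub> a' s') (fst z) * cb (b s \<otimes>\<^bsub>B\<^esub> b' s') (snd z))"
      using r r' z by (intro sum.cong refl) (subst pure_mult_coords, auto dest: repD)
    finally show ?thesis .
  qed
  then show ?thesis
    using r r' by (auto simp: rep_def TA.mult_in A.mult_in B.mult_in sum.cartesian_product')
qed

lemma pure_mult:
  assumes "a \<in> carrier A" "b \<in> carrier B" "a' \<in> carrier A" "b' \<in> carrier B"
  shows "pure_tensor A B a b \<otimes>\<^bsub>T\<^esub> pure_tensor A B a' b' = pure_tensor A B (a \<otimes>\<^bsub>A\<^esub> a') (b \<otimes>\<^bsub>B\<^esub> b')"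
  by (rule rep_eq[OF rep_mult[OF rep_pure rep_pure] rep_pure]) (auto simp: assms A.mult_in B.mult_in)

lemma tensor_monoid:
  assumes "monoid A" "monoid B"
  shows "monoid T"
proof -
  interpret MA: monoid A by fact
  interpret MB: monoid B by fact
  show ?thesis
  proof (rule monoidI)
    fix x y z assume "x \<in> carrier T" "y \<in> carrier T" "z \<in> carrier T"
    note r = this[THEN rep_exists]
    show "x \<otimes>\<^bsub>T\<^esub> y \<otimes>\<^bsub>T\<^esub> z = x \<otimes>\<^bsub>T\<^esub> (y \<otimes>\<^bsub>T\<^esub> z)"
    proof (rule rep_eq[OF rep_mult[OF rep_mult[OF r(1,2)] r(3)] rep_mult[OF r(1) rep_mult[OF r(2,3)]]])
      have *: "(\<Sum>s\<in>(X \<times> Y) \<times> Z. h s) = (\<Sum>s\<in>X \<times> Y \<times> Z. h ((fst s, fst (snd s)), snd (snd s)))" for X Y Z and h :: "_ \<Rightarrow> 'k"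
        by (simp add: sum.cartesian_product')
      fix p q assume "p \<in> I" "q \<in> J"
      show "(\<Sum>s\<in>((I \<times> J) \<times> I \<times> J) \<times> I \<times> J.
        ca (case s of (s, s') \<Rightarrow> (case s of (s, s') \<Rightarrow> coT x s \<odot>\<^bsub>A\<^esub> A.bas (fst s) \<otimes>\<^bsub>A\<^esub> (coT y s' \<odot>\<^bsub>A\<^esub> A.bas (fst s'))) \<otimes>\<^bsub>A\<^esub>
              (coT z s' \<odot>\<^bsub>A\<^esub> A.bas (fst s'))) p *
        cb (case s of (s, s') \<Rightarrow> (case s of (s, s') \<Rightarrow> B.bas (snd s) \<otimes>\<^bsub>B\<^esub> B.bas (snd s')) \<otimes>\<^bsub>B\<^esub> B.bas (snd s')) q) =
        (\<Sum>s\<in>(I \<times> J) \<times> (I \<times> J) \<times> I \<times> J.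
        ca (case s of (s, s') \<Rightarrow> coT x s \<odot>\<^bsub>A\<^esub> A.bas (fst s) \<otimes>\<^bsub>A\<^esub>
              (case s' of (s, s') \<Rightarrow> coT y s \<odot>\<^bsub>A\<^esub> A.bas (fst s) \<otimes>\<^bsub>A\<^esub> (coT z s' \<odot>\<^bsub>A\<^esub> A.bas (fst s')))) p *
        cb (case s of (s, s') \<Rightarrow> B.bas (snd s) \<otimes>\<^bsub>B\<^esub> (case s' of (s, s') \<Rightarrow> B.bas (snd s) \<otimes>\<^bsub>B\<^esub> B.bas (snd s'))) q)"
        by (subst *, intro sum.cong refl) (auto simp: MA.m_assoc MB.m_assoc A.smult_in A.bas_in B.bas_in)
    qed
  next
    fix x assume "x \<in> carrier T"
    note r = rep_exists[OF this]
    show "\<one>\<^bsub>T\<^esub> \<otimes>\<^bsub>T\<^esub> x = x"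
      unfolding T_one
      by (rule rep_eq[OF rep_mult[OF rep_pure[OF A.one_in B.one_in] r] r])
        (auto simp: sum.cartesian_product' A.smult_in A.bas_in B.bas_in cong: sum.cong)
    show "x \<otimes>\<^bsub>T\<^esub> \<one>\<^bsub>T\<^esub> = x"
      unfolding T_one
      by (rule rep_eq[OF rep_mult[OF r rep_pure[OF A.one_in B.one_in]] r])
        (auto simp: sum.cartesian_product' A.smult_in A.bas_in B.bas_in cong: sum.cong)
  qed (auto simp: TA.mult_in TA.one_in)
qed

end

section \<open>Two-leg tensors over a finite-dimensional algebra\<close>

text \<open>
  A linear dependence among the first legs allows one of the summands to be absorbed into the others.
\<close>

lemma shorten_rank:
  fixes u v :: "nat \<Rightarrow> 'i \<Rightarrow> 'k :: field"
  assumes "\<And>p q. p \<in> I \<Longrightarrow> q \<in> J \<Longrightarrow> R p q = (\<Sum>k<m. u k p * v k q)"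
    and "\<And>p. p \<in> I \<Longrightarrow> (\<Sum>k<m. d k * u k p) = 0" and l: "l < m" "d l \<noteq> 0"
  shows "\<exists>u' v'. \<forall>p\<in>I. \<forall>q\<in>J. R p q = (\<Sum>k<m-1. u' k p * v' k q)"
proof -
  \<comment> \<open>Skips \<open>l\<close>: the last summand takes the place of the one that is absorbed.\<close>
  define \<tau> where "\<tau> i = (if i = l then m - 1 else i)" for i
  have \<tau>: "bij_betw \<tau> {..<m-1} ({..<m} - {l})"
  proof -
    obtain m' where m: "m = Suc m'" using l(1) by (cases m) auto
    show ?thesis unfolding \<tau>_def m using l(1)[unfolded m]
      by (intro bij_betw_byWitness[where f' = "\<lambda>i. if i = m' then l else i"]) (auto split: if_splits)
  qed
  define v' where "v' k q = v k q - d k / d l * v l q" for k q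
  have "R p q = (\<Sum>k<m-1. u (\<tau> k) p * v' (\<tau> k) q)" if p: "p \<in> I" and q: "q \<in> J" for p q
  proof -
    have rem: "(\<Sum>k<m. h k) = h l + (\<Sum>k\<in>{..<m}-{l}. h k)" for h :: "nat \<Rightarrow> 'k"
      using l(1) by (simp add: sum.remove)
    have dep: "(\<Sum>k\<in>{..<m}-{l}. d k * u k p) = - (d l * u l p)"
      using assms(2)[OF p] rem[of "\<lambda>k. d k * u k p"] by (simp add: eq_neg_iff_add_eq_0 add.commute)
    have "(\<Sum>k\<in>{..<m}-{l}. u k p * (d k / d l * v l q)) = (\<Sum>k\<in>{..<m}-{l}. d k * u k p) * (v l q / d l)"
      unfolding sum_distrib_right by (intro sum.cong refl) simp
    also have "\<dots> = - (u l p * v l q)" using l(2) by (simp add: dep)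
    finally have "(\<Sum>k\<in>{..<m}-{l}. u k p * v' k q) = (\<Sum>k<m. u k p * v k q)"
      using rem[of "\<lambda>k. u k p * v k q"] by (simp add: v'_def right_diff_distrib sum_subtractf)
    moreover have "(\<Sum>k<m-1. u (\<tau> k) p * v' (\<tau> k) q) = (\<Sum>k\<in>{..<m}-{l}. u k p * v' k q)"
      by (rule sum.reindex_bij_betw[OF \<tau>])
    ultimately show ?thesis using assms(1)[OF p q] by simp
  qed
  then show ?thesis
    by (intro exI[of _ "\<lambda>k. u (\<tau> k)"] exI[of _ "\<lambda>k. v' (\<tau> k)"]) simp
qed

locale falg = assoc_algebra M + coordinates M I c
  for M :: "('k :: field, 'a) module" (structure) and I :: "'i set" and c :: "'a \<Rightarrow> 'i \<Rightarrow> 'k"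
begin

lemma ring_M: "ring M" by (rule ring)

sublocale MA: algebra_coordinates M I c "\<lambda>p q r. c (bas p \<otimes> bas q) r"
  by (rule assoc_algebra_coordinates) unfold_locales

sublocale T2: tensor_algebra M I c "\<lambda>p q r. c (bas p \<otimes> bas q) r" M I c "\<lambda>p q r. c (bas p \<otimes> bas q) r"
  by unfold_locales

sublocale T3: tensor_algebra "tensor M M" "I \<times> I" T2.coT T2.\<mu>T M I c "\<lambda>p q r. c (bas p \<otimes> bas q) r"
  by unfold_locales

lemma mon2: "monoid (tensor M M)"
proof -
  interpret R: ring M by (rule ring_M)
  show ?thesis by (rule T2.tensor_monoid) (rule R.monoid_axioms)+
qed

text \<open>
  The three embeddings of \<open>M \<otimes> M\<close> into \<open>M \<otimes> M \<otimes> M\<close> are induced by bilinear maps that only place their arguments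
  in two legs: the coordinate \<open>(p, q, x)\<close> of the result is the product of the coordinates of the arguments
  at positions \<open>\<pi>\<close> and \<open>\<rho>\<close> and of a coordinate \<open>k\<close> of the unit.
\<close>

lemma leg_rep:
  assumes r: "T2.rep t S a b"
    and f: "\<And>u v. u \<in> carrier M \<Longrightarrow> v \<in> carrier M \<Longrightarrow> f u v \<in> carrier (tensor M M)"
    and g: "\<And>u v. u \<in> carrier M \<Longrightarrow> v \<in> carrier M \<Longrightarrow> g u v \<in> carrier M"
    and fg: "\<And>u v p q x. \<lbrakk>u \<in> carrier M; v \<in> carrier M; p \<in> I; q \<in> I; x \<in> I\<rbrakk> \<Longrightarrow>
      T2.coT (f u v) (p, q) * c (g u v) x = c u (\<pi> p q x) * c v (\<rho> p q x) * k p q x"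
    and pos: "\<And>p q x. \<lbrakk>p \<in> I; q \<in> I; x \<in> I\<rbrakk> \<Longrightarrow> \<pi> p q x \<in> I \<and> \<rho> p q x \<in> I"
  shows "T3.rep (tensor_lift (tensor (tensor M M) M) (\<lambda>u v. pure_tensor (tensor M M) M (f u v) (g u v)) t)
    S (\<lambda>s. f (a s) (b s)) (\<lambda>s. g (a s) (b s))"
    (is "T3.rep ?t _ _ _")
proof -
  let ?\<pi> = "\<lambda>z. \<pi> (fst (fst z)) (snd (fst z)) (snd z)" and ?\<rho> = "\<lambda>z. \<rho> (fst (fst z)) (snd (fst z)) (snd z)"
    and ?k = "\<lambda>z. k (fst (fst z)) (snd (fst z)) (snd z)"
  let ?\<gamma> = "\<lambda>p q z. ?k z * (if p = ?\<pi> z \<and> q = ?\<rho> z then 1 else 0)"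
  have delta: "(\<Sum>p\<in>I. \<Sum>q\<in>I. h p q * ?\<gamma> p q z) = h (?\<pi> z) (?\<rho> z) * ?k z" if "z \<in> (I \<times> I) \<times> I" for h z
    using sum_delta_both[OF finI finI, of "?\<pi> z" "?\<rho> z" "\<lambda>p q. h p q * ?k z"] pos that
    by (auto simp: mult.assoc)
  have 1: "pure_tensor (tensor M M) M (f u v) (g u v) \<in> carrier (tensor (tensor M M) M)"
    if "u \<in> carrier M" "v \<in> carrier M" for u v
    using that by (intro T3.pure_in f g)
  have 2: "T3.coT (pure_tensor (tensor M M) M (f u v) (g u v)) z = (\<Sum>p\<in>I. \<Sum>q\<in>I. c u p * c v q * ?\<gamma> p q z)"
    if "u \<in> carrier M" "v \<in> carrier M" "z \<in> (I \<times> I) \<times> I" for u v z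
    unfolding delta[OF that(3)] using that fg by (auto simp: T3.coT_pure f g)
  note L = T2.lift[OF T3.T.coordinates_axioms 1 2 T2.repD(1)[OF r]]
  have "T3.coT ?t (z, x) = (\<Sum>s\<in>S. T2.coT (f (a s) (b s)) z * c (g (a s) (b s)) x)"
    if z: "z \<in> I \<times> I" "x \<in> I" for z x
  proof -
    obtain p q where pq: "z = (p, q)" "p \<in> I" "q \<in> I" using z by auto
    have "T3.coT ?t (z, x) = T2.coT t (\<pi> p q x, \<rho> p q x) * k p q x"
      using L(2)[of "(z, x)"] delta[of "(z, x)" "\<lambda>p q. T2.coT t (p, q)"] z by (simp add: pq(1))
    also have "\<dots> = (\<Sum>s\<in>S. c (a s) (\<pi> p q x) * c (b s) (\<rho> p q x) * k p q x)"
      using pos pq z by (simp add: T2.repD(4)[OF r] sum_distrib_right)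
    also have "\<dots> = (\<Sum>s\<in>S. T2.coT (f (a s) (b s)) z * c (g (a s) (b s)) x)"
      unfolding pq(1) by (intro sum.cong refl fg[symmetric] T2.repD(2,3)[OF r] pq z)
    finally show ?thesis .
  qed
  then show ?thesis unfolding T3.rep_def using L(1) T2.repD(2,3)[OF r] by (auto intro: f g)
qed

lemma leg12_rep:
  assumes "T2.rep t S a b"
  shows "T3.rep (leg12 M t) S (\<lambda>s. pure_tensor M M (a s) (b s)) (\<lambda>_. \<one>)"
  unfolding leg12_def
  by (rule leg_rep[OF assms, where \<pi> = "\<lambda>p q x. p" and \<rho> = "\<lambda>p q x. q" and k = "\<lambda>p q x. c \<one> x"])
    (simp_all add: T2.pure_in T2.coT_pure MA.one_in)

lemma leg13_rep:
  assumes "T2.rep t S a b"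
  shows "T3.rep (leg13 M t) S (\<lambda>s. pure_tensor M M (a s) \<one>) b"
  unfolding leg13_def
  by (rule leg_rep[OF assms, where \<pi> = "\<lambda>p q x. p" and \<rho> = "\<lambda>p q x. x" and k = "\<lambda>p q x. c \<one> q"])
    (simp_all add: T2.pure_in T2.coT_pure MA.one_in)

lemma leg23_rep:
  assumes "T2.rep t S a b"
  shows "T3.rep (leg23 M t) S (\<lambda>s. pure_tensor M M \<one> (a s)) b"
  unfolding leg23_def
  by (rule leg_rep[OF assms, where \<pi> = "\<lambda>p q x. q" and \<rho> = "\<lambda>p q x. x" and k = "\<lambda>p q x. c \<one> p"])
    (simp_all add: T2.pure_in T2.coT_pure MA.one_in)

text \<open>
  Coordinates of both sides of \<open>R\<^sup>1\<^sup>2 R\<^sup>1\<^sup>3 R\<^sup>2\<^sup>3 = R\<^sup>2\<^sup>3 R\<^sup>1\<^sup>2\<close> for \<open>R = \<Sum> A\<^sub>i \<otimes> B\<^sub>i\<close>.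
\<close>

lemma pentagon_iff:
  assumes r: "T2.rep R S A B"
  shows "pentagon_equation M R \<longleftrightarrow> (\<forall>p\<in>I. \<forall>q\<in>I. \<forall>x\<in>I.
    (\<Sum>i\<in>S. \<Sum>j\<in>S. \<Sum>k\<in>S. c (A i \<otimes> A j) p * c (B i \<otimes> A k) q * c (B j \<otimes> B k) x) =
    (\<Sum>i\<in>S. \<Sum>j\<in>S. c (A j) p * c (A i \<otimes> B j) q * c (B i) x))"
    (is "_ \<longleftrightarrow> ?rhs")
proof -
  interpret R: ring M by (rule ring_M)
  note AB = T2.repD(2,3)[OF r]
  let ?L = "leg12 M R \<otimes>\<^bsub>tensor (tensor M M) M\<^esub> leg13 M R \<otimes>\<^bsub>tensor (tensor M M) M\<^esub> leg23 M R"
  let ?R = "leg23 M R \<otimes>\<^bsub>tensor (tensor M M) M\<^esub> leg12 M R"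
  note L = T3.rep_mult[OF T3.rep_mult[OF leg12_rep[OF r] leg13_rep[OF r]] leg23_rep[OF r]]
  note R = T3.rep_mult[OF leg23_rep[OF r] leg12_rep[OF r]]
  have cL: "T3.coT ?L ((p, q), x) = (\<Sum>i\<in>S. \<Sum>j\<in>S. \<Sum>k\<in>S. c (A i \<otimes> A j) p * c (B i \<otimes> A k) q * c (B j \<otimes> B k) x)"
    if "p \<in> I" "q \<in> I" "x \<in> I" for p q x
    using that AB T3.repD(4)[OF L, of "(p, q)" x]
    by (simp add: sum.cartesian_product' T2.pure_mult T2.coT_pure cong: sum.cong)
  have cR: "T3.coT ?R ((p, q), x) = (\<Sum>i\<in>S. \<Sum>j\<in>S. c (A j) p * c (A i \<otimes> B j) q * c (B i) x)"
    if "p \<in> I" "q \<in> I" "x \<in> I" for p q x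
    using that AB T3.repD(4)[OF R, of "(p, q)" x]
    by (simp add: sum.cartesian_product' T2.pure_mult T2.coT_pure cong: sum.cong)
  have "?L = ?R \<longleftrightarrow> (\<forall>p\<in>I. \<forall>q\<in>I. \<forall>x\<in>I. T3.coT ?L ((p, q), x) = T3.coT ?R ((p, q), x))"
    using T3.T.c_inj[OF T3.repD(1)[OF L] T3.repD(1)[OF R]] by auto
  then show ?thesis unfolding pentagon_equation_def by (simp add: cL cR cong: ball_cong)
qed

definition indep :: "nat \<Rightarrow> (nat \<Rightarrow> 'a) \<Rightarrow> bool" where
  "indep m v \<longleftrightarrow> (\<forall>d. (\<forall>i\<in>I. (\<Sum>k<m. d k * c (v k) i) = 0) \<longrightarrow> (\<forall>k<m. d k = 0))"

lemma indepD: "indep m v \<Longrightarrow> (\<And>i. i \<in> I \<Longrightarrow> (\<Sum>k<m. d k * c (v k) i) = 0) \<Longrightarrow> k < m \<Longrightarrow> d k = 0"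
  by (auto simp: indep_def)

lemma indep_eqD:
  assumes "indep m v" "\<And>i. i \<in> I \<Longrightarrow> (\<Sum>k<m. d k * c (v k) i) = (\<Sum>k<m. d' k * c (v k) i)" "k < m"
  shows "d k = d' k"
proof -
  have "d k - d' k = 0"
    by (rule indepD[OF assms(1) _ assms(3), of "\<lambda>k. d k - d' k"]) (use assms(2) in \<open>simp add: algebra_simps sum_subtractf\<close>)
  then show ?thesis by simp
qed

lemma indep_dual:
  assumes "indep m v"
  obtains \<psi> where "\<And>i l. i < m \<Longrightarrow> l < m \<Longrightarrow> (\<Sum>j\<in>I. \<psi> i j * c (v l) j) = (if i = l then 1 else 0)"
proof -
  have "\<exists>\<psi>. \<forall>i<m. \<forall>l<m. (\<Sum>j\<in>I. \<psi> i j * c (v l) j) = (if i = l then 1 else 0)"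
  proof (rule dual_functionals[OF finI])
    fix d assume "\<And>j. j \<in> I \<Longrightarrow> (\<Sum>i<m. d i * c (v i) j) = 0"
    then show "\<forall>i<m. d i = 0" using indepD[OF assms, of d] by blast
  qed
  then show ?thesis using that by blast
qed

lemma is_decomposition_iff:
  "is_decomposition M R m a b \<longleftrightarrow> T2.rep R {..<m} a b"
proof -
  have "R = (\<Oplus>\<^bsub>tensor M M\<^esub>i\<in>{..<m}. pure_tensor M M (a i) (b i)) \<longleftrightarrow> T2.rep R {..<m} a b"
    if "\<And>i. i < m \<Longrightarrow> a i \<in> carrier M" "\<And>i. i < m \<Longrightarrow> b i \<in> carrier M"
    using T2.rep_iff_finsum[of "{..<m}" a b R] that by simp
  then show ?thesis unfolding is_decomposition_def
    by (auto dest: T2.repD simp: Pi_def)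
qed

lemma decomposition_exists_iff:
  assumes "R \<in> carrier (tensor M M)"
  shows "(\<exists>a b. is_decomposition M R m a b) \<longleftrightarrow>
    (\<exists>u v :: nat \<Rightarrow> 'i \<Rightarrow> 'k. \<forall>p\<in>I. \<forall>q\<in>I. T2.coT R (p, q) = (\<Sum>k<m. u k p * v k q))"
proof
  assume "\<exists>a b. is_decomposition M R m a b"
  then obtain a b where r: "T2.rep R {..<m} a b" by (auto simp: is_decomposition_iff)
  show "\<exists>u v :: nat \<Rightarrow> 'i \<Rightarrow> 'k. \<forall>p\<in>I. \<forall>q\<in>I. T2.coT R (p, q) = (\<Sum>k<m. u k p * v k q)"
    by (rule exI[of _ "\<lambda>k. c (a k)"], rule exI[of _ "\<lambda>k. c (b k)"]) (use T2.repD(4)[OF r] in auto)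
next
  assume "\<exists>u v :: nat \<Rightarrow> 'i \<Rightarrow> 'k. \<forall>p\<in>I. \<forall>q\<in>I. T2.coT R (p, q) = (\<Sum>k<m. u k p * v k q)"
  then obtain u v :: "nat \<Rightarrow> 'i \<Rightarrow> 'k" where "\<forall>p\<in>I. \<forall>q\<in>I. T2.coT R (p, q) = (\<Sum>k<m. u k p * v k q)" by blast
  then have "T2.rep R {..<m} (\<lambda>k. vec (u k)) (\<lambda>k. vec (v k))"
    using assms by (simp add: T2.rep_def vec_in c_vec)
  then show "\<exists>a b. is_decomposition M R m a b" unfolding is_decomposition_iff by blast
qed

lemma minimal_decomposition_exists:
  assumes R: "R \<in> carrier (tensor M M)"
  shows "\<exists>a b. is_decomposition M R (tensor_length M R) a b"
proof -
  obtain h where h: "bij_betw h {..<card (I \<times> I)} (I \<times> I)"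
    using ex_bij_betw_nat_finite[of "I \<times> I"] finI by (auto simp: atLeast0LessThan)
  let ?a = "\<lambda>s. T2.coT R s \<odot> bas (fst s)" and ?b = "\<lambda>s. bas (snd s)"
  note r = T2.rep_exists[OF R]
  have "T2.rep R {..<card (I \<times> I)} (?a \<circ> h) (?b \<circ> h)"
    unfolding T2.rep_def
  proof (intro conjI ballI)
    fix p q assume "p \<in> I" "q \<in> I"
    then have "T2.coT R (p, q) = (\<Sum>s\<in>I \<times> I. c (?a s) p * c (?b s) q)" by (rule T2.repD(4)[OF r])
    also have "\<dots> = (\<Sum>s<card (I \<times> I). c (?a (h s)) p * c (?b (h s)) q)"
      by (rule sum.reindex_bij_betw[OF h, symmetric])
    finally show "T2.coT R (p, q) = (\<Sum>s<card (I \<times> I). c ((?a \<circ> h) s) p * c ((?b \<circ> h) s) q)" by simp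
  qed (auto simp: R smult_in bas_in)
  then have "\<exists>m a b. is_decomposition M R m a b" unfolding is_decomposition_iff by blast
  then show ?thesis unfolding tensor_length_def by (rule LeastI_ex)
qed

text \<open>
  A dependence in either leg would allow a shorter decomposition.
\<close>

lemma minimal_decomposition_indep:
  assumes r: "T2.rep R {..<tensor_length M R} a b"
  shows "indep (tensor_length M R) a" "indep (tensor_length M R) b"
proof -
  let ?m = "tensor_length M R"
  have R: "R \<in> carrier (tensor M M)" by (rule T2.repD(1)[OF r])
  have min: "\<not> (\<exists>u v :: nat \<Rightarrow> 'i \<Rightarrow> 'k. \<forall>p\<in>I. \<forall>q\<in>I. T2.coT R (p, q) = (\<Sum>k<?m-1. u k p * v k q))" if "0 < ?m"
  proof
    assume "\<exists>u v :: nat \<Rightarrow> 'i \<Rightarrow> 'k. \<forall>p\<in>I. \<forall>q\<in>I. T2.coT R (p, q) = (\<Sum>k<?m-1. u k p * v k q)"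
    then have "\<exists>a b. is_decomposition M R (?m-1) a b" using decomposition_exists_iff[OF R] by blast
    then have "?m \<le> ?m - 1" unfolding tensor_length_def by (rule Least_le)
    with that show False by simp
  qed
  note eq = T2.repD(4)[OF r]
  show "indep ?m a" unfolding indep_def
  proof (intro allI impI, rule ccontr)
    fix d l assume d: "\<forall>i\<in>I. (\<Sum>k<?m. d k * c (a k) i) = 0" and l: "l < ?m" "d l \<noteq> 0"
    have "\<exists>u' v'. \<forall>p\<in>I. \<forall>q\<in>I. T2.coT R (p, q) = (\<Sum>k<?m-1. u' k p * v' k q)"
      by (rule shorten_rank[where u = "\<lambda>k. c (a k)" and v = "\<lambda>k. c (b k)" and d = d and l = l])
        (use d eq l in simp_all)
    with min l show False by auto
  qed
  show "indep ?m b" unfolding indep_def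
  proof (intro allI impI, rule ccontr)
    fix d l assume d: "\<forall>i\<in>I. (\<Sum>k<?m. d k * c (b k) i) = 0" and l: "l < ?m" "d l \<noteq> 0"
    have "\<exists>u' v'. \<forall>q\<in>I. \<forall>p\<in>I. T2.coT R (p, q) = (\<Sum>k<?m-1. u' k q * v' k p)"
      by (rule shorten_rank[where u = "\<lambda>k. c (b k)" and v = "\<lambda>k. c (a k)" and d = d and l = l])
        (use d eq l in \<open>simp_all add: mult.commute\<close>)
    then obtain u' v' :: "nat \<Rightarrow> 'i \<Rightarrow> 'k" where "\<forall>q\<in>I. \<forall>p\<in>I. T2.coT R (p, q) = (\<Sum>k<?m-1. u' k q * v' k p)" by blast
    then have "\<forall>p\<in>I. \<forall>q\<in>I. T2.coT R (p, q) = (\<Sum>k<?m-1. v' k p * u' k q)" by (simp add: ac_simps)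
    with min l show False by auto
  qed
qed

text \<open>
  Contracting the second leg with the functionals dual to the \<open>B' p\<close> isolates \<open>A' p\<close>.
\<close>

lemma first_leg_in_span:
  assumes r: "T2.rep R {..<m} A B" and r': "T2.rep R {..<m'} A' B'" and "indep m' B'"
  obtains w where "\<And>p i. p < m' \<Longrightarrow> i \<in> I \<Longrightarrow> c (A' p) i = (\<Sum>k<m. w p k * c (A k) i)"
proof -
  obtain \<psi> where \<psi>: "\<And>i l. i < m' \<Longrightarrow> l < m' \<Longrightarrow> (\<Sum>j\<in>I. \<psi> i j * c (B' l) j) = (if i = l then 1 else 0)"
    using indep_dual[OF assms(3)] by blast
  have "c (A' p) i = (\<Sum>k<m. (\<Sum>j\<in>I. \<psi> p j * c (B k) j) * c (A k) i)" if p: "p < m'" and i: "i \<in> I" for p i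
  proof -
    have "(\<Sum>j\<in>I. \<psi> p j * T2.coT R (i, j)) = (\<Sum>j\<in>I. \<Sum>l<m'. c (A' l) i * (\<psi> p j * c (B' l) j))"
      using i by (simp add: T2.repD(4)[OF r'] sum_distrib_left ac_simps cong: sum.cong)
    also have "\<dots> = (\<Sum>l<m'. c (A' l) i * (\<Sum>j\<in>I. \<psi> p j * c (B' l) j))"
      by (subst sum.swap) (simp add: sum_distrib_left)
    also have "\<dots> = (\<Sum>l<m'. if l = p then c (A' l) i else 0)"
      using p by (intro sum.cong refl) (auto simp: \<psi>)
    finally have 1: "(\<Sum>j\<in>I. \<psi> p j * T2.coT R (i, j)) = c (A' p) i" using p by simp
    have "(\<Sum>j\<in>I. \<psi> p j * T2.coT R (i, j)) = (\<Sum>j\<in>I. \<Sum>k<m. \<psi> p j * c (B k) j * c (A k) i)"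
      using i by (simp add: T2.repD(4)[OF r] sum_distrib_left ac_simps cong: sum.cong)
    also have "\<dots> = (\<Sum>k<m. (\<Sum>j\<in>I. \<psi> p j * c (B k) j) * c (A k) i)"
      by (subst sum.swap) (simp add: sum_distrib_right)
    finally show ?thesis using 1 by simp
  qed
  then show ?thesis by (rule that)
qed

end

text \<open>
  The Hopf algebra of a solution and the span of the \<open>A\<^sub>i\<close> inside the matrix algebra are different
  records with the same operations; tensor products depend on the operations only.
\<close>

lemma tensor_cong:
  assumes "carrier A = carrier A'" "mult A = mult A'" "one A = one A'" "add A = add A'" "Module.smult A = Module.smult A'"
    and "carrier B = carrier B'" "mult B = mult B'" "one B = one B'" "add B = add B'" "Module.smult B = Module.smult B'"
  shows "tensor A B = tensor A' B'" "pure_tensor A B = pure_tensor A' B'"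
proof -
  have F: "formal_tensors A B = formal_tensors A' B'" using assms by (simp add: formal_tensors_def)
  have I: "tensor_ideal A B = tensor_ideal A' B'"
    unfolding tensor_ideal_def F using assms by (simp add: bilinear_relations_def)
  show "tensor A B = tensor A' B'" "pure_tensor A B = pure_tensor A' B'"
    by (simp_all add: tensor_def pure_tensor_def F I fun_eq_iff)
qed

context falg
begin

lemma mem_span_iff:
  fixes m :: nat
  assumes v: "\<And>k. k < m \<Longrightarrow> v k \<in> carrier M"
  shows "x \<in> vspan M (v ` {..<m}) \<longleftrightarrow> x \<in> carrier M \<and> (\<exists>d. \<forall>i\<in>I. c x i = (\<Sum>k<m. d k * c (v k) i))"
proof -
  have S: "vspan M (v ` {..<m}) = {\<Oplus>k\<in>{..<m}. d k \<odot> v k | d. True}"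
    by (rule span_family) (use v in auto)
  have cl: "c (\<Oplus>k\<in>{..<m}. d k \<odot> v k) i = (\<Sum>k<m. d k * c (v k) i)" for d i
    by (rule c_lincomb) (use v in auto)
  have li: "(\<Oplus>k\<in>{..<m}. d k \<odot> v k) \<in> carrier M" for d
    by (rule lincomb_in) (use v in auto)
  show ?thesis
  proof
    assume "x \<in> vspan M (v ` {..<m})"
    then obtain d where "x = (\<Oplus>k\<in>{..<m}. d k \<odot> v k)" using S by auto
    then show "x \<in> carrier M \<and> (\<exists>d. \<forall>i\<in>I. c x i = (\<Sum>k<m. d k * c (v k) i))"
      using cl li by auto
  next
    assume "x \<in> carrier M \<and> (\<exists>d. \<forall>i\<in>I. c x i = (\<Sum>k<m. d k * c (v k) i))"
    then obtain d where x: "x \<in> carrier M" and d: "\<forall>i\<in>I. c x i = (\<Sum>k<m. d k * c (v k) i)" by blast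
    have "x = (\<Oplus>k\<in>{..<m}. d k \<odot> v k)"
      by (rule c_inj[OF x li]) (simp add: cl d)
    then show "x \<in> vspan M (v ` {..<m})" using S by auto
  qed
qed

lemma dual_basis_eq:
  assumes ind: "indep m v" and v: "\<And>k. k < m \<Longrightarrow> v k \<in> carrier M" and x: "x \<in> carrier M"
    and d: "\<And>i. i \<in> I \<Longrightarrow> c x i = (\<Sum>k<m. d k * c (v k) i)" and p: "p < m"
  shows "dual_basis M m v p x = d p"
proof -
  have cl: "c (\<Oplus>k\<in>{..<m}. d k \<odot> v k) i = (\<Sum>k<m. d k * c (v k) i)" for d i
    by (rule c_lincomb) (use v in auto)
  have li: "(\<Oplus>k\<in>{..<m}. d k \<odot> v k) \<in> carrier M" for d
    by (rule lincomb_in) (use v in auto)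
  let ?d = "\<lambda>k. if k < m then d k else 0"
  have "(THE d. (\<forall>i\<ge>m. d i = 0) \<and> x = (\<Oplus>i\<in>{..<m}. d i \<odot> v i)) = ?d"
  proof (rule the_equality)
    show "(\<forall>i\<ge>m. ?d i = 0) \<and> x = (\<Oplus>i\<in>{..<m}. ?d i \<odot> v i)"
      by (auto intro!: c_inj[OF x li] simp: cl d)
    fix g assume g: "(\<forall>i\<ge>m. g i = 0) \<and> x = (\<Oplus>i\<in>{..<m}. g i \<odot> v i)"
    have "g k = d k" if "k < m" for k
      by (rule indep_eqD[OF ind _ that]) (use g d cl in metis)
    then show "g = ?d" using g by (auto simp: fun_eq_iff)
  qed
  then show ?thesis using p by (simp add: dual_basis_def)
qed

text \<open>
  Coordinates on a subspace \<open>V\<close> with respect to a family \<open>v\<close>. It covers the whole space as well as the span of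
  an independent family, the two kinds of subspaces to which tensors are restricted.
\<close>

definition subco :: "'a set \<Rightarrow> 'p set \<Rightarrow> ('a \<Rightarrow> 'p \<Rightarrow> 'k) \<Rightarrow> ('p \<Rightarrow> 'a) \<Rightarrow> bool" where
  "subco V P cV v \<longleftrightarrow> coordinates (M\<lparr>carrier := V\<rparr>) P cV \<and> V \<subseteq> carrier M \<and>
    (\<forall>k\<in>P. v k \<in> carrier M) \<and>
    (\<forall>x\<in>V. \<forall>i\<in>I. c x i = (\<Sum>k\<in>P. cV x k * c (v k) i)) \<and>
    (\<forall>d. (\<forall>i\<in>I. (\<Sum>k\<in>P. d k * c (v k) i) = 0) \<longrightarrow> (\<forall>k\<in>P. d k = 0))"

lemma subco_carrier: "subco (carrier M) I c bas"
proof -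
  have "coordinates (M\<lparr>carrier := carrier M\<rparr>) I c" using coordinates_axioms by simp
  then show ?thesis
    using finI by (auto simp: subco_def bas_in c_bas delta_mult cong: sum.cong)
qed

lemma subco_span:
  fixes m :: nat
  assumes ind: "indep m v" and v: "\<And>k. k < m \<Longrightarrow> v k \<in> carrier M"
  obtains cV where "subco (vspan M (v ` {..<m})) {..<m} cV v"
    "\<And>k l. k < m \<Longrightarrow> cV (v k) l = (if l = k then 1 else 0)"
    "\<And>x d k. x \<in> carrier M \<Longrightarrow> (\<And>i. i \<in> I \<Longrightarrow> c x i = (\<Sum>k<m. d k * c (v k) i)) \<Longrightarrow> k < m \<Longrightarrow> cV x k = d k"
proof -
  have ind': "\<forall>k\<in>{..<m}. d k = 0" if "\<And>i. i \<in> I \<Longrightarrow> (\<Sum>k\<in>{..<m}. d k * c (v k) i) = 0" for d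
    using indepD[OF ind that] by blast
  have vin: "v k \<in> carrier M" if "k \<in> {..<m}" for k using v that by simp
  from coordinates_on_span[where K = "{..<m}" and v = v, OF finite_lessThan vin ind'] obtain cK where
    1: "coordinates (M\<lparr>carrier := vspan M (v ` {..<m})\<rparr>) {..<m} cK"
    and 2: "\<And>d k. k \<in> {..<m} \<Longrightarrow> cK (\<Oplus>k\<in>{..<m}. d k \<odot> v k) k = d k"
    and 3: "\<And>k l. k \<in> {..<m} \<Longrightarrow> cK (v k) l = (if l = k then 1 else 0)"
    and 4: "\<And>x i. x \<in> vspan M (v ` {..<m}) \<Longrightarrow> c x i = (\<Sum>k\<in>{..<m}. cK x k * c (v k) i)" by blast
  have "vspan M (v ` {..<m}) \<subseteq> carrier M" using mem_span_iff[of m v] v by blast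
  then have "subco (vspan M (v ` {..<m})) {..<m} cK v"
    unfolding subco_def using 1 4 v ind' by auto
  moreover have "cK x k = d k" if x: "x \<in> carrier M" and d: "\<And>i. i \<in> I \<Longrightarrow> c x i = (\<Sum>k<m. d k * c (v k) i)" and k: "k < m" for x d k
  proof -
    have "c (\<Oplus>k\<in>{..<m}. d k \<odot> v k) i = (\<Sum>k<m. d k * c (v k) i)" for i
      by (rule c_lincomb) (rule vin)
    then have "x = (\<Oplus>k\<in>{..<m}. d k \<odot> v k)"
      by (intro c_inj[OF x lincomb_in] vin) (simp_all add: d)
    then show ?thesis using 2 k by simp
  qed
  ultimately show ?thesis using 3 by (intro that) auto
qed

text \<open>
  Independence of the families \<open>v\<close> and \<open>w\<close> makes the canonical map from the tensor product of the
  subspaces injective, so that the coordinates determine the restriction.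
\<close>

lemma tensor_restrict_eq:
  assumes V: "subco V P cV v" and W: "subco W Q cW w"
    and s: "s \<in> carrier (tensor (M\<lparr>carrier := V\<rparr>) (M\<lparr>carrier := W\<rparr>))"
    and t: "t \<in> carrier (tensor M M)"
    and eq: "\<And>i j. i \<in> I \<Longrightarrow> j \<in> I \<Longrightarrow> T2.coT t (i, j) =
      (\<Sum>p\<in>P. \<Sum>q\<in>Q. tensor_coordinates.coT cV cW s (p, q) * (c (v p) i * c (w q) j))"
  shows "tensor_restrict M V M W t = s"
proof -
  interpret V: coordinates "M\<lparr>carrier := V\<rparr>" P cV using V by (simp add: subco_def)
  interpret W: coordinates "M\<lparr>carrier := W\<rparr>" Q cW using W by (simp add: subco_def)
  interpret VW: tensor_coordinates "M\<lparr>carrier := V\<rparr>" P cV "M\<lparr>carrier := W\<rparr>" Q cW by unfold_locales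
  have VM: "V \<subseteq> carrier M" and WM: "W \<subseteq> carrier M" using V W by (auto simp: subco_def)
  have indV: "\<forall>k\<in>P. d k = 0" if "\<forall>i\<in>I. (\<Sum>k\<in>P. d k * c (v k) i) = 0" for d
    using V that unfolding subco_def by blast
  have indW: "\<forall>k\<in>Q. d k = 0" if "\<forall>i\<in>I. (\<Sum>k\<in>Q. d k * c (w k) i) = 0" for d
    using W that unfolding subco_def by blast
  define \<gamma> where "\<gamma> p q z = c (v p) (fst z) * c (w q) (snd z)" for p q z
  let ?m = "tensor_map M M (\<lambda>a. a) (\<lambda>b. b)"
  have beta: "T2.coT (pure_tensor M M a b) z = (\<Sum>p\<in>P. \<Sum>q\<in>Q. cV a p * cW b q * \<gamma> p q z)"
    if "a \<in> V" "b \<in> W" "z \<in> I \<times> I" for a b z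
  proof -
    have "c a (fst z) = (\<Sum>p\<in>P. cV a p * c (v p) (fst z))" "c b (snd z) = (\<Sum>q\<in>Q. cW b q * c (w q) (snd z))"
      using V W that by (auto simp: subco_def)
    moreover have "T2.coT (pure_tensor M M a b) z = c a (fst z) * c b (snd z)"
      using that VM WM by (intro T2.coT_pure) auto
    ultimately show ?thesis by (simp add: sum_product \<gamma>_def ac_simps)
  qed
  have m_in: "?m u \<in> carrier (tensor M M)" if "u \<in> carrier (tensor (M\<lparr>carrier := V\<rparr>) (M\<lparr>carrier := W\<rparr>))" for u
    unfolding tensor_map_def
    by (rule VW.lift(1)[OF T2.T.coordinates_axioms _ _ that]) (use beta VM WM in \<open>auto intro: T2.pure_in\<close>)
  have m: "T2.coT (?m u) z = (\<Sum>p\<in>P. \<Sum>q\<in>Q. VW.coT u (p, q) * \<gamma> p q z)"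
    if "u \<in> carrier (tensor (M\<lparr>carrier := V\<rparr>) (M\<lparr>carrier := W\<rparr>))" "z \<in> I \<times> I" for u z
    unfolding tensor_map_def
    by (rule VW.lift(2)[OF T2.T.coordinates_axioms _ _ that(1) that(2)]) (use beta VM WM in \<open>auto intro: T2.pure_in\<close>)
  show ?thesis unfolding tensor_restrict_def
  proof (rule the_equality)
    show "s \<in> carrier (tensor (M\<lparr>carrier := V\<rparr>) (M\<lparr>carrier := W\<rparr>)) \<and> ?m s = t"
    proof (intro conjI s T2.T.c_inj m_in t)
      fix z assume "z \<in> I \<times> I"
      then show "T2.coT (?m s) z = T2.coT t z"
        using m[OF s, of z] eq[of "fst z" "snd z"] by (auto simp: \<gamma>_def)
    qed
    fix u assume u: "u \<in> carrier (tensor (M\<lparr>carrier := V\<rparr>) (M\<lparr>carrier := W\<rparr>)) \<and> ?m u = t"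
    have "VW.coT u (p, q) = VW.coT s (p, q)" if pq: "p \<in> P" "q \<in> Q" for p q
    proof -
      define D where "D p q = VW.coT u (p, q) - VW.coT s (p, q)" for p q
      have 0: "(\<Sum>p\<in>P. (\<Sum>q\<in>Q. D p q * c (w q) j) * c (v p) i) = 0" if "i \<in> I" "j \<in> I" for i j
      proof -
        have "(\<Sum>p\<in>P. \<Sum>q\<in>Q. VW.coT u (p, q) * \<gamma> p q (i, j)) = (\<Sum>p\<in>P. \<Sum>q\<in>Q. VW.coT s (p, q) * \<gamma> p q (i, j))"
          using m[of u "(i, j)"] u eq[OF that] that by (simp add: \<gamma>_def)
        then show ?thesis
          by (simp add: D_def \<gamma>_def sum_distrib_left sum_distrib_right algebra_simps sum_subtractf)
      qed
      have 1: "(\<Sum>q\<in>Q. D p q * c (w q) j) = 0" if "j \<in> I" for j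
        using indV[of "\<lambda>p. \<Sum>q\<in>Q. D p q * c (w q) j"] 0[OF _ that] pq by blast
      have "D p q = 0" using indW[of "D p"] 1 pq by blast
      then show ?thesis by (simp add: D_def)
    qed
    then show "u = s" using u s by (intro VW.T.c_inj) auto
  qed
qed

end

section \<open>Structure constants of a Hopf algebra\<close>

text \<open>
  The indices are natural numbers because the theory of structure constants above uses matrices
  indexed by natural numbers.
\<close>

locale hopf_coordinates = hopf_algebra L + coordinates L I c
  for L :: "('k :: field, 'a) hopf" (structure) and I :: "nat set" and c
begin

abbreviation "str p q r \<equiv> c (bas p \<otimes> bas q) r"

sublocale LA: algebra_coordinates L I c "\<lambda>p q r. c (bas p \<otimes> bas q) r"
  by (rule assoc_algebra_coordinates) unfold_locales

sublocale L2: tensor_algebra L I c "\<lambda>p q r. c (bas p \<otimes> bas q) r" L I c "\<lambda>p q r. c (bas p \<otimes> bas q) r"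
  by unfold_locales

sublocale L3: tensor_algebra "tensor L L" "I \<times> I" L2.coT L2.\<mu>T L I c "\<lambda>p q r. c (bas p \<otimes> bas q) r"
  by unfold_locales

lemma comult_in: "x \<in> carrier L \<Longrightarrow> comult L x \<in> carrier (tensor L L)"
  by (rule algebra_homD(1)[OF comult_hom])

definition dco :: "nat \<Rightarrow> nat \<Rightarrow> nat \<Rightarrow> 'k" where
  "dco p i j = L2.coT (comult L (bas p)) (i, j)"

lemma comult_coords:
  assumes "x \<in> carrier L" "i \<in> I" "j \<in> I"
  shows "L2.coT (comult L x) (i, j) = (\<Sum>p\<in>I. c x p * dco p i j)"
  unfolding dco_def
  by (rule linear_functional_expand[of "\<lambda>x. L2.coT (comult L x) (i, j)", OF _ _ assms(1)])
    (simp_all add: algebra_homD[OF comult_hom] L2.T.c_add L2.T.c_smult)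

lemma counit_coords:
  assumes "x \<in> carrier L"
  shows "counit L x = (\<Sum>p\<in>I. c x p * counit L (bas p))"
  by (rule linear_functional_expand[OF _ _ assms])
    (simp_all add: algebra_homD[OF counit_hom] field_algebra_def)

lemma antipode_in: "x \<in> carrier L \<Longrightarrow> antipode L x \<in> carrier L"
  by (rule linear_homD(1)[OF antipode_linear])

lemma antipode_coords:
  assumes "x \<in> carrier L"
  shows "c (antipode L x) q = (\<Sum>p\<in>I. c x p * c (antipode L (bas p)) q)"
  by (rule linear_functional_expand[of "\<lambda>x. c (antipode L x) q", OF _ _ assms])
    (simp_all add: linear_homD[OF antipode_linear] c_add c_smult)

lemma coassoc_coords:
  assumes p: "p \<in> I" and ijk: "i \<in> I" "j \<in> I" "k \<in> I"
  shows "(\<Sum>a\<in>I. dco p a k * dco a i j) = (\<Sum>a\<in>I. dco p i a * dco a j k)"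
proof -
  interpret R: ring L by (rule ring)
  note sum1 = sum_delta_right[OF finI] and sum2 = sum_delta_left[OF finI]
  let ?x = "comult L (bas p)"
  \<comment> \<open>The coefficient arrays of the bilinear maps that occur in the coassociativity axiom, in the order
    in which the axiom applies them.\<close>
  define \<gamma>1 where "\<gamma>1 a b z = (if b = snd z then dco a (fst (fst z)) (snd (fst z)) else 0)" for a b and z :: "(nat \<times> nat) \<times> nat"
  have 1: "L3.coT (pure_tensor (tensor L L) L (comult L a) b) z = (\<Sum>a'\<in>I. \<Sum>b'\<in>I. c a a' * c b b' * \<gamma>1 a' b' z)"
    if "a \<in> carrier L" "b \<in> carrier L" "z \<in> (I \<times> I) \<times> I" for a b z
  proof -
    have "(\<Sum>a'\<in>I. \<Sum>b'\<in>I. c a a' * c b b' * \<gamma>1 a' b' z) = (\<Sum>a'\<in>I. c a a' * c b (snd z) * dco a' (fst (fst z)) (snd (fst z)))"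
      unfolding \<gamma>1_def by (rule sum1) (use that in auto)
    then show ?thesis using that by (auto simp: L3.coT_pure comult_in comult_coords sum_distrib_left ac_simps)
  qed
  have l: "L3.coT (tensor_lift (tensor (tensor L L) L) (\<lambda>a b. pure_tensor (tensor L L) L (comult L a) b) ?x) ((i, j), k)
      = (\<Sum>a\<in>I. dco p a k * dco a i j)"
  proof -
    have "L3.coT (tensor_lift (tensor (tensor L L) L) (\<lambda>a b. pure_tensor (tensor L L) L (comult L a) b) ?x) ((i, j), k)
      = (\<Sum>a\<in>I. \<Sum>b\<in>I. L2.coT ?x (a, b) * \<gamma>1 a b ((i, j), k))"
      by (rule L2.lift(2)[OF L3.T.coordinates_axioms]) (use 1 ijk p in \<open>auto intro: L3.pure_in comult_in bas_in\<close>)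
    then show ?thesis using ijk by (simp add: \<gamma>1_def sum1 dco_def)
  qed
  define \<gamma>2 where "\<gamma>2 a u v z = (if u = snd (fst z) \<and> v = snd z then c a (fst (fst z)) else 0)" for a u v and z :: "(nat \<times> nat) \<times> nat"
  have g2: "(\<Sum>u\<in>I. \<Sum>v\<in>I. h u v * \<gamma>2 a u v ((i, j), k)) = h j k * c a i" if "j \<in> I" "k \<in> I" for h a i j k
  proof -
    have "(\<Sum>u\<in>I. \<Sum>v\<in>I. h u v * \<gamma>2 a u v ((i, j), k)) = (\<Sum>u\<in>I. \<Sum>v\<in>I. h u v * (if v = k then if u = j then c a i else 0 else 0))"
      by (intro sum.cong refl) (auto simp: \<gamma>2_def)
    also have "\<dots> = (\<Sum>u\<in>I. h u k * (if u = j then c a i else 0))" by (rule sum1[OF that(2)])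
    also have "\<dots> = (\<Sum>u\<in>I. if u = j then h u k * c a i else 0)" by (rule sum.cong) auto
    finally show ?thesis using that finI by simp
  qed
  have 2: "L3.coT (pure_tensor (tensor L L) L (pure_tensor L L a u) v) z = (\<Sum>u'\<in>I. \<Sum>v'\<in>I. c u u' * c v v' * \<gamma>2 a u' v' z)"
    if "a \<in> carrier L" "u \<in> carrier L" "v \<in> carrier L" "z \<in> (I \<times> I) \<times> I" for a u v z
    using that by (auto simp: L3.coT_pure L2.coT_pure L2.pure_in g2)
  let ?\<beta> = "\<lambda>a b. tensor_lift (tensor (tensor L L) L) (\<lambda>u v. pure_tensor (tensor L L) L (pure_tensor L L a u) v) (comult L b)"
  have \<beta>_in: "?\<beta> a b \<in> carrier (tensor (tensor L L) L)" if "a \<in> carrier L" "b \<in> carrier L" for a b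
    by (rule L2.lift(1)[OF L3.T.coordinates_axioms _ 2]) (use that in \<open>auto intro: L3.pure_in L2.pure_in comult_in\<close>)
  have \<beta>: "L3.coT (?\<beta> a b) z = L2.coT (comult L b) (snd (fst z), snd z) * c a (fst (fst z))"
    if "a \<in> carrier L" "b \<in> carrier L" "z \<in> (I \<times> I) \<times> I" for a b z
  proof -
    have "L3.coT (?\<beta> a b) z = (\<Sum>u\<in>I. \<Sum>v\<in>I. L2.coT (comult L b) (u, v) * \<gamma>2 a u v z)"
      by (rule L2.lift(2)[OF L3.T.coordinates_axioms _ 2]) (use that in \<open>auto intro: L3.pure_in L2.pure_in comult_in\<close>)
    then show ?thesis using that g2 by auto
  qed
  define \<gamma>3 where "\<gamma>3 a b z = (if a = fst (fst z) then dco b (snd (fst z)) (snd z) else 0)" for a b and z :: "(nat \<times> nat) \<times> nat"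
  have 3: "L3.coT (?\<beta> a b) z = (\<Sum>a'\<in>I. \<Sum>b'\<in>I. c a a' * c b b' * \<gamma>3 a' b' z)"
    if "a \<in> carrier L" "b \<in> carrier L" "z \<in> (I \<times> I) \<times> I" for a b z
  proof -
    have "(\<Sum>a'\<in>I. \<Sum>b'\<in>I. c a a' * c b b' * \<gamma>3 a' b' z) = (\<Sum>b'\<in>I. c a (fst (fst z)) * c b b' * dco b' (snd (fst z)) (snd z))"
      unfolding \<gamma>3_def by (rule sum2) (use that in auto)
    then show ?thesis using that by (auto simp: \<beta> comult_coords sum_distrib_left ac_simps)
  qed
  have r: "L3.coT (tensor_lift (tensor (tensor L L) L) ?\<beta> ?x) ((i, j), k) = (\<Sum>a\<in>I. dco p i a * dco a j k)"
  proof -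
    have "L3.coT (tensor_lift (tensor (tensor L L) L) ?\<beta> ?x) ((i, j), k)
      = (\<Sum>a\<in>I. \<Sum>b\<in>I. L2.coT ?x (a, b) * \<gamma>3 a b ((i, j), k))"
      by (rule L2.lift(2)[OF L3.T.coordinates_axioms]) (use 3 \<beta>_in ijk p in \<open>auto intro: comult_in bas_in\<close>)
    then show ?thesis using ijk by (simp add: \<gamma>3_def sum2 dco_def)
  qed
  show ?thesis using l r coassoc[OF bas_in[of p]] by simp
qed

text \<open>
  Each axiom of a Hopf algebra is evaluated on basis vectors and compared in coordinates.
\<close>

lemma hopf_constants:
  "hopf_sc I str dco (c \<one>) (\<lambda>p. counit L (bas p)) (\<lambda>p. c (antipode L (bas p)))"
proof (intro hopf_sc.intro hopf_sc_axioms.intro coalg.intro)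
  interpret R: ring L by (rule ring)
  note d1 = sum_delta_right[OF finI] and d2 = sum_delta_left[OF finI]
  show "finite I" "finite I" by (rule finI)+
  show "\<And>p i j k. p \<in> I \<Longrightarrow> i \<in> I \<Longrightarrow> j \<in> I \<Longrightarrow> k \<in> I \<Longrightarrow>
    (\<Sum>a\<in>I. dco p a k * dco a i j) = (\<Sum>a\<in>I. dco p i a * dco a j k)" by (rule coassoc_coords)
  fix p j assume pj: "p \<in> I" "j \<in> I"
  note xin = bas_in[of p]
  show "(\<Sum>i\<in>I. dco p i j * counit L (bas i)) = (if p = j then 1 else 0)"
  proof -
    have 1: "c (counit L a \<odot> b) x = (\<Sum>p\<in>I. \<Sum>q\<in>I. c a p * c b q * (if q = x then counit L (bas p) else 0))"
      if "a \<in> carrier L" "b \<in> carrier L" "x \<in> I" for a b x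
      using that counit_coords[of a] by (subst d1) (auto simp: c_smult sum_distrib_left sum_distrib_right ac_simps)
    have "c (tensor_lift L (\<lambda>a b. counit L a \<odot> b) (comult L (bas p))) j
      = (\<Sum>a\<in>I. \<Sum>b\<in>I. L2.coT (comult L (bas p)) (a, b) * (if b = j then counit L (bas a) else 0))"
      by (rule L2.lift(2)[OF coordinates_axioms _ 1 comult_in[OF xin] pj(2)]) (simp add: smult_in)
    then show ?thesis using counit_left[OF xin] pj by (auto simp: d1 dco_def c_bas)
  qed
  show "(\<Sum>i\<in>I. dco p j i * counit L (bas i)) = (if p = j then 1 else 0)"
  proof -
    have 1: "c (counit L b \<odot> a) x = (\<Sum>p\<in>I. \<Sum>q\<in>I. c a p * c b q * (if p = x then counit L (bas q) else 0))"
      if "a \<in> carrier L" "b \<in> carrier L" "x \<in> I" for a b x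
      using that counit_coords[of b] by (subst d2) (auto simp: c_smult sum_distrib_left sum_distrib_right ac_simps)
    have "c (tensor_lift L (\<lambda>a b. counit L b \<odot> a) (comult L (bas p))) j
      = (\<Sum>a\<in>I. \<Sum>b\<in>I. L2.coT (comult L (bas p)) (a, b) * (if a = j then counit L (bas b) else 0))"
      by (rule L2.lift(2)[OF coordinates_axioms _ 1 comult_in[OF xin] pj(2)]) (simp add: smult_in)
    then show ?thesis using counit_right[OF xin] pj by (auto simp: d2 dco_def c_bas)
  qed
next
  interpret R: ring L by (rule ring)
  fix p i j k assume *: "p \<in> I" "i \<in> I" "j \<in> I" "k \<in> I"
  have 1: "c (bas i \<otimes> bas j \<otimes> bas k) p = (\<Sum>a\<in>I. str a k p * str i j a)"
  proof -
    have "c (bas i \<otimes> bas j \<otimes> bas k) p = (\<Sum>a\<in>I. \<Sum>b\<in>I. str i j a * (if b = k then 1 else 0) * str a b p)"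
      using * by (subst LA.c_mult) (simp_all add: LA.mult_in bas_in c_bas)
    also have "\<dots> = (\<Sum>a\<in>I. \<Sum>b\<in>I. if b = k then str a b p * str i j a else 0)"
      by (intro sum.cong refl) simp
    finally show ?thesis using * finI by simp
  qed
  have 2: "c (bas i \<otimes> (bas j \<otimes> bas k)) p = (\<Sum>a\<in>I. str i a p * str j k a)"
  proof -
    have "c (bas i \<otimes> (bas j \<otimes> bas k)) p = (\<Sum>b\<in>I. \<Sum>a\<in>I. (if b = i then 1 else 0) * str j k a * str b a p)"
      using * by (subst LA.c_mult) (simp_all add: LA.mult_in bas_in c_bas)
    also have "\<dots> = (\<Sum>b\<in>I. if b = i then \<Sum>a\<in>I. str b a p * str j k a else 0)"
      by (intro sum.cong refl) (simp add: ac_simps)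
    finally show ?thesis using * finI by simp
  qed
  show "(\<Sum>a\<in>I. str a k p * str i j a) = (\<Sum>a\<in>I. str i a p * str j k a)"
    using 1 2 R.m_assoc[OF bas_in bas_in bas_in, of i j k] by simp
next
  interpret R: ring L by (rule ring)
  fix p j assume *: "p \<in> I" "j \<in> I"
  have "c (\<one> \<otimes> bas j) p = (\<Sum>i\<in>I. \<Sum>b\<in>I. (c \<one> i * str i b p) * (if b = j then 1 else 0))"
    using * by (subst LA.c_mult) (simp_all add: bas_in c_bas ac_simps)
  also have "\<dots> = (\<Sum>i\<in>I. c \<one> i * str i j p * 1)"
    by (rule sum_delta_right[OF finI *(2), where g = "\<lambda>_. 1"])
  finally show "(\<Sum>i\<in>I. str i j p * c \<one> i) = (if p = j then 1 else 0)"
    using * R.l_one[OF bas_in, of j] by (simp add: c_bas mult.commute)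
  have "c (bas j \<otimes> \<one>) p = (\<Sum>b\<in>I. \<Sum>i\<in>I. (if b = j then 1 else 0) * (str b i p * c \<one> i))"
    using * by (subst LA.c_mult) (simp_all add: bas_in c_bas ac_simps)
  also have "\<dots> = (\<Sum>b\<in>I. if b = j then (\<Sum>i\<in>I. str b i p * c \<one> i) else 0)"
    by (intro sum.cong refl) simp
  finally show "(\<Sum>i\<in>I. str j i p * c \<one> i) = (if p = j then 1 else 0)"
    using * finI R.r_one[OF bas_in, of j] by (simp add: c_bas)
next
  interpret R: ring L by (rule ring)
  fix i j k l assume *: "i \<in> I" "j \<in> I" "k \<in> I" "l \<in> I"
  have "comult L (bas i \<otimes> bas j) = comult L (bas i) \<otimes>\<^bsub>tensor L L\<^esub> comult L (bas j)"
    by (rule algebra_homD(2)[OF comult_hom bas_in bas_in])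
  moreover have "L2.coT (comult L (bas i \<otimes> bas j)) (k, l) = (\<Sum>a\<in>I. str i j a * dco a k l)"
    using * by (intro comult_coords) (auto intro: LA.mult_in bas_in)
  moreover have "L2.coT (comult L (bas i) \<otimes>\<^bsub>tensor L L\<^esub> comult L (bas j)) (k, l)
    = (\<Sum>x\<in>I\<times>I. \<Sum>y\<in>I\<times>I. L2.coT (comult L (bas i)) x * L2.coT (comult L (bas j)) y * L2.\<mu>T x y (k, l))"
    using * by (intro L2.TA.c_mult) (auto intro: comult_in bas_in)
  ultimately show "(\<Sum>a\<in>I. str i j a * dco a k l) =
      (\<Sum>p\<in>I. \<Sum>q\<in>I. \<Sum>r\<in>I. \<Sum>s\<in>I. dco i p q * dco j r s * str p r k * str q s l)"
    by (simp add: sum.cartesian_product' L2.\<mu>T_def dco_def ac_simps)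
next
  interpret R: ring L by (rule ring)
  fix i j assume *: "i \<in> I" "j \<in> I"
  have "counit L (bas i \<otimes> bas j) = counit L (bas i) * counit L (bas j)"
    using algebra_homD(2)[OF counit_hom bas_in bas_in, of i j] by (simp add: field_algebra_def)
  then show "(\<Sum>a\<in>I. str i j a * counit L (bas a)) = counit L (bas i) * counit L (bas j)"
    using counit_coords[OF LA.mult_in[OF bas_in bas_in], of i j] by simp
  have "comult L \<one> = pure_tensor L L \<one> \<one>"
    using algebra_homD(4)[OF comult_hom] by (simp add: L2.T_one)
  then have "L2.coT (comult L \<one>) (i, j) = c \<one> i * c \<one> j"
    by (simp add: L2.coT_pure)
  then show "(\<Sum>a\<in>I. dco a i j * c \<one> a) = c \<one> i * c \<one> j"
    using comult_coords[of \<one> i j] * by (simp add: ac_simps)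
next
  interpret R: ring L by (rule ring)
  have "counit L \<one> = 1" using algebra_homD(4)[OF counit_hom] by (simp add: field_algebra_def)
  then show "(\<Sum>a\<in>I. counit L (bas a) * c \<one> a) = 1"
    using counit_coords[of \<one>] by (simp add: ac_simps)
next
  interpret R: ring L by (rule ring)
  fix p q assume pq: "p \<in> I" "q \<in> I"
  note xin = bas_in[of p]
  define \<gamma> where "\<gamma> a b x = (\<Sum>r\<in>I. c (antipode L (bas a)) r * str r b x)" for a b x
  have 1: "c (antipode L a \<otimes> b) x = (\<Sum>a'\<in>I. \<Sum>b'\<in>I. c a a' * c b b' * \<gamma> a' b' x)"
    if "a \<in> carrier L" "b \<in> carrier L" "x \<in> I" for a b x
  proof -
    have "c (antipode L a \<otimes> b) x = (\<Sum>r\<in>I. \<Sum>b'\<in>I. \<Sum>a'\<in>I. c a a' * c b b' * (c (antipode L (bas a')) r * str r b' x))"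
      using that by (simp add: LA.c_mult antipode_in antipode_coords[of a] sum_distrib_right sum_distrib_left ac_simps)
    also have "\<dots> = (\<Sum>a'\<in>I. \<Sum>b'\<in>I. \<Sum>r\<in>I. c a a' * c b b' * (c (antipode L (bas a')) r * str r b' x))"
      by (rule sum_swap_13)
    finally show ?thesis by (simp add: \<gamma>_def sum_distrib_left)
  qed
  have "c (tensor_lift L (\<lambda>a b. antipode L a \<otimes> b) (comult L (bas p))) q
    = (\<Sum>a\<in>I. \<Sum>b\<in>I. L2.coT (comult L (bas p)) (a, b) * \<gamma> a b q)"
    by (rule L2.lift(2)[OF coordinates_axioms _ 1 comult_in[OF xin] pq(2)]) (simp_all add: antipode_in)
  then show "(\<Sum>i\<in>I. \<Sum>j\<in>I. \<Sum>a\<in>I. dco p i j * c (antipode L (bas i)) a * str a j q) = counit L (bas p) * c \<one> q"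
    using antipode_left[OF xin] by (simp add: \<gamma>_def dco_def c_smult sum_distrib_left mult.assoc)
  define \<gamma>' where "\<gamma>' a b x = (\<Sum>r\<in>I. c (antipode L (bas b)) r * str a r x)" for a b x
  have 2: "c (a \<otimes> antipode L b) x = (\<Sum>a'\<in>I. \<Sum>b'\<in>I. c a a' * c b b' * \<gamma>' a' b' x)"
    if "a \<in> carrier L" "b \<in> carrier L" "x \<in> I" for a b x
  proof -
    have "c (a \<otimes> antipode L b) x = (\<Sum>a'\<in>I. \<Sum>r\<in>I. \<Sum>b'\<in>I. c a a' * c b b' * (c (antipode L (bas b')) r * str a' r x))"
      using that by (simp add: LA.c_mult antipode_in antipode_coords[of b] sum_distrib_right sum_distrib_left ac_simps)
    also have "\<dots> = (\<Sum>a'\<in>I. \<Sum>b'\<in>I. \<Sum>r\<in>I. c a a' * c b b' * (c (antipode L (bas b')) r * str a' r x))"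
      by (rule sum_swap_23)
    finally show ?thesis by (simp add: \<gamma>'_def sum_distrib_left)
  qed
  have "c (tensor_lift L (\<lambda>a b. a \<otimes> antipode L b) (comult L (bas p))) q
    = (\<Sum>a\<in>I. \<Sum>b\<in>I. L2.coT (comult L (bas p)) (a, b) * \<gamma>' a b q)"
    by (rule L2.lift(2)[OF coordinates_axioms _ 2 comult_in[OF xin] pq(2)]) (simp_all add: antipode_in)
  then show "(\<Sum>i\<in>I. \<Sum>j\<in>I. \<Sum>a\<in>I. dco p i j * c (antipode L (bas j)) a * str i a q) = counit L (bas p) * c \<one> q"
    using antipode_right[OF xin] by (simp add: \<gamma>'_def dco_def c_smult sum_distrib_left mult.assoc)
qed

end

section \<open>From the pentagon equation to the Heisenberg relations\<close>

locale pentagon_solution = falg M I c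
  for M :: "('k :: field, 'a) module" (structure) and I :: "'i set" and c :: "'a \<Rightarrow> 'i \<Rightarrow> 'k" +
  fixes R and m :: nat and A B :: "nat \<Rightarrow> 'a"
  assumes R_rep: "T2.rep R {..<m} A B"
    and A_indep: "indep m A" and B_indep: "indep m B"
    and R_unit: "R \<in> Units (tensor M M)"
    and R_pentagon: "pentagon_equation M R"
begin

lemma A_in: "i < m \<Longrightarrow> A i \<in> carrier M" and B_in: "i < m \<Longrightarrow> B i \<in> carrier M"
  using T2.repD(2,3)[OF R_rep] by auto

lemma R_in: "R \<in> carrier (tensor M M)" by (rule T2.repD(1)[OF R_rep])

text \<open>
  Functionals dual to the family \<open>B\<close>, by their coefficients.
\<close>

definition \<beta> :: "nat \<Rightarrow> 'i \<Rightarrow> 'k" where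
  "\<beta> = (SOME \<psi>. \<forall>i<m. \<forall>l<m. (\<Sum>j\<in>I. \<psi> i j * c (B l) j) = (if i = l then 1 else 0))"

lemma \<beta>: "i < m \<Longrightarrow> l < m \<Longrightarrow> (\<Sum>j\<in>I. \<beta> i j * c (B l) j) = (if i = l then 1 else 0)"
proof -
  have "\<exists>\<psi>. \<forall>i<m. \<forall>l<m. (\<Sum>j\<in>I. \<psi> i j * c (B l) j) = (if i = l then 1 else 0)"
    by (rule indep_dual[OF B_indep]) blast
  from someI_ex[OF this] show "i < m \<Longrightarrow> l < m \<Longrightarrow> ?thesis" unfolding \<beta>_def by blast
qed

text \<open>
  The coefficients of \<open>B\<^sub>i B\<^sub>j\<close> along \<open>B\<^sub>p\<close>; they turn out to be the comultiplication constants of the Hopf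
  algebra of \<open>R\<close>.
\<close>

definition d :: "nat \<Rightarrow> nat \<Rightarrow> nat \<Rightarrow> 'k" where
  "d p i j = (\<Sum>x\<in>I. \<beta> p x * c (B i \<otimes> B j) x)"

text \<open>
  The tensor \<open>\<Sum> h j k A\<^sub>j \<otimes> A\<^sub>k\<close>.
\<close>

definition X :: "(nat \<Rightarrow> nat \<Rightarrow> 'k) \<Rightarrow> ('a \<times> 'a \<Rightarrow>\<^sub>0 'k) set" where
  "X h = T2.T.vec (\<lambda>(y, z). \<Sum>j<m. \<Sum>k<m. h j k * c (A j) y * c (A k) z)"

lemma X_rep: "T2.rep (X h) ({..<m} \<times> {..<m}) (\<lambda>(j, k). h j k \<odot> A j) (\<lambda>(j, k). A k)"
  unfolding T2.rep_def
  by (auto simp: X_def T2.T.vec_in T2.T.c_vec A_in smult_in c_smult sum.cartesian_product' cong: sum.cong_simp)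

text \<open>
  The pentagon equation, contracted with the functional \<open>\<phi>\<close> in the third leg and with its first factor
  on the left-hand side split off: \<open>R \<cdot> \<Sum> \<phi>(B\<^sub>j B\<^sub>k) A\<^sub>j \<otimes> A\<^sub>k = \<Sum> \<phi>(B\<^sub>i) A\<^sub>j \<otimes> A\<^sub>i B\<^sub>j\<close>.
\<close>

lemma slice:
  assumes "p \<in> I" "q \<in> I"
  shows "T2.coT (R \<otimes>\<^bsub>tensor M M\<^esub> X (\<lambda>j k. \<Sum>x\<in>I. \<phi> x * c (B j \<otimes> B k) x)) (p, q)
    = (\<Sum>i<m. \<Sum>j<m. (\<Sum>x\<in>I. \<phi> x * c (B i) x) * c (A j) p * c (A i \<otimes> B j) q)"
proof -
  interpret Rg: ring M by (rule ring_M)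
  let ?h = "\<lambda>j k. \<Sum>x\<in>I. \<phi> x * c (B j \<otimes> B k) x"
  have "T2.coT (R \<otimes>\<^bsub>tensor M M\<^esub> X ?h) (p, q)
    = (\<Sum>i<m. \<Sum>j<m. \<Sum>k<m. ?h j k * (c (A i \<otimes> A j) p * c (B i \<otimes> A k) q))"
    using T2.repD(4)[OF T2.rep_mult[OF R_rep X_rep] assms, of ?h]
    by (simp add: sum.cartesian_product' A_in B_in smult_mult_right c_smult mult.assoc cong: sum.cong_simp)
  also have "\<dots> = (\<Sum>i<m. \<Sum>j<m. \<Sum>k<m. \<Sum>x\<in>I. \<phi> x * (c (A i \<otimes> A j) p * c (B i \<otimes> A k) q * c (B j \<otimes> B k) x))"
    by (simp add: sum_distrib_right sum_distrib_left ac_simps)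
  also have "\<dots> = (\<Sum>i<m. \<Sum>x\<in>I. \<Sum>j<m. \<Sum>k<m. \<phi> x * (c (A i \<otimes> A j) p * c (B i \<otimes> A k) q * c (B j \<otimes> B k) x))"
    by (intro sum.cong refl sum_rotate3')
  also have "\<dots> = (\<Sum>x\<in>I. \<phi> x * (\<Sum>i<m. \<Sum>j<m. \<Sum>k<m. c (A i \<otimes> A j) p * c (B i \<otimes> A k) q * c (B j \<otimes> B k) x))"
    by (subst sum.swap) (simp only: sum_distrib_left)
  also have "\<dots> = (\<Sum>x\<in>I. \<phi> x * (\<Sum>i<m. \<Sum>j<m. c (A j) p * c (A i \<otimes> B j) q * c (B i) x))"
    using R_pentagon[unfolded pentagon_iff[OF R_rep]] assms by (intro sum.cong refl) simp
  also have "\<dots> = (\<Sum>x\<in>I. \<Sum>i<m. \<Sum>j<m. \<phi> x * c (B i) x * c (A j) p * c (A i \<otimes> B j) q)"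
    by (simp add: sum_distrib_left ac_simps)
  also have "\<dots> = (\<Sum>i<m. \<Sum>j<m. \<Sum>x\<in>I. \<phi> x * c (B i) x * c (A j) p * c (A i \<otimes> B j) q)"
    by (rule sum_rotate3)
  finally show ?thesis by (simp add: sum_distrib_right)
qed

lemma inv_R_in: "inv\<^bsub>tensor M M\<^esub> R \<in> carrier (tensor M M)"
  by (rule monoid.Units_inv_closed[OF mon2 R_unit])

lemma inv_R_cancel:
  assumes z: "z \<in> carrier (tensor M M)"
  shows "inv\<^bsub>tensor M M\<^esub> R \<otimes>\<^bsub>tensor M M\<^esub> (R \<otimes>\<^bsub>tensor M M\<^esub> z) = z"
proof -
  have "inv\<^bsub>tensor M M\<^esub> R \<otimes>\<^bsub>tensor M M\<^esub> (R \<otimes>\<^bsub>tensor M M\<^esub> z)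
    = inv\<^bsub>tensor M M\<^esub> R \<otimes>\<^bsub>tensor M M\<^esub> R \<otimes>\<^bsub>tensor M M\<^esub> z"
    by (rule monoid.m_assoc[OF mon2 inv_R_in R_in z, symmetric])
  also have "inv\<^bsub>tensor M M\<^esub> R \<otimes>\<^bsub>tensor M M\<^esub> R = \<one>\<^bsub>tensor M M\<^esub>"
    by (rule monoid.Units_l_inv[OF mon2 R_unit])
  finally show ?thesis by (simp only: monoid.l_one[OF mon2 z])
qed

lemma left_cancel:
  assumes "x \<in> carrier (tensor M M)" "y \<in> carrier (tensor M M)"
    "R \<otimes>\<^bsub>tensor M M\<^esub> x = R \<otimes>\<^bsub>tensor M M\<^esub> y"
  shows "x = y"
  using inv_R_cancel[OF assms(1)] inv_R_cancel[OF assms(2)] assms(3) by metis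

lemma X_zero:
  assumes "\<And>p q. p \<in> I \<Longrightarrow> q \<in> I \<Longrightarrow> T2.coT (X h) (p, q) = 0" "j < m" "k < m"
  shows "h j k = 0"
proof -
  have 0: "(\<Sum>j<m. (\<Sum>k<m. h j k * c (A k) q) * c (A j) p) = 0" if "p \<in> I" "q \<in> I" for p q
    using T2.repD(4)[OF X_rep that, of h] assms(1)[OF that]
    by (simp add: sum.cartesian_product' A_in c_smult sum_distrib_left sum_distrib_right ac_simps cong: sum.cong_simp)
  have 1: "(\<Sum>k<m. h j k * c (A k) q) = 0" if "q \<in> I" for q
    by (rule indepD[OF A_indep _ assms(2), of "\<lambda>j. \<Sum>k<m. h j k * c (A k) q"]) (rule 0[OF _ that])
  show ?thesis by (rule indepD[OF A_indep _ assms(3), of "h j"]) (rule 1)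
qed

text \<open>
  A functional \<open>\<phi>\<close> that vanishes on all \<open>B\<^sub>l\<close> vanishes on all products \<open>B\<^sub>j B\<^sub>k\<close>: the contracted pentagon
  equation becomes \<open>R \<cdot> \<Sum> \<phi>(B\<^sub>j B\<^sub>k) A\<^sub>j \<otimes> A\<^sub>k = 0\<close>, and \<open>R\<close> is invertible. It is applied to the functional
  that reads off coordinate \<open>x\<close> of the difference between a vector and its projection to the span of \<open>B\<close>.
\<close>

lemma B_mult:
  assumes ij: "i < m" "j < m" and x: "x \<in> I"
  shows "c (B i \<otimes> B j) x = (\<Sum>p<m. d p i j * c (B p) x)"
proof -
  define \<phi> where "\<phi> y = (if y = x then 1 else 0) - (\<Sum>p<m. c (B p) x * \<beta> p y)" for y
  have \<phi>: "(\<Sum>y\<in>I. \<phi> y * g y) = g x - (\<Sum>p<m. c (B p) x * (\<Sum>y\<in>I. \<beta> p y * g y))" for g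
  proof -
    have "\<phi> y * g y = (if y = x then g y else 0) - (\<Sum>p<m. c (B p) x * (\<beta> p y * g y))" for y
      by (simp add: \<phi>_def left_diff_distrib sum_distrib_right mult.assoc)
    then have "(\<Sum>y\<in>I. \<phi> y * g y) = (\<Sum>y\<in>I. if y = x then g y else 0) - (\<Sum>y\<in>I. \<Sum>p<m. c (B p) x * (\<beta> p y * g y))"
      by (simp add: sum_subtractf)
    also have "(\<Sum>y\<in>I. \<Sum>p<m. c (B p) x * (\<beta> p y * g y)) = (\<Sum>p<m. c (B p) x * (\<Sum>y\<in>I. \<beta> p y * g y))"
      by (subst sum.swap) (simp add: sum_distrib_left)
    finally show ?thesis using x finI by simp
  qed
  have \<phi>B: "(\<Sum>y\<in>I. \<phi> y * c (B l) y) = 0" if "l < m" for l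
  proof -
    have "(\<Sum>p<m. c (B p) x * (\<Sum>y\<in>I. \<beta> p y * c (B l) y)) = (\<Sum>p<m. if p = l then c (B p) x else 0)"
      using that by (intro sum.cong refl) (simp add: \<beta>)
    then show ?thesis using that unfolding \<phi> by simp
  qed
  let ?h = "\<lambda>j k. \<Sum>y\<in>I. \<phi> y * c (B j \<otimes> B k) y"
  have z: "T2.T.vec (\<lambda>_. 0) \<in> carrier (tensor M M)" by (rule T2.T.vec_in)
  have "X ?h = T2.T.vec (\<lambda>_. 0)"
  proof (rule left_cancel)
    show "R \<otimes>\<^bsub>tensor M M\<^esub> X ?h = R \<otimes>\<^bsub>tensor M M\<^esub> T2.T.vec (\<lambda>_. 0)"
    proof (rule T2.T.c_inj)
      fix w assume w: "w \<in> I \<times> I"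
      then obtain a b where ab: "w = (a, b)" "a \<in> I" "b \<in> I" by auto
      have "T2.coT (R \<otimes>\<^bsub>tensor M M\<^esub> X ?h) w = 0"
        unfolding ab(1) slice[OF ab(2,3)] by (intro sum.neutral ballI) (simp add: \<phi>B)
      moreover have "T2.coT (R \<otimes>\<^bsub>tensor M M\<^esub> T2.T.vec (\<lambda>_. 0)) w = 0"
        unfolding T2.TA.c_mult[OF R_in z w] T2.T.c_vec by simp
      ultimately show "T2.coT (R \<otimes>\<^bsub>tensor M M\<^esub> X ?h) w = T2.coT (R \<otimes>\<^bsub>tensor M M\<^esub> T2.T.vec (\<lambda>_. 0)) w"
        by simp
    next
      show "R \<otimes>\<^bsub>tensor M M\<^esub> X ?h \<in> carrier (tensor M M)"
        by (rule T2.TA.mult_in[OF R_in T2.repD(1)[OF X_rep]])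
      show "R \<otimes>\<^bsub>tensor M M\<^esub> T2.T.vec (\<lambda>_. 0) \<in> carrier (tensor M M)"
        by (rule T2.TA.mult_in[OF R_in z])
    qed
  qed (rule T2.repD(1)[OF X_rep], rule z)
  then have "T2.coT (X ?h) (a, b) = 0" for a b by (simp only: T2.T.c_vec if_cancel)
  then have "?h i j = 0" by (rule X_zero[OF _ ij])
  then have "c (B i \<otimes> B j) x - (\<Sum>p<m. c (B p) x * d p i j) = 0"
    unfolding \<phi> d_def .
  then show ?thesis by (simp add: mult.commute)
qed

text \<open>
  The contracted pentagon equation for the functional dual to \<open>B\<^sub>p\<close>.
\<close>

lemma R_X: "p < m \<Longrightarrow> pure_tensor M M \<one> (A p) \<otimes>\<^bsub>tensor M M\<^esub> R = R \<otimes>\<^bsub>tensor M M\<^esub> X (d p)"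
proof (rule T2.T.c_inj)
  interpret Rg: ring M by (rule ring_M)
  assume p: "p < m"
  fix z assume "z \<in> I \<times> I"
  then obtain x y where z: "z = (x, y)" and xy: "x \<in> I" "y \<in> I" by auto
  have "T2.coT (R \<otimes>\<^bsub>tensor M M\<^esub> X (d p)) (x, y)
    = (\<Sum>i<m. \<Sum>j<m. (\<Sum>y\<in>I. \<beta> p y * c (B i) y) * c (A j) x * c (A i \<otimes> B j) y)"
    unfolding d_def[abs_def] by (rule slice[OF xy])
  also have "\<dots> = (\<Sum>i<m. if i = p then \<Sum>j<m. c (A j) x * c (A i \<otimes> B j) y else 0)"
    using p by (intro sum.cong refl) (simp add: \<beta>)
  also have "\<dots> = (\<Sum>j<m. c (A j) x * c (A p \<otimes> B j) y)" using p by simp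
  also have "\<dots> = T2.coT (pure_tensor M M \<one> (A p) \<otimes>\<^bsub>tensor M M\<^esub> R) (x, y)"
    using T2.repD(4)[OF T2.rep_mult[OF T2.rep_pure R_rep] xy, of \<one> "A p"] p
    by (simp add: sum.cartesian_product' A_in cong: sum.cong_simp)
  finally show "T2.coT (pure_tensor M M \<one> (A p) \<otimes>\<^bsub>tensor M M\<^esub> R) z = T2.coT (R \<otimes>\<^bsub>tensor M M\<^esub> X (d p)) z"
    by (simp add: z)
qed (auto intro!: T2.TA.mult_in R_in T2.pure_in T2.repD(1)[OF X_rep] A_in simp: ring_M ring.ring_simprules)

lemma conj_X:
  assumes p: "p < m"
  shows "inv\<^bsub>tensor M M\<^esub> R \<otimes>\<^bsub>tensor M M\<^esub> pure_tensor M M \<one> (A p) \<otimes>\<^bsub>tensor M M\<^esub> R = X (d p)"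
proof -
  interpret Rg: ring M by (rule ring_M)
  have 1: "pure_tensor M M \<one> (A p) \<in> carrier (tensor M M)" using p by (intro T2.pure_in A_in) auto
  have "inv\<^bsub>tensor M M\<^esub> R \<otimes>\<^bsub>tensor M M\<^esub> pure_tensor M M \<one> (A p) \<otimes>\<^bsub>tensor M M\<^esub> R
    = inv\<^bsub>tensor M M\<^esub> R \<otimes>\<^bsub>tensor M M\<^esub> (R \<otimes>\<^bsub>tensor M M\<^esub> X (d p))"
    unfolding R_X[OF p, symmetric] by (rule monoid.m_assoc[OF mon2 inv_R_in 1 R_in])
  also have "\<dots> = X (d p)" by (rule inv_R_cancel[OF T2.repD(1)[OF X_rep]])
  finally show ?thesis .
qed

text \<open>
  Comparison of the coefficients of \<open>A\<^sub>q\<close> in the first leg of \<open>(1 \<otimes> A\<^sub>p) R = R \<Delta>(A\<^sub>p)\<close>.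
\<close>

lemma AB_commute:
  assumes \<mu>: "\<And>r i x. r < m \<Longrightarrow> i < m \<Longrightarrow> x \<in> I \<Longrightarrow> c (A r \<otimes> A i) x = (\<Sum>q<m. \<mu> r i q * c (A q) x)"
    and pq: "p < m" "q < m" and y: "y \<in> I"
  shows "c (A p \<otimes> B q) y = (\<Sum>r<m. \<Sum>i<m. \<Sum>j<m. d p i j * \<mu> r i q * c (B r \<otimes> A j) y)"
proof (rule indep_eqD[OF A_indep _ pq(2), of "\<lambda>q. c (A p \<otimes> B q) y" "\<lambda>q. \<Sum>r<m. \<Sum>i<m. \<Sum>j<m. d p i j * \<mu> r i q * c (B r \<otimes> A j) y"])
  interpret Rg: ring M by (rule ring_M)
  fix x assume x: "x \<in> I"
  have "(\<Sum>q<m. c (A p \<otimes> B q) y * c (A q) x) = T2.coT (pure_tensor M M \<one> (A p) \<otimes>\<^bsub>tensor M M\<^esub> R) (x, y)"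
    using T2.repD(4)[OF T2.rep_mult[OF T2.rep_pure R_rep] x y, of \<one> "A p"] pq
    by (simp add: sum.cartesian_product' A_in ac_simps cong: sum.cong_simp)
  also have "\<dots> = T2.coT (R \<otimes>\<^bsub>tensor M M\<^esub> X (d p)) (x, y)" using R_X[OF pq(1)] by simp
  also have "\<dots> = (\<Sum>r<m. \<Sum>i<m. \<Sum>j<m. d p i j * c (A r \<otimes> A i) x * c (B r \<otimes> A j) y)"
    using T2.repD(4)[OF T2.rep_mult[OF R_rep X_rep] x y, of "d p"]
    by (simp add: sum.cartesian_product' A_in B_in smult_mult_right c_smult mult.assoc cong: sum.cong_simp)
  also have "\<dots> = (\<Sum>r<m. \<Sum>i<m. \<Sum>j<m. \<Sum>q<m. d p i j * \<mu> r i q * c (B r \<otimes> A j) y * c (A q) x)"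
    using x by (simp add: \<mu> sum_distrib_left sum_distrib_right ac_simps cong: sum.cong_simp)
  also have "\<dots> = (\<Sum>r<m. \<Sum>q<m. \<Sum>i<m. \<Sum>j<m. d p i j * \<mu> r i q * c (B r \<otimes> A j) y * c (A q) x)"
    by (intro sum.cong refl sum_rotate3')
  also have "\<dots> = (\<Sum>q<m. (\<Sum>r<m. \<Sum>i<m. \<Sum>j<m. d p i j * \<mu> r i q * c (B r \<otimes> A j) y) * c (A q) x)"
    by (subst sum.swap) (simp add: sum_distrib_right)
  finally show "(\<Sum>q<m. c (A p \<otimes> B q) y * c (A q) x) =
    (\<Sum>q<m. (\<Sum>r<m. \<Sum>i<m. \<Sum>j<m. d p i j * \<mu> r i q * c (B r \<otimes> A j) y) * c (A q) x)" .
qed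

text \<open>
  The element \<open>u = \<Sum> \<epsilon>\<^sub>i B\<^sub>i\<close> satisfies \<open>u B\<^sub>j = B\<^sub>j\<close>, hence \<open>(1 \<otimes> u) R = R\<close>, and \<open>R\<close> may be cancelled. The
  coordinate \<open>x\<^sub>0\<close> witnesses that the algebra is not zero.
\<close>

lemma B_unit:
  assumes \<epsilon>: "\<And>p j. p < m \<Longrightarrow> j < m \<Longrightarrow> (\<Sum>i<m. d p i j * \<epsilon> i) = (if p = j then 1 else 0)"
    and one: "x0 \<in> I" "c \<one> x0 \<noteq> 0" and y: "y \<in> I"
  shows "(\<Sum>i<m. \<epsilon> i * c (B i) y) = c \<one> y"
proof -
  interpret Rg: ring M by (rule ring_M)
  define u where "u = (\<Oplus>i\<in>{..<m}. \<epsilon> i \<odot> B i)"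
  have u: "u \<in> carrier M" unfolding u_def by (rule lincomb_in) (simp add: B_in)
  have cu: "c u y = (\<Sum>i<m. \<epsilon> i * c (B i) y)" for y
    unfolding u_def by (rule c_lincomb) (simp add: B_in)
  have uB: "c (u \<otimes> B j) y = c (B j) y" if j: "j < m" and y: "y \<in> I" for j y
  proof -
    have "c (u \<otimes> B j) y = (\<Sum>i<m. \<epsilon> i * c (B i \<otimes> B j) y)"
    proof -
      have "u \<otimes> B j = (\<Oplus>i\<in>{..<m}. (\<epsilon> i \<odot> B i) \<otimes> B j)"
        unfolding u_def using j by (intro Rg.finsum_ldistr) (auto intro: smult_in B_in)
      also have "c \<dots> y = (\<Sum>i<m. c ((\<epsilon> i \<odot> B i) \<otimes> B j) y)"
        using j by (intro c_finsum) (auto intro: smult_in B_in)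
      finally show ?thesis using j by (simp add: smult_mult_left B_in c_smult cong: sum.cong_simp)
    qed
    also have "\<dots> = (\<Sum>i<m. \<Sum>p<m. d p i j * \<epsilon> i * c (B p) y)"
      using j y by (simp add: B_mult sum_distrib_left ac_simps cong: sum.cong_simp)
    also have "\<dots> = (\<Sum>p<m. (\<Sum>i<m. d p i j * \<epsilon> i) * c (B p) y)"
      by (subst sum.swap) (simp add: sum_distrib_right)
    also have "\<dots> = (\<Sum>p<m. if p = j then c (B p) y else 0)"
      using j by (intro sum.cong refl) (simp add: \<epsilon>)
    finally show ?thesis using j by simp
  qed
  have "pure_tensor M M \<one> u \<otimes>\<^bsub>tensor M M\<^esub> R = R"
    by (rule T2.rep_eq[OF T2.rep_mult[OF T2.rep_pure R_rep] R_rep])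
      (simp_all add: u sum.cartesian_product' A_in uB cong: sum.cong_simp)
  then have "pure_tensor M M \<one> u = \<one>\<^bsub>tensor M M\<^esub>"
  proof -
    assume eq: "pure_tensor M M \<one> u \<otimes>\<^bsub>tensor M M\<^esub> R = R"
    have 1: "pure_tensor M M \<one> u \<in> carrier (tensor M M)" by (rule T2.pure_in[OF Rg.one_closed u])
    have r: "R \<otimes>\<^bsub>tensor M M\<^esub> inv\<^bsub>tensor M M\<^esub> R = \<one>\<^bsub>tensor M M\<^esub>"
      by (rule monoid.Units_r_inv[OF mon2 R_unit])
    have "pure_tensor M M \<one> u = pure_tensor M M \<one> u \<otimes>\<^bsub>tensor M M\<^esub> (R \<otimes>\<^bsub>tensor M M\<^esub> inv\<^bsub>tensor M M\<^esub> R)"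
      unfolding r by (rule monoid.r_one[OF mon2 1, symmetric])
    also have "\<dots> = pure_tensor M M \<one> u \<otimes>\<^bsub>tensor M M\<^esub> R \<otimes>\<^bsub>tensor M M\<^esub> inv\<^bsub>tensor M M\<^esub> R"
      by (rule monoid.m_assoc[OF mon2 1 R_in inv_R_in, symmetric])
    finally show ?thesis unfolding eq r .
  qed
  then have "c \<one> x0 * c u y = c \<one> x0 * c \<one> y"
    using T2.coT_pure[OF Rg.one_closed u, of "(x0, y)"] T2.coT_pure[OF Rg.one_closed Rg.one_closed, of "(x0, y)"]
    by (auto simp: T2.T_one)
  then show ?thesis using one cu by simp
qed

text \<open>
  Comparison of the coefficients of \<open>A\<^sub>q\<close> in the first leg of \<open>(1 \<otimes> a) R = 1 \<otimes> a\<close>, where \<open>1 = \<Sum> \<eta>\<^sub>q A\<^sub>q\<close>.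
\<close>

lemma coinvariants_iff:
  assumes \<eta>: "\<And>x. x \<in> I \<Longrightarrow> (\<Sum>k<m. \<eta> k * c (A k) x) = c \<one> x"
  shows "a \<in> right_coinvariants M R \<longleftrightarrow> a \<in> carrier M \<and> (\<forall>q<m. a \<otimes> B q = \<eta> q \<odot> a)"
proof -
  interpret Rg: ring M by (rule ring_M)
  have "pure_tensor M M \<one> a \<otimes>\<^bsub>tensor M M\<^esub> R = pure_tensor M M \<one> a \<longleftrightarrow> (\<forall>q<m. a \<otimes> B q = \<eta> q \<odot> a)"
    if a: "a \<in> carrier M"
  proof -
    let ?l = "pure_tensor M M \<one> a \<otimes>\<^bsub>tensor M M\<^esub> R" and ?r = "pure_tensor M M \<one> a"
    have in1: "?l \<in> carrier (tensor M M)" "?r \<in> carrier (tensor M M)"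
      using a by (auto intro!: T2.TA.mult_in T2.pure_in R_in)
    have l: "T2.coT ?l (x, y) = (\<Sum>q<m. c (a \<otimes> B q) y * c (A q) x)" if "x \<in> I" "y \<in> I" for x y
      using T2.repD(4)[OF T2.rep_mult[OF T2.rep_pure R_rep] that, of \<one> a] a
      by (simp add: sum.cartesian_product' A_in ac_simps cong: sum.cong_simp)
    have r: "T2.coT ?r (x, y) = (\<Sum>q<m. (\<eta> q * c a y) * c (A q) x)" if "x \<in> I" "y \<in> I" for x y
      using a \<eta>[OF that(1), symmetric] by (simp add: T2.coT_pure sum_distrib_left ac_simps)
    show ?thesis
    proof
      assume eq: "?l = ?r"
      show "\<forall>q<m. a \<otimes> B q = \<eta> q \<odot> a"
      proof (intro allI impI c_inj)
        fix q y assume q: "q < m" and y: "y \<in> I"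
        have "c (a \<otimes> B q) y = \<eta> q * c a y"
        proof (rule indep_eqD[OF A_indep _ q, of "\<lambda>q. c (a \<otimes> B q) y" "\<lambda>q. \<eta> q * c a y"])
          fix x assume x: "x \<in> I"
          show "(\<Sum>q<m. c (a \<otimes> B q) y * c (A q) x) = (\<Sum>q<m. \<eta> q * c a y * c (A q) x)"
            using l[OF x y] r[OF x y] by (simp only: eq)
        qed
        then show "c (a \<otimes> B q) y = c (\<eta> q \<odot> a) y" by (simp add: c_smult a)
      qed (simp_all add: a smult_in B_in)
    next
      assume inv: "\<forall>q<m. a \<otimes> B q = \<eta> q \<odot> a"
      show "?l = ?r"
      proof (rule T2.T.c_inj[OF in1])
        fix z assume "z \<in> I \<times> I"
        then obtain x y where z: "z = (x, y)" "x \<in> I" "y \<in> I" by auto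
        show "T2.coT ?l z = T2.coT ?r z"
          unfolding z(1) l[OF z(2,3)] r[OF z(2,3)] by (intro sum.cong refl) (simp add: inv c_smult a)
      qed
    qed
  qed
  then show ?thesis by (auto simp: right_coinvariants_def)
qed

end

lemma tensor_map_coords:
  assumes L: "coordinates L K cL" and V: "coordinates V K cV"
    and f: "\<And>x. x \<in> carrier L \<Longrightarrow> f x \<in> carrier V" "\<And>x k. x \<in> carrier L \<Longrightarrow> k \<in> K \<Longrightarrow> cV (f x) k = cL x k"
    and t: "t \<in> carrier (tensor L L)"
  shows "tensor_map V V f f t \<in> carrier (tensor V V)"
    and "i \<in> K \<Longrightarrow> j \<in> K \<Longrightarrow>
      tensor_coordinates.coT cV cV (tensor_map V V f f t) (i, j) = tensor_coordinates.coT cL cL t (i, j)"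
proof -
  interpret L: tensor_coordinates L K cL L K cL by (intro tensor_coordinates.intro L)
  interpret V: tensor_coordinates V K cV V K cV by (intro tensor_coordinates.intro V)
  let ?\<gamma> = "\<lambda>a b z. if a = fst z \<and> b = snd z then 1 else 0"
  have 1: "pure_tensor V V (f a) (f b) \<in> carrier (tensor V V)" if "a \<in> carrier L" "b \<in> carrier L" for a b
    using that by (intro V.pure_in f)
  have 2: "V.coT (pure_tensor V V (f a) (f b)) z = (\<Sum>p\<in>K. \<Sum>q\<in>K. cL a p * cL b q * ?\<gamma> p q z)"
    if "a \<in> carrier L" "b \<in> carrier L" "z \<in> K \<times> K" for a b z
    using that L.A.finI by (subst sum_delta_both) (auto simp: V.coT_pure f)
  show "tensor_map V V f f t \<in> carrier (tensor V V)"
    unfolding tensor_map_def by (rule L.lift(1)[OF V.T.coordinates_axioms 1 2 t])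
  assume ij: "i \<in> K" "j \<in> K"
  have "V.coT (tensor_map V V f f t) (i, j) = (\<Sum>p\<in>K. \<Sum>q\<in>K. L.coT t (p, q) * ?\<gamma> p q (i, j))"
    unfolding tensor_map_def by (rule L.lift(2)[OF V.T.coordinates_axioms 1 2 t]) (use ij in auto)
  also have "\<dots> = L.coT t (i, j)"
    using sum_delta_both[OF L.A.finI L.A.finI ij, of "\<lambda>p q. L.coT t (p, q)"] by simp
  finally show "V.coT (tensor_map V V f f t) (i, j) = L.coT t (i, j)" .
qed

context pentagon_solution
begin

abbreviation "SA \<equiv> vspan M (A ` {..<m})"

text \<open>
  An isomorphism \<open>f\<close> onto the Hopf algebra of \<open>R\<close> transports the coordinates with respect to \<open>A\<close> to
  \<open>L\<close>, and the structure constants of \<open>L\<close> become those of \<open>A\<close> and \<open>B\<close>.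
\<close>

lemma iso_coordinates:
  fixes L :: "('k, 'l) hopf" and H :: "('k, 'a) hopf"
  assumes L: "hopf_algebra L" and iso: "hopf_isomorphic L H"
    and H: "carrier H = SA" "mult H = mult M" "one H = one M" "zero H = zero M" "add H = add M"
      "Module.smult H = Module.smult M"
      "\<And>x. comult H x = tensor_restrict M SA M SA (inv\<^bsub>tensor M M\<^esub> R \<otimes>\<^bsub>tensor M M\<^esub> pure_tensor M M \<one> x \<otimes>\<^bsub>tensor M M\<^esub> R)"
  obtains cL where "hopf_coordinates L {..<m} cL"
    "\<And>r i x. r < m \<Longrightarrow> i < m \<Longrightarrow> x \<in> I \<Longrightarrow> c (A r \<otimes> A i) x = (\<Sum>q<m. hopf_coordinates.str L {..<m} cL r i q * c (A q) x)"
    "\<And>x. x \<in> I \<Longrightarrow> (\<Sum>k<m. cL \<one>\<^bsub>L\<^esub> k * c (A k) x) = c \<one> x"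
    "\<And>p i j. p < m \<Longrightarrow> i < m \<Longrightarrow> j < m \<Longrightarrow> hopf_coordinates.dco L {..<m} cL p i j = d p i j"
proof -
  interpret L: hopf_algebra L by (rule L)
  interpret Lr: ring L by (rule L.ring)
  interpret Mr: ring M by (rule ring_M)
  obtain cV where sub: "subco SA {..<m} cV A"
    and cVA: "\<And>k l. k < m \<Longrightarrow> cV (A k) l = (if l = k then 1 else 0)"
    and cVe: "\<And>x d k. x \<in> carrier M \<Longrightarrow> (\<And>i. i \<in> I \<Longrightarrow> c x i = (\<Sum>k<m. d k * c (A k) i)) \<Longrightarrow> k < m \<Longrightarrow> cV x k = d k"
    using subco_span[OF A_indep A_in] by blast
  interpret V: coordinates "M\<lparr>carrier := SA\<rparr>" "{..<m}" cV using sub by (simp add: subco_def)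
  have SAM: "SA \<subseteq> carrier M" and cSA: "\<And>x i. x \<in> SA \<Longrightarrow> i \<in> I \<Longrightarrow> c x i = (\<Sum>k<m. cV x k * c (A k) i)"
    using sub by (auto simp: subco_def)
  have A_SA: "A k \<in> SA" if "k < m" for k
  proof -
    have "\<exists>d. \<forall>i\<in>I. c (A k) i = (\<Sum>l<m. d l * c (A l) i)"
      by (rule exI[of _ "\<lambda>l. if l = k then 1 else 0"]) (use that in \<open>simp add: delta_mult\<close>)
    then show ?thesis using mem_span_iff[of m A "A k"] A_in that by blast
  qed
  obtain f where f: "f \<in> algebra_hom L H" "bij_betw f (carrier L) (carrier H)"
    and fco: "\<And>x. x \<in> carrier L \<Longrightarrow> comult H (f x) = tensor_map H H f f (comult L x)"
    using iso by (auto simp: hopf_isomorphic_def)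
  have f_in: "f x \<in> SA" if "x \<in> carrier L" for x
    using f(2) that H by (auto simp: bij_betw_def)
  have f_mult: "f (x \<otimes>\<^bsub>L\<^esub> y) = f x \<otimes> f y" "f (x \<oplus>\<^bsub>L\<^esub> y) = f x \<oplus> f y" if "x \<in> carrier L" "y \<in> carrier L" for x y
    using that algebra_homD[OF f(1)] by (simp_all add: H)
  have f_one: "f \<one>\<^bsub>L\<^esub> = \<one>" using algebra_homD(4)[OF f(1)] by (simp add: H)
  have f_smult: "f (k \<odot>\<^bsub>L\<^esub> x) = k \<odot> f x" if "x \<in> carrier L" for k x
    using algebra_homD(5)[OF f(1) that] by (simp add: H)
  define cL where "cL x = cV (f x)" for x
  have Lc: "coordinates L {..<m} cL"
  proof (rule coordinates.intro[OF L.vectorspace finite_lessThan])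
    show "cL (x \<oplus>\<^bsub>L\<^esub> y) i = cL x i + cL y i" if "x \<in> carrier L" "y \<in> carrier L" for x y i
      using V.c_add[of "f x" "f y" i] f_in that by (simp add: cL_def f_mult)
    show "cL (k \<odot>\<^bsub>L\<^esub> x) i = k * cL x i" if "x \<in> carrier L" for k x i
      using V.c_smult[of "f x" k i] f_in that by (simp add: cL_def f_smult)
    have "bij_betw (cV \<circ> f) (carrier L) {f. \<forall>i. i \<notin> {..<m} \<longrightarrow> f i = 0}"
      by (rule bij_betw_trans[of f _ SA]) (use f(2) H V.c_bij in auto)
    then show "bij_betw cL (carrier L) {f. \<forall>i. i \<notin> {..<m} \<longrightarrow> f i = 0}"
      by (simp add: cL_def[abs_def] comp_def)
  qed
  interpret Lh: hopf_coordinates L "{..<m}" cL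
    by (intro hopf_coordinates.intro L Lc)
  have f_bas: "f (Lh.bas k) = A k" if "k < m" for k
    by (rule V.c_inj) (use that A_SA f_in Lh.bas_in cVA[OF that] Lh.c_bas[of k] in \<open>simp_all add: cL_def[symmetric]\<close>)
  have cf: "c (f x) i = (\<Sum>k<m. cL x k * c (A k) i)" if "x \<in> carrier L" "i \<in> I" for x i
    using cSA[OF f_in[OF that(1)] that(2)] by (simp add: cL_def)
  have "c (A r \<otimes> A i) x = (\<Sum>q<m. Lh.str r i q * c (A q) x)" if "r < m" "i < m" "x \<in> I" for r i x
    using cf[of "Lh.bas r \<otimes>\<^bsub>L\<^esub> Lh.bas i" x] that by (simp add: f_mult Lh.bas_in f_bas)
  moreover have "(\<Sum>k<m. cL \<one>\<^bsub>L\<^esub> k * c (A k) x) = c \<one> x" if "x \<in> I" for x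
    using cf[of "\<one>\<^bsub>L\<^esub>" x] that by (simp add: f_one)
  moreover have "Lh.dco p i j = d p i j" if p: "p < m" and ij: "i < m" "j < m" for p i j
  proof -
    interpret VV: tensor_coordinates "M\<lparr>carrier := SA\<rparr>" "{..<m}" cV "M\<lparr>carrier := SA\<rparr>" "{..<m}" cV
      by unfold_locales
    have T: "tensor H H = tensor (M\<lparr>carrier := SA\<rparr>) (M\<lparr>carrier := SA\<rparr>)"
      "pure_tensor H H = pure_tensor (M\<lparr>carrier := SA\<rparr>) (M\<lparr>carrier := SA\<rparr>)"
      by (rule tensor_cong; simp add: H)+
    define s where "s = VV.T.vec (\<lambda>(i, j). d p i j)"
    have s: "s \<in> carrier (tensor (M\<lparr>carrier := SA\<rparr>) (M\<lparr>carrier := SA\<rparr>))" unfolding s_def by (rule VV.T.vec_in)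
    have "tensor_restrict M SA M SA (X (d p)) = s"
    proof (rule tensor_restrict_eq[OF sub sub s T2.repD(1)[OF X_rep]])
      fix i j assume "i \<in> I" "j \<in> I"
      then show "T2.coT (X (d p)) (i, j) = (\<Sum>p'\<in>{..<m}. \<Sum>q\<in>{..<m}. VV.coT s (p', q) * (c (A p') i * c (A q) j))"
        using T2.repD(4)[OF X_rep[of "d p"], of i j]
        by (simp add: sum.cartesian_product' s_def VV.T.c_vec A_in c_smult mult.assoc cong: sum.cong_simp)
    qed
    then have "comult H (f (Lh.bas p)) = s"
      using p by (simp add: H f_bas conj_X)
    then have "VV.coT (tensor_map H H f f (comult L (Lh.bas p))) (i, j) = d p i j"
      using fco[OF Lh.bas_in, of p] ij by (simp add: s_def VV.T.c_vec)
    moreover have "VV.coT (tensor_map H H f f (comult L (Lh.bas p))) (i, j) = Lh.L2.coT (comult L (Lh.bas p)) (i, j)"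
      unfolding tensor_map_def T
      by (rule tensor_map_coords(2)[unfolded tensor_map_def, OF Lc V.coordinates_axioms])
        (use ij f_in in \<open>auto simp: cL_def intro: Lh.comult_in Lh.bas_in\<close>)
    ultimately show ?thesis using ij by (simp add: Lh.dco_def)
  qed
  ultimately show ?thesis using that[of cL] Lh.hopf_coordinates_axioms by blast
qed

end

section \<open>The dimension of the coinvariants\<close>

text \<open>
  Matrix entries as coordinates; the entries outside the matrix are set to 0.
\<close>

definition entries :: "nat \<Rightarrow> 'k :: field mat \<Rightarrow> nat \<times> nat \<Rightarrow> 'k" where
  "entries n X p = (if fst p < n \<and> snd p < n then X $$ p else 0)"

abbreviation "sq n \<equiv> {..<n} \<times> {..<n :: nat}"

lemma mat_algebra_coordinates:
  "coordinates (mat_algebra n :: ('k :: field, 'k mat) module) (sq n) (entries n)"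
proof (rule coordinates.intro)
  show "vectorspace class_ring (mat_algebra n :: ('k, 'k mat) module)"
  proof (rule vectorspace_if_coordinates[where c = "entries n"])
    fix x y :: "'k mat" assume "x \<in> carrier (mat_algebra n)" "y \<in> carrier (mat_algebra n)" "\<And>i. entries n x i = entries n y i"
    then have xy: "x \<in> carrier_mat n n" "y \<in> carrier_mat n n" "\<And>i. entries n x i = entries n y i"
      by (simp_all add: module_mat_simps)
    show "x = y"
    proof (rule eq_matI)
      fix i j assume "i < dim_row y" "j < dim_col y"
      then show "x $$ (i, j) = y $$ (i, j)" using xy(3)[of "(i, j)"] xy(1,2) by (simp add: entries_def)
    qed (use xy in auto)
  qed (auto simp: module_mat_simps entries_def)
  show "bij_betw (entries n) (carrier (mat_algebra n :: ('k, 'k mat) module)) {f. \<forall>i. i \<notin> sq n \<longrightarrow> f i = 0}"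
    unfolding bij_betw_def
  proof
    show "inj_on (entries n) (carrier (mat_algebra n :: ('k, 'k mat) module))"
    proof (rule inj_onI, rule eq_matI)
      fix x y :: "'k mat" and i j
      assume *: "x \<in> carrier (mat_algebra n)" "y \<in> carrier (mat_algebra n)" "entries n x = entries n y" "i < dim_row y" "j < dim_col y"
      from *(3) have "entries n x (i, j) = entries n y (i, j)" by simp
      with *(1,2,4,5) show "x $$ (i, j) = y $$ (i, j)"
        by (simp add: module_mat_simps entries_def)
    qed (auto simp: module_mat_simps)
    show "entries n ` carrier (mat_algebra n :: ('k, 'k mat) module) = {f. \<forall>i. i \<notin> sq n \<longrightarrow> f i = 0}"
    proof (intro equalityI subsetI)
      fix f :: "nat \<times> nat \<Rightarrow> 'k" assume "f \<in> {f. \<forall>i. i \<notin> sq n \<longrightarrow> f i = 0}"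
      then have "f = entries n (mat n n f)" by (auto simp: entries_def fun_eq_iff)
      then show "f \<in> entries n ` carrier (mat_algebra n :: ('k, 'k mat) module)"
        by (rule image_eqI) (simp add: module_mat_simps)
    qed (auto simp: entries_def)
  qed
qed (auto simp: module_mat_simps entries_def)

lemma mat_algebra_assoc: "assoc_algebra (mat_algebra n :: ('k :: field, 'k mat) module)"
proof (rule assoc_algebra.intro)
  show "vectorspace class_ring (mat_algebra n :: ('k, 'k mat) module)"
    using mat_algebra_coordinates by (rule coordinates.vs)
  show "ring (mat_algebra n :: ('k, 'k mat) module)"
  proof (rule ring.intro[OF abelian_group_mat])
    show "monoid (mat_algebra n :: ('k, 'k mat) module)"
      by unfold_locales (auto simp: module_mat_simps)
    show "ring_axioms (mat_algebra n :: ('k, 'k mat) module)"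
      by unfold_locales (auto simp: module_mat_simps add_mult_distrib_mat mult_add_distrib_mat)
  qed
qed (auto simp: module_mat_simps)

lemma mat_algebra_falg: "falg (mat_algebra n :: ('k :: field, 'k mat) module) (sq n) (entries n)"
  by (intro falg.intro mat_algebra_assoc mat_algebra_coordinates)

lemma entries_mult:
  assumes "X \<in> carrier_mat n n" "Y \<in> carrier_mat n n" "a < n" "b < n"
  shows "entries n (X * Y) (a, b) = (\<Sum>k<n. entries n X (a, k) * entries n Y (k, b))"
  using assms by (simp add: entries_def scalar_prod_def lessThan_atLeast0)

text \<open>
  The embedding of matrices into the ring of operators, where the identities of the Heisenberg double
  are available.
\<close>

definition emb :: "nat \<Rightarrow> 'k :: field mat \<Rightarrow> 'k lend" where
  "emb n X = opm {..<n} (\<lambda>a b. entries n X (a, b))"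

lemma emb_mult:
  assumes "X \<in> carrier_mat n n" "Y \<in> carrier_mat n n"
  shows "emb n (X * Y) = emb n X * emb n Y"
  unfolding emb_def opm_mult by (rule opm_cong) (simp add: entries_mult assms)

lemma emb_lincomb:
  assumes "finite K" "\<And>a b. a < n \<Longrightarrow> b < n \<Longrightarrow> entries n X (a, b) = (\<Sum>k\<in>K. d k * entries n (Y k) (a, b))"
  shows "emb n X = (\<Sum>k\<in>K. scl (d k) (emb n (Y k)))"
  unfolding emb_def opm_lincomb[OF assms(1)] by (rule opm_cong) (simp add: assms(2))

lemma emb_inject:
  assumes "X \<in> carrier_mat n n" "Y \<in> carrier_mat n n" "emb n X = emb n Y"
  shows "X = Y"
proof (rule eq_matI)
  fix i j assume "i < dim_row Y" "j < dim_col Y"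
  then have "entries n X (i, j) = entries n Y (i, j)"
    using opm_inject[OF finite_lessThan assms(3)[unfolded emb_def], of i j] assms by simp
  then show "X $$ (i, j) = Y $$ (i, j)" using assms \<open>i < dim_row Y\<close> \<open>j < dim_col Y\<close> by (simp add: entries_def)
qed (use assms in auto)

locale matrix_pentagon_solution =
  pentagon_solution "mat_algebra n :: ('k :: field, 'k mat) module" "sq n" "entries n" R m A B
  for n R m A B +
  assumes n_pos: "n > 0"
begin

abbreviation "M \<equiv> mat_algebra n :: ('k, 'k mat) module"

text \<open>
  The map \<open>a \<mapsto> (a B\<^sub>i e)\<^sub>i\<close> is a linear bijection from the matrices onto \<open>N\<^sup>m\<close>, with inverse
  \<open>(w\<^sub>i) \<mapsto> \<Sum> w\<^sub>i A\<^sub>i\<close>. The matrices \<open>A\<^sub>i\<close>, \<open>B\<^sub>i\<close> represent the Heisenberg double of \<open>L\<close>; since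
  the abstract identities are stated for the co-opposite version, they are applied to the co-opposite
  of \<open>L\<close>, whose antipode exists because that of \<open>L\<close> is bijective.
\<close>

lemma coinvariants_dim:
  fixes L :: "('k, 'l) hopf" and H :: "('k, 'k mat) hopf"
  assumes L: "hopf_algebra L" and iso: "hopf_isomorphic L H"
    and H: "carrier H = SA" "mult H = mult M" "one H = one M" "zero H = zero M" "add H = add M"
      "Module.smult H = Module.smult M"
      "\<And>x. comult H x = tensor_restrict M SA M SA (inv\<^bsub>tensor M M\<^esub> R \<otimes>\<^bsub>tensor M M\<^esub> pure_tensor M M \<one>\<^bsub>M\<^esub> x \<otimes>\<^bsub>tensor M M\<^esub> R)"
  shows "vectorspace.dim class_ring L = m"
    and "n\<^sup>2 = m * vectorspace.dim class_ring (M\<lparr>carrier := right_coinvariants M R\<rparr>)"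
proof -
  obtain cL where Lc: "hopf_coordinates L {..<m} cL"
    and A_mult: "\<And>r i x. r < m \<Longrightarrow> i < m \<Longrightarrow> x \<in> sq n \<Longrightarrow> entries n (A r \<otimes>\<^bsub>M\<^esub> A i) x = (\<Sum>q<m. hopf_coordinates.str L {..<m} cL r i q * entries n (A q) x)"
    and A_one: "\<And>x. x \<in> sq n \<Longrightarrow> (\<Sum>k<m. cL \<one>\<^bsub>L\<^esub> k * entries n (A k) x) = entries n \<one>\<^bsub>M\<^esub> x"
    and dco: "\<And>p i j. p < m \<Longrightarrow> i < m \<Longrightarrow> j < m \<Longrightarrow> hopf_coordinates.dco L {..<m} cL p i j = d p i j"
    using iso_coordinates[OF L iso H] by blast
  interpret Lh: hopf_coordinates L "{..<m}" cL by (rule Lc)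
  show "vectorspace.dim class_ring L = m" using Lh.dim(2) by simp
  interpret S: hopf_sc "{..<m}" Lh.str Lh.dco "cL \<one>\<^bsub>L\<^esub>" "\<lambda>p. counit L (Lh.bas p)" "\<lambda>p. cL (antipode L (Lh.bas p))"
    by (rule Lh.hopf_constants)
  obtain T where T: "hopf_sc {..<m} Lh.str (\<lambda>p i j. Lh.dco p j i) (cL \<one>\<^bsub>L\<^esub>) (\<lambda>p. counit L (Lh.bas p)) T"
    using S.co_opposite[OF refl] by blast
  interpret Tc: hopf_sc "{..<m}" Lh.str "\<lambda>p i j. Lh.dco p j i" "cL \<one>\<^bsub>L\<^esub>" "\<lambda>p. counit L (Lh.bas p)" T by (rule T)
  have AC: "A i \<in> carrier_mat n n" and BC: "B i \<in> carrier_mat n n" if "i < m" for i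
    using A_in[OF that] B_in[OF that] by (simp_all add: module_mat_simps)
  have one0: "(0, 0) \<in> sq n" "entries n \<one>\<^bsub>M\<^esub> (0, 0) \<noteq> 0" using n_pos by (auto simp: module_mat_simps entries_def)
  have B_one: "(\<Sum>i<m. counit L (Lh.bas i) * entries n (B i) y) = entries n \<one>\<^bsub>M\<^esub> y" if "y \<in> sq n" for y
    by (rule B_unit[OF _ one0 that]) (use S.C.counit_l in \<open>simp add: dco\<close>)
  let ?A = "\<lambda>i. emb n (A i)" and ?B = "\<lambda>i. emb n (B i)" and ?u = "emb n \<one>\<^bsub>M\<^esub>"
  interpret He: heisenberg "{..<m}" Lh.str "\<lambda>p i j. Lh.dco p j i" "cL \<one>\<^bsub>L\<^esub>" "\<lambda>p. counit L (Lh.bas p)" T ?A ?B ?u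
  proof
    fix i j assume ij: "i \<in> {..<m}" "j \<in> {..<m}"
    have "emb n (A i * A j) = (\<Sum>q<m. scl (Lh.str i j q) (?A q))"
      by (rule emb_lincomb) (use A_mult ij in \<open>auto simp: module_mat_simps\<close>)
    then show "?A i * ?A j = Tc.img ?A (Lh.str i j)"
      using ij by (simp add: emb_mult AC Tc.img_def)
    have "emb n (B i * B j) = (\<Sum>p<m. scl (Lh.dco p i j) (?B p))"
    proof (rule emb_lincomb)
      fix a b assume ab: "a < n" "b < n"
      have "entries n (B i \<otimes>\<^bsub>M\<^esub> B j) (a, b) = (\<Sum>p<m. d p i j * entries n (B p) (a, b))"
        by (rule B_mult) (use ij ab in auto)
      also have "\<dots> = (\<Sum>p<m. Lh.dco p i j * entries n (B p) (a, b))"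
        using ij by (intro sum.cong refl) (simp add: dco)
      finally show "entries n (B i * B j) (a, b) = (\<Sum>p<m. Lh.dco p i j * entries n (B p) (a, b))"
        by (simp add: module_mat_simps)
    qed simp
    then show "?B i * ?B j = (\<Sum>p<m. scl (Lh.dco p i j) (?B p))"
      using ij by (simp add: emb_mult BC)
  next
    show "Tc.img ?A (cL \<one>\<^bsub>L\<^esub>) = ?u" unfolding Tc.img_def
      by (rule emb_lincomb[symmetric]) (use A_one in auto)
    show "Tc.img ?B (\<lambda>p. counit L (Lh.bas p)) = ?u" unfolding Tc.img_def
      by (rule emb_lincomb[symmetric]) (use B_one in auto)
  next
    fix p q assume pq: "p \<in> {..<m}" "q \<in> {..<m}"
    have "emb n (A p * B q) = (\<Sum>z\<in>{..<m} \<times> {..<m} \<times> {..<m}. scl (Lh.dco p (fst (snd z)) (snd (snd z)) * Lh.str (fst z) (fst (snd z)) q) (emb n (B (fst z) * A (snd (snd z)))))"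
    proof (rule emb_lincomb)
      fix a b assume "a < n" "b < n"
      then have "entries n (A p \<otimes>\<^bsub>M\<^esub> B q) (a, b) = (\<Sum>r<m. \<Sum>i<m. \<Sum>j<m. d p i j * Lh.str r i q * entries n (B r \<otimes>\<^bsub>M\<^esub> A j) (a, b))"
        using pq A_mult by (intro AB_commute) auto
      then show "entries n (A p * B q) (a, b) = (\<Sum>z\<in>{..<m} \<times> {..<m} \<times> {..<m}. Lh.dco p (fst (snd z)) (snd (snd z)) * Lh.str (fst z) (fst (snd z)) q * entries n (B (fst z) * A (snd (snd z))) (a, b))"
        using pq by (simp add: sum.cartesian_product' module_mat_simps dco cong: sum.cong_simp)
    qed simp
    then show "?A p * ?B q = (\<Sum>r<m. \<Sum>i<m. \<Sum>j<m. scl (Lh.dco p i j * Lh.str r i q) (?B r * ?A j))"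
      using pq by (simp add: sum.cartesian_product' emb_mult AC BC cong: sum.cong_simp)
  qed
  interpret Mr: ring M by (rule ring_M)
  define s where "s i = (\<Oplus>\<^bsub>M\<^esub>k\<in>{..<m}. T i k \<odot>\<^bsub>M\<^esub> A k)" for i
  have s_in: "s i \<in> carrier M" for i unfolding s_def by (rule lincomb_in) (simp add: A_in)
  have s: "emb n (s i) = He.s i" for i
    unfolding He.s_def Tc.img_def s_def by (rule emb_lincomb, simp, rule c_lincomb) (simp add: A_in)
  define e where "e = (\<Oplus>\<^bsub>M\<^esub>i\<in>{..<m}. 1 \<odot>\<^bsub>M\<^esub> (B i \<otimes>\<^bsub>M\<^esub> s i))"
  have Bs_in: "B i \<otimes>\<^bsub>M\<^esub> s i \<in> carrier M" if "i < m" for i using that s_in B_in by simp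
  have e_in: "e \<in> carrier M" unfolding e_def by (rule lincomb_in) (simp add: Bs_in)
  have e: "emb n e = He.e"
  proof -
    have "emb n e = (\<Sum>i<m. scl 1 (emb n (B i \<otimes>\<^bsub>M\<^esub> s i)))"
      unfolding e_def by (rule emb_lincomb, simp, rule c_lincomb) (simp add: Bs_in)
    then show ?thesis using s_in BC by (simp add: He.e_def s[symmetric] emb_mult module_mat_simps cong: sum.cong_simp)
  qed
  have emb_m: "emb n (x \<otimes>\<^bsub>M\<^esub> y) = emb n x * emb n y" if "x \<in> carrier M" "y \<in> carrier M" for x y
    using that by (simp add: emb_mult module_mat_simps)
  have emb_i: "x = y" if "x \<in> carrier M" "y \<in> carrier M" "emb n x = emb n y" for x y
    using that by (auto intro!: emb_inject simp: module_mat_simps)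
  have emb_s: "emb n (k \<odot>\<^bsub>M\<^esub> x) = scl k (emb n x)" if "x \<in> carrier M" for k x
    using emb_lincomb[of "{0::nat}" n "k \<odot>\<^bsub>M\<^esub> x" "\<lambda>_. k" "\<lambda>_. x"] that by (simp add: c_smult)
  have emb_u: "emb n x * ?u = emb n x" if "x \<in> carrier M" for x
    using emb_m[OF that Mr.one_closed] that by simp
  have emb_sum: "emb n (\<Oplus>\<^bsub>M\<^esub>i\<in>{..<m}. x i) = (\<Sum>i<m. emb n (x i))" if "\<And>i. i < m \<Longrightarrow> x i \<in> carrier M" for x
  proof -
    have "emb n (\<Oplus>\<^bsub>M\<^esub>i\<in>{..<m}. x i) = (\<Sum>i<m. scl 1 (emb n (x i)))"
    proof (rule emb_lincomb)
      fix a b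
      have "entries n (\<Oplus>\<^bsub>M\<^esub>i\<in>{..<m}. x i) (a, b) = (\<Sum>i<m. entries n (x i) (a, b))"
        by (rule c_finsum) (simp add: that)
      then show "entries n (\<Oplus>\<^bsub>M\<^esub>i\<in>{..<m}. x i) (a, b) = (\<Sum>i<m. 1 * entries n (x i) (a, b))" by simp
    qed simp
    then show ?thesis by simp
  qed
  let ?N = "right_coinvariants M R"
  have N: "a \<in> ?N \<longleftrightarrow> a \<in> carrier M \<and> (\<forall>q<m. a \<otimes>\<^bsub>M\<^esub> B q = cL \<one>\<^bsub>L\<^esub> q \<odot>\<^bsub>M\<^esub> a)" for a
    by (rule coinvariants_iff[OF A_one])
  have Ne: "a \<otimes>\<^bsub>M\<^esub> e \<in> ?N" if a: "a \<in> carrier M" for a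
    unfolding N
  proof (intro conjI allI impI)
    show "a \<otimes>\<^bsub>M\<^esub> e \<in> carrier M" using a e_in by simp
    fix q assume q: "q < m"
    show "a \<otimes>\<^bsub>M\<^esub> e \<otimes>\<^bsub>M\<^esub> B q = cL \<one>\<^bsub>L\<^esub> q \<odot>\<^bsub>M\<^esub> (a \<otimes>\<^bsub>M\<^esub> e)"
      by (rule emb_i) (use a e_in q B_in He.e_B[of q] in \<open>simp_all add: smult_in emb_m emb_s e mult.assoc\<close>)
  qed
  have Ninv: "a \<otimes>\<^bsub>M\<^esub> e = a" if "a \<in> ?N" for a
  proof (rule emb_i)
    have a: "a \<in> carrier M" "\<And>q. q < m \<Longrightarrow> a \<otimes>\<^bsub>M\<^esub> B q = cL \<one>\<^bsub>L\<^esub> q \<odot>\<^bsub>M\<^esub> a" using that N by auto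
    show "a \<in> carrier M" "a \<otimes>\<^bsub>M\<^esub> e \<in> carrier M" using a e_in by auto
    have "emb n a * He.e = emb n a"
      by (rule He.invariant_e) (use a emb_m[OF a(1) B_in, symmetric] emb_s emb_u in auto)
    then show "emb n (a \<otimes>\<^bsub>M\<^esub> e) = emb n a" using a e_in by (simp add: emb_m e)
  qed
  have NM: "?N \<subseteq> carrier M" using N by auto
  let ?NV = "M\<lparr>carrier := ?N\<rparr>"
  interpret MV: vectorspace class_ring M by (rule vs)
  have Nadd: "x \<oplus>\<^bsub>M\<^esub> y \<in> ?N" if "x \<in> ?N" "y \<in> ?N" for x y
    using that unfolding N by (auto simp: Mr.l_distr B_in MV.smult_r_distr)
  have Nsm: "k \<odot>\<^bsub>M\<^esub> x \<in> ?N" if "x \<in> ?N" for k x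
    unfolding N
  proof (intro conjI allI impI)
    have x: "x \<in> carrier M" "\<And>q. q < m \<Longrightarrow> x \<otimes>\<^bsub>M\<^esub> B q = cL \<one>\<^bsub>L\<^esub> q \<odot>\<^bsub>M\<^esub> x" using that N by auto
    show "k \<odot>\<^bsub>M\<^esub> x \<in> carrier M" by (rule smult_in[OF x(1)])
    fix q assume q: "q < m"
    have "k \<odot>\<^bsub>M\<^esub> x \<otimes>\<^bsub>M\<^esub> B q = k \<odot>\<^bsub>M\<^esub> (cL \<one>\<^bsub>L\<^esub> q \<odot>\<^bsub>M\<^esub> x)"
      using smult_mult_left[OF x(1) B_in[OF q]] x(2)[OF q] by simp
    also have "\<dots> = cL \<one>\<^bsub>L\<^esub> q \<odot>\<^bsub>M\<^esub> (k \<odot>\<^bsub>M\<^esub> x)"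
      by (rule c_inj) (simp_all add: smult_in x c_smult)
    finally show "k \<odot>\<^bsub>M\<^esub> x \<otimes>\<^bsub>M\<^esub> B q = cL \<one>\<^bsub>L\<^esub> q \<odot>\<^bsub>M\<^esub> (k \<odot>\<^bsub>M\<^esub> x)" .
  qed
  have Nz: "\<zero>\<^bsub>M\<^esub> \<in> ?N"
    unfolding N
  proof (intro conjI allI impI)
    show "\<zero>\<^bsub>M\<^esub> \<in> carrier M" by (rule zero_in)
    fix q assume "q < m"
    then have "\<zero>\<^bsub>M\<^esub> \<otimes>\<^bsub>M\<^esub> B q = \<zero>\<^bsub>M\<^esub>" by (intro Mr.l_null B_in)
    also have "\<dots> = cL \<one>\<^bsub>L\<^esub> q \<odot>\<^bsub>M\<^esub> \<zero>\<^bsub>M\<^esub>"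
      by (rule c_inj) (simp_all only: smult_in zero_in c_smult c_zero mult_zero_right)
    finally show "\<zero>\<^bsub>M\<^esub> \<otimes>\<^bsub>M\<^esub> B q = cL \<one>\<^bsub>L\<^esub> q \<odot>\<^bsub>M\<^esub> \<zero>\<^bsub>M\<^esub>" .
  qed
  have "submodule class_ring ?N M"
    by (rule LinearCombinations.submodule.intro[OF is_module]) (use NM Nadd Nsm Nz in auto)
  then have Nsub: "subspace class_ring ?N M" by (simp add: subspace_def vs)
  have NVS: "vectorspace class_ring ?NV" by (rule MV.subspace_is_vs[OF Nsub])
  have Nfin: "vectorspace.fin_dim class_ring ?NV"
  proof (rule linear_map.surj_fin_dim)
    show "linear_map class_ring M ?NV (\<lambda>a. a \<otimes>\<^bsub>M\<^esub> e)"
    proof (intro linear_map.intro mod_hom.intro mod_hom_axioms.intro vs NVS is_module)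
      show "Module.module class_ring ?NV" using NVS by (simp add: vectorspace_def)
      show "(\<lambda>a. a \<otimes>\<^bsub>M\<^esub> e) \<in> LinearCombinations.module_hom class_ring M ?NV"
        using Ne e_in by (auto simp: LinearCombinations.module_hom_def Mr.l_distr smult_mult_left)
    qed
    show "MV.fin_dim" by (rule dim(1))
    show "(\<lambda>a. a \<otimes>\<^bsub>M\<^esub> e) ` carrier M = carrier ?NV"
    proof (intro equalityI subsetI)
      fix x assume "x \<in> (\<lambda>a. a \<otimes>\<^bsub>M\<^esub> e) ` carrier M"
      then obtain a where "a \<in> carrier M" "x = a \<otimes>\<^bsub>M\<^esub> e" by blast
      then show "x \<in> carrier ?NV" using Ne by simp
    next
      fix x assume "x \<in> carrier ?NV"
      then have x: "x \<in> ?N" by simp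
      show "x \<in> (\<lambda>a. a \<otimes>\<^bsub>M\<^esub> e) ` carrier M"
        by (rule image_eqI[where x = x]) (use Ninv[OF x] NM x in auto)
    qed
  qed
  obtain cN where "coordinates ?NV {..<vectorspace.dim class_ring ?NV} cN"
    using fin_dim_coordinates[OF NVS Nfin] by blast
  then interpret Nc: coordinates ?NV "{..<vectorspace.dim class_ring ?NV}" cN .
  let ?r = "vectorspace.dim class_ring ?NV"
  define c' where "c' a z = (if fst z < m then cN (a \<otimes>\<^bsub>M\<^esub> B (fst z) \<otimes>\<^bsub>M\<^esub> e) (snd z) else 0)" for a z
  have BN: "a \<otimes>\<^bsub>M\<^esub> B j \<otimes>\<^bsub>M\<^esub> e \<in> ?N" if "a \<in> carrier M" "j < m" for a j
    using Ne that B_in by simp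
  \<comment> \<open>Every matrix is \<open>\<Sum> w\<^sub>i A\<^sub>i\<close> with coinvariant \<open>w\<^sub>i = a B\<^sub>i e\<close>.\<close>
  have expand: "(\<Oplus>\<^bsub>M\<^esub>i\<in>{..<m}. a \<otimes>\<^bsub>M\<^esub> B i \<otimes>\<^bsub>M\<^esub> e \<otimes>\<^bsub>M\<^esub> A i) = a" if a: "a \<in> carrier M" for a
  proof (rule emb_i)
    have in1: "a \<otimes>\<^bsub>M\<^esub> B i \<otimes>\<^bsub>M\<^esub> e \<otimes>\<^bsub>M\<^esub> A i \<in> carrier M" if "i < m" for i
      using that a e_in A_in B_in by simp
    show "(\<Oplus>\<^bsub>M\<^esub>i\<in>{..<m}. a \<otimes>\<^bsub>M\<^esub> B i \<otimes>\<^bsub>M\<^esub> e \<otimes>\<^bsub>M\<^esub> A i) \<in> carrier M" by (rule finsum_in) (simp add: in1)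
    have "emb n (\<Oplus>\<^bsub>M\<^esub>i\<in>{..<m}. a \<otimes>\<^bsub>M\<^esub> B i \<otimes>\<^bsub>M\<^esub> e \<otimes>\<^bsub>M\<^esub> A i) = emb n a * (\<Sum>i<m. ?B i * He.e * ?A i)"
      using a e_in A_in B_in by (simp add: emb_sum in1 emb_m e sum_distrib_left mult.assoc cong: sum.cong_simp)
    then show "emb n (\<Oplus>\<^bsub>M\<^esub>i\<in>{..<m}. a \<otimes>\<^bsub>M\<^esub> B i \<otimes>\<^bsub>M\<^esub> e \<otimes>\<^bsub>M\<^esub> A i) = emb n a"
      using He.sum_B_e_A emb_u[OF a] by simp
  qed (rule a)
  have "coordinates M ({..<m} \<times> {..<?r}) c'"
  proof (rule coordinates.intro[OF vs])
    show "c' (x \<oplus>\<^bsub>M\<^esub> y) i = c' x i + c' y i" if "x \<in> carrier M" "y \<in> carrier M" for x y i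
      using that Nc.c_add[OF _ _, of "x \<otimes>\<^bsub>M\<^esub> B (fst i) \<otimes>\<^bsub>M\<^esub> e" "y \<otimes>\<^bsub>M\<^esub> B (fst i) \<otimes>\<^bsub>M\<^esub> e" "snd i"] BN
      by (auto simp: c'_def Mr.l_distr B_in e_in)
    show "c' (k \<odot>\<^bsub>M\<^esub> x) i = k * c' x i" if "x \<in> carrier M" for k x i
      using that Nc.c_smult[of "x \<otimes>\<^bsub>M\<^esub> B (fst i) \<otimes>\<^bsub>M\<^esub> e" k "snd i"] BN
      by (auto simp: c'_def smult_mult_left B_in e_in)
    show "bij_betw c' (carrier M) {f. \<forall>i. i \<notin> {..<m} \<times> {..<?r} \<longrightarrow> f i = 0}"
      unfolding bij_betw_def
    proof
      show "inj_on c' (carrier M)"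
      proof (rule inj_onI)
        fix x y assume xy: "x \<in> carrier M" "y \<in> carrier M" "c' x = c' y"
        have "x \<otimes>\<^bsub>M\<^esub> B j \<otimes>\<^bsub>M\<^esub> e = y \<otimes>\<^bsub>M\<^esub> B j \<otimes>\<^bsub>M\<^esub> e" if "j < m" for j
        proof (rule Nc.c_inj)
          fix k assume "k \<in> {..<?r}"
          show "cN (x \<otimes>\<^bsub>M\<^esub> B j \<otimes>\<^bsub>M\<^esub> e) k = cN (y \<otimes>\<^bsub>M\<^esub> B j \<otimes>\<^bsub>M\<^esub> e) k"
            using fun_cong[OF xy(3), of "(j, k)"] that by (simp add: c'_def)
        qed (use BN xy that in auto)
        then have "(\<Oplus>\<^bsub>M\<^esub>i\<in>{..<m}. x \<otimes>\<^bsub>M\<^esub> B i \<otimes>\<^bsub>M\<^esub> e \<otimes>\<^bsub>M\<^esub> A i) = (\<Oplus>\<^bsub>M\<^esub>i\<in>{..<m}. y \<otimes>\<^bsub>M\<^esub> B i \<otimes>\<^bsub>M\<^esub> e \<otimes>\<^bsub>M\<^esub> A i)"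
          using xy A_in B_in e_in by (intro Mr.finsum_cong') auto
        then show "x = y" using expand xy by simp
      qed
      show "c' ` carrier M = {f. \<forall>i. i \<notin> {..<m} \<times> {..<?r} \<longrightarrow> f i = 0}"
      proof (intro equalityI subsetI)
        fix g assume "g \<in> c' ` carrier M"
        then obtain a where a: "a \<in> carrier M" "g = c' a" by auto
        have "c' a (j, k) = 0" if "(j, k) \<notin> {..<m} \<times> {..<?r}" for j k
          using that Nc.c_out[of "a \<otimes>\<^bsub>M\<^esub> B j \<otimes>\<^bsub>M\<^esub> e" k] BN[OF a(1), of j] by (auto simp: c'_def)
        then show "g \<in> {f. \<forall>i. i \<notin> {..<m} \<times> {..<?r} \<longrightarrow> f i = 0}" using a by auto
      next
        fix g :: "nat \<times> nat \<Rightarrow> 'k" assume g: "g \<in> {f. \<forall>i. i \<notin> {..<m} \<times> {..<?r} \<longrightarrow> f i = 0}"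
        define w where "w i = Nc.vec (\<lambda>k. g (i, k))" for i
        have w: "w i \<in> ?N" for i using Nc.vec_in[of "\<lambda>k. g (i, k)"] by (simp add: w_def)
        have wM: "w i \<in> carrier M" for i using w NM by auto
        define a where "a = (\<Oplus>\<^bsub>M\<^esub>i\<in>{..<m}. w i \<otimes>\<^bsub>M\<^esub> A i)"
        have wA: "w i \<otimes>\<^bsub>M\<^esub> A i \<in> carrier M" if "i < m" for i using that A_in wM by simp
        have a: "a \<in> carrier M" unfolding a_def by (rule finsum_in) (simp add: wA)
        have aw: "a \<otimes>\<^bsub>M\<^esub> B j \<otimes>\<^bsub>M\<^esub> e = w j" if j: "j < m" for j
        proof (rule emb_i)
          show "a \<otimes>\<^bsub>M\<^esub> B j \<otimes>\<^bsub>M\<^esub> e \<in> carrier M" using a j B_in e_in by simp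
          have "emb n (w i) * He.e = emb n (w i)" for i
            using emb_m[OF wM e_in, of i] Ninv[OF w, of i] by (simp add: e)
          then have 1: "emb n (w i) * He.e * (?A i * (?B j * He.e)) = emb n (w i) * (?A i * (?B j * He.e))" for i
            by simp
          have 2: "emb n a = (\<Sum>i<m. emb n (w i) * ?A i)"
            unfolding a_def by (subst emb_sum[OF wA]) (simp_all add: emb_m wM A_in cong: sum.cong_simp)
          have "emb n (a \<otimes>\<^bsub>M\<^esub> B j \<otimes>\<^bsub>M\<^esub> e) = emb n a * ?B j * He.e"
            using a j B_in e_in by (simp add: emb_m e)
          also have "\<dots> = (\<Sum>i<m. emb n (w i) * (?A i * (?B j * He.e)))"
            unfolding 2 by (simp add: sum_distrib_right mult.assoc)
          also have "\<dots> = (\<Sum>i<m. emb n (w i) * He.e * (?A i * (?B j * He.e)))"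
            by (simp only: 1)
          also have "\<dots> = (\<Sum>i<m. emb n (w i) * (He.e * ?A i * ?B j * He.e))"
            by (simp only: mult.assoc)
          also have "\<dots> = (\<Sum>i<m. if i = j then emb n (w i) * He.e else 0)"
            using j by (intro sum.cong refl) (simp add: He.e_A_B_e)
          also have "\<dots> = emb n (w j)"
            using j emb_m[OF wM e_in, of j] Ninv[OF w, of j] by (simp add: e)
          finally show "emb n (a \<otimes>\<^bsub>M\<^esub> B j \<otimes>\<^bsub>M\<^esub> e) = emb n (w j)" .
        qed (rule wM)
        have "c' a (j, k) = g (j, k)" for j k
          using g aw Nc.c_vec[of "\<lambda>k. g (j, k)" k] by (auto simp: c'_def w_def)
        then have "g = c' a" by auto
        then show "g \<in> c' ` carrier M" using a by (rule image_eqI)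
      qed
    qed
  qed simp
  then interpret C': coordinates M "{..<m} \<times> {..<?r}" c' .
  show "n\<^sup>2 = m * ?r"
    using C'.dim(2) dim(2) by (simp add: card_cartesian_product power2_eq_square)
qed

end

section \<open>From the Heisenberg relations to the Hopf algebra of a solution\<close>

lemma (in algebra_coordinates) c_mult_lincomb_right:
  assumes "x \<in> carrier A" "Y \<in> carrier A" "\<And>k. k \<in> K \<Longrightarrow> v k \<in> carrier A"
    and Y: "\<And>p. p \<in> I \<Longrightarrow> c Y p = (\<Sum>k\<in>K. b k * c (v k) p)" and z: "z \<in> I"
  shows "c (x \<otimes> Y) z = (\<Sum>k\<in>K. b k * c (x \<otimes> v k) z)"
proof -
  have "c (x \<otimes> Y) z = (\<Sum>p\<in>I. \<Sum>q\<in>I. \<Sum>k\<in>K. b k * (c x p * c (v k) q * \<mu> p q z))"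
    using assms by (simp add: c_mult sum_distrib_left sum_distrib_right ac_simps)
  also have "\<dots> = (\<Sum>k\<in>K. \<Sum>p\<in>I. \<Sum>q\<in>I. b k * (c x p * c (v k) q * \<mu> p q z))"
    by (rule sum_rotate3')
  finally show ?thesis using assms by (simp add: c_mult sum_distrib_left)
qed

lemma (in algebra_coordinates) c_mult_lincomb_left:
  assumes "y \<in> carrier A" "X \<in> carrier A" "\<And>k. k \<in> K \<Longrightarrow> v k \<in> carrier A"
    and X: "\<And>p. p \<in> I \<Longrightarrow> c X p = (\<Sum>k\<in>K. b k * c (v k) p)" and z: "z \<in> I"
  shows "c (X \<otimes> y) z = (\<Sum>k\<in>K. b k * c (v k \<otimes> y) z)"
proof -
  have "c (X \<otimes> y) z = (\<Sum>p\<in>I. \<Sum>q\<in>I. \<Sum>k\<in>K. b k * (c (v k) p * c y q * \<mu> p q z))"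
    using assms by (simp add: c_mult sum_distrib_left sum_distrib_right ac_simps)
  also have "\<dots> = (\<Sum>k\<in>K. \<Sum>p\<in>I. \<Sum>q\<in>I. b k * (c (v k) p * c y q * \<mu> p q z))"
    by (rule sum_rotate3')
  finally show ?thesis using assms by (simp add: c_mult sum_distrib_left)
qed

text \<open>
  A solution whose legs satisfy the Heisenberg relations of the Hopf algebra \<open>L\<close>, and whose inverse is
  \<open>\<Sum> S(A\<^sub>i) \<otimes> B\<^sub>i\<close>.
\<close>

locale hopf_realization = pentagon_solution M I c R m A B + Lh: hopf_coordinates L "{..<m}" cL
  for M :: "('k :: field, 'a) module" (structure) and I :: "'i set" and c :: "'a \<Rightarrow> 'i \<Rightarrow> 'k"
    and R and m :: nat and A B :: "nat \<Rightarrow> 'a"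
    and L :: "('k, 'l) hopf" and cL :: "'l \<Rightarrow> nat \<Rightarrow> 'k" +
  assumes A_mult: "\<And>r i x. r < m \<Longrightarrow> i < m \<Longrightarrow> x \<in> I \<Longrightarrow> c (A r \<otimes> A i) x = (\<Sum>q<m. Lh.str r i q * c (A q) x)"
    and A_one: "\<And>x. x \<in> I \<Longrightarrow> (\<Sum>k<m. cL \<one>\<^bsub>L\<^esub> k * c (A k) x) = c \<one> x"
    and dco_d: "\<And>p i j. p < m \<Longrightarrow> i < m \<Longrightarrow> j < m \<Longrightarrow> Lh.dco p i j = d p i j"
    and B_one: "\<And>y. y \<in> I \<Longrightarrow> (\<Sum>i<m. counit L (Lh.bas i) * c (B i) y) = c \<one> y"
    and inv_rep: "T2.rep (inv\<^bsub>tensor M M\<^esub> R) {..<m}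
      (\<lambda>i. \<Oplus>a\<in>{..<m}. cL (antipode L (Lh.bas i)) a \<odot> A a) B"
begin

definition realize :: "'l \<Rightarrow> 'a" where "realize x = (\<Oplus>k\<in>{..<m}. cL x k \<odot> A k)"

lemma realize_in: "realize x \<in> carrier M"
  unfolding realize_def by (rule lincomb_in) (simp add: A_in)

lemma c_realize: "c (realize x) z = (\<Sum>k<m. cL x k * c (A k) z)"
  unfolding realize_def by (rule c_lincomb) (simp add: A_in)

lemma realize_in_SA: "realize x \<in> SA"
  using mem_span_iff[of m A "realize x"] A_in realize_in c_realize by blast

lemma realize_add: "x \<in> carrier L \<Longrightarrow> y \<in> carrier L \<Longrightarrow> realize (x \<oplus>\<^bsub>L\<^esub> y) = realize x \<oplus> realize y"
  by (rule c_inj)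
    (simp_all add: realize_in add_in c_add c_realize Lh.c_add distrib_right sum.distrib)

lemma realize_smult: "x \<in> carrier L \<Longrightarrow> realize (k \<odot>\<^bsub>L\<^esub> x) = k \<odot> realize x"
  by (rule c_inj)
    (simp_all add: realize_in smult_in c_smult c_realize Lh.c_smult sum_distrib_left mult.assoc)

lemma realize_one: "realize \<one>\<^bsub>L\<^esub> = \<one>"
proof -
  interpret Mr: ring M by (rule ring_M)
  show ?thesis by (rule c_inj) (simp_all add: realize_in c_realize A_one)
qed

lemma realize_mult:
  assumes "x \<in> carrier L" "y \<in> carrier L"
  shows "realize (x \<otimes>\<^bsub>L\<^esub> y) = realize x \<otimes> realize y"
proof (rule c_inj)
  show "realize x \<otimes> realize y \<in> carrier M" by (intro MA.mult_in realize_in)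
  fix z assume z: "z \<in> I"
  have "c (realize x \<otimes> realize y) z = (\<Sum>k<m. cL x k * c (A k \<otimes> realize y) z)"
    by (rule MA.c_mult_lincomb_left) (simp_all add: realize_in A_in c_realize z)
  also have "\<dots> = (\<Sum>k<m. cL x k * (\<Sum>l<m. cL y l * c (A k \<otimes> A l) z))"
  proof (intro sum.cong refl arg_cong2[where f = "(*)"])
    fix k assume "k \<in> {..<m}"
    then show "c (A k \<otimes> realize y) z = (\<Sum>l<m. cL y l * c (A k \<otimes> A l) z)"
      by (intro MA.c_mult_lincomb_right) (simp_all add: realize_in A_in c_realize z)
  qed
  also have "\<dots> = (\<Sum>k<m. \<Sum>l<m. \<Sum>q<m. cL x k * cL y l * Lh.str k l q * c (A q) z)"
    using z by (simp add: A_mult sum_distrib_left mult.assoc cong: sum.cong_simp)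
  also have "\<dots> = (\<Sum>q<m. (\<Sum>k<m. \<Sum>l<m. cL x k * cL y l * Lh.str k l q) * c (A q) z)"
    unfolding sum_distrib_right by (rule sum_rotate3')
  also have "\<dots> = (\<Sum>q<m. cL (x \<otimes>\<^bsub>L\<^esub> y) q * c (A q) z)"
    using assms by (intro sum.cong refl) (simp add: Lh.LA.c_mult)
  finally show "c (realize (x \<otimes>\<^bsub>L\<^esub> y)) z = c (realize x \<otimes> realize y) z" by (simp add: c_realize)
qed (rule realize_in)

lemma realize_bij: "bij_betw realize (carrier L) SA"
  unfolding bij_betw_def
proof
  show "inj_on realize (carrier L)"
  proof (rule inj_onI)
    fix x y assume xy: "x \<in> carrier L" "y \<in> carrier L" "realize x = realize y"
    show "x = y"
    proof (rule Lh.c_inj[OF xy(1,2)])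
      fix k assume "k \<in> {..<m}"
      then show "cL x k = cL y k"
        by (intro indep_eqD[OF A_indep, of "cL x" "cL y"]) (simp_all add: c_realize[symmetric] xy(3))
    qed
  qed
  show "realize ` carrier L = SA"
  proof (intro equalityI subsetI)
    fix y assume "y \<in> SA"
    then obtain g where y: "y \<in> carrier M" and g: "\<And>i. i \<in> I \<Longrightarrow> c y i = (\<Sum>k<m. g k * c (A k) i)"
      using mem_span_iff[of m A y] A_in by blast
    have "y = realize (Lh.vec g)"
      by (rule c_inj[OF y realize_in]) (simp add: c_realize Lh.c_vec g)
    then show "y \<in> realize ` carrier L" using Lh.vec_in by blast
  qed (use realize_in_SA in auto)
qed

text \<open>
  Linearity reduces this to basis vectors, where it is the formula \<open>R\<^sup>-\<^sup>1 (1 \<otimes> A\<^sub>p) R = \<Delta>(A\<^sub>p)\<close>.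
\<close>

lemma conj_realize:
  assumes x: "x \<in> carrier L" and ab: "a \<in> I" "b \<in> I"
  shows "T2.coT (inv\<^bsub>tensor M M\<^esub> R \<otimes>\<^bsub>tensor M M\<^esub> pure_tensor M M \<one> (realize x) \<otimes>\<^bsub>tensor M M\<^esub> R) (a, b)
    = (\<Sum>j<m. \<Sum>k<m. Lh.L2.coT (comult L x) (j, k) * (c (A j) a * c (A k) b))"
proof -
  interpret Mr: ring M by (rule ring_M)
  let ?U = "inv\<^bsub>tensor M M\<^esub> R" and ?p = "pure_tensor M M \<one>"
  have p_in: "?p y \<in> carrier (tensor M M)" if "y \<in> carrier M" for y
    using that by (intro T2.pure_in) auto
  have 1: "T2.coT (?p (realize x)) z = (\<Sum>p<m. cL x p * T2.coT (?p (A p)) z)" if z: "z \<in> I \<times> I" for z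
    using z by (auto simp: T2.coT_pure realize_in A_in c_realize sum_distrib_left ac_simps cong: sum.cong_simp)
  have 2: "T2.coT (?U \<otimes>\<^bsub>tensor M M\<^esub> ?p (realize x)) z = (\<Sum>p<m. cL x p * T2.coT (?U \<otimes>\<^bsub>tensor M M\<^esub> ?p (A p)) z)"
    if "z \<in> I \<times> I" for z
    by (rule T2.TA.c_mult_lincomb_right[OF inv_R_in p_in p_in 1 that]) (simp_all add: realize_in A_in)
  have "T2.coT (?U \<otimes>\<^bsub>tensor M M\<^esub> ?p (realize x) \<otimes>\<^bsub>tensor M M\<^esub> R) (a, b)
    = (\<Sum>p<m. cL x p * T2.coT (?U \<otimes>\<^bsub>tensor M M\<^esub> ?p (A p) \<otimes>\<^bsub>tensor M M\<^esub> R) (a, b))"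
    by (rule T2.TA.c_mult_lincomb_left[OF R_in _ _ 2])
      (use ab in \<open>auto intro!: T2.TA.mult_in inv_R_in p_in realize_in A_in\<close>)
  also have "\<dots> = (\<Sum>p<m. \<Sum>j<m. \<Sum>k<m. cL x p * Lh.dco p j k * (c (A j) a * c (A k) b))"
  proof (intro sum.cong refl)
    fix p assume p: "p \<in> {..<m}"
    have "T2.coT (X (d p)) (a, b) = (\<Sum>j<m. \<Sum>k<m. d p j k * (c (A j) a * c (A k) b))"
      using T2.repD(4)[OF X_rep[of "d p"] ab]
      by (simp add: sum.cartesian_product' A_in c_smult mult.assoc cong: sum.cong_simp)
    then show "cL x p * T2.coT (?U \<otimes>\<^bsub>tensor M M\<^esub> ?p (A p) \<otimes>\<^bsub>tensor M M\<^esub> R) (a, b)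
      = (\<Sum>j<m. \<Sum>k<m. cL x p * Lh.dco p j k * (c (A j) a * c (A k) b))"
      using p by (simp add: conj_X dco_d sum_distrib_left mult.assoc cong: sum.cong_simp)
  qed
  also have "\<dots> = (\<Sum>j<m. \<Sum>k<m. (\<Sum>p<m. cL x p * Lh.dco p j k) * (c (A j) a * c (A k) b))"
    unfolding sum_distrib_right by (rule sum_rotate3)
  finally show ?thesis by (simp add: Lh.comult_coords[OF x] cong: sum.cong_simp)
qed

text \<open>
  The Hopf algebra on the right is formed from a second decomposition \<open>R = \<Sum> A'\<^sub>p \<otimes> B'\<^sub>p\<close>. Let
  \<open>A\<^sub>i = \<Sum> q i p A'\<^sub>p\<close> and \<open>A'\<^sub>p = \<Sum> w p k A\<^sub>k\<close>; comparing the two decompositions gives \<open>B'\<^sub>p = \<Sum> q i p B\<^sub>i\<close> and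
  \<open>B\<^sub>k = \<Sum> w p k B'\<^sub>p\<close>. Since \<open>q\<close> and \<open>w\<close> are inverse to each other (fact \<open>pairing\<close>), the counit and the
  antipode, which contract an \<open>A'\<close>-coordinate with a \<open>B'\<close>-coordinate, may be computed with \<open>A\<close> and \<open>B\<close>.
\<close>

lemma realize_iso:
  fixes H :: "('k, 'a) hopf" and m' :: nat
  assumes r': "T2.rep R {..<m'} A' B'" and A'_indep: "indep m' A'" and B'_indep: "indep m' B'"
    and H: "carrier H = vspan M (A' ` {..<m'})" "mult H = mult M" "one H = one M" "zero H = zero M" "add H = add M"
      "Module.smult H = Module.smult M"
      "\<And>x. comult H x = tensor_restrict M (vspan M (A' ` {..<m'})) M (vspan M (A' ` {..<m'}))
        (inv\<^bsub>tensor M M\<^esub> R \<otimes>\<^bsub>tensor M M\<^esub> pure_tensor M M \<one> x \<otimes>\<^bsub>tensor M M\<^esub> R)"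
      "\<And>x. counit H x = (\<Sum>p<m'. dual_basis M m' A' p x * dual_basis M m' B' p \<one>)"
      "\<And>x. antipode H x = (\<Oplus>p \<in> {..<m'}. dual_basis M m' A' p x \<odot>
          tensor_lift M (\<lambda>u v. dual_basis M m' B' p v \<odot> u)
            (tensor_restrict M (carrier M) M (vspan M (B' ` {..<m'})) (inv\<^bsub>tensor M M\<^esub> R)))"
  shows "hopf_isomorphic L H"
proof -
  interpret Mr: ring M by (rule ring_M)
  have A'_in: "p < m' \<Longrightarrow> A' p \<in> carrier M" and B'_in: "p < m' \<Longrightarrow> B' p \<in> carrier M" for p
    using T2.repD(2,3)[OF r'] by auto
  obtain q where q: "\<And>i x. i < m \<Longrightarrow> x \<in> I \<Longrightarrow> c (A i) x = (\<Sum>p<m'. q i p * c (A' p) x)"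
    using first_leg_in_span[OF r' R_rep B_indep] by metis
  obtain w where w: "\<And>p x. p < m' \<Longrightarrow> x \<in> I \<Longrightarrow> c (A' p) x = (\<Sum>k<m. w p k * c (A k) x)"
    using first_leg_in_span[OF R_rep r' B'_indep] by metis
  have expA: "(\<Sum>i<m. g i * c (A i) x) = (\<Sum>p<m'. (\<Sum>i<m. g i * q i p) * c (A' p) x)" if "x \<in> I" for g x
  proof -
    have "(\<Sum>i<m. g i * c (A i) x) = (\<Sum>i<m. \<Sum>p<m'. g i * q i p * c (A' p) x)"
      using that by (simp add: q sum_distrib_left mult.assoc cong: sum.cong_simp)
    also have "\<dots> = (\<Sum>p<m'. \<Sum>i<m. g i * q i p * c (A' p) x)" by (rule sum.swap)
    finally show ?thesis by (simp add: sum_distrib_right)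
  qed
  have expA': "(\<Sum>p<m'. g p * c (A' p) x) = (\<Sum>k<m. (\<Sum>p<m'. g p * w p k) * c (A k) x)" if "x \<in> I" for g x
  proof -
    have "(\<Sum>p<m'. g p * c (A' p) x) = (\<Sum>p<m'. \<Sum>k<m. g p * w p k * c (A k) x)"
      using that by (simp add: w sum_distrib_left mult.assoc cong: sum.cong_simp)
    also have "\<dots> = (\<Sum>k<m. \<Sum>p<m'. g p * w p k * c (A k) x)" by (rule sum.swap)
    finally show ?thesis by (simp add: sum_distrib_right)
  qed
  have R_eq: "(\<Sum>p<m'. c (A' p) x * c (B' p) y) = (\<Sum>i<m. c (A i) x * c (B i) y)" if "x \<in> I" "y \<in> I" for x y
    using T2.repD(4)[OF r' that] T2.repD(4)[OF R_rep that] by simp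
  have wB: "c (B k) y = (\<Sum>p<m'. w p k * c (B' p) y)" if k: "k < m" and y: "y \<in> I" for k y
  proof -
    have "(\<lambda>k. c (B k) y) k = (\<lambda>k. \<Sum>p<m'. c (B' p) y * w p k) k"
    proof (rule indep_eqD[OF A_indep _ k])
      fix x assume x: "x \<in> I"
      show "(\<Sum>k<m. c (B k) y * c (A k) x) = (\<Sum>k<m. (\<Sum>p<m'. c (B' p) y * w p k) * c (A k) x)"
        using R_eq[OF x y] expA'[OF x, of "\<lambda>p. c (B' p) y"] by (simp add: mult.commute)
    qed
    then show ?thesis by (simp add: mult.commute)
  qed
  have qB: "c (B' p) y = (\<Sum>i<m. q i p * c (B i) y)" if p: "p < m'" and y: "y \<in> I" for p y
  proof -
    have "(\<lambda>p. c (B' p) y) p = (\<lambda>p. \<Sum>i<m. c (B i) y * q i p) p"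
    proof (rule indep_eqD[OF A'_indep _ p])
      fix x assume x: "x \<in> I"
      show "(\<Sum>p<m'. c (B' p) y * c (A' p) x) = (\<Sum>p<m'. (\<Sum>i<m. c (B i) y * q i p) * c (A' p) x)"
        using R_eq[OF x y] expA[OF x, of "\<lambda>i. c (B i) y"] by (simp add: mult.commute)
    qed
    then show ?thesis by (simp add: mult.commute)
  qed
  have expB: "(\<Sum>i<m. g i * c (B i) x) = (\<Sum>p<m'. (\<Sum>i<m. g i * w p i) * c (B' p) x)" if "x \<in> I" for g x
  proof -
    have "(\<Sum>i<m. g i * c (B i) x) = (\<Sum>i<m. \<Sum>p<m'. g i * w p i * c (B' p) x)"
      using that by (simp add: wB sum_distrib_left mult.assoc cong: sum.cong_simp)
    also have "\<dots> = (\<Sum>p<m'. \<Sum>i<m. g i * w p i * c (B' p) x)" by (rule sum.swap)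
    finally show ?thesis by (simp add: sum_distrib_right)
  qed
  have qw: "(\<Sum>p<m'. q i p * w p k) = (if k = i then 1 else 0)" if "i < m" "k < m" for i k
  proof -
    have "(\<lambda>k. \<Sum>p<m'. q i p * w p k) k = (\<lambda>k. if k = i then 1 else 0) k"
    proof (rule indep_eqD[OF A_indep _ that(2)])
      fix x assume x: "x \<in> I"
      have "(\<Sum>k<m. (\<Sum>p<m'. q i p * w p k) * c (A k) x) = c (A i) x"
        using expA'[OF x, of "q i"] q[OF that(1) x] by simp
      then show "(\<Sum>k<m. (\<Sum>p<m'. q i p * w p k) * c (A k) x) = (\<Sum>k<m. (if k = i then 1 else 0) * c (A k) x)"
        using that by (simp add: delta_mult)
    qed
    then show ?thesis by simp
  qed
  have pairing: "(\<Sum>p<m'. (\<Sum>i<m. g i * q i p) * (\<Sum>k<m. h k * w p k)) = (\<Sum>i<m. g i * h i)" for g h :: "nat \<Rightarrow> 'k"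
  proof -
    have "(\<Sum>p<m'. (\<Sum>i<m. g i * q i p) * (\<Sum>k<m. h k * w p k))
      = (\<Sum>p<m'. \<Sum>i<m. \<Sum>k<m. g i * h k * (q i p * w p k))"
      by (simp add: sum_product ac_simps)
    also have "\<dots> = (\<Sum>i<m. \<Sum>k<m. \<Sum>p<m'. g i * h k * (q i p * w p k))" by (rule sum_rotate3)
    also have "\<dots> = (\<Sum>i<m. \<Sum>k<m. g i * h k * (if k = i then 1 else 0))"
      by (intro sum.cong refl) (simp add: sum_distrib_left[symmetric] qw)
    also have "\<dots> = (\<Sum>i<m. g i * h i)" by (intro sum.cong refl) (simp add: delta_mult)
    finally show ?thesis .
  qed
  have SA': "vspan M (A' ` {..<m'}) = SA"
  proof (intro equalityI subsetI)
    fix x assume "x \<in> vspan M (A' ` {..<m'})"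
    then obtain g where x: "x \<in> carrier M" and "\<forall>i\<in>I. c x i = (\<Sum>p<m'. g p * c (A' p) i)"
      using mem_span_iff[of m' A' x] A'_in by blast
    then have "\<forall>i\<in>I. c x i = (\<Sum>k<m. (\<Sum>p<m'. g p * w p k) * c (A k) i)" using expA'[of _ g] by simp
    then have "\<exists>h. \<forall>i\<in>I. c x i = (\<Sum>k<m. h k * c (A k) i)"
      by (rule exI[of _ "\<lambda>k. \<Sum>p<m'. g p * w p k"])
    then show "x \<in> SA" using mem_span_iff[of m A x] A_in x by blast
  next
    fix x assume "x \<in> SA"
    then obtain g where x: "x \<in> carrier M" and "\<forall>i\<in>I. c x i = (\<Sum>p<m. g p * c (A p) i)"
      using mem_span_iff[of m A x] A_in by blast
    then have "\<forall>i\<in>I. c x i = (\<Sum>p<m'. (\<Sum>i<m. g i * q i p) * c (A' p) i)" using expA[of _ g] by simp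
    then have "\<exists>h. \<forall>i\<in>I. c x i = (\<Sum>p<m'. h p * c (A' p) i)"
      by (rule exI[of _ "\<lambda>p. \<Sum>i<m. g i * q i p"])
    then show "x \<in> vspan M (A' ` {..<m'})" using mem_span_iff[of m' A' x] A'_in x by blast
  qed
  have SB': "vspan M (B' ` {..<m'}) = vspan M (B ` {..<m})"
  proof (intro equalityI subsetI)
    fix x assume "x \<in> vspan M (B' ` {..<m'})"
    then obtain g where x: "x \<in> carrier M" and g: "\<forall>i\<in>I. c x i = (\<Sum>p<m'. g p * c (B' p) i)"
      using mem_span_iff[of m' B' x] B'_in by blast
    have h: "c x y = (\<Sum>i<m. (\<Sum>p<m'. g p * q i p) * c (B i) y)" if "y \<in> I" for y
    proof -
      have "c x y = (\<Sum>p<m'. \<Sum>i<m. g p * q i p * c (B i) y)"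
        using that g by (simp add: qB sum_distrib_left mult.assoc cong: sum.cong_simp)
      also have "\<dots> = (\<Sum>i<m. \<Sum>p<m'. g p * q i p * c (B i) y)" by (rule sum.swap)
      finally show ?thesis by (simp add: sum_distrib_right)
    qed
    have "\<exists>h. \<forall>i\<in>I. c x i = (\<Sum>k<m. h k * c (B k) i)"
      by (rule exI[of _ "\<lambda>i. \<Sum>p<m'. g p * q i p"]) (use h in blast)
    then show "x \<in> vspan M (B ` {..<m})" using mem_span_iff[of m B x] B_in x by blast
  next
    fix x assume "x \<in> vspan M (B ` {..<m})"
    then obtain g where x: "x \<in> carrier M" and "\<forall>i\<in>I. c x i = (\<Sum>p<m. g p * c (B p) i)"
      using mem_span_iff[of m B x] B_in by blast
    then have "\<forall>i\<in>I. c x i = (\<Sum>p<m'. (\<Sum>i<m. g i * w p i) * c (B' p) i)" using expB[of _ g] by simp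
    then have "\<exists>h. \<forall>i\<in>I. c x i = (\<Sum>p<m'. h p * c (B' p) i)"
      by (rule exI[of _ "\<lambda>p. \<Sum>i<m. g i * w p i"])
    then show "x \<in> vspan M (B' ` {..<m'})" using mem_span_iff[of m' B' x] B'_in x by blast
  qed
  have dualA': "dual_basis M m' A' p (realize x) = (\<Sum>i<m. cL x i * q i p)" if "p < m'" for p x
    by (rule dual_basis_eq[OF A'_indep A'_in realize_in _ that]) (simp_all add: c_realize expA)
  have dualB': "dual_basis M m' B' p v = (\<Sum>i<m. g i * w p i)"
    if "p < m'" "v \<in> carrier M" "\<And>y. y \<in> I \<Longrightarrow> c v y = (\<Sum>i<m. g i * c (B i) y)" for p v g
    by (rule dual_basis_eq[OF B'_indep B'_in that(2) _ that(1)]) (simp_all add: that(3) expB)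
  obtain cV where sub: "subco SA {..<m} cV A"
    and "\<And>k l. k < m \<Longrightarrow> cV (A k) l = (if l = k then 1 else 0)"
    and cVe: "\<And>x d k. x \<in> carrier M \<Longrightarrow> (\<And>i. i \<in> I \<Longrightarrow> c x i = (\<Sum>k<m. d k * c (A k) i)) \<Longrightarrow> k < m \<Longrightarrow> cV x k = d k"
    using subco_span[OF A_indep A_in] by blast
  have comult: "comult H (realize x) = tensor_map H H realize realize (comult L x)" if x: "x \<in> carrier L" for x
  proof -
    interpret V: coordinates "M\<lparr>carrier := SA\<rparr>" "{..<m}" cV using sub by (simp add: subco_def)
    have T: "tensor H H = tensor (M\<lparr>carrier := SA\<rparr>) (M\<lparr>carrier := SA\<rparr>)"
      "pure_tensor H H = pure_tensor (M\<lparr>carrier := SA\<rparr>) (M\<lparr>carrier := SA\<rparr>)"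
      by (rule tensor_cong; simp add: H SA')+
    have TM: "tensor_map H H realize realize (comult L x) = tensor_map (M\<lparr>carrier := SA\<rparr>) (M\<lparr>carrier := SA\<rparr>) realize realize (comult L x)"
      by (simp add: tensor_map_def T)
    have 1: "\<And>x. x \<in> carrier L \<Longrightarrow> realize x \<in> carrier (M\<lparr>carrier := SA\<rparr>)" by (simp add: realize_in_SA)
    have 2: "cV (realize x) k = cL x k" if "x \<in> carrier L" "k \<in> {..<m}" for x k
      by (rule cVe) (use that in \<open>simp_all add: realize_in c_realize\<close>)
    let ?s = "tensor_map (M\<lparr>carrier := SA\<rparr>) (M\<lparr>carrier := SA\<rparr>) realize realize (comult L x)"
    have tm: "?s \<in> carrier (tensor (M\<lparr>carrier := SA\<rparr>) (M\<lparr>carrier := SA\<rparr>))"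
      "\<And>i j. i < m \<Longrightarrow> j < m \<Longrightarrow> tensor_coordinates.coT cV cV ?s (i, j) = Lh.L2.coT (comult L x) (i, j)"
    proof -
      show "?s \<in> carrier (tensor (M\<lparr>carrier := SA\<rparr>) (M\<lparr>carrier := SA\<rparr>))"
        by (rule tensor_map_coords(1)[where f = realize, OF Lh.coordinates_axioms V.coordinates_axioms _ _ Lh.comult_in[OF x]], erule 1, erule (1) 2)
      fix i j assume "i < m" "j < m"
      then have ij: "i \<in> {..<m}" "j \<in> {..<m}" by simp_all
      show "tensor_coordinates.coT cV cV ?s (i, j) = Lh.L2.coT (comult L x) (i, j)"
        by (rule tensor_map_coords(2)[where f = realize, OF Lh.coordinates_axioms V.coordinates_axioms _ _ Lh.comult_in[OF x] ij], erule 1, erule (1) 2)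
    qed
    show ?thesis unfolding H(7) SA' TM
    proof (rule tensor_restrict_eq[OF sub sub tm(1)])
      show "inv\<^bsub>tensor M M\<^esub> R \<otimes>\<^bsub>tensor M M\<^esub> pure_tensor M M \<one> (realize x) \<otimes>\<^bsub>tensor M M\<^esub> R \<in> carrier (tensor M M)"
        by (intro T2.TA.mult_in inv_R_in T2.pure_in R_in realize_in Mr.one_closed)
      fix i j assume ij: "i \<in> I" "j \<in> I"
      show "T2.coT (inv\<^bsub>tensor M M\<^esub> R \<otimes>\<^bsub>tensor M M\<^esub> pure_tensor M M \<one> (realize x) \<otimes>\<^bsub>tensor M M\<^esub> R) (i, j) =
        (\<Sum>p\<in>{..<m}. \<Sum>q\<in>{..<m}. tensor_coordinates.coT cV cV ?s (p, q) * (c (A p) i * c (A q) j))"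
        unfolding conj_realize[OF x ij] by (intro sum.cong refl) (simp add: tm(2))
    qed
  qed
  have counit: "counit H (realize x) = counit L x" if x: "x \<in> carrier L" for x
  proof -
    have "counit H (realize x) = (\<Sum>p<m'. (\<Sum>i<m. cL x i * q i p) * (\<Sum>k<m. counit L (Lh.bas k) * w p k))"
      unfolding H(8)
    proof (intro sum.cong refl)
      fix p assume "p \<in> {..<m'}"
      then have p: "p < m'" by simp
      show "dual_basis M m' A' p (realize x) * dual_basis M m' B' p \<one>
        = (\<Sum>i<m. cL x i * q i p) * (\<Sum>k<m. counit L (Lh.bas k) * w p k)"
        unfolding dualA'[OF p]
        by (rule arg_cong2[where f = "(*)", OF refl dualB'[OF p Mr.one_closed]]) (rule B_one[symmetric])
    qed
    also have "\<dots> = counit L x" unfolding pairing by (rule Lh.counit_coords[OF x, symmetric])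
    finally show ?thesis .
  qed
  obtain cW where subW: "subco (vspan M (B ` {..<m})) {..<m} cW B"
    by (rule subco_span[OF B_indep B_in])
  define s where "s i = (\<Oplus>a\<in>{..<m}. cL (antipode L (Lh.bas i)) a \<odot> A a)" for i
  have s_realize: "s i = realize (antipode L (Lh.bas i))" for i by (simp add: s_def realize_def)
  have antipode: "antipode H (realize x) = realize (antipode L x)" if x: "x \<in> carrier L" for x
  proof -
    let ?SB = "vspan M (B ` {..<m})" and ?U = "inv\<^bsub>tensor M M\<^esub> R"
    interpret W: coordinates "M\<lparr>carrier := ?SB\<rparr>" "{..<m}" cW using subW by (simp add: subco_def)
    interpret V: coordinates "M\<lparr>carrier := carrier M\<rparr>" I c using subco_carrier by (simp add: subco_def)
    interpret VW: tensor_coordinates "M\<lparr>carrier := carrier M\<rparr>" I c "M\<lparr>carrier := ?SB\<rparr>" "{..<m}" cW by unfold_locales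
    have SBM: "?SB \<subseteq> carrier M" and cSB: "\<And>x i. x \<in> ?SB \<Longrightarrow> i \<in> I \<Longrightarrow> c x i = (\<Sum>k<m. cW x k * c (B k) i)"
      using subW by (auto simp: subco_def)
    define t where "t = VW.T.vec (\<lambda>(z, j). c (s j) z)"
    have t: "t \<in> carrier (tensor (M\<lparr>carrier := carrier M\<rparr>) (M\<lparr>carrier := ?SB\<rparr>))"
      unfolding t_def by (rule VW.T.vec_in)
    have ct: "VW.coT t (z, j) = c (s j) z" if "z \<in> I" "j < m" for z j
      unfolding t_def VW.T.c_vec using that by simp
    have restr: "tensor_restrict M (carrier M) M ?SB ?U = t"
    proof (rule tensor_restrict_eq[OF subco_carrier subW t inv_R_in])
      fix z y assume zy: "z \<in> I" "y \<in> I"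
      have "T2.coT ?U (z, y) = (\<Sum>j<m. c (s j) z * c (B j) y)"
        using T2.repD(4)[OF inv_rep zy] by (simp add: s_def)
      also have "\<dots> = (\<Sum>p\<in>I. if p = z then \<Sum>j<m. c (s j) p * c (B j) y else 0)"
        using zy finI by simp
      also have "\<dots> = (\<Sum>p\<in>I. \<Sum>j<m. VW.coT t (p, j) * (c (bas p) z * c (B j) y))"
        by (intro sum.cong refl) (auto simp: ct c_bas cong: sum.cong_simp)
      finally show "T2.coT ?U (z, y) = (\<Sum>p\<in>I. \<Sum>j\<in>{..<m}. VW.coT t (p, j) * (c (bas p) z * c (B j) y))" .
    qed
    have lift: "tensor_lift M (\<lambda>u v. dual_basis M m' B' p v \<odot> u) t \<in> carrier M"
      "\<And>z. z \<in> I \<Longrightarrow> c (tensor_lift M (\<lambda>u v. dual_basis M m' B' p v \<odot> u) t) z = (\<Sum>j<m. c (s j) z * w p j)"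
      if p: "p < m'" for p
    proof -
      have b1: "dual_basis M m' B' p v \<odot> u \<in> carrier M" if "u \<in> carrier M" for u v
        by (rule smult_in[OF that])
      have b2: "c (dual_basis M m' B' p v \<odot> u) z = (\<Sum>z'\<in>I. \<Sum>j<m. c u z' * cW v j * (if z' = z then w p j else 0))"
        if "u \<in> carrier M" "v \<in> ?SB" "z \<in> I" for u v z
      proof -
        have "c (dual_basis M m' B' p v \<odot> u) z = (\<Sum>j<m. cW v j * w p j) * c u z"
          using that SBM p by (subst dualB'[of p v "cW v"]) (auto simp: cSB c_smult)
        also have "\<dots> = (\<Sum>j<m. c u z * cW v j * w p j)" by (simp add: sum_distrib_left mult.assoc mult.commute[of _ "c u z"])
        also have "\<dots> = (\<Sum>z'\<in>I. \<Sum>j<m. c u z' * cW v j * (if z' = z then w p j else 0))"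
          by (rule sum_delta_left[OF finI that(3), symmetric])
        finally show ?thesis .
      qed
      show "tensor_lift M (\<lambda>u v. dual_basis M m' B' p v \<odot> u) t \<in> carrier M"
        by (rule VW.lift(1)[OF coordinates_axioms _ b2 t]) (simp_all add: b1)
      fix z assume z: "z \<in> I"
      have "c (tensor_lift M (\<lambda>u v. dual_basis M m' B' p v \<odot> u) t) z
        = (\<Sum>z'\<in>I. \<Sum>j<m. VW.coT t (z', j) * (if z' = z then w p j else 0))"
        by (rule VW.lift(2)[OF coordinates_axioms _ b2 t z]) (simp_all add: b1)
      also have "\<dots> = (\<Sum>j<m. VW.coT t (z, j) * w p j)" by (rule sum_delta_left[OF finI z])
      finally show "c (tensor_lift M (\<lambda>u v. dual_basis M m' B' p v \<odot> u) t) z = (\<Sum>j<m. c (s j) z * w p j)"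
        using z by (simp add: ct cong: sum.cong_simp)
    qed
    have H9: "antipode H (realize x) = (\<Oplus>p \<in> {..<m'}. dual_basis M m' A' p (realize x) \<odot>
        tensor_lift M (\<lambda>u v. dual_basis M m' B' p v \<odot> u) t)"
      unfolding H(9) SB' restr ..
    show ?thesis
    proof (rule c_inj)
      show "antipode H (realize x) \<in> carrier M" unfolding H9 by (rule lincomb_in) (simp add: lift)
      fix z assume z: "z \<in> I"
      have "c (antipode H (realize x)) z = (\<Sum>p<m'. dual_basis M m' A' p (realize x) * c (tensor_lift M (\<lambda>u v. dual_basis M m' B' p v \<odot> u) t) z)"
        unfolding H9 by (rule c_lincomb) (simp add: lift)
      also have "\<dots> = (\<Sum>p<m'. (\<Sum>i<m. cL x i * q i p) * (\<Sum>j<m. c (s j) z * w p j))"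
        using z by (intro sum.cong refl) (simp add: dualA' lift)
      also have "\<dots> = (\<Sum>i<m. cL x i * c (s i) z)" by (rule pairing)
      also have "\<dots> = (\<Sum>i<m. \<Sum>a<m. cL x i * cL (antipode L (Lh.bas i)) a * c (A a) z)"
        by (simp add: s_realize c_realize sum_distrib_left mult.assoc)
      also have "\<dots> = (\<Sum>a<m. (\<Sum>i<m. cL x i * cL (antipode L (Lh.bas i)) a) * c (A a) z)"
        by (subst sum.swap) (simp add: sum_distrib_right)
      also have "\<dots> = c (realize (antipode L x)) z"
        by (simp add: c_realize Lh.antipode_coords[OF x])
      finally show "c (antipode H (realize x)) z = c (realize (antipode L x)) z" .
    qed (rule realize_in)
  qed
  have "realize \<in> algebra_hom L H"
    unfolding algebra_hom_def Ring.ring_hom_def LinearCombinations.module_hom_def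
    using realize_in_SA by (auto simp: H SA' realize_mult realize_add realize_smult realize_one)
  moreover have "bij_betw realize (carrier L) (carrier H)" using realize_bij by (simp add: H SA')
  ultimately show ?thesis
    unfolding hopf_isomorphic_def using comult counit antipode by blast
qed

end

context falg
begin

text \<open>
  The antipode axioms show that \<open>\<Sum> A\<^sub>i \<otimes> B\<^sub>i\<close> and \<open>\<Sum> S(A\<^sub>i) \<otimes> B\<^sub>i\<close> are inverse to each other: multiplying the
  second legs collects \<open>\<Sum> \<delta> p i j A\<^sub>i S(A\<^sub>j) = \<epsilon>\<^sub>p\<close> in front of \<open>B\<^sub>p\<close>. The pentagon equation holds because
  its right-hand side \<open>\<Sum> A\<^sub>j \<otimes> A\<^sub>i B\<^sub>j \<otimes> B\<^sub>i\<close>, expanded by the commutation relation, and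
  its left-hand side \<open>\<Sum> A\<^sub>r A\<^sub>a \<otimes> B\<^sub>r A\<^sub>b \<otimes> B\<^sub>a B\<^sub>b\<close>, expanded by the multiplication rules, are the same sum.
\<close>

lemma realization_of_heisenberg_relations:
  fixes L :: "('k, 'l) hopf" and m :: nat and A B :: "nat \<Rightarrow> 'a"
  assumes "hopf_coordinates L {..<m} cL"
  defines "\<mu> \<equiv> hopf_coordinates.str L {..<m} cL" and "\<delta> \<equiv> hopf_coordinates.dco L {..<m} cL"
  assumes A_in: "\<And>i. i < m \<Longrightarrow> A i \<in> carrier M" and B_in: "\<And>i. i < m \<Longrightarrow> B i \<in> carrier M"
    and A_mult: "\<And>r i x. r < m \<Longrightarrow> i < m \<Longrightarrow> x \<in> I \<Longrightarrow> c (A r \<otimes> A i) x = (\<Sum>q<m. \<mu> r i q * c (A q) x)"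
    and B_mult: "\<And>i j x. i < m \<Longrightarrow> j < m \<Longrightarrow> x \<in> I \<Longrightarrow> c (B i \<otimes> B j) x = (\<Sum>p<m. \<delta> p i j * c (B p) x)"
    and AB: "\<And>p q x. p < m \<Longrightarrow> q < m \<Longrightarrow> x \<in> I \<Longrightarrow>
      c (A p \<otimes> B q) x = (\<Sum>r<m. \<Sum>i<m. \<Sum>j<m. \<delta> p i j * \<mu> r i q * c (B r \<otimes> A j) x)"
    and A_one: "\<And>x. x \<in> I \<Longrightarrow> (\<Sum>k<m. cL \<one>\<^bsub>L\<^esub> k * c (A k) x) = c \<one> x"
    and B_one: "\<And>x. x \<in> I \<Longrightarrow> (\<Sum>k<m. counit L (coordinates.bas L {..<m} cL k) * c (B k) x) = c \<one> x"
    and A_indep: "indep m A" and B_indep: "indep m B"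
  obtains R where "hopf_realization M I c R m A B L cL"
proof -
  interpret Lh: hopf_coordinates L "{..<m}" cL by fact
  note \<mu> = \<mu>_def and \<delta> = \<delta>_def
  let ?\<eta> = "cL \<one>\<^bsub>L\<^esub>" and ?\<epsilon> = "\<lambda>p. counit L (Lh.bas p)"
  define S where "S p = cL (antipode L (Lh.bas p))" for p
  have "hopf_sc {..<m} \<mu> \<delta> ?\<eta> ?\<epsilon> S"
    using Lh.hopf_constants unfolding \<mu> \<delta> S_def .
  then interpret S: hopf_sc "{..<m}" \<mu> \<delta> ?\<eta> ?\<epsilon> S .
  interpret Mr: ring M by (rule ring_M)
  define s where "s i = (\<Oplus>a\<in>{..<m}. S i a \<odot> A a)" for i
  have s_in: "s i \<in> carrier M" for i unfolding s_def by (rule lincomb_in) (simp add: A_in)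
  have cs: "c (s i) x = (\<Sum>a<m. S i a * c (A a) x)" for i x
    unfolding s_def by (rule c_lincomb) (simp add: A_in)
  define R where "R = T2.T.vec (\<lambda>(x, y). \<Sum>i<m. c (A i) x * c (B i) y)"
  define U where "U = T2.T.vec (\<lambda>(x, y). \<Sum>i<m. c (s i) x * c (B i) y)"
  have R_rep: "T2.rep R {..<m} A B" and U_rep: "T2.rep U {..<m} s B"
    by (simp_all add: T2.rep_def R_def U_def T2.T.vec_in T2.T.c_vec A_in B_in s_in)
  have R_in: "R \<in> carrier (tensor M M)" and U_in: "U \<in> carrier (tensor M M)"
    by (rule T2.repD(1)[OF R_rep], rule T2.repD(1)[OF U_rep])
  have one_rep: "T2.rep \<one>\<^bsub>tensor M M\<^esub> {0::nat} (\<lambda>_. \<one>) (\<lambda>_. \<one>)"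
    unfolding T2.T_one by (intro T2.rep_pure Mr.one_closed)
  \<comment> \<open>Multiplying two decompositions with the same second legs \<open>B\<close>.\<close>
  have collapse: "(\<Sum>i<m. \<Sum>j<m. h i j * c (B i \<otimes> B j) y) = k * c \<one> y"
    if h: "\<And>p. p < m \<Longrightarrow> (\<Sum>i<m. \<Sum>j<m. \<delta> p i j * h i j) = ?\<epsilon> p * k" and y: "y \<in> I" for h k y
  proof -
    have "(\<Sum>i<m. \<Sum>j<m. h i j * c (B i \<otimes> B j) y) = (\<Sum>i<m. \<Sum>j<m. \<Sum>p<m. \<delta> p i j * h i j * c (B p) y)"
      using y by (simp add: B_mult sum_distrib_left ac_simps cong: sum.cong_simp)
    also have "\<dots> = (\<Sum>p<m. (\<Sum>i<m. \<Sum>j<m. \<delta> p i j * h i j) * c (B p) y)"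
      unfolding sum_distrib_right by (rule sum_rotate3')
    also have "\<dots> = (\<Sum>p<m. k * (?\<epsilon> p * c (B p) y))"
      by (intro sum.cong refl) (simp add: h)
    finally show ?thesis using B_one[OF y] by (simp add: sum_distrib_left[symmetric])
  qed
  have As: "(\<Sum>i<m. \<Sum>j<m. \<delta> p i j * c (A i \<otimes> s j) x) = ?\<epsilon> p * c \<one> x" if p: "p < m" and x: "x \<in> I" for p x
  proof -
    have 1: "c (A i \<otimes> s j) x = (\<Sum>a<m. S j a * c (A i \<otimes> A a) x)" if "i < m" for i j
      by (rule MA.c_mult_lincomb_right) (use that x in \<open>simp_all add: A_in s_in cs\<close>)
    have "(\<Sum>i<m. \<Sum>j<m. \<delta> p i j * c (A i \<otimes> s j) x)
      = (\<Sum>i<m. \<Sum>j<m. \<Sum>a<m. \<Sum>q<m. \<delta> p i j * S j a * \<mu> i a q * c (A q) x)"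
      using x by (simp add: 1 A_mult sum_distrib_left mult.assoc cong: sum.cong_simp)
    also have "\<dots> = (\<Sum>i<m. \<Sum>q<m. \<Sum>j<m. \<Sum>a<m. \<delta> p i j * S j a * \<mu> i a q * c (A q) x)"
      by (intro sum.cong refl sum_rotate3')
    also have "\<dots> = (\<Sum>q<m. \<Sum>i<m. \<Sum>j<m. \<Sum>a<m. \<delta> p i j * S j a * \<mu> i a q * c (A q) x)"
      by (rule sum.swap)
    also have "\<dots> = (\<Sum>q<m. ?\<epsilon> p * (?\<eta> q * c (A q) x))"
      using S.S_right p by (intro sum.cong refl) (simp add: sum_distrib_right[symmetric])
    finally show ?thesis using A_one[OF x] by (simp add: sum_distrib_left[symmetric])
  qed
  have sA: "(\<Sum>i<m. \<Sum>j<m. \<delta> p i j * c (s i \<otimes> A j) x) = ?\<epsilon> p * c \<one> x" if p: "p < m" and x: "x \<in> I" for p x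
  proof -
    have 1: "c (s i \<otimes> A j) x = (\<Sum>a<m. S i a * c (A a \<otimes> A j) x)" if "j < m" for i j
      by (rule MA.c_mult_lincomb_left) (use that x in \<open>simp_all add: A_in s_in cs\<close>)
    have "(\<Sum>i<m. \<Sum>j<m. \<delta> p i j * c (s i \<otimes> A j) x)
      = (\<Sum>i<m. \<Sum>j<m. \<Sum>a<m. \<Sum>q<m. \<delta> p i j * S i a * \<mu> a j q * c (A q) x)"
      using x by (simp add: 1 A_mult sum_distrib_left mult.assoc cong: sum.cong_simp)
    also have "\<dots> = (\<Sum>i<m. \<Sum>q<m. \<Sum>j<m. \<Sum>a<m. \<delta> p i j * S i a * \<mu> a j q * c (A q) x)"
      by (intro sum.cong refl sum_rotate3')
    also have "\<dots> = (\<Sum>q<m. \<Sum>i<m. \<Sum>j<m. \<Sum>a<m. \<delta> p i j * S i a * \<mu> a j q * c (A q) x)"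
      by (rule sum.swap)
    also have "\<dots> = (\<Sum>q<m. ?\<epsilon> p * (?\<eta> q * c (A q) x))"
      using S.S_left p by (intro sum.cong refl) (simp add: sum_distrib_right[symmetric])
    finally show ?thesis using A_one[OF x] by (simp add: sum_distrib_left[symmetric])
  qed
  have RU: "R \<otimes>\<^bsub>tensor M M\<^esub> U = \<one>\<^bsub>tensor M M\<^esub>"
  proof (rule T2.rep_eq[OF T2.rep_mult[OF R_rep U_rep] one_rep])
    fix x y assume xy: "x \<in> I" "y \<in> I"
    show "(\<Sum>z\<in>{..<m} \<times> {..<m}. c (case z of (i, j) \<Rightarrow> A i \<otimes> s j) x * c (case z of (i, j) \<Rightarrow> B i \<otimes> B j) y)
      = (\<Sum>z\<in>{0::nat}. c \<one> x * c \<one> y)"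
      using collapse[OF As[OF _ xy(1)] xy(2)] by (simp add: sum.cartesian_product')
  qed
  have UR: "U \<otimes>\<^bsub>tensor M M\<^esub> R = \<one>\<^bsub>tensor M M\<^esub>"
  proof (rule T2.rep_eq[OF T2.rep_mult[OF U_rep R_rep] one_rep])
    fix x y assume xy: "x \<in> I" "y \<in> I"
    show "(\<Sum>z\<in>{..<m} \<times> {..<m}. c (case z of (i, j) \<Rightarrow> s i \<otimes> A j) x * c (case z of (i, j) \<Rightarrow> B i \<otimes> B j) y)
      = (\<Sum>z\<in>{0::nat}. c \<one> x * c \<one> y)"
      using collapse[OF sA[OF _ xy(1)] xy(2)] by (simp add: sum.cartesian_product')
  qed
  have R_unit: "R \<in> Units (tensor M M)" unfolding Units_def using R_in U_in RU UR by blast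
  have inv_R: "inv\<^bsub>tensor M M\<^esub> R = U" by (rule monoid.inv_char[OF mon2 R_in U_in RU UR])
  have "pentagon_equation M R" unfolding pentagon_iff[OF R_rep]
  proof (intro ballI)
    fix p q x assume pqx: "p \<in> I" "q \<in> I" "x \<in> I"
    let ?F = "\<lambda>i j r a b. \<delta> i a b * \<mu> r a j * c (A j) p * c (B i) x * c (B r \<otimes> A b) q"
    have "(\<Sum>i<m. \<Sum>j<m. c (A j) p * c (A i \<otimes> B j) q * c (B i) x) = (\<Sum>i<m. \<Sum>j<m. \<Sum>r<m. \<Sum>a<m. \<Sum>b<m. ?F i j r a b)"
      using pqx by (simp add: AB sum_distrib_left sum_distrib_right ac_simps cong: sum.cong_simp)
    also have "\<dots> = (\<Sum>r<m. \<Sum>i<m. \<Sum>j<m. \<Sum>a<m. \<Sum>b<m. ?F i j r a b)" by (rule sum_rotate3')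
    also have "\<dots> = (\<Sum>r<m. \<Sum>a<m. \<Sum>b<m. \<Sum>i<m. \<Sum>j<m. ?F i j r a b)"
      by (intro sum.cong refl sum_swap_pairs)
    also have "\<dots> = (\<Sum>r<m. \<Sum>a<m. \<Sum>b<m. (\<Sum>j<m. \<mu> r a j * c (A j) p) * c (B r \<otimes> A b) q * (\<Sum>i<m. \<delta> i a b * c (B i) x))"
      by (intro sum.cong refl, subst sum.swap) (simp add: sum_distrib_left sum_distrib_right ac_simps)
    also have "\<dots> = (\<Sum>r<m. \<Sum>a<m. \<Sum>b<m. c (A r \<otimes> A a) p * c (B r \<otimes> A b) q * c (B a \<otimes> B b) x)"
      using pqx by (intro sum.cong refl) (simp add: A_mult B_mult)
    finally show "(\<Sum>i<m. \<Sum>j<m. \<Sum>k<m. c (A i \<otimes> A j) p * c (B i \<otimes> A k) q * c (B j \<otimes> B k) x) =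
      (\<Sum>i<m. \<Sum>j<m. c (A j) p * c (A i \<otimes> B j) q * c (B i) x)" by simp
  qed
  with R_rep A_indep B_indep R_unit interpret P: pentagon_solution M I c R m A B
    by unfold_locales
  have d: "\<delta> p i j = P.d p i j" if "p < m" "i < m" "j < m" for p i j
  proof -
    have "P.d p i j = (\<Sum>x\<in>I. \<Sum>q<m. \<delta> q i j * (P.\<beta> p x * c (B q) x))"
      using that by (simp add: P.d_def B_mult sum_distrib_left ac_simps)
    also have "\<dots> = (\<Sum>q<m. \<delta> q i j * (\<Sum>x\<in>I. P.\<beta> p x * c (B q) x))"
      by (subst sum.swap) (simp add: sum_distrib_left)
    also have "\<dots> = (\<Sum>q<m. if q = p then \<delta> q i j else 0)"
      using that by (intro sum.cong refl) (simp add: P.\<beta>)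
    finally show ?thesis using that by simp
  qed
  have "hopf_realization M I c R m A B L cL"
  proof (intro hopf_realization.intro hopf_realization_axioms.intro)
    show "pentagon_solution M I c R m A B" by (rule P.pentagon_solution_axioms)
    show "hopf_coordinates L {..<m} cL" by fact
    show "T2.rep (inv\<^bsub>tensor M M\<^esub> R) {..<m} (\<lambda>i. \<Oplus>a\<in>{..<m}. cL (antipode L (Lh.bas i)) a \<odot> A a) B"
      unfolding inv_R using U_rep by (simp add: s_def[abs_def] S_def[abs_def])
  qed (use A_mult A_one B_one d in \<open>simp_all only: \<mu> \<delta>\<close>)
  then show ?thesis by (rule that)
qed

end

text \<open>
  With matrices acting on row vectors, \<open>A\<^sub>j\<close> is right multiplication by \<open>e\<^sub>j\<close> and \<open>B\<^sub>q\<close> is \<open>x \<mapsto> \<langle>e\<^sub>q\<^sup>*, x\<^sub>1\<rangle> x\<^sub>2\<close>.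
  The multiplication rules are associativity and coassociativity, and the commutation relation is the
  compatibility of multiplication and comultiplication. Acting on the unit, respectively followed by the
  counit, the operators are seen to be independent.
\<close>

lemma regular_realization:
  fixes L :: "('k :: field, 'l) hopf" and m :: nat
  assumes "hopf_coordinates L {..<m} cL"
  obtains R A B where "m > 0" "hopf_realization (mat_algebra m) (sq m) (entries m) R m A B L cL"
proof -
  interpret Lh: hopf_coordinates L "{..<m}" cL by fact
  interpret S: hopf_sc "{..<m}" Lh.str Lh.dco "cL \<one>\<^bsub>L\<^esub>" "\<lambda>p. counit L (Lh.bas p)" "\<lambda>p. cL (antipode L (Lh.bas p))"
    by (rule Lh.hopf_constants)
  have m: "m > 0" using S.eps_eta by (cases m) auto
  interpret F: falg "mat_algebra m :: ('k, 'k mat) module" "sq m" "entries m" by (rule mat_algebra_falg)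
  let ?M = "mat_algebra m :: ('k, 'k mat) module"
  define A where "A j = mat m m (\<lambda>(x, y). Lh.str x j y)" for j
  define B where "B q = mat m m (\<lambda>(x, y). Lh.dco x q y)" for q
  have cA: "entries m (A j) (x, y) = Lh.str x j y" and cB: "entries m (B j) (x, y) = Lh.dco x j y"
    if "x < m" "y < m" for j x y
    using that by (simp_all add: entries_def A_def B_def)
  have AM: "A j \<in> carrier_mat m m" and BM: "B j \<in> carrier_mat m m" for j by (simp_all add: A_def B_def)
  have mult: "entries m (X \<otimes>\<^bsub>?M\<^esub> Y) (x, y) = (\<Sum>k<m. entries m X (x, k) * entries m Y (k, y))"
    if "X \<in> carrier_mat m m" "Y \<in> carrier_mat m m" "x < m" "y < m" for X Y x y
    using entries_mult[OF that] by (simp add: module_mat_simps)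
  have one: "entries m \<one>\<^bsub>?M\<^esub> (x, y) = (if y = x then 1 else 0)" if "x < m" "y < m" for x y
    using that by (simp add: entries_def module_mat_simps)
  obtain R where "hopf_realization ?M (sq m) (entries m) R m A B L cL"
  proof (rule F.realization_of_heisenberg_relations[OF assms, of A B])
    show "A i \<in> carrier ?M" "B i \<in> carrier ?M" for i using AM BM by (simp_all add: module_mat_simps)
  next
    fix r i z assume ri: "r < m" "i < m" and "z \<in> sq m"
    then obtain x y where z: "z = (x, y)" "x < m" "y < m" by auto
    show "entries m (A r \<otimes>\<^bsub>?M\<^esub> A i) z = (\<Sum>q<m. Lh.str r i q * entries m (A q) z)"
      using S.D.coassoc[of y x r i] ri z(2,3) unfolding z(1) mult[OF AM AM z(2,3)]
      by (simp add: cA mult.commute cong: sum.cong_simp)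
  next
    fix i j z assume ij: "i < m" "j < m" and "z \<in> sq m"
    then obtain x y where z: "z = (x, y)" "x < m" "y < m" by auto
    show "entries m (B i \<otimes>\<^bsub>?M\<^esub> B j) z = (\<Sum>p<m. Lh.dco p i j * entries m (B p) z)"
      using S.C.coassoc[of x i j y] ij z(2,3) unfolding z(1) mult[OF BM BM z(2,3)]
      by (simp add: cB mult.commute cong: sum.cong_simp)
  next
    fix p q z assume pq: "p < m" "q < m" and "z \<in> sq m"
    then obtain x y where z: "z = (x, y)" "x < m" "y < m" by auto
    have "entries m (A p \<otimes>\<^bsub>?M\<^esub> B q) (x, y) = (\<Sum>k<m. Lh.str x p k * Lh.dco k q y)"
      unfolding mult[OF AM BM z(2,3)] using z by (intro sum.cong refl) (simp add: cA cB)
    also have "\<dots> = (\<Sum>r<m. \<Sum>k<m. \<Sum>i<m. \<Sum>j<m. Lh.dco x r k * Lh.dco p i j * Lh.str r i q * Lh.str k j y)"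
      by (rule S.bialg) (use pq z in auto)
    also have "\<dots> = (\<Sum>r<m. \<Sum>i<m. \<Sum>j<m. \<Sum>k<m. Lh.dco x r k * Lh.dco p i j * Lh.str r i q * Lh.str k j y)"
      by (intro sum.cong refl sum_rotate3)
    also have "\<dots> = (\<Sum>r<m. \<Sum>i<m. \<Sum>j<m. Lh.dco p i j * Lh.str r i q * (\<Sum>k<m. Lh.dco x r k * Lh.str k j y))"
      by (simp add: sum_distrib_left ac_simps)
    also have "\<dots> = (\<Sum>r<m. \<Sum>i<m. \<Sum>j<m. Lh.dco p i j * Lh.str r i q * entries m (B r \<otimes>\<^bsub>?M\<^esub> A j) (x, y))"
      unfolding mult[OF BM AM z(2,3)] using z
      by (intro sum.cong refl arg_cong2[where f = "(*)"]) (simp_all add: cA cB)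
    finally show "entries m (A p \<otimes>\<^bsub>?M\<^esub> B q) z =
        (\<Sum>r<m. \<Sum>i<m. \<Sum>j<m. Lh.dco p i j * Lh.str r i q * entries m (B r \<otimes>\<^bsub>?M\<^esub> A j) z)"
      unfolding z(1) .
  next
    fix z assume "z \<in> sq m"
    then obtain x y where z: "z = (x, y)" "x < m" "y < m" by auto
    show "(\<Sum>k<m. cL \<one>\<^bsub>L\<^esub> k * entries m (A k) z) = entries m \<one>\<^bsub>?M\<^esub> z"
      using S.D.counit_r[of y x] z by (simp add: cA one mult.commute)
    show "(\<Sum>k<m. counit L (Lh.bas k) * entries m (B k) z) = entries m \<one>\<^bsub>?M\<^esub> z"
      using S.C.counit_l[of x y] z by (auto simp: cB one mult.commute)
  next
    show "F.indep m A" unfolding F.indep_def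
    proof (intro allI impI)
      fix g y assume g: "\<forall>i\<in>sq m. (\<Sum>k<m. g k * entries m (A k) i) = 0" and y: "y < m"
      have "g y = (\<Sum>k<m. g k * (\<Sum>x<m. Lh.str x k y * cL \<one>\<^bsub>L\<^esub> x))"
        using y S.D.counit_l[of y] by (simp add: delta_mult cong: sum.cong_simp)
      also have "\<dots> = (\<Sum>x<m. (\<Sum>k<m. g k * Lh.str x k y) * cL \<one>\<^bsub>L\<^esub> x)"
        unfolding sum_distrib_left sum_distrib_right by (subst sum.swap) (simp add: mult.assoc)
      also have "\<dots> = 0"
        using g y by (intro sum.neutral ballI) (force simp: cA[symmetric])
      finally show "g y = 0" .
    qed
    show "F.indep m B" unfolding F.indep_def
    proof (intro allI impI)
      fix g x assume g: "\<forall>i\<in>sq m. (\<Sum>k<m. g k * entries m (B k) i) = 0" and x: "x < m"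
      have "g x = (\<Sum>k<m. g k * (\<Sum>y<m. Lh.dco x k y * counit L (Lh.bas y)))"
        using x S.C.counit_r[of x] by (simp add: delta_mult cong: sum.cong_simp)
      also have "\<dots> = (\<Sum>y<m. (\<Sum>k<m. g k * Lh.dco x k y) * counit L (Lh.bas y))"
        unfolding sum_distrib_left sum_distrib_right by (subst sum.swap) (simp add: mult.assoc)
      also have "\<dots> = 0"
        using g x by (intro sum.neutral ballI) (force simp: cB[symmetric])
      finally show "g x = 0" .
    qed
  qed
  then show ?thesis using m that by blast
qed

section \<open>Characterization of finite-dimensional Hopf algebras\<close>

lemma P_hopf_minimal_decomposition:
  fixes R :: "('k :: field mat \<times> 'k mat \<Rightarrow>\<^sub>0 'k) set"
  assumes R: "R \<in> carrier (tensor (mat_algebra n) (mat_algebra n))"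
  obtains A B where
    "is_decomposition (mat_algebra n) R (tensor_length (mat_algebra n) R) A B"
    "P_hopf n R = P_of_decomposition n R (tensor_length (mat_algebra n) R) A B"
proof -
  interpret F: falg "mat_algebra n :: ('k, 'k mat) module" "sq n" "entries n" by (rule mat_algebra_falg)
  let ?D = "\<lambda>(A, B). is_decomposition (mat_algebra n) R (tensor_length (mat_algebra n) R) A B"
  obtain A B where AB: "(SOME z. ?D z) = (A, B)" by fastforce
  have "\<exists>z. ?D z" using F.minimal_decomposition_exists[OF R] by auto
  then have "?D (SOME z. ?D z)" by (rule someI_ex)
  then show ?thesis using that[of A B] by (simp add: AB P_hopf_def Let_def)
qed

lemma invertible_pentagon_solution_decomposed:
  fixes R :: "('k :: field mat \<times> 'k mat \<Rightarrow>\<^sub>0 'k) set"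
  assumes "n > 0" "invertible_pentagon_solution n R"
  obtains A B where "matrix_pentagon_solution n R (tensor_length (mat_algebra n) R) A B"
    "P_hopf n R = P_of_decomposition n R (tensor_length (mat_algebra n) R) A B"
proof -
  interpret F: falg "mat_algebra n :: ('k, 'k mat) module" "sq n" "entries n" by (rule mat_algebra_falg)
  have R: "R \<in> Units (tensor (mat_algebra n) (mat_algebra n))" "pentagon_equation (mat_algebra n) R"
    using assms by (auto simp: invertible_pentagon_solution_def)
  then have "R \<in> carrier (tensor (mat_algebra n) (mat_algebra n))" by (simp add: Units_def)
  then obtain A B where AB: "is_decomposition (mat_algebra n) R (tensor_length (mat_algebra n) R) A B"
    and P: "P_hopf n R = P_of_decomposition n R (tensor_length (mat_algebra n) R) A B"
    by (rule P_hopf_minimal_decomposition)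
  have r: "F.T2.rep R {..<tensor_length (mat_algebra n) R} A B"
    using AB by (simp only: F.is_decomposition_iff)
  have "matrix_pentagon_solution n R (tensor_length (mat_algebra n) R) A B"
    by (intro matrix_pentagon_solution.intro pentagon_solution.intro pentagon_solution_axioms.intro
        matrix_pentagon_solution_axioms.intro mat_algebra_falg r F.minimal_decomposition_indep[OF r] R assms)
  then show ?thesis using P by (rule that)
qed

lemma P_hopf_dimensions:
  fixes L :: "('k :: field, 'a) hopf"
  assumes L: "hopf_algebra L" and n: "n > 0" and R: "invertible_pentagon_solution n R"
    and iso: "hopf_isomorphic L (P_hopf n R)"
  shows "vectorspace.fin_dim class_ring L"
    and "vectorspace.dim class_ring L = tensor_length (mat_algebra n) R"
    and "n\<^sup>2 = tensor_length (mat_algebra n) R * vectorspace.dim class_ring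
      ((mat_algebra n :: ('k, 'k mat) module)\<lparr>carrier := right_coinvariants (mat_algebra n) R\<rparr>)"
proof -
  let ?m = "tensor_length (mat_algebra n) R"
  obtain A B where 1: "matrix_pentagon_solution n R ?m A B"
    and P: "P_hopf n R = P_of_decomposition n R ?m A B"
    by (rule invertible_pentagon_solution_decomposed[OF n R])
  interpret matrix_pentagon_solution n R ?m A B by (rule 1)
  have H: "carrier (P_hopf n R) = SA" "mult (P_hopf n R) = mult M" "one (P_hopf n R) = one M"
    "zero (P_hopf n R) = zero M" "add (P_hopf n R) = add M" "Module.smult (P_hopf n R) = Module.smult M"
    "\<And>x. comult (P_hopf n R) x = tensor_restrict M SA M SA
      (inv\<^bsub>tensor M M\<^esub> R \<otimes>\<^bsub>tensor M M\<^esub> pure_tensor M M \<one>\<^bsub>M\<^esub> x \<otimes>\<^bsub>tensor M M\<^esub> R)"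
    unfolding P P_of_decomposition_def Let_def by simp_all
  show "vectorspace.dim class_ring L = ?m" by (rule coinvariants_dim(1)[OF L iso H])
  show "n\<^sup>2 = ?m * vectorspace.dim class_ring (M\<lparr>carrier := right_coinvariants M R\<rparr>)"
    by (rule coinvariants_dim(2)[OF L iso H])
  obtain cL where "hopf_coordinates L {..<?m} cL"
    by (rule iso_coordinates[OF L iso H])
  then interpret Lh: hopf_coordinates L "{..<?m}" cL .
  show "vectorspace.fin_dim class_ring L" by (rule Lh.dim(1))
qed

lemma fin_dim_hopf_is_P_hopf:
  fixes L :: "('k :: field, 'a) hopf"
  assumes L: "hopf_algebra L" and fin: "vectorspace.fin_dim class_ring L"
  obtains n R where "n > 0" "invertible_pentagon_solution n R" "hopf_isomorphic L (P_hopf n R)"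
proof -
  interpret hopf_algebra L by (rule L)
  obtain cL where "coordinates L {..<vectorspace.dim class_ring L} cL"
    using fin_dim_coordinates[OF vectorspace fin] by blast
  then have "hopf_coordinates L {..<vectorspace.dim class_ring L} cL"
    using L by (intro hopf_coordinates.intro)
  then obtain R A B where n: "vectorspace.dim class_ring L > 0"
    and 1: "hopf_realization (mat_algebra (vectorspace.dim class_ring L)) (sq (vectorspace.dim class_ring L))
      (entries (vectorspace.dim class_ring L)) R (vectorspace.dim class_ring L) A B L cL"
    by (rule regular_realization)
  let ?n = "vectorspace.dim class_ring L"
  interpret H: hopf_realization "mat_algebra ?n" "sq ?n" "entries ?n" R ?n A B L cL by (rule 1)
  have R: "invertible_pentagon_solution ?n R"
    unfolding invertible_pentagon_solution_def using H.R_unit H.R_pentagon by (rule conjI)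
  let ?m' = "tensor_length (mat_algebra ?n) R"
  obtain A' B' where 2: "matrix_pentagon_solution ?n R ?m' A' B'"
    and P: "P_hopf ?n R = P_of_decomposition ?n R ?m' A' B'"
    by (rule invertible_pentagon_solution_decomposed[OF n R])
  interpret P: matrix_pentagon_solution ?n R ?m' A' B' by (rule 2)
  have "hopf_isomorphic L (P_hopf ?n R)"
    by (rule H.realize_iso[OF P.R_rep P.A_indep P.B_indep])
      (simp_all add: P P_of_decomposition_def Let_def)
  then show ?thesis using n R by (intro that)
qed

theorem theorem3p2:
  fixes L :: "('k :: field, 'a) hopf"
  assumes "hopf_algebra L"
  shows "(vectorspace.fin_dim class_ring L \<longleftrightarrow>
      (\<exists>n R. n > 0 \<and> invertible_pentagon_solution n R \<and> hopf_isomorphic L (P_hopf n R))) \<and>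
    (\<forall>n R. n > 0 \<longrightarrow> invertible_pentagon_solution n R \<longrightarrow> hopf_isomorphic L (P_hopf n R) \<longrightarrow>
      (of_nat (vectorspace.dim class_ring L) :: rat) =
        of_nat (n ^ 2) / of_nat (vectorspace.dim class_ring
          ((mat_algebra n :: ('k, 'k mat) module)
            \<lparr>carrier := right_coinvariants (mat_algebra n) R\<rparr>)) \<and>
      vectorspace.dim class_ring L = tensor_length (mat_algebra n) R)"
proof (intro conjI iffI allI impI)
  assume "vectorspace.fin_dim class_ring L"
  then show "\<exists>n R. n > 0 \<and> invertible_pentagon_solution n R \<and> hopf_isomorphic L (P_hopf n R)"
    using fin_dim_hopf_is_P_hopf[OF assms] by metis
next
  assume "\<exists>n R. n > 0 \<and> invertible_pentagon_solution n R \<and> hopf_isomorphic L (P_hopf n R)"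
  then show "vectorspace.fin_dim class_ring L" using P_hopf_dimensions(1)[OF assms] by blast
next
  fix n and R :: "('k mat \<times> 'k mat \<Rightarrow>\<^sub>0 'k) set"
  assume *: "n > 0" "invertible_pentagon_solution n R" "hopf_isomorphic L (P_hopf n R)"
  show dim: "vectorspace.dim class_ring L = tensor_length (mat_algebra n) R"
    by (rule P_hopf_dimensions(2)[OF assms *])
  let ?r = "vectorspace.dim class_ring
    ((mat_algebra n :: ('k, 'k mat) module)\<lparr>carrier := right_coinvariants (mat_algebra n) R\<rparr>)"
  have sq: "n\<^sup>2 = vectorspace.dim class_ring L * ?r"
    using P_hopf_dimensions(3)[OF assms *] by (simp only: dim)
  then have "?r \<noteq> 0" using *(1) by (intro notI) simp
  then show "(of_nat (vectorspace.dim class_ring L) :: rat) = of_nat (n ^ 2) / of_nat ?r"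
    unfolding sq of_nat_mult by simp
qed

end
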